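(* Let $\widehat H$ be a Hamilton operator with $f$ degrees of freedom whose (Weyl) symbol has an expansion $$H=E_0+\sum_{s=2}^{\infty}H_s,\qquad H_s\in\mathcal W^s,$$ where $E_0$ is a constant energy and $$H_2=\lambda I+\omega_2J_2+\dots+\omega_fJ_f,$$ with $\lambda$ real and nonzero and with real frequencies $\omega_2,\dots,\omega_f$ that are rationally independent (the non-resonant case). Put $\widehat H^{(2)}=\widehat H$ and, for $n=3,4,\dots,N$, transform $\widehat H$ by successive conjugations with unitary operators $$\widehat H^{(n)}=e^{i\widehat W_n/\hbar}\,\widehat H^{(n-1)}\,e^{-i\widehat W_n/\hbar},\qquad W_n\in\mathcal W^n,$$ so that the symbols are related by $H^{(n)}=\sum_{k=0}^{\infty}\frac1{k!}[\mathrm{Mad}_{W_n}]^kH^{(n-1)}$. Write $H^{(n)}=E_0+\sum_{s\ge2}H^{(n)}_s$ with $H^{(n)}_s\in\mathcal W^s$. Then: (i) $H^{(n)}_s=H^{(n-1)}_s$ for $s<n$ (in particular $H^{(n)}_2=H_2$ for all $n\ge3$), and for $s=n$ one has the homological equation $$H^{(n)}_n=H^{(n-1)}_n+\{W_n,H_2\},$$ where $\{\cdot,\cdot\}$ is the Poisson bracket. Given any $H^{(n-1)}_n\in\mathcal W^n$ there exists a unique $W_n\in\mathcal W^n$ such that $H^{(n)}_n$ can be written as a function of the actions $I,J_2,\dots,J_f$ alone (equivalently, such that $\{I,H^{(n)}_n\}=\{J_2,H^{(n)}_n\}=\dots=\{J_f,H^{(n)}_n\}=0$). (ii) Choosing $W_n$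 recursively for $n=3,4,\dots,N$ as solutions of the homological equation in this sense, one obtains an operator $\widehat H^{(N)}$ whose symbol is of the form $$H^{(N)}=E_0+\sum_{s=2}^{N}H^{(N)}_s+R^{(N+1)},$$ where $E_0+\sum_{s=2}^{N}H^{(N)}_s$ is a polynomial in the actions $I,J_2,\dots,J_f$ (with coefficients that may depend on $\hbar$), and the remainder $R^{(N+1)}$ consists of terms of order $N+1$ and higher. (iii) The quantizations of powers of $I$ satisfy $\widehat{I^{\,n+1}}=\widehat I\,\widehat{I^{\,n}}-\tfrac{n^2\hbar^2}{4}\,\widehat{I^{\,n-1}}$, and there is a similar recursion for each $J_k$; hence the quantization of the normal form part can be expressed through the quantized actions: there is a polynomial $H^{(N)}_{\mathrm{QNF}}$ (with coefficients that may depend on $\hbar$) such that $$U_N^*\,\widehat H\,U_N=H^{(N)}_{\mathrm{QNF}}(\widehat I,\widehat J_2,\dots,\widehat J_f)+\widehat R^{(N+1)},\qquad U_N=\prod_{n=3}^{N}e^{-i\widehat W_n/\hbar},$$ where the symbol of $\widehat R^{(N+1)}$ is of order $N+1$. (iv) In the limit $\hbar\to0$ one recovers the classical normal form of order $N$: $$\lim_{\hbar\to0}H^{(N)}_{\mathrm{QNF}}(I,J_2,\dots,J_f)=H^{(N)}_{\mathrm{cl}}.$$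
   Context: Phase space is $\mathbb R^{2f}$ with coordinates $(p,x)=(p_1,\dots,p_f,x_1,\dots,x_f)$. Set $I=p_1x_1$ and $J_k=\tfrac12(p_k^2+x_k^2)$ for $k=2,\dots,f$. The form of $H_2$ corresponds to a classical equilibrium point of saddle-center-…-center type: the linearized system has one pair of real eigenvalues $\pm\lambda$ and $f-1$ pairs of imaginary eigenvalues $\pm i\omega_k$. The hat denotes Weyl quantization: an operator $\widehat A$ has symbol $A(p,x)$ if $$\widehat A\psi(x)=\frac1{(2\pi\hbar)^f}\int_{\mathbb R^{2f}}e^{\frac i\hbar\langle x-y,p\rangle}A\big(p,\tfrac{x+y}2\big)\psi(y)\,dy\,dp.$$ The star product of symbols is $$A*B=A\exp\Big(\tfrac{i\hbar}2\big[\langle\overleftarrow\partial_x,\overrightarrow\partial_p\rangle-\langle\overrightarrow\partial_x,\overleftarrow\partial_p\rangle\big]\Big)B,$$ where left (right) arrows indicate differentiation of $A$ (of $B$); it satisfies $\widehat A\widehat B=\widehat{A*B}$. The Moyal bracket is $\{A,B\}_M=\frac i\hbar(A*B-B*A)$, and $\mathrm{Mad}_AB=\{A,B\}_M$. If one of the two functions is quadratic in $(p,x)$, the Moyal bracket reduces to the Poisson bracket, in the convention $\{A,B\}=\sum_k(\partial_{p_k}A\,\partial_{x_k}B-\partial_{x_k}A\,\partial_{p_k}B)$. The order of a monomial $p^\alpha x^\beta\hbar^n$ is $|\alpha|+|\beta|+2n$, and $\mathcal W^s$ is the vector space of polynomials spanned by the monomials of order $s$. For $A\in\mathcal W^s$,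 $B\in\mathcal W^{s'}$ one has $[\mathrm{Mad}_A]^nB\in\mathcal W^{n(s-2)+s'}$. The operator $H^{(N)}_{\mathrm{QNF}}(\widehat I,\widehat J_2,\dots,\widehat J_f)$, a function of the commuting operators $\widehat I,\widehat J_k$, is called the quantum normal form of $\widehat H$ of order $N$. The product in $U_N$ is ordered with $n$ increasing from left to right. $H^{(N)}_{\mathrm{cl}}$ denotes the classical (Poincaré–Birkhoff) normal form of order $N$, i.e. the polynomial in $I,J_2,\dots,J_f$ obtained by the same procedure with the Moyal bracket replaced by the Poisson bracket.
   Formalization: W_n is not unique for even n (one may add I^{n/2}): proved are existence, uniqueness up to functions of the actions, and literal uniqueness for odd n. As exp(iW_n/ħ) need not exist as an operator, conjugation, unitarity and the expansions are read order by order as formal series. *)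

theory Defs
  imports "HOL-Analysis.Analysis" "HOL-Library.Poly_Mapping"
begin

section \<open>Polynomial symbols\<close>

text \<open>Phase space is \<open>real^'n \<times> real^'n\<close>; the number \<open>f\<close> of degrees of freedom is
  \<open>CARD('n)\<close>, and a fixed \<open>r :: 'n\<close> plays the role of the first index (the saddle
  direction). Symbols are formal polynomials in the momenta, the positions and the reduced Planck constant \<open>h\<close>.\<close>

datatype 'n svar = MOM 'n | POS 'n | HBAR

type_synonym 'n sym = "('n svar \<Rightarrow>\<^sub>0 nat) \<Rightarrow>\<^sub>0 complex"

definition sconst :: "complex \<Rightarrow> 'n sym" where
  "sconst c = Poly_Mapping.single 0 c"

definition svar :: "'n svar \<Rightarrow> 'n sym" where
  "svar v = Poly_Mapping.single (Poly_Mapping.single v 1) 1"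

definition peval :: "('a::zero \<Rightarrow> 'b::comm_ring_1) \<Rightarrow> ('v \<Rightarrow> 'b) \<Rightarrow> (('v \<Rightarrow>\<^sub>0 nat) \<Rightarrow>\<^sub>0 'a) \<Rightarrow> 'b" where
  "peval emb val A = (\<Sum>m\<in>Poly_Mapping.keys A.
     emb (Poly_Mapping.lookup A m) * (\<Prod>v\<in>Poly_Mapping.keys m. val v ^ Poly_Mapping.lookup m v))"

definition sym_eval :: "real \<Rightarrow> real^'n \<Rightarrow> real^'n \<Rightarrow> 'n sym \<Rightarrow> complex" where
  "sym_eval h p x A = peval id
     (\<lambda>v. complex_of_real (case v of MOM k \<Rightarrow> p $ k | POS k \<Rightarrow> x $ k | HBAR \<Rightarrow> h)) A"

definition spartial :: "'n svar \<Rightarrow> 'n sym \<Rightarrow> 'n sym" where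
  "spartial v A = (\<Sum>m\<in>Poly_Mapping.keys A.
     Poly_Mapping.single (m - Poly_Mapping.single v 1)
       (of_nat (Poly_Mapping.lookup m v) * Poly_Mapping.lookup A m))"

definition mon_order :: "('n svar \<Rightarrow>\<^sub>0 nat) \<Rightarrow> nat" where
  "mon_order m = (\<Sum>v\<in>Poly_Mapping.keys m. (if v = HBAR then 2 else 1) * Poly_Mapping.lookup m v)"

text \<open>The space of polynomials of order \<open>s\<close>. It is the \<^emph>\<open>real\<close> span of the monomials:
  real symbols correspond to symmetric operators, so that \<open>exp (i W / h)\<close> is unitary.\<close>

definition Word :: "nat \<Rightarrow> 'n sym set" where
  "Word s = {A. \<forall>m\<in>Poly_Mapping.keys A. mon_order m = s \<and> Poly_Mapping.lookup A m \<in> \<real>}"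

definition drop_hbar :: "'n sym \<Rightarrow> 'n sym" where
  "drop_hbar A = (\<Sum>m\<in>{m\<in>Poly_Mapping.keys A. Poly_Mapping.lookup m HBAR = 0}.
     Poly_Mapping.single m (Poly_Mapping.lookup A m))"

section \<open>Star product and brackets\<close>

text \<open>\<open>bidiff k A B\<close> is \<open>A [\<langle>\<partial>x, \<partial>p\<rangle> - \<langle>\<partial>p, \<partial>x\<rangle>]^k B\<close>, where in each pairing the first derivative
  acts on \<open>A\<close> and the second one on \<open>B\<close>.\<close>

fun bidiff :: "nat \<Rightarrow> 'n::finite sym \<Rightarrow> 'n sym \<Rightarrow> 'n sym" where
  "bidiff 0 A B = A * B"
| "bidiff (Suc k) A B = (\<Sum>j\<in>UNIV.
     bidiff k (spartial (POS j) A) (spartial (MOM j) B)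
   - bidiff k (spartial (MOM j) A) (spartial (POS j) B))"

definition star :: "'n::finite sym \<Rightarrow> 'n sym \<Rightarrow> 'n sym" where
  "star A B = (\<Sum>k. (sconst (\<i> / 2) * svar HBAR) ^ k * sconst (1 / fact k) * bidiff k A B)"

definition moyal :: "'n::finite sym \<Rightarrow> 'n sym \<Rightarrow> 'n sym" where
  "moyal A B = (THE M. svar HBAR * M = sconst \<i> * (star A B - star B A))"

definition poisson :: "'n::finite sym \<Rightarrow> 'n sym \<Rightarrow> 'n sym" where
  "poisson A B = (\<Sum>k\<in>UNIV.
     spartial (MOM k) A * spartial (POS k) B - spartial (POS k) A * spartial (MOM k) B)"

section \<open>Actions\<close>

definition action :: "'n \<Rightarrow> 'n \<Rightarrow> 'n sym" where
  "action r k = (if k = r then svar (MOM k) * svar (POS k)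
     else sconst (1 / 2) * (svar (MOM k) ^ 2 + svar (POS k) ^ 2))"

definition quadratic_part :: "'n::finite \<Rightarrow> real \<Rightarrow> ('n \<Rightarrow> real) \<Rightarrow> 'n sym" where
  "quadratic_part r lam om = sconst (of_real lam) * action r r
     + (\<Sum>k\<in>UNIV - {r}. sconst (of_real (om k)) * action r k)"

definition fn_of_actions :: "'n::finite \<Rightarrow> 'n sym \<Rightarrow> bool" where
  "fn_of_actions r A \<longleftrightarrow> (\<exists>g :: real \<Rightarrow> ('n \<Rightarrow> complex) \<Rightarrow> complex.
     \<forall>h (p :: real^'n) x. sym_eval h p x A = g h (\<lambda>k. sym_eval h p x (action r k)))"

text \<open>Polynomials in the actions whose coefficients are polynomials in Planck's constant.\<close>

datatype 'n avar = ACT 'n | AHBAR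

type_synonym 'n apoly = "('n avar \<Rightarrow>\<^sub>0 nat) \<Rightarrow>\<^sub>0 real"

definition apoly_sym :: "'n \<Rightarrow> 'n apoly \<Rightarrow> 'n sym" where
  "apoly_sym r K = peval (\<lambda>c. sconst (of_real c))
     (\<lambda>v. case v of ACT k \<Rightarrow> action r k | AHBAR \<Rightarrow> svar HBAR) K"

definition apoly_val :: "real \<Rightarrow> ('n \<Rightarrow> real) \<Rightarrow> 'n apoly \<Rightarrow> real" where
  "apoly_val h a K = peval id (\<lambda>v. case v of ACT k \<Rightarrow> a k | AHBAR \<Rightarrow> h) K"

text \<open>Each action is quadratic and Planck's constant has order two, so every variable counts twice.\<close>

definition apoly_part :: "nat \<Rightarrow> 'n apoly \<Rightarrow> 'n apoly" where
  "apoly_part s K = (\<Sum>m\<in>{m\<in>Poly_Mapping.keys K.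
       2 * (\<Sum>v\<in>Poly_Mapping.keys m. Poly_Mapping.lookup m v) = s}.
     Poly_Mapping.single m (Poly_Mapping.lookup K m))"

section \<open>The normal form procedure for symbols\<close>

text \<open>A symbol with an expansion into terms of increasing order is a sequence whose entry \<open>s\<close> is the
  term of order \<open>s\<close>. If \<open>W\<close> has order \<open>n\<close>, bracketing with \<open>W\<close> raises the order by \<open>n - 2\<close>, so
  \<open>exp_ad br n W H\<close> is \<open>\<Sum>k. (1 / k!) [br W]^k H\<close> collected by orders; it is meant for \<open>n \<ge> 3\<close>.\<close>

definition exp_ad :: "('n sym \<Rightarrow> 'n sym \<Rightarrow> 'n sym) \<Rightarrow> nat \<Rightarrow> 'n sym \<Rightarrow> (nat \<Rightarrow> 'n sym) \<Rightarrow> nat \<Rightarrow> 'n sym" where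
  "exp_ad br n W H s = (\<Sum>k | k * (n - 2) \<le> s.
     sconst (1 / fact k) * ((br W) ^^ k) (H (s - k * (n - 2))))"

text \<open>The bracket is a parameter: the Moyal bracket gives the quantum procedure, the Poisson bracket
  the classical one.\<close>

fun transformed :: "('n sym \<Rightarrow> 'n sym \<Rightarrow> 'n sym) \<Rightarrow> (nat \<Rightarrow> 'n sym) \<Rightarrow> (nat \<Rightarrow> 'n sym) \<Rightarrow> nat \<Rightarrow> nat \<Rightarrow> 'n sym" where
  "transformed br W H 0 = H"
| "transformed br W H (Suc n) = (if Suc n < 3 then H
     else exp_ad br (Suc n) (W (Suc n)) (transformed br W H n))"

text \<open>The classical Hamiltonian is the part of the symbol that is free of Planck's constant, and the
  classical generators are free of it as well.\<close>

definition classical_normal_form :: "'n::finite \<Rightarrow> (nat \<Rightarrow> 'n sym) \<Rightarrow> nat \<Rightarrow> (('n \<Rightarrow>\<^sub>0 nat) \<Rightarrow>\<^sub>0 real) \<Rightarrow> bool" where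
  "classical_normal_form r H N C \<longleftrightarrow> (\<exists>V.
     (\<forall>n\<in>{3..N}. V n \<in> Word n \<and> drop_hbar (V n) = V n \<and>
        fn_of_actions r (transformed poisson V (\<lambda>s. drop_hbar (H s)) n n)) \<and>
     (\<Sum>s\<le>N. transformed poisson V (\<lambda>s. drop_hbar (H s)) N s)
        = peval (\<lambda>c. sconst (of_real c)) (action r) C)"

section \<open>Weyl quantization\<close>

definition pdiff :: "'n \<Rightarrow> (real^'n \<Rightarrow> complex) \<Rightarrow> real^'n \<Rightarrow> complex" where
  "pdiff j \<psi> x = vector_derivative (\<lambda>t. \<psi> (x + t *\<^sub>R axis j 1)) (at 0)"

definition schwartz :: "(real^'n \<Rightarrow> complex) set" where
  "schwartz = {\<psi>. \<forall>js. (\<forall>x. foldr pdiff js \<psi> differentiable (at x)) \<and>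
     (\<forall>k. bounded (range (\<lambda>x. (1 + norm x) ^ k *\<^sub>R foldr pdiff js \<psi> x)))}"

type_synonym 'n oper = "(real^'n \<Rightarrow> complex) \<Rightarrow> real^'n \<Rightarrow> complex"

text \<open>For a polynomial symbol and a Schwartz function the oscillatory integral over phase space is
  understood as an iterated integral, first over \<open>y\<close> and then over \<open>p\<close>; both integrals then converge
  absolutely. Operators are only considered on Schwartz functions.\<close>

definition weyl :: "real \<Rightarrow> 'n::finite sym \<Rightarrow> 'n oper" where
  "weyl h A \<psi> x = of_real (1 / (2 * pi * h) ^ CARD('n)) *
     (LINT p|lborel. LINT y|lborel.
        exp (\<i> / of_real h * of_real ((x - y) \<bullet> p)) * sym_eval h p ((1 / 2) *\<^sub>R (x + y)) A * \<psi> y)"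

definition inner_L2 :: "(real^'n \<Rightarrow> complex) \<Rightarrow> (real^'n \<Rightarrow> complex) \<Rightarrow> complex" where
  "inner_L2 \<phi> \<psi> = (LINT x|lborel. cnj (\<phi> x) * \<psi> x)"

definition op_adjoint :: "'n::finite oper \<Rightarrow> 'n oper" where
  "op_adjoint T \<phi> = (THE \<eta>. \<eta> \<in> schwartz \<and> (\<forall>\<psi>\<in>schwartz. inner_L2 \<eta> \<psi> = inner_L2 \<phi> (T \<psi>)))"

section \<open>Formal operator series\<close>

text \<open>An operator with an expansion by orders is a sequence whose entry \<open>s\<close> is the operator of order
  \<open>s\<close>, for a fixed value of Planck's constant. The order is additive under products, and
  \<open>h powi -1\<close> has order \<open>-2\<close>, so that \<open>W / h\<close> has order \<open>n - 2 \<ge> 1\<close> if \<open>W\<close> has order \<open>n \<ge> 3\<close>,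
  and every entry of a product or of an exponential is a finite sum.\<close>

type_synonym 'n oper_series = "nat \<Rightarrow> 'n oper"

definition ser_eq :: "'n::finite oper_series \<Rightarrow> 'n oper_series \<Rightarrow> bool" where
  "ser_eq S T \<longleftrightarrow> (\<forall>s. \<forall>\<psi>\<in>schwartz. S s \<psi> = T s \<psi>)"

definition ser_one :: "'n::finite oper_series" where
  "ser_one s \<psi> x = (if s = 0 then \<psi> x else 0)"

definition ser_add :: "'n::finite oper_series \<Rightarrow> 'n oper_series \<Rightarrow> 'n oper_series" where
  "ser_add S T s \<psi> x = S s \<psi> x + T s \<psi> x"

definition ser_mult :: "'n::finite oper_series \<Rightarrow> 'n oper_series \<Rightarrow> 'n oper_series" where
  "ser_mult S T s \<psi> x = (\<Sum>t\<le>s. S t (T (s - t) \<psi>) x)"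

definition ser_adjoint :: "'n::finite oper_series \<Rightarrow> 'n oper_series" where
  "ser_adjoint S s = op_adjoint (S s)"

definition ser_unitary :: "'n::finite oper_series \<Rightarrow> bool" where
  "ser_unitary S \<longleftrightarrow> ser_eq (ser_mult (ser_adjoint S) S) ser_one \<and>
     ser_eq (ser_mult S (ser_adjoint S)) ser_one"

definition ser_weyl :: "real \<Rightarrow> (nat \<Rightarrow> 'n::finite sym) \<Rightarrow> 'n oper_series" where
  "ser_weyl h H s = weyl h (H s)"

text \<open>\<open>ser_exp h c n W\<close> is the exponential of \<open>c / h\<close> times the quantization of \<open>W\<close>, for \<open>W\<close> of
  order \<open>n \<ge> 3\<close>: the \<open>k\<close>-th term of the exponential series has order \<open>k * (n - 2)\<close>.\<close>

definition ser_exp :: "real \<Rightarrow> complex \<Rightarrow> nat \<Rightarrow> 'n::finite sym \<Rightarrow> 'n oper_series" where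
  "ser_exp h c n W s \<psi> x = (\<Sum>k | k * (n - 2) = s.
     (c / of_real h) ^ k / fact k * ((weyl h W) ^^ k) \<psi> x)"

fun U_ser :: "real \<Rightarrow> (nat \<Rightarrow> 'n::finite sym) \<Rightarrow> nat \<Rightarrow> 'n oper_series" where
  "U_ser h W 0 = ser_one"
| "U_ser h W (Suc n) = (if Suc n < 3 then ser_one
     else ser_mult (U_ser h W n) (ser_exp h (- \<i>) (Suc n) (W (Suc n))))"

text \<open>A polynomial of the quantized actions, where \<open>ks\<close> lists the degrees of freedom in the order in
  which the (commuting) factors are multiplied.\<close>

definition apoly_op :: "real \<Rightarrow> 'n::finite \<Rightarrow> 'n list \<Rightarrow> 'n apoly \<Rightarrow> 'n oper" where
  "apoly_op h r ks K \<psi> x = (\<Sum>m\<in>Poly_Mapping.keys K.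
     of_real (Poly_Mapping.lookup K m * h ^ Poly_Mapping.lookup m AHBAR) *
     foldr (\<lambda>k. (weyl h (action r k)) ^^ Poly_Mapping.lookup m (ACT k)) ks \<psi> x)"

definition ser_apoly :: "real \<Rightarrow> 'n::finite \<Rightarrow> 'n list \<Rightarrow> 'n apoly \<Rightarrow> 'n oper_series" where
  "ser_apoly h r ks K s = apoly_op h r ks (apoly_part s K)"

end

theory Submission
  imports Defs "HOL-Probability.Characteristic_Functions" "HOL-Probability.Sinc_Integral"
begin

text \<open>On Schwartz functions, Fourier inversion shows that the quantization of \<open>1\<close> is the identity, and
  differentiating under the integral computes the quantization of a symbol times a coordinate. By
  induction on the degree the star product is composition of operators, so that conjugation by
  \<open>exp (i W / h)\<close> is the exponential of the adjoint action, order by order.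

  In the coordinates \<open>p\<^sub>1, x\<^sub>1, p\<^sub>k \<plusminus> i x\<^sub>k\<close> the map \<open>W \<mapsto> {W, H\<^sub>2}\<close> is diagonal on monomials, its
  eigenvalues being linear combinations of \<open>\<lambda>\<close> and the \<open>i \<omega>\<^sub>k\<close>; by nonresonance its kernel consists of
  the polynomials in the actions, which is complementary to its image. A power of an action agrees with
  its star power up to \<open>h\<^sup>2\<close> times lower powers, which rewrites the normal form in terms of
  the quantized actions by induction on the degree and does not affect the limit \<open>h \<rightarrow> 0\<close>.

  The generators are determined only up to functions of the actions, so the classical limit requires
  the classical normal form to be independent of their choice. Two normalizing automorphisms of the
  Poisson algebra first differ by a derivation, which is Hamiltonian by the Poincare lemma; its generator
  commutes with \<open>H\<^sub>2\<close>, hence is a function of the actions and can be absorbed without changing the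
  normal form.\<close>

text \<open>The formal variable \<open>HBAR\<close> cannot be inverted in a polynomial ring, whereas
  the generators occur divided by Planck's constant. Two calculi are therefore kept side by side:
  the Moyal bracket, where the variable is cancelled symbolically, governs orders, reality and the
  classical limit; operator series with numerical factors 1/h, at a fixed number h, govern the
  conjugations. They are matched only after quantization, where \<open>HBAR\<close> and h become the
  same scalar. Analysis enters in few places: Fourier inversion, the absence of boundary terms, and
  decay of the inner integral. Everything else about the Weyl integral follows from one recursion
  that expresses the quantization of \<open>svar w * A\<close> through \<open>A\<close> and its
  derivatives. The predicate \<open>fn_of_actions\<close> admits arbitrary functions of the values
  of the actions, so it has to be made algebraic: invariance under the flows of the actions gives
  vanishing brackets, and these are decided on monomials in diagonalizing coordinates. Those
  coordinates are complex while generators must be real; taking real parts repairs this because the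
  quadratic part is real.\<close>

abbreviation lk where "lk \<equiv> Poly_Mapping.lookup"
abbreviation sg where "sg \<equiv> Poly_Mapping.single"
abbreviation kys where "kys \<equiv> Poly_Mapping.keys"

section \<open>Monomials and polynomials: degree, induction, coefficients of products\<close>

lemma poly_expand: "A = (\<Sum>m\<in>kys A. sg m (lk A m))"
  by (rule poly_mapping_eqI) (simp add: lookup_sum lookup_single when_def in_keys_iff)

definition tdeg :: "('v \<Rightarrow>\<^sub>0 nat) \<Rightarrow> nat" where
  "tdeg m = (\<Sum>v\<in>kys m. lk m v)"

lemma tdeg_superset: "finite K \<Longrightarrow> kys m \<subseteq> K \<Longrightarrow> tdeg m = (\<Sum>v\<in>K. lk m v)"
  unfolding tdeg_def by (rule sum.mono_neutral_left) (auto simp: in_keys_iff)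

lemma tdeg_add: "tdeg (m + n) = tdeg m + tdeg n"
proof -
  let ?K = "kys m \<union> kys n"
  have "kys (m + n) \<subseteq> ?K" by (rule keys_add)
  then show ?thesis
    using tdeg_superset[of ?K "m+n"] tdeg_superset[of ?K m] tdeg_superset[of ?K n]
    by (simp add: lookup_add sum.distrib)
qed

lemma tdeg_zero [simp]: "tdeg 0 = 0" by (simp add: tdeg_def)
lemma tdeg_single [simp]: "tdeg (sg v k) = k" by (simp add: tdeg_def)

lemma mono_split: "lk m v \<noteq> 0 \<Longrightarrow> sg v 1 + (m - sg v 1) = (m :: 'v \<Rightarrow>\<^sub>0 nat)"
  by (rule poly_mapping_eqI) (auto simp: lookup_add lookup_minus lookup_single when_def)

lemma mono_induct [case_names zero step]:
  assumes "P 0" "\<And>v m. P m \<Longrightarrow> P (sg v 1 + m)"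
  shows "P (m :: 'v \<Rightarrow>\<^sub>0 nat)"
proof (induction "tdeg m" arbitrary: m)
  case 0
  then have "m = 0"
    by (intro poly_mapping_eqI) (auto simp: tdeg_def in_keys_iff)
  then show ?case using assms by simp
next
  case (Suc d)
  then obtain v where v: "lk m v \<noteq> 0"
    unfolding tdeg_def by (metis sum.neutral Zero_not_Suc)
  note e = mono_split[OF v]
  then have "tdeg m = 1 + tdeg (m - sg v 1)" by (metis tdeg_add tdeg_single)
  then have "P (m - sg v 1)" using Suc by simp
  then show ?case using assms(2) e by metis
qed

text \<open>Constants, sums and multiplication by one variable generate the polynomial ring, so
  identities between homomorphisms or derivations need only be checked on single variables.\<close>

lemma poly_induct [case_names const add var]:
  fixes A :: "('v \<Rightarrow>\<^sub>0 nat) \<Rightarrow>\<^sub>0 'a::comm_ring_1"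
  assumes c: "\<And>c. P (sg 0 c)" and a: "\<And>A B. P A \<Longrightarrow> P B \<Longrightarrow> P (A + B)"
    and v: "\<And>v A. P A \<Longrightarrow> P (sg (sg v 1) 1 * A)"
  shows "P A"
proof -
  have m: "P (sg m c)" for m c
  proof (induction m rule: mono_induct)
    case (step v m)
    from v[OF this, of v] show ?case by (simp add: mult_single)
  qed (rule c)
  have "P (\<Sum>m\<in>K. sg m (lk A m))" if "finite K" for K
    using that
  proof (induction K rule: finite_induct)
    case empty
    then show ?case using c[of 0] by simp
  qed (auto intro: a m)
  then show ?thesis using poly_expand[of A] by (metis finite_keys)
qed

lemma lookup_single_times: "lk (sg k c * A) (k + n) = (c::'a::comm_ring_1) * lk A (n::'v \<Rightarrow>\<^sub>0 nat)"
proof -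
  have "lk (sg k c * A) (k+n) = lk (\<Sum>m\<in>kys A. sg (k+m) (c * lk A m)) (k+n)"
    by (subst poly_expand[of A]) (simp add: sum_distrib_left mult_single)
  also have "\<dots> = c * lk A n"
    by (simp add: lookup_sum lookup_single when_def in_keys_iff)
  finally show ?thesis .
qed

lemma lookup_single_times_0:
  fixes m :: "'v \<Rightarrow>\<^sub>0 nat"
  assumes "\<And>n. k + n \<noteq> m"
  shows "lk (sg k c * A) m = (0::'a::comm_ring_1)"
proof -
  have "lk (sg k c * A) m = lk (\<Sum>m\<in>kys A. sg (k+m) (c * lk A m)) m"
    by (subst poly_expand[of A]) (simp add: sum_distrib_left mult_single)
  also have "\<dots> = 0"
    using assms by (simp add: lookup_sum lookup_single when_def)
  finally show ?thesis .
qed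

lemma lookup_var_times: "lk (sg (sg v 1) 1 * A) m = 
   (if lk m v = 0 then 0 else lk (A :: ('v \<Rightarrow>\<^sub>0 nat) \<Rightarrow>\<^sub>0 'a::comm_ring_1) (m - sg v 1))"
proof (cases "lk m v = 0")
  case True
  then have "sg v 1 + n \<noteq> m" for n by (auto simp: lookup_add)
  then show ?thesis using True lookup_single_times_0 by fastforce
next
  case False
  then show ?thesis using lookup_single_times[of "sg v 1" 1 A "m - sg v 1"] mono_split[OF False] by simp
qed

lemma lookup_const_times: "lk (sg 0 c * A) m = (c::'a::comm_ring_1) * lk A (m::'v \<Rightarrow>\<^sub>0 nat)"
  using lookup_single_times[of 0 c A m] by simp

subsection \<open>Evaluation\<close>

text \<open>One notion serves all coefficient maps that \<open>peval\<close> is used with, such as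
  the identity, the embedding of constants into symbols, and that of real coefficients.\<close>

definition ring_map :: "('a::comm_ring_1 \<Rightarrow> 'b::comm_ring_1) \<Rightarrow> bool" where
  "ring_map f \<longleftrightarrow> f 0 = 0 \<and> f 1 = 1 \<and> (\<forall>x y. f (x + y) = f x + f y) \<and> (\<forall>x y. f (x * y) = f x * f y)"

definition mev :: "('v \<Rightarrow> 'b::comm_ring_1) \<Rightarrow> ('v \<Rightarrow>\<^sub>0 nat) \<Rightarrow> 'b" where
  "mev val m = (\<Prod>v\<in>kys m. val v ^ lk m v)"

lemma mev_superset: "finite K \<Longrightarrow> kys m \<subseteq> K \<Longrightarrow> mev val m = (\<Prod>v\<in>K. val v ^ lk m v)"
  unfolding mev_def by (rule prod.mono_neutral_left) (auto simp: in_keys_iff)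

lemma mev_zero [simp]: "mev val 0 = 1" by (simp add: mev_def)
lemma mev_single [simp]: "mev val (sg v k) = val v ^ k" by (simp add: mev_def)
lemma mev_add: "mev val (m + n) = mev val m * mev val n"
proof -
  let ?K = "kys m \<union> kys n"
  have "kys (m + n) \<subseteq> ?K" by (rule keys_add)
  then show ?thesis
    using mev_superset[of ?K "m+n" val] mev_superset[of ?K m val] mev_superset[of ?K n val]
    by (simp add: lookup_add power_add prod.distrib)
qed

lemma peval_superset: "emb 0 = 0 \<Longrightarrow> finite K \<Longrightarrow> kys A \<subseteq> K \<Longrightarrow> 
  peval emb val A = (\<Sum>m\<in>K. emb (lk A m) * mev val m)"
  unfolding peval_def mev_def by (rule sum.mono_neutral_left) (auto simp: in_keys_iff)

context
  fixes emb :: "'a::comm_ring_1 \<Rightarrow> 'b::comm_ring_1" and val :: "'v \<Rightarrow> 'b"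
  assumes e: "ring_map emb"
begin

lemma peval_zero [simp]: "peval emb val 0 = 0" by (simp add: peval_def)

lemma peval_single: "peval emb val (sg m c) = emb c * mev val m"
  using peval_superset[of emb "{m}" "sg m c" val] e by (simp add: ring_map_def)

lemma peval_add: "peval emb val (A + B) = peval emb val A + peval emb val B"
proof -
  let ?K = "kys A \<union> kys B"
  have "kys (A + B) \<subseteq> ?K" by (rule keys_add)
  then show ?thesis
    using peval_superset[of emb ?K "A+B" val] peval_superset[of emb ?K A val] peval_superset[of emb ?K B val] e
    by (simp add: lookup_add sum.distrib ring_map_def algebra_simps)
qed

lemma peval_uminus: "peval emb val (- A) = - peval emb val A"
proof -
  have "peval emb val (- A) + peval emb val A = 0" by (simp flip: peval_add)
  then show ?thesis by (simp add: eq_neg_iff_add_eq_0)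
qed

lemma peval_diff: "peval emb val (A - B) = peval emb val A - peval emb val B"
  using peval_add[of A "-B"] peval_uminus by simp

lemma peval_sum: "peval emb val (\<Sum>i\<in>I. A i) = (\<Sum>i\<in>I. peval emb val (A i))"
  by (induction I rule: infinite_finite_induct) (auto simp: peval_add)

lemma peval_const: "peval emb val (sg 0 c) = emb c" by (simp add: peval_single)

lemma peval_one: "peval emb val 1 = 1" using peval_const[of 1] e by (simp add: ring_map_def single_one)

lemma peval_var: "peval emb val (sg (sg v 1) 1) = val v" using e by (simp add: peval_single ring_map_def)

lemma peval_mult: "peval emb val (A * B) = peval emb val A * peval emb val B"
proof -
  have "A * B = (\<Sum>m\<in>kys A. sg m (lk A m)) * (\<Sum>n\<in>kys B. sg n (lk B n))"
    using poly_expand[of A] poly_expand[of B] by metis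
  also have "\<dots> = (\<Sum>m\<in>kys A. \<Sum>n\<in>kys B. sg (m+n) (lk A m * lk B n))"
    by (simp add: sum_product mult_single)
  finally have "peval emb val (A * B) = (\<Sum>m\<in>kys A. \<Sum>n\<in>kys B. emb (lk A m * lk B n) * mev val (m+n))"
    by (simp add: peval_sum peval_single)
  also have "\<dots> = (\<Sum>m\<in>kys A. emb (lk A m) * mev val m) * (\<Sum>n\<in>kys B. emb (lk B n) * mev val n)"
    unfolding sum_product using e by (simp add: ring_map_def mev_add mult_ac)
  also have "\<dots> = peval emb val A * peval emb val B" by (simp add: peval_def mev_def)
  finally show ?thesis .
qed

lemma peval_power: "peval emb val (A ^ n) = peval emb val A ^ n"
  by (induction n) (auto simp: peval_one peval_mult)

end

lemma ring_map_id [simp]: "ring_map id" by (simp add: ring_map_def)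
lemma ring_map_sconst [simp]: "ring_map sconst"
  by (simp add: ring_map_def sconst_def single_add mult_single flip: single_one)
lemma ring_map_sconst_real [simp]: "ring_map (\<lambda>c. sconst (of_real c))"
  by (simp add: ring_map_def sconst_def single_add mult_single flip: single_one)

subsection \<open>Symbols\<close>

lemma sym_induct [case_names const add var]:
  fixes A :: "'n sym"
  assumes "\<And>c. P (sconst c)" "\<And>A B. P A \<Longrightarrow> P B \<Longrightarrow> P (A + B)" "\<And>v A. P A \<Longrightarrow> P (svar v * A)"
  shows "P A"
  using assms unfolding sconst_def svar_def by (rule poly_induct)

lemma lookup_svar_times: "lk (svar v * A) m = (if lk m v = 0 then 0 else lk A (m - sg v 1))"
  unfolding svar_def by (rule lookup_var_times)

lemma lookup_sconst_times [simp]: "lk (sconst c * A) m = c * lk A m"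
  unfolding sconst_def by (rule lookup_const_times)

lemma sconst_0 [simp]: "sconst 0 = 0" by (simp add: sconst_def)
lemma sconst_1 [simp]: "sconst 1 = 1" by (simp add: sconst_def single_one)
lemma sconst_add: "sconst (a + b) = sconst a + sconst b" by (simp add: sconst_def single_add)
lemma sconst_mult: "sconst (a * b) = sconst a * sconst b" by (simp add: sconst_def mult_single)
lemma sconst_uminus: "sconst (- a) = - sconst a" by (simp add: sconst_def single_uminus)
lemma sconst_diff: "sconst (a - b) = sconst a - sconst b" by (simp add: sconst_def single_diff)
lemma sconst_power: "sconst (a ^ n) = sconst a ^ n" by (induction n) (auto simp: sconst_mult)
lemma sconst_of_nat: "sconst (of_nat n) = of_nat n" by (induction n) (auto simp: sconst_add)
lemma sconst_numeral: "sconst (numeral n) = numeral n"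
  using sconst_of_nat[of "numeral n"] by simp
lemma sconst_sum: "sconst (\<Sum>i\<in>I. f i) = (\<Sum>i\<in>I. sconst (f i))"
  by (induction I rule: infinite_finite_induct) (auto simp: sconst_add)
lemma sconst_inj [simp]: "sconst a = sconst b \<longleftrightarrow> a = b"
  unfolding sconst_def by (metis lookup_single_eq)

lemma lookup_spartial: "lk (spartial v A) n = of_nat (lk n v + 1) * lk A (n + sg v 1)"
proof -
  have "lk (spartial v A) n = (\<Sum>m\<in>kys A. (of_nat (lk m v) * lk A m when m - sg v 1 = n))"
    by (simp add: spartial_def lookup_sum lookup_single)
  also have "\<dots> = (\<Sum>m\<in>kys A. if m = n + sg v 1 then of_nat (lk m v) * lk A m else 0)"
  proof (rule sum.cong[OF refl])
    fix m
    show "(of_nat (lk m v) * lk A m when m - sg v 1 = n) = (if m = n + sg v 1 then of_nat (lk m v) * lk A m else 0)"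
    proof (cases "lk m v = 0")
      case False
      then have "sg v 1 + (m - sg v 1) = m" by (rule mono_split)
      then have "m - sg v 1 = n \<longleftrightarrow> m = n + sg v 1" by (metis add.commute add_diff_cancel_left')
      then show ?thesis by (simp add: when_def)
    qed (auto simp: when_def lookup_add)
  qed
  also have "\<dots> = of_nat (lk n v + 1) * lk A (n + sg v 1)"
    by (auto simp: lookup_add in_keys_iff)
  finally show ?thesis .
qed

lemma spartial_add: "spartial v (A + B) = spartial v A + spartial v B"
  by (rule poly_mapping_eqI) (simp add: lookup_spartial lookup_add algebra_simps)
lemma spartial_uminus: "spartial v (- A) = - spartial v A"
  by (rule poly_mapping_eqI) (simp add: lookup_spartial lookup_add algebra_simps)
lemma spartial_diff: "spartial v (A - B) = spartial v A - spartial v B"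
  by (rule poly_mapping_eqI) (simp add: lookup_spartial lookup_minus algebra_simps)
lemma spartial_0 [simp]: "spartial v 0 = 0"
  by (rule poly_mapping_eqI) (simp add: lookup_spartial)
lemma spartial_sum: "spartial v (\<Sum>i\<in>I. A i) = (\<Sum>i\<in>I. spartial v (A i))"
  by (induction I rule: infinite_finite_induct) (auto simp: spartial_add)
lemma spartial_sconst_mult: "spartial v (sconst c * A) = sconst c * spartial v A"
  by (rule poly_mapping_eqI) (simp add: lookup_spartial)
lemma spartial_comm: "spartial v (spartial w A) = spartial w (spartial v A)"
  by (rule poly_mapping_eqI) (simp add: lookup_spartial lookup_add lookup_single when_def add_ac)
lemma spartial_sconst [simp]: "spartial v (sconst c) = 0"
proof (rule poly_mapping_eqI)
  fix n
  have "lk (n + sg v (1::nat)) v \<noteq> 0" by (simp add: lookup_add)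
  then have "n + sg v (1::nat) \<noteq> 0" by force
  then show "lk (spartial v (sconst c)) n = lk 0 n"
    by (simp add: lookup_spartial sconst_def lookup_single when_def)
qed
lemma spartial_1 [simp]: "spartial v 1 = 0" using spartial_sconst[of v 1] by simp

lemma spartial_svar_mult: "spartial v (svar w * A) = (if v = w then A else 0) + svar w * spartial v A"
proof (rule poly_mapping_eqI)
  fix n
  show "lk (spartial v (svar w * A)) n = lk ((if v = w then A else 0) + svar w * spartial v A) n"
  proof (cases "v = w")
    case True
    show ?thesis
    proof (cases "lk n v = 0")
      case False
      then have "n - sg v 1 + sg v 1 = n" using mono_split[of n v] by (metis add.commute)
      then show ?thesis using True False
        by (simp add: lookup_spartial lookup_svar_times lookup_add lookup_minus of_nat_diff)
          (simp add: add.commute algebra_simps)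
    qed (use True in \<open>simp add: lookup_spartial lookup_svar_times lookup_add lookup_minus\<close>)
  next
    case False
    show ?thesis
    proof (cases "lk n w = 0")
      case True
      then show ?thesis using False
        by (simp add: lookup_spartial lookup_svar_times lookup_add lookup_single when_def)
    next
      case ne: False
      have "n + sg v 1 - sg w 1 = n - sg w 1 + sg v 1"
        using ne by (intro poly_mapping_eqI) (auto simp: lookup_add lookup_minus lookup_single when_def)
      then show ?thesis using False ne
        by (simp add: lookup_spartial lookup_svar_times lookup_add lookup_minus lookup_single when_def)
    qed
  qed
qed

lemma spartial_svar: "spartial v (svar w) = (if v = w then 1 else 0)"
  using spartial_svar_mult[of v w 1] by simp

lemma spartial_mult: "spartial v (A * B) = spartial v A * B + A * spartial v B"
proof (induction A rule: sym_induct)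
  case (var w A)
  have "spartial v (svar w * A * B) = (if v = w then A * B else 0) + svar w * spartial v (A * B)"
    using spartial_svar_mult[of v w "A * B"] by (simp add: mult.assoc)
  then show ?case using var by (simp only: spartial_svar_mult) (simp add: algebra_simps)
next
  case (add A A')
  then show ?case by (simp add: spartial_add algebra_simps)
qed (simp add: spartial_sconst_mult)

lemma spartial_power: "spartial v (A ^ n) = of_nat n * A ^ (n - 1) * spartial v A"
proof (induction n)
  case (Suc n)
  then show ?case by (cases n) (auto simp: spartial_mult algebra_simps)
qed simp

text \<open>Multiplication by a variable only shifts exponents. Applied to \<open>HBAR\<close>, this
  cancellation makes the definite description in \<open>moyal\<close> unique.\<close>

lemma svar_mult_inj: "svar v * A = svar v * B \<Longrightarrow> A = B"
proof (rule poly_mapping_eqI)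
  fix m assume "svar v * A = svar v * B"
  then have "lk (svar v * A) (sg v 1 + m) = lk (svar v * B) (sg v 1 + m)" by simp
  then show "lk A m = lk B m" by (simp add: lookup_svar_times lookup_add)
qed

subsection \<open>Order and reality\<close>

definition weight :: "'n svar \<Rightarrow> nat" where "weight v = (if v = HBAR then 2 else 1)"

lemma mon_order_superset: "finite K \<Longrightarrow> kys m \<subseteq> K \<Longrightarrow> mon_order m = (\<Sum>v\<in>K. weight v * lk m v)"
  unfolding mon_order_def weight_def by (rule sum.mono_neutral_left) (auto simp: in_keys_iff)

lemma mon_order_zero [simp]: "mon_order 0 = 0" by (simp add: mon_order_def)
lemma mon_order_single [simp]: "mon_order (sg v k) = weight v * k"
  by (simp add: mon_order_def weight_def)
lemma mon_order_add: "mon_order (m + n) = mon_order m + mon_order n"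
proof -
  let ?K = "kys m \<union> kys n"
  have "kys (m + n) \<subseteq> ?K" by (rule keys_add)
  then show ?thesis
    using mon_order_superset[of ?K "m+n"] mon_order_superset[of ?K m] mon_order_superset[of ?K n]
    by (simp add: lookup_add sum.distrib algebra_simps)
qed

definition homog :: "nat \<Rightarrow> 'n sym \<Rightarrow> bool" where
  "homog s A \<longleftrightarrow> (\<forall>m. lk A m \<noteq> 0 \<longrightarrow> mon_order m = s)"

definition realsym :: "'n sym \<Rightarrow> bool" where
  "realsym A \<longleftrightarrow> (\<forall>m. lk A m \<in> \<real>)"

lemma Word_iff: "A \<in> Word s \<longleftrightarrow> homog s A \<and> realsym A"
proof -
  have "lk A m \<in> \<real>" if "lk A m = 0" for m using that by simp
  then show ?thesis unfolding Word_def homog_def realsym_def by (auto simp: in_keys_iff)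
qed

lemma homog_0 [simp]: "homog s 0" by (simp add: homog_def)
lemma homog_add: "homog s A \<Longrightarrow> homog s B \<Longrightarrow> homog s (A + B)"
  unfolding homog_def lookup_add by (metis add_0)
lemma homog_uminus: "homog s A \<Longrightarrow> homog s (- A)"
  by (auto simp: homog_def)
lemma homog_diff: "homog s A \<Longrightarrow> homog s B \<Longrightarrow> homog s (A - B)"
  using homog_add[of s A "-B"] homog_uminus by auto
lemma homog_sum: "(\<And>i. i \<in> I \<Longrightarrow> homog s (A i)) \<Longrightarrow> homog s (\<Sum>i\<in>I. A i)"
  by (induction I rule: infinite_finite_induct) (auto intro: homog_add)
lemma homog_sconst: "homog 0 (sconst c)"
  by (simp add: homog_def sconst_def lookup_single when_def)
lemma homog_svar: "homog (weight v) (svar v)"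
  by (auto simp add: homog_def svar_def lookup_single when_def)
lemma homog_mult: assumes "homog s A" "homog t B" shows "homog (s + t) (A * B)"
proof -
  have "A * B = (\<Sum>m\<in>kys A. sg m (lk A m)) * (\<Sum>n\<in>kys B. sg n (lk B n))"
    using poly_expand[of A] poly_expand[of B] by metis
  also have "\<dots> = (\<Sum>m\<in>kys A. \<Sum>n\<in>kys B. sg (m+n) (lk A m * lk B n))"
    by (simp add: sum_product mult_single)
  finally have e: "A * B = (\<Sum>m\<in>kys A. \<Sum>n\<in>kys B. sg (m+n) (lk A m * lk B n))" .
  have "homog (s + t) (sg (m+n) (lk A m * lk B n))" for m n
    using assms by (auto simp: homog_def lookup_single when_def mon_order_add)
  then show ?thesis unfolding e by (intro homog_sum)
qed
lemma homog_mult_eq: "homog s A \<Longrightarrow> homog t B \<Longrightarrow> u = s + t \<Longrightarrow> homog u (A * B)"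
  using homog_mult by blast
lemma homog_sconst_mult: "homog s A \<Longrightarrow> homog s (sconst c * A)"
  by (auto simp: homog_def)
lemma homog_power: "homog s A \<Longrightarrow> homog (s * n) (A ^ n)"
proof (induction n)
  case 0
  then show ?case using homog_sconst[of 1] by simp
next
  case (Suc n)
  then show ?case using homog_mult[of s A "s * n" "A ^ n"] by simp
qed
lemma homog_spartial: "homog s A \<Longrightarrow> homog (s - weight v) (spartial v A)"
  unfolding homog_def lookup_spartial
  by (metis add_diff_cancel_right' mon_order_add mon_order_single mult.right_neutral mult_zero_right)
lemma homog_small_spartial: "homog s A \<Longrightarrow> s < weight v \<Longrightarrow> spartial v A = 0"
proof (rule poly_mapping_eqI)
  fix m assume "homog s A" "s < weight v"
  then have "lk A (m + sg v 1) = 0"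
    by (metis homog_def mon_order_add mon_order_single mult.right_neutral not_add_less2)
  then show "lk (spartial v A) m = lk 0 m" by (simp add: lookup_spartial)
qed

lemma realsym_0 [simp]: "realsym 0" by (simp add: realsym_def)
lemma realsym_add: "realsym A \<Longrightarrow> realsym B \<Longrightarrow> realsym (A + B)"
  by (simp add: realsym_def lookup_add)
lemma realsym_diff: "realsym A \<Longrightarrow> realsym B \<Longrightarrow> realsym (A - B)"
  by (simp add: realsym_def lookup_minus)
lemma realsym_sum: "(\<And>i. i \<in> I \<Longrightarrow> realsym (A i)) \<Longrightarrow> realsym (\<Sum>i\<in>I. A i)"
  by (induction I rule: infinite_finite_induct) (auto intro: realsym_add)
lemma realsym_sconst: "c \<in> \<real> \<Longrightarrow> realsym (sconst c)"
  by (simp add: realsym_def sconst_def lookup_single when_def)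
lemma realsym_sconst_mult: "c \<in> \<real> \<Longrightarrow> realsym A \<Longrightarrow> realsym (sconst c * A)"
  by (simp add: realsym_def)
lemma realsym_svar: "realsym (svar v)"
  by (simp add: realsym_def svar_def lookup_single when_def)
lemma realsym_mult: assumes "realsym A" "realsym B" shows "realsym (A * B)"
proof -
  have "A * B = (\<Sum>m\<in>kys A. sg m (lk A m)) * (\<Sum>n\<in>kys B. sg n (lk B n))"
    using poly_expand[of A] poly_expand[of B] by metis
  also have "\<dots> = (\<Sum>m\<in>kys A. \<Sum>n\<in>kys B. sg (m+n) (lk A m * lk B n))"
    by (simp add: sum_product mult_single)
  finally have e: "A * B = (\<Sum>m\<in>kys A. \<Sum>n\<in>kys B. sg (m+n) (lk A m * lk B n))" .
  have "realsym (sg (m+n) (lk A m * lk B n))" for m n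
    using assms by (auto simp: realsym_def lookup_single when_def)
  then show ?thesis unfolding e by (intro realsym_sum)
qed
lemma realsym_1 [simp]: "realsym 1" using realsym_sconst[of 1] by simp
lemma realsym_power: "realsym A \<Longrightarrow> realsym (A ^ n)"
  by (induction n) (auto intro: realsym_mult)

section \<open>Complex conjugation of coefficients and the real part of a symbol\<close>

definition scnj :: "'n sym \<Rightarrow> 'n sym" where "scnj A = Poly_Mapping.map cnj A"

lemma lookup_scnj [simp]: "lk (scnj A) m = cnj (lk A m)"
  by (simp add: scnj_def map.rep_eq when_def)
lemma scnj_add: "scnj (A + B) = scnj A + scnj B"
  by (rule poly_mapping_eqI) (simp add: lookup_add)
lemma scnj_diff: "scnj (A - B) = scnj A - scnj B"
  by (rule poly_mapping_eqI) (simp add: lookup_minus)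
lemma scnj_0 [simp]: "scnj 0 = 0"
  by (rule poly_mapping_eqI) simp
lemma scnj_sum: "scnj (\<Sum>i\<in>I. A i) = (\<Sum>i\<in>I. scnj (A i))"
  by (induction I rule: infinite_finite_induct) (auto simp: scnj_add)
lemma scnj_sconst [simp]: "scnj (sconst c) = sconst (cnj c)"
  by (rule poly_mapping_eqI) (simp add: sconst_def lookup_single when_def)
lemma scnj_svar [simp]: "scnj (svar v) = svar v"
  by (rule poly_mapping_eqI) (simp add: svar_def lookup_single when_def)
lemma scnj_svar_mult [simp]: "scnj (svar v * A) = svar v * scnj A"
  by (rule poly_mapping_eqI) (simp add: lookup_svar_times)
lemma scnj_sconst_mult [simp]: "scnj (sconst c * A) = sconst (cnj c) * scnj A"
  by (rule poly_mapping_eqI) simp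
lemma scnj_mult: "scnj (A * B) = scnj A * scnj B"
proof (induction A rule: sym_induct)
  case (var w A)
  then show ?case using scnj_svar_mult[of w "A * B"] by (simp add: mult.assoc)
next
  case (add A A')
  then show ?case by (simp add: scnj_add distrib_right)
qed simp
lemma scnj_spartial: "scnj (spartial v A) = spartial v (scnj A)"
  by (rule poly_mapping_eqI) (simp add: lookup_spartial)
lemma scnj_scnj [simp]: "scnj (scnj A) = A"
  by (rule poly_mapping_eqI) simp
lemma realsym_iff: "realsym A \<longleftrightarrow> scnj A = A"
  by (auto simp: realsym_def poly_mapping_eq_iff fun_eq_iff Reals_cnj_iff)
lemma homog_scnj: "homog s A \<Longrightarrow> homog s (scnj A)" by (simp add: homog_def)

text \<open>Projection onto the real symbols. It turns complex solutions of linear equations with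
  real data into real ones and respects the order.\<close>

definition sre :: "'n sym \<Rightarrow> 'n sym" where "sre A = sconst (1/2) * (A + scnj A)"

lemma realsym_sre: "realsym (sre A)" by (simp add: sre_def realsym_iff scnj_add add.commute)
lemma homog_sre: "homog s A \<Longrightarrow> homog s (sre A)"
  by (simp add: sre_def homog_add homog_scnj homog_sconst_mult)
lemma sre_real: "realsym A \<Longrightarrow> sre A = A"
  by (rule poly_mapping_eqI) (simp only: sre_def realsym_iff lookup_sconst_times lookup_add, simp)
lemma sre_Word: "homog s A \<Longrightarrow> sre A \<in> Word s"
  by (simp add: Word_iff homog_sre realsym_sre)

lemma Word_0 [simp]: "0 \<in> Word s" by (simp add: Word_iff)
lemma Word_add: "A \<in> Word s \<Longrightarrow> B \<in> Word s \<Longrightarrow> A + B \<in> Word s"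
  by (simp add: Word_iff homog_add realsym_add)
lemma Word_diff: "A \<in> Word s \<Longrightarrow> B \<in> Word s \<Longrightarrow> A - B \<in> Word s"
  by (simp add: Word_iff homog_diff realsym_diff)
lemma Word_sum: "(\<And>i. i \<in> I \<Longrightarrow> A i \<in> Word s) \<Longrightarrow> (\<Sum>i\<in>I. A i) \<in> Word s"
  by (simp add: Word_iff homog_sum realsym_sum)
lemma Word_mult: "A \<in> Word s \<Longrightarrow> B \<in> Word t \<Longrightarrow> A * B \<in> Word (s + t)"
  by (simp add: Word_iff homog_mult realsym_mult)
lemma Word_scale: "c \<in> \<real> \<Longrightarrow> A \<in> Word s \<Longrightarrow> sconst c * A \<in> Word s"
  by (simp add: Word_iff homog_sconst_mult realsym_sconst_mult)

subsection \<open>Degree\<close>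

text \<open>Plain degree, with \<open>HBAR\<close> counted once, as opposed to the order. It bounds
  the number of terms of a star product and serves as an induction parameter.\<close>

definition poly_deg_le :: "nat \<Rightarrow> 'n sym \<Rightarrow> bool" where
  "poly_deg_le d A \<longleftrightarrow> (\<forall>m. lk A m \<noteq> 0 \<longrightarrow> tdeg m \<le> d)"

lemma poly_deg_le_exists: "\<exists>d. poly_deg_le d A"
proof (cases "kys A = {}")
  case True
  then show ?thesis by (auto simp: poly_deg_le_def in_keys_iff)
next
  case False
  then have "poly_deg_le (Max (tdeg ` kys A)) A"
    by (auto simp: poly_deg_le_def in_keys_iff intro!: Max_ge)
  then show ?thesis ..
qed

lemma poly_deg_le_mono: "poly_deg_le d A \<Longrightarrow> d \<le> e \<Longrightarrow> poly_deg_le e A"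
  by (force simp: poly_deg_le_def)

lemma poly_deg_le_spartial: "poly_deg_le d A \<Longrightarrow> poly_deg_le (d - 1) (spartial v A)"
  unfolding poly_deg_le_def lookup_spartial
  by (metis add_diff_cancel_right' diff_le_mono mult_zero_right tdeg_add tdeg_single)

lemma poly_deg_le_0_spartial: "poly_deg_le 0 A \<Longrightarrow> spartial v A = 0"
proof (rule poly_mapping_eqI)
  fix m assume "poly_deg_le 0 A"
  then have "lk A (m + sg v 1) = 0"
    unfolding poly_deg_le_def by (metis add_is_0 le_zero_eq one_neq_zero tdeg_add tdeg_single)
  then show "lk (spartial v A) m = lk 0 m" by (simp add: lookup_spartial)
qed

lemma spartial_single: "spartial v (sg m c) = sg (m - sg v 1) (of_nat (lk m v) * c)"
  unfolding spartial_def by (cases "c = 0") auto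

text \<open>Multiplying a symbol by a coordinate makes derivatives of the symbol appear in its
  quantization. Induction over the degree of monomials provides the hypothesis for all first
  derivatives along with the symbol itself.\<close>

lemma sym_induct_deriv [case_names const add var]:
  fixes A :: "'n sym"
  assumes c: "\<And>c. P (sconst c)" and a: "\<And>A B. P A \<Longrightarrow> P B \<Longrightarrow> P (A + B)"
    and v: "\<And>v A. P A \<Longrightarrow> (\<And>w. P (spartial w A)) \<Longrightarrow> P (svar v * A)"
  shows "P A"
proof -
  have z: "P 0" using c[of 0] by simp
  have m: "P (sg m c)" for m c
  proof (induction "tdeg m" arbitrary: m c rule: less_induct)
    case less
    show ?case
    proof (cases "m = 0")
      case True
      then show ?thesis using c by (simp add: sconst_def)
    next
      case False
      then obtain v where v0: "lk m v \<noteq> 0" by (metis poly_mapping_eqI lookup_zero)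
      define m' where "m' = m - sg v 1"
      have m: "m = sg v 1 + m'" using mono_split[OF v0] by (simp add: m'_def)
      have t: "tdeg m = 1 + tdeg m'" unfolding m by (simp add: tdeg_add)
      have "P (spartial w (sg m' c))" for w
      proof (cases "lk m' w = 0")
        case True
        then show ?thesis using z by (simp add: spartial_single)
      next
        case False
        then have "sg w 1 + (m' - sg w 1) = m'" by (rule mono_split)
        then have "tdeg m' = 1 + tdeg (m' - sg w 1)" by (metis tdeg_add tdeg_single)
        then show ?thesis using less t by (simp add: spartial_single)
      qed
      then have "P (svar v * sg m' c)" using v less t by simp
      then show ?thesis by (simp add: svar_def mult_single m)
    qed
  qed
  have "P (\<Sum>m\<in>K. sg m (lk A m))" if "finite K" for K
    using that by (induction K rule: finite_induct) (auto intro: a m z)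
  then show ?thesis using poly_expand[of A] by (metis finite_keys)
qed

subsection \<open>The bidifferential operators\<close>

lemma bidiff_0_left [simp]: "bidiff k 0 B = 0" by (induction k arbitrary: B) auto
lemma bidiff_0_right [simp]: "bidiff k A 0 = 0" by (induction k arbitrary: A) auto

lemma bidiff_add_left: "bidiff k (A + A') B = bidiff k A B + bidiff k A' B"
proof (induction k arbitrary: A A' B)
  case (Suc k)
  then show ?case by (simp add: spartial_add flip: sum.distrib) (simp add: algebra_simps)
qed (simp add: algebra_simps)

text \<open>Exchanging the arguments reverses the sign of each of the k antisymmetric pairings.
  Rules for one argument are thereby carried over to the other.\<close>

lemma bidiff_comm: "bidiff k B A = (-1) ^ k * bidiff k A B"
proof (induction k arbitrary: A B)
  case (Suc k)
  have "bidiff (Suc k) B A = (\<Sum>j\<in>UNIV. (-1)^k * bidiff k (spartial (MOM j) A) (spartial (POS j) B)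
      - (-1)^k * bidiff k (spartial (POS j) A) (spartial (MOM j) B))"
    by (simp flip: Suc)
  also have "\<dots> = (-1) ^ Suc k * bidiff (Suc k) A B"
    by (simp add: sum_distrib_left algebra_simps flip: sum_negf)
  finally show ?case .
qed (simp add: mult.commute)

lemma bidiff_add_right: "bidiff k A (B + B') = bidiff k A B + bidiff k A B'"
  using bidiff_add_left[of k B B' A] by (simp add: bidiff_comm[of k A] algebra_simps)

lemma bidiff_uminus_left: "bidiff k (- A) B = - bidiff k A B"
proof -
  have "bidiff k (- A) B + bidiff k A B = 0" by (simp flip: bidiff_add_left)
  then show ?thesis by (simp add: eq_neg_iff_add_eq_0)
qed

lemma bidiff_sconst_left: "bidiff k (sconst c * A) B = sconst c * bidiff k A B"
proof (induction k arbitrary: A B)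
  case (Suc k)
  then show ?case by (simp add: spartial_sconst_mult sum_distrib_left right_diff_distrib)
qed (simp add: mult.assoc)

lemma bidiff_spartial: "spartial v (bidiff k A B) = bidiff k (spartial v A) B + bidiff k A (spartial v B)"
proof (induction k arbitrary: A B)
  case (Suc k)
  then show ?case
    by (simp add: spartial_sum spartial_diff spartial_comm[of v] flip: sum.distrib) (simp add: algebra_simps)
qed (simp add: spartial_mult)

text \<open>The derivative along the conjugate variable, for which \<open>star A w = A * w + (i h / 2) * conj_deriv w A\<close>.\<close>

fun conj_deriv :: "'n svar \<Rightarrow> 'n sym \<Rightarrow> 'n sym" where
  "conj_deriv (POS j) A = - spartial (MOM j) A"
| "conj_deriv (MOM j) A = spartial (POS j) A"
| "conj_deriv HBAR A = 0"

lemma conj_deriv_spartial: "conj_deriv w (spartial v A) = spartial v (conj_deriv w A)"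
  by (cases w) (auto simp: spartial_comm spartial_uminus)
lemma conj_deriv_1 [simp]: "conj_deriv w 1 = 0" by (cases w) auto

text \<open>A variable can be differentiated only once, so at most one of the k pairings hits
  \<open>w\<close>; there are k choices for it, and it leaves the conjugate derivative on
  \<open>A\<close>.\<close>

lemma bidiff_svar_right:
  "bidiff k A (svar w * B) = svar w * bidiff k A B + of_nat k * bidiff (k - 1) (conj_deriv w A) B"
proof (induction k arbitrary: A B)
  case (Suc k)
  \<comment> \<open>The contribution in which the outermost pairing hits \<open>w\<close>.\<close>
  have 1: "(\<Sum>j\<in>UNIV. bidiff k (spartial (POS j) A) (if MOM j = w then B else 0)
     - bidiff k (spartial (MOM j) A) (if POS j = w then B else 0)) = bidiff k (conj_deriv w A) B"
  proof (cases w)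
    case (MOM i)
    then show ?thesis by (simp add: if_distrib[of "bidiff k _"] cong: if_cong)
  next
    case (POS i)
    then show ?thesis by (simp add: if_distrib[of "bidiff k _"] bidiff_uminus_left sum_negf cong: if_cong)
  qed simp
  \<comment> \<open>One of the k inner pairings has hit \<open>w\<close>; the outermost pairing
    joins the others. For k = 0 both sides vanish.\<close>
  have 2: "of_nat k * (\<Sum>j\<in>UNIV. bidiff (k-1) (spartial (POS j) (conj_deriv w A)) (spartial (MOM j) B)
     - bidiff (k-1) (spartial (MOM j) (conj_deriv w A)) (spartial (POS j) B)) = of_nat k * bidiff k (conj_deriv w A) B"
    by (cases k) simp_all
  have "bidiff (Suc k) A (svar w * B) = 
     (\<Sum>j\<in>UNIV. bidiff k (spartial (POS j) A) (if MOM j = w then B else 0)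
     - bidiff k (spartial (MOM j) A) (if POS j = w then B else 0)) +
     (svar w * bidiff (Suc k) A B + of_nat k * (\<Sum>j\<in>UNIV. bidiff (k-1) (spartial (POS j) (conj_deriv w A)) (spartial (MOM j) B)
     - bidiff (k-1) (spartial (MOM j) (conj_deriv w A)) (spartial (POS j) B)))"
    by (simp add: spartial_svar_mult bidiff_add_right Suc conj_deriv_spartial sum_distrib_left
        flip: sum.distrib) (simp add: algebra_simps)
  then show ?case unfolding 1 2 by (simp add: algebra_simps)
qed simp

lemma bidiff_vanish: "poly_deg_le d A \<Longrightarrow> d < k \<Longrightarrow> bidiff k A B = 0"
proof (induction k arbitrary: A B d)
  case (Suc k)
  show ?case
  proof (cases "d = 0")
    case True
    then have "spartial v A = 0" for v using Suc.prems poly_deg_le_0_spartial by blast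
    then show ?thesis by simp
  next
    case False
    have "bidiff k (spartial v A) C = 0" for v C
      by (rule Suc.IH[of "d - 1"]) (use Suc.prems False poly_deg_le_spartial in auto)
    then show ?thesis by simp
  qed
qed simp

lemma bidiff_vanish_right: "poly_deg_le d B \<Longrightarrow> d < k \<Longrightarrow> bidiff k A B = 0"
  using bidiff_vanish[of d B k A] by (simp add: bidiff_comm[of k A B])

lemma scnj_bidiff: "scnj (bidiff k A B) = bidiff k (scnj A) (scnj B)"
  by (induction k arbitrary: A B) (auto simp: scnj_mult scnj_sum scnj_diff scnj_spartial)

text \<open>Each pairing removes one momentum and one position, that is order two, which the
  accompanying factor \<open>HBAR\<close> restores. Keeping this factor avoids a subtraction of
  natural numbers in the statement.\<close>

lemma homog_bidiff: "homog s A \<Longrightarrow> homog t B \<Longrightarrow> homog (s + t) (svar HBAR ^ k * bidiff k A B)"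
proof (induction k arbitrary: A B s t)
  case 0
  then show ?case by (simp add: homog_mult)
next
  case (Suc k)
  have *: "homog (s + t) (svar HBAR * (svar HBAR ^ k * bidiff k (spartial v A) (spartial w B)))"
    if "weight v = 1" "weight w = 1" for v w
  \<comment> \<open>In order zero the derivative itself is zero, so the truncated differences
    \<open>s - 1\<close> and \<open>t - 1\<close> below are genuine.\<close>
  proof (cases "s = 0 \<or> t = 0")
    case True
    then have "spartial v A = 0 \<or> spartial w B = 0" using Suc.prems that homog_small_spartial by (metis less_one)
    then show ?thesis by auto
  next
    case False
    have "homog ((s - 1) + (t - 1)) (svar HBAR ^ k * bidiff k (spartial v A) (spartial w B))"
      using Suc.prems that by (intro Suc.IH) (metis homog_spartial)+
    then show ?thesis
      by (rule homog_mult_eq[OF homog_svar]) (use False in \<open>auto simp: weight_def\<close>)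
  qed
  have "svar HBAR ^ Suc k * bidiff (Suc k) A B = (\<Sum>j\<in>UNIV. 
     svar HBAR * (svar HBAR ^ k * bidiff k (spartial (POS j) A) (spartial (MOM j) B)) -
     svar HBAR * (svar HBAR ^ k * bidiff k (spartial (MOM j) A) (spartial (POS j) B)))"
    by (simp add: sum_distrib_left algebra_simps)
  then show ?case
    using * by (auto intro!: homog_sum homog_diff simp: weight_def)
qed

subsection \<open>Star product\<close>

definition ih2 :: "'n sym" where "ih2 = sconst (\<i> / 2) * svar HBAR"

text \<open>The sum over all k in \<open>star\<close> is a sum over its finite support, because more
  derivatives than the degree annihilate \<open>A\<close>.\<close>

lemma star_eq: "poly_deg_le n A \<Longrightarrow> star A B = (\<Sum>k\<le>n. ih2 ^ k * sconst (1 / fact k) * bidiff k A B)"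
  unfolding star_def ih2_def
  by (rule Sum_any.expand_superset) (use bidiff_vanish not_le in \<open>auto, fastforce\<close>)

lemma common_deg: "\<exists>d. poly_deg_le d A \<and> poly_deg_le d B \<and> poly_deg_le d C"
proof -
  obtain a b c where "poly_deg_le a A" "poly_deg_le b B" "poly_deg_le c C" using poly_deg_le_exists by metis
  then have "poly_deg_le (a+b+c) A \<and> poly_deg_le (a+b+c) B \<and> poly_deg_le (a+b+c) C"
    by (auto elim: poly_deg_le_mono)
  then show ?thesis by blast
qed

lemma star_add_left: "star (A + A') B = star A B + star A' B"
proof -
  obtain d where "poly_deg_le d A" "poly_deg_le d A'" "poly_deg_le d (A+A')" using common_deg by blast
  then show ?thesis by (simp add: star_eq bidiff_add_left algebra_simps sum.distrib)
qed

lemma star_add_right: "star A (B + B') = star A B + star A B'"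
proof -
  obtain d where "poly_deg_le d A" using poly_deg_le_exists by blast
  then show ?thesis by (simp add: star_eq bidiff_add_right algebra_simps sum.distrib)
qed

lemma star_sconst_left: "star (sconst c * A) B = sconst c * star A B"
proof -
  obtain d where "poly_deg_le d A" "poly_deg_le d (sconst c * A)" using common_deg by blast
  then show ?thesis by (simp add: star_eq bidiff_sconst_left sum_distrib_left mult.left_commute)
qed

lemma star_0_left [simp]: "star 0 B = 0"
  using star_add_left[of 0 0 B] by simp
lemma star_0_right [simp]: "star B 0 = 0"
  using star_add_right[of B 0 0] by simp
lemma star_uminus_left: "star (- A) B = - star A B"
  using star_add_left[of A "-A" B] by (simp add: eq_neg_iff_add_eq_0 add.commute)

lemma star_1_left [simp]: "star 1 B = B"
proof -
  have "poly_deg_le 0 (1::'a sym)" by (simp add: poly_deg_le_def lookup_one when_def)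
  then show ?thesis by (simp add: star_eq[of 0])
qed

lemma star_spartial: "spartial v (star A B) = star (spartial v A) B + star A (spartial v B)" if "v \<noteq> HBAR"
proof -
  have h: "spartial v (ih2 ^ k) = 0" for k
    using that by (simp add: spartial_power ih2_def spartial_mult spartial_svar)
  obtain d where "poly_deg_le d A" "poly_deg_le d (spartial v A)" using common_deg by blast
  then show ?thesis 
    by (simp add: star_eq spartial_sum spartial_mult bidiff_spartial h sum.distrib algebra_simps)
qed

lemma star_cwd: "conj_deriv v (star A B) = star (conj_deriv v A) B + star A (conj_deriv v B)"
proof (cases v)
  case (POS j)
  have "star A (- spartial (MOM j) B) = - star A (spartial (MOM j) B)"
    using star_add_right[of A "spartial (MOM j) B" "- spartial (MOM j) B"]
    by (simp add: eq_neg_iff_add_eq_0 add.commute)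
  then show ?thesis using POS by (simp add: star_spartial star_uminus_left)
qed (auto simp: star_spartial)

text \<open>In the k-th term the factor k from \<open>bidiff_svar_right\<close> turns 1/k! into
  1/(k-1)!, so the extra terms form a star product again, shifted by one power of
  \<open>ih2\<close>. Associativity and the composition theorem for quantization rest on this
  recursion.\<close>

lemma star_svar_right: "star A (svar w * B) = svar w * star A B + ih2 * star (conj_deriv w A) B"
proof -
  obtain d where "poly_deg_le d A" "poly_deg_le d (conj_deriv w A)" using common_deg by blast
  then have d: "poly_deg_le (Suc d) A" "poly_deg_le d (conj_deriv w A)" by (auto elim: poly_deg_le_mono)
  have "(\<Sum>k\<le>Suc d. ih2 ^ k * sconst (1 / fact k) * (of_nat k * bidiff (k - 1) (conj_deriv w A) B)) =
    (\<Sum>k\<le>d. ih2 ^ Suc k * sconst (1 / fact (Suc k)) * (of_nat (Suc k) * bidiff k (conj_deriv w A) B))"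
    by (subst sum.atMost_Suc_shift) simp
  also have "\<dots> = (\<Sum>k\<le>d. ih2 * (ih2 ^ k * sconst (1 / fact k) * bidiff k (conj_deriv w A) B))"
  proof (rule sum.cong[OF refl])
    fix k
    have "sconst (1 / fact (Suc k)) * of_nat (Suc k) = sconst (1 / fact (Suc k) * of_nat (Suc k))"
      by (simp only: sconst_mult sconst_of_nat)
    also have "1 / fact (Suc k) * of_nat (Suc k) = (1 / fact k :: complex)"
      by (simp add: field_simps del: of_nat_Suc)
    finally have "ih2 ^ Suc k * sconst (1 / fact (Suc k)) * (of_nat (Suc k) * bidiff k (conj_deriv w A) B) =
      ih2 ^ Suc k * sconst (1 / fact k) * bidiff k (conj_deriv w A) B"
      by (metis mult.assoc)
    then show "ih2 ^ Suc k * sconst (1 / fact (Suc k)) * (of_nat (Suc k) * bidiff k (conj_deriv w A) B) =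
      ih2 * (ih2 ^ k * sconst (1 / fact k) * bidiff k (conj_deriv w A) B)" by (simp add: mult_ac)
  qed
  finally have "(\<Sum>k\<le>Suc d. ih2 ^ k * sconst (1 / fact k) * (of_nat k * bidiff (k - 1) (conj_deriv w A) B)) =
      ih2 * star (conj_deriv w A) B" by (simp add: star_eq[OF d(2)] sum_distrib_left)
  moreover have "star A (svar w * B) = svar w * star A B + 
     (\<Sum>k\<le>Suc d. ih2 ^ k * sconst (1 / fact k) * (of_nat k * bidiff (k - 1) (conj_deriv w A) B))"
    unfolding star_eq[OF d(1)] bidiff_svar_right
    by (simp only: distrib_left sum.distrib sum_distrib_left) (simp only: mult_ac)
  ultimately show ?thesis by simp
qed

lemma star_1_right [simp]: "star A 1 = A"
proof -
  obtain d where d: "poly_deg_le d A" using poly_deg_le_exists by blast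
  have "ih2 ^ k * sconst (1 / fact k) * bidiff k A 1 = (if k = 0 then A else 0)" for k by (cases k) auto
  then show ?thesis unfolding star_eq[OF d] by simp
qed

lemma star_sconst_right': "star A (sconst c * B) = sconst c * star A B"
proof -
  obtain d where d: "poly_deg_le d A" using poly_deg_le_exists by blast
  have "bidiff k A (sconst c * B) = sconst c * bidiff k A B" for k
    by (simp add: bidiff_comm[of k A] bidiff_sconst_left mult.left_commute)
  then show ?thesis unfolding star_eq[OF d] by (simp add: sum_distrib_left mult.left_commute)
qed

lemma star_sconst_right [simp]: "star A (sconst c) = sconst c * A"
  using star_sconst_right'[of A c 1] by simp
lemma star_sconst_left1 [simp]: "star (sconst c) A = sconst c * A"
  using star_sconst_left[of c 1 A] by simp

lemma star_ih2_right: "star A (ih2 * B) = ih2 * star A B"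
  unfolding ih2_def mult.assoc star_sconst_right' star_svar_right by simp

text \<open>Induction on the last factor. Both sides obey the recursion
  \<open>star_svar_right\<close>, and the corrections agree because the conjugate derivative is a
  derivation of the star product.\<close>

lemma star_assoc: "star A (star B C) = star (star A B) C"
proof (induction C arbitrary: A B rule: sym_induct)
  case (const c)
  then show ?case by (simp add: star_sconst_right')
next
  case (add C C')
  then show ?case by (simp add: star_add_right)
next
  case (var w C)
  then show ?case
    by (simp add: star_svar_right star_add_right star_ih2_right star_add_left star_cwd distrib_left add.assoc add.left_commute)
qed

text \<open>Conjugation changes the sign of \<open>ih2\<close>, and the resulting sign (-1) ^ k is
  the one produced by exchanging the arguments of \<open>bidiff k\<close>. This is the symbol form
  of taking adjoints.\<close>

lemma scnj_star: "scnj (star A B) = star (scnj B) (scnj A)"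
proof -
  obtain a b where "poly_deg_le a A" "poly_deg_le b (scnj B)" using poly_deg_le_exists by blast
  then have d: "poly_deg_le (a+b) A" "poly_deg_le (a+b) (scnj B)" by (auto elim: poly_deg_le_mono)
  have s1: "scnj (1::'a sym) = 1" using scnj_sconst[of 1] by simp
  have p: "scnj (X ^ k) = scnj X ^ k" for X :: "'a sym" and k
    by (induction k) (auto simp: scnj_mult s1)
  have h: "scnj ih2 = - (ih2 :: 'a sym)" by (simp add: ih2_def sconst_uminus)
  have one: "(-1) ^ k * (-1) ^ k = (1 :: 'a sym)" for k by (simp flip: power_mult_distrib)
  have "scnj (ih2 ^ k * sconst (1 / fact k) * bidiff k A B) =
    ih2 ^ k * sconst (1 / fact k) * bidiff k (scnj B) (scnj A)" for k
  proof -
    have "scnj (ih2 ^ k * sconst (1 / fact k) * bidiff k A B) =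
      (-1) ^ k * ih2 ^ k * sconst (1 / fact k) * ((-1) ^ k * bidiff k (scnj B) (scnj A))"
      by (simp add: scnj_mult p h power_minus[of ih2] scnj_bidiff bidiff_comm[of k "scnj A" "scnj B"])
    also have "\<dots> = ((-1) ^ k * (-1) ^ k) * (ih2 ^ k * sconst (1 / fact k) * bidiff k (scnj B) (scnj A))"
      by (simp only: mult_ac)
    finally show ?thesis unfolding one by simp
  qed
  then show ?thesis unfolding star_eq[OF d(1)] star_eq[OF d(2)] scnj_sum by simp
qed

lemma homog_star: assumes "homog s A" "homog t B" shows "homog (s + t) (star A B)"
proof -
  obtain d where d: "poly_deg_le d A" using poly_deg_le_exists by blast
  have "ih2 ^ k * sconst (1 / fact k) * bidiff k A B
     = sconst ((\<i>/2)^k * (1 / fact k)) * (svar HBAR ^ k * bidiff k A B)" for k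
    by (simp only: ih2_def power_mult_distrib sconst_mult sconst_power mult_ac)
  then show ?thesis unfolding star_eq[OF d]
    by (auto intro!: homog_sum homog_sconst_mult homog_bidiff assms)
qed

subsection \<open>Brackets\<close>

lemma poisson_bidiff: "poisson A B = - bidiff 1 A B"
  unfolding poisson_def One_nat_def bidiff.simps by (simp add: algebra_simps flip: sum_negf)

text \<open>The bracket is minus 2/h times the sine of h/2 times the pairing; these are the Taylor
  coefficients, apart from the powers of h.\<close>

definition moyal_coeff :: "nat \<Rightarrow> real" where
  "moyal_coeff k = (if odd k then - ((-1) ^ (k div 2)) / (2 ^ (k - 1) * fact k) else 0)"

lemma moyal_coeff: "\<i> * ((\<i>/2)^k * (1 / fact k) - (-1)^k * ((\<i>/2)^k * (1 / fact k))) = of_real (moyal_coeff k)"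
proof (cases "odd k")
  case True
  then obtain j where k: "k = 2 * j + 1" by (metis oddE)
  define x :: complex where "x = (-1)^j / (4^j * fact k)"
  have "(\<i>/2)^2 = (-1)/4" by (simp add: power_divide)
  then have "(\<i>/2)^k = ((-1)/4)^j * (\<i>/2)" unfolding k power_add power_mult by simp
  then have p: "(\<i>/2)^k * (1 / fact k) = x * \<i> / 2" unfolding x_def power_divide
    by (simp add: mult_ac)
  have s: "(-1)^k = (-1 :: complex)" using k by simp
  have "of_real (moyal_coeff k) = - x" unfolding moyal_coeff_def x_def using k by (simp add: power_mult)
  then show ?thesis unfolding p s by (simp add: mult.left_commute)
qed (simp add: moyal_coeff_def)

lemma moyal_coeff_1 [simp]: "moyal_coeff (Suc 0) = - 1" by (simp add: moyal_coeff_def)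
lemma moyal_coeff_0 [simp]: "moyal_coeff 0 = 0" by (simp add: moyal_coeff_def)
lemma moyal_coeff_2 [simp]: "moyal_coeff 2 = 0" by (simp add: moyal_coeff_def)

lemma moyal_unique: 
  assumes "svar HBAR * M = sconst \<i> * (star A B - star B A)"
  shows "moyal A B = M"
  unfolding moyal_def
proof (rule the_equality)
  fix M' assume "svar HBAR * M' = sconst \<i> * (star A B - star B A)"
  then have "svar HBAR * M' = svar HBAR * M" using assms by simp
  then show "M' = M" by (rule svar_mult_inj)
qed (rule assms)

text \<open>The terms with k = 0 cancel in the commutator, so a factor \<open>HBAR\<close> can be
  split off from all others. The truncated exponent \<open>k - 1\<close> is harmless, as
  \<open>moyal_coeff 0 = 0\<close>.\<close>

lemma moyal_explicit_aux: 
  assumes "poly_deg_le n A" "poly_deg_le n B"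
  shows "svar HBAR * (\<Sum>k\<le>n. sconst (of_real (moyal_coeff k)) * svar HBAR ^ (k - 1) * bidiff k A B)
     = sconst \<i> * (star A B - star B A)"
  unfolding star_eq[OF assms(1)] star_eq[OF assms(2)] sum_subtractf[symmetric] sum_distrib_left
proof (rule sum.cong[OF refl])
  fix k
  define c where "c = (\<i>/2)^k * (1 / fact k :: complex)"
  have e: "ih2 ^ k * sconst (1 / fact k) = sconst c * svar HBAR ^ k"
    unfolding c_def ih2_def by (simp only: power_mult_distrib sconst_mult sconst_power mult_ac)
  have mc: "sconst (of_real (moyal_coeff k)) = sconst \<i> * (sconst c - (-1)^k * sconst c)"
  proof -
    have "of_real (moyal_coeff k) = \<i> * (c - (-1)^k * c)" unfolding c_def by (rule moyal_coeff[symmetric])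
    then show ?thesis by (simp only: sconst_mult sconst_diff sconst_power sconst_uminus sconst_1)
  qed
  have "svar HBAR * (sconst (of_real (moyal_coeff k)) * svar HBAR ^ (k - 1) * bidiff k A B) =
     sconst (of_real (moyal_coeff k)) * svar HBAR ^ k * bidiff k A B"
    by (cases k) (simp_all add: mult_ac)
  also have "\<dots> = sconst \<i> * (ih2 ^ k * sconst (1 / fact k) * bidiff k A B - ih2 ^ k * sconst (1 / fact k) * bidiff k B A)"
    unfolding e mc bidiff_comm[of k B A] by (simp add: algebra_simps)
  finally show "svar HBAR * (sconst (of_real (moyal_coeff k)) * svar HBAR ^ (k - 1) * bidiff k A B) = 
    sconst \<i> * (ih2 ^ k * sconst (1 / fact k) * bidiff k A B - ih2 ^ k * sconst (1 / fact k) * bidiff k B A)" .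
qed

lemma moyal_explicit: 
  assumes "poly_deg_le n A" "poly_deg_le n B"
  shows "moyal A B = (\<Sum>k\<le>n. sconst (of_real (moyal_coeff k)) * svar HBAR ^ (k - 1) * bidiff k A B)"
  by (rule moyal_unique) (rule moyal_explicit_aux[OF assms])

lemma moyal: "svar HBAR * moyal A B = sconst \<i> * (star A B - star B A)"
proof -
  obtain n where n: "poly_deg_le n A" "poly_deg_le n B" using common_deg by blast
  show ?thesis using moyal_explicit[OF n] moyal_explicit_aux[OF n] by simp
qed

lemma moyal_sconst [simp]: "moyal A (sconst c) = 0"
  by (rule moyal_unique) simp

lemma homog_svar_cancel: "homog n (svar v * A) \<Longrightarrow> homog (n - weight v) A"
  unfolding homog_def
proof (intro allI impI)
  fix m assume a: "\<forall>m. lk (svar v * A) m \<noteq> 0 \<longrightarrow> mon_order m = n" "lk A m \<noteq> 0"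
  have "lk (svar v * A) (sg v 1 + m) = lk A m" by (simp add: lookup_svar_times lookup_add)
  then have "mon_order (sg v 1 + m) = n" using a by metis
  then show "mon_order m = n - weight v" by (simp add: mon_order_add)
qed

lemma realsym_svar_cancel: "realsym (svar v * A) \<Longrightarrow> realsym A"
  unfolding realsym_iff using svar_mult_inj by (metis scnj_svar_mult)

text \<open>Conjugation reverses star products and hence negates a commutator of real symbols; the
  factor i compensates this. Order and reality are established for \<open>HBAR\<close> times the
  bracket and then passed to the quotient.\<close>

lemma moyal_Word:
  assumes "A \<in> Word s" "B \<in> Word t"
  shows "moyal A B \<in> Word (s + t - 2)"
  unfolding Word_iff
proof
  have a: "homog s A" "homog t B" "scnj A = A" "scnj B = B" using assms by (auto simp: Word_iff realsym_iff)
  have "homog (s + t) (svar HBAR * moyal A B)" unfolding moyal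
    using homog_star[OF a(1,2)] homog_star[OF a(2,1)] by (intro homog_sconst_mult homog_diff) (auto simp: add.commute)
  from homog_svar_cancel[OF this] show "homog (s + t - 2) (moyal A B)" by (simp add: weight_def)
  have "realsym (svar HBAR * moyal A B)" unfolding moyal realsym_iff
    by (simp add: scnj_diff scnj_star a sconst_uminus algebra_simps)
  then show "realsym (moyal A B)" by (rule realsym_svar_cancel)
qed

text \<open>The sine series has no second-order term, and three derivatives annihilate a quadratic
  symbol, so only the first pairing remains.\<close>

lemma moyal_quadratic: assumes "poly_deg_le 2 B" shows "moyal A B = poisson A B"
proof -
  obtain n0 where n: "poly_deg_le n0 A" "poly_deg_le n0 B" using common_deg by blast
  define n where "n = n0 + 2"
  have n: "poly_deg_le n A" "poly_deg_le n B" using n by (auto elim: poly_deg_le_mono simp: n_def)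
  have "moyal A B = (\<Sum>k\<le>n. if k = 1 then - bidiff 1 A B else 0)"
    unfolding moyal_explicit[OF n]
  proof (rule sum.cong[OF refl])
    fix k :: nat
    consider "k = 0" | "k = 1" | "k = 2" | "k > 2" by linarith
    then show "sconst (of_real (moyal_coeff k)) * svar HBAR ^ (k - 1) * bidiff k A B = (if k = 1 then - bidiff 1 A B else 0)"
      by cases (auto simp: sconst_uminus bidiff_vanish_right[OF assms] simp del: bidiff.simps)
  qed
  then show ?thesis by (simp add: poisson_bidiff n_def del: bidiff.simps)
qed

section \<open>Derivation rules for the Poisson bracket\<close>

lemma poisson_add_left: "poisson (A + A') B = poisson A B + poisson A' B"
  by (simp add: poisson_bidiff bidiff_add_left del: bidiff.simps)
lemma poisson_add_right: "poisson A (B + B') = poisson A B + poisson A B'"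
  by (simp add: poisson_bidiff bidiff_add_right del: bidiff.simps)
lemma poisson_0 [simp]: "poisson A 0 = 0" "poisson 0 A = 0"
  by (simp_all add: poisson_bidiff del: bidiff.simps)
lemma poisson_skew: "poisson A B = - poisson B A"
  using bidiff_comm[of 1 A B] by (simp add: poisson_bidiff del: bidiff.simps)
lemma poisson_uminus_left: "poisson (- A) B = - poisson A B"
  by (simp add: poisson_bidiff bidiff_uminus_left del: bidiff.simps)
lemma poisson_uminus_right: "poisson B (- A) = - poisson B A"
  using poisson_uminus_left poisson_skew by metis
lemma poisson_diff_left: "poisson (A - A') B = poisson A B - poisson A' B"
  using poisson_add_left[of A "-A'"] by (simp add: poisson_uminus_left)
lemma poisson_diff_right: "poisson A (B - B') = poisson A B - poisson A B'"
  using poisson_add_right[of A B "-B'"] by (simp add: poisson_uminus_right)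
lemma poisson_sum_left: "poisson (\<Sum>i\<in>I. A i) B = (\<Sum>i\<in>I. poisson (A i) B)"
  by (induction I rule: infinite_finite_induct) (auto simp: poisson_add_left)
lemma poisson_sum_right: "poisson A (\<Sum>i\<in>I. B i) = (\<Sum>i\<in>I. poisson A (B i))"
  by (induction I rule: infinite_finite_induct) (auto simp: poisson_add_right)
lemma poisson_mult_right: "poisson A (B * C) = poisson A B * C + B * poisson A C"
  by (simp add: poisson_def spartial_mult sum_distrib_left sum_distrib_right algebra_simps flip: sum.distrib)
lemma poisson_mult_left: "poisson (B * C) A = poisson B A * C + B * poisson C A"
  using poisson_mult_right[of A B C] poisson_skew[of _ A] by (simp add: algebra_simps)
lemma poisson_sconst [simp]: "poisson A (sconst c) = 0" "poisson (sconst c) A = 0"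
  by (simp_all add: poisson_def)
lemma poisson_sconst_mult: "poisson A (sconst c * B) = sconst c * poisson A B"
  "poisson (sconst c * A) B = sconst c * poisson A B"
  by (simp_all add: poisson_mult_right poisson_mult_left)
lemma poisson_spartial: "spartial v (poisson A B) = poisson (spartial v A) B + poisson A (spartial v B)"
  by (simp add: poisson_bidiff bidiff_spartial spartial_uminus del: bidiff.simps)
lemma poisson_svar_right: "poisson A (svar v) = - conj_deriv v A"
proof -
  have m: "\<And>b X (Y::'a sym). (X::'a sym) * (if b then 1 else 0) = (if b then X else 0)" by simp
  show ?thesis by (cases v) (simp_all add: poisson_def spartial_svar m sum_negf sum_subtractf)
qed
lemma poisson_cwd: "conj_deriv v (poisson A B) = poisson (conj_deriv v A) B + poisson A (conj_deriv v B)"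
  by (cases v) (simp_all add: poisson_spartial poisson_uminus_left poisson_uminus_right)
text \<open>The difference of the two iterated brackets is a derivation in \<open>C\<close>, so
  variables suffice; there the identity says that the conjugate derivative is a derivation of the
  bracket.\<close>

lemma poisson_jacobi: "poisson A (poisson B C) = poisson (poisson A B) C + poisson B (poisson A C)"
proof (induction C rule: sym_induct)
  case (var v C)
  have "poisson A (poisson B (svar v)) = poisson (poisson A B) (svar v) + poisson B (poisson A (svar v))"
    by (simp add: poisson_svar_right poisson_cwd poisson_uminus_right) (metis poisson_skew add_uminus_conv_diff diff_add_cancel add.commute minus_add_distrib add.inverse_inverse)
  then show ?case using var by (simp add: poisson_mult_right poisson_add_right algebra_simps)
qed (auto simp: poisson_add_right)

lemma scnj_poisson: "scnj (poisson A B) = poisson (scnj A) (scnj B)"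
  by (simp add: poisson_def scnj_sum scnj_diff scnj_mult scnj_spartial)
lemma homog_poisson: assumes "homog s A" "homog t B" shows "homog (s + t - 2) (poisson A B)"
proof -
  have "homog (s + t) (svar HBAR ^ 1 * bidiff 1 A B)" using assms by (rule homog_bidiff)
  then have "homog (s + t - 2) (bidiff 1 A B)" using homog_svar_cancel[of "s+t" HBAR] by (simp add: weight_def)
  then show ?thesis unfolding poisson_bidiff by (rule homog_uminus)
qed
lemma sre_poisson: "realsym B \<Longrightarrow> sre (poisson A B) = poisson (sre A) B"
  by (simp add: sre_def realsym_iff scnj_poisson poisson_sconst_mult poisson_add_left)
lemma poisson_Word: "A \<in> Word s \<Longrightarrow> B \<in> Word t \<Longrightarrow> poisson A B \<in> Word (s + t - 2)"
  by (simp add: Word_iff homog_poisson) (simp add: realsym_iff scnj_poisson)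

subsection \<open>The classical limit\<close>

lemma lookup_drop_hbar: "lk (drop_hbar A) m = (if lk m HBAR = 0 then lk A m else 0)"
  by (auto simp: drop_hbar_def lookup_sum lookup_single when_def in_keys_iff)
lemma drop_hbar_add: "drop_hbar (A + B) = drop_hbar A + drop_hbar B"
  by (rule poly_mapping_eqI) (simp add: lookup_drop_hbar lookup_add)
lemma drop_hbar_diff: "drop_hbar (A - B) = drop_hbar A - drop_hbar B"
  by (rule poly_mapping_eqI) (simp add: lookup_drop_hbar lookup_minus)
lemma drop_hbar_uminus: "drop_hbar (- B) = - drop_hbar B"
  by (rule poly_mapping_eqI) (simp add: lookup_drop_hbar)
lemma drop_hbar_0 [simp]: "drop_hbar 0 = 0"
  by (rule poly_mapping_eqI) (simp add: lookup_drop_hbar)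
lemma drop_hbar_sum: "drop_hbar (\<Sum>i\<in>I. A i) = (\<Sum>i\<in>I. drop_hbar (A i))"
  by (induction I rule: infinite_finite_induct) (auto simp: drop_hbar_add)
lemma drop_hbar_sconst_mult [simp]: "drop_hbar (sconst c * A) = sconst c * drop_hbar A"
  by (rule poly_mapping_eqI) (simp add: lookup_drop_hbar)
lemma drop_hbar_HBAR [simp]: "drop_hbar (svar HBAR * A) = 0"
  by (rule poly_mapping_eqI) (auto simp add: lookup_drop_hbar lookup_svar_times)
lemma drop_hbar_svar_mult: "v \<noteq> HBAR \<Longrightarrow> drop_hbar (svar v * A) = svar v * drop_hbar A"
  by (rule poly_mapping_eqI) (auto simp add: lookup_drop_hbar lookup_svar_times lookup_minus lookup_single)
lemma drop_hbar_sconst [simp]: "drop_hbar (sconst c) = sconst c"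
  by (rule poly_mapping_eqI) (auto simp add: lookup_drop_hbar sconst_def lookup_single when_def)
lemma drop_hbar_1 [simp]: "drop_hbar 1 = 1" using drop_hbar_sconst[of 1] by simp
lemma drop_hbar_svar: "drop_hbar (svar v) = (if v = HBAR then 0 else svar v)"
  using drop_hbar_svar_mult[of v 1] drop_hbar_HBAR[of 1] by auto
lemma drop_hbar_mult: "drop_hbar (A * B) = drop_hbar A * drop_hbar B"
proof (induction A rule: sym_induct)
  case (var w A)
  then show ?case
    using drop_hbar_svar_mult[of w "A * B"] drop_hbar_HBAR[of "A * B"] drop_hbar_svar_mult[of w A]
    by (cases "w = HBAR") (auto simp: mult.assoc)
next
  case (add A A')
  then show ?case by (simp add: drop_hbar_add distrib_right)
qed simp
lemma drop_hbar_spartial: "v \<noteq> HBAR \<Longrightarrow> drop_hbar (spartial v A) = spartial v (drop_hbar A)"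
  by (rule poly_mapping_eqI) (auto simp add: lookup_drop_hbar lookup_spartial lookup_add lookup_single when_def)
lemma drop_hbar_idem [simp]: "drop_hbar (drop_hbar A) = drop_hbar A"
  by (rule poly_mapping_eqI) (simp add: lookup_drop_hbar)
lemma drop_hbar_poisson: "drop_hbar (poisson A B) = poisson (drop_hbar A) (drop_hbar B)"
  by (simp add: poisson_def drop_hbar_sum drop_hbar_diff drop_hbar_mult drop_hbar_spartial)
lemma drop_hbar_Word: "A \<in> Word s \<Longrightarrow> drop_hbar A \<in> Word s"
  by (auto simp: Word_iff homog_def realsym_def lookup_drop_hbar)
text \<open>Among the terms with nonzero coefficient only k = 1 carries no power of
  \<open>HBAR\<close>. Setting Planck's constant to zero is thus a homomorphism from the Moyal to
  the Poisson bracket.\<close>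

lemma drop_hbar_moyal: "drop_hbar (moyal A B) = poisson (drop_hbar A) (drop_hbar B)"
proof -
  obtain n0 where n: "poly_deg_le n0 A" "poly_deg_le n0 B" using common_deg by blast
  define n where "n = n0 + 2"
  have n: "poly_deg_le n A" "poly_deg_le n B" using n by (auto elim: poly_deg_le_mono simp: n_def)
  have p: "drop_hbar (svar HBAR ^ j) = (if j = 0 then 1 else 0 :: 'a sym)" for j
    by (cases j) simp_all
  have "drop_hbar (moyal A B) = (\<Sum>k\<le>n. if k = 1 then - drop_hbar (bidiff 1 A B) else 0)"
    unfolding moyal_explicit[OF n] drop_hbar_sum
  proof (rule sum.cong[OF refl])
    fix k :: nat
    consider "k = 0" | "k = 1" | "k - 1 \<noteq> 0" "k \<noteq> 1" by linarith
    then show "drop_hbar (sconst (of_real (moyal_coeff k)) * svar HBAR ^ (k - 1) * bidiff k A B) = (if k = 1 then - drop_hbar (bidiff 1 A B) else 0)"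
      by cases (auto simp: sconst_uminus drop_hbar_uminus drop_hbar_mult p simp del: bidiff.simps)
  qed
  also have "\<dots> = drop_hbar (poisson A B)"
    by (simp add: poisson_bidiff n_def drop_hbar_uminus del: bidiff.simps)
  finally show ?thesis by (simp add: drop_hbar_poisson)
qed

section \<open>Fourier inversion\<close>

text \<open>Continuity and decay without conditions on derivatives: such functions are integrable,
  and the class is stable under oscillating factors and polynomial growth.\<close>

definition rapid :: "('a::euclidean_space \<Rightarrow> complex) \<Rightarrow> bool" where
  "rapid f \<longleftrightarrow> continuous_on UNIV f \<and> (\<forall>k. \<exists>C. \<forall>x. (1 + norm x) ^ k * norm (f x) \<le> C)"

text \<open>Lebesgue measure is the image of a product of one-dimensional ones under the
  coordinates, so integrals of products of functions of single coordinates factorize.\<close>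

lemma lborel_prod_integral:
  fixes g :: "'a::euclidean_space \<Rightarrow> real \<Rightarrow> 'b::{real_normed_field,banach,second_countable_topology}"
  assumes "\<And>b. b \<in> Basis \<Longrightarrow> integrable lborel (g b)"
  shows "integrable lborel (\<lambda>x::'a. \<Prod>b\<in>Basis. g b (x \<bullet> b))" (is ?I)
    and "(LINT x|lborel. (\<Prod>b\<in>Basis. g b ((x::'a) \<bullet> b))) = (\<Prod>b\<in>Basis. (LINT t|lborel. g b t))" (is ?E)
proof -
  interpret product_sigma_finite "\<lambda>_::'a. lborel :: real measure"
    by standard
  have m: "(\<lambda>f. \<Sum>b\<in>Basis. f b *\<^sub>R b) \<in> measurable (\<Pi>\<^sub>M b\<in>(Basis::'a set). lborel) borel"
    by measurable
  have gm: "g b \<in> borel_measurable borel" if "b \<in> Basis" for b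
    using assms[OF that] by (auto dest: borel_measurable_integrable)
  have pm: "(\<lambda>x::'a. \<Prod>b\<in>Basis. g b (x \<bullet> b)) \<in> borel_measurable borel"
    using gm by (intro borel_measurable_prod measurable_compose[OF _ gm]) auto
  have s: "(\<Prod>b\<in>Basis. g b ((\<Sum>c\<in>Basis. f c *\<^sub>R c) \<bullet> b)) = (\<Prod>b\<in>(Basis::'a set). g b (f b))" for f
    by (intro prod.cong refl) (simp add: inner_sum_left_Basis)
  show ?I
    unfolding lborel_eq[where 'a='a]
    by (subst integrable_distr_eq[OF m pm], subst s, rule product_integrable_prod) (auto intro: assms)
  show ?E
    unfolding lborel_eq[where 'a='a]
    by (subst integral_distr[OF m pm], subst s, rule product_integral_prod) (auto intro: assms)
qed

text \<open>An integrable majorant in product form, so that its integrability reduces to dimension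
  one. It dominates the power -2 DIM of 1 + norm x.\<close>

definition decay :: "'a::euclidean_space \<Rightarrow> real" where
  "decay x = (\<Prod>b\<in>Basis. inverse (1 + (x \<bullet> b)\<^sup>2))"

lemma decay_integrable: "integrable lborel (decay :: 'a::euclidean_space \<Rightarrow> real)"
proof -
  have "integrable lborel (\<lambda>x::real. inverse (1 + x^2))"
    using integrable_inverse_1_plus_square by (simp add: set_integrable_def)
  then show ?thesis unfolding decay_def[abs_def]
    by (intro lborel_prod_integral(1))
qed

lemma decay_bound: "1 \<le> (1 + norm x) ^ (2 * DIM('a)) * decay (x::'a::euclidean_space)"
proof -
  have "(\<Prod>b\<in>(Basis::'a set). 1 + (x \<bullet> b)\<^sup>2) \<le> (\<Prod>b\<in>(Basis::'a set). (1 + norm x)^2)"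
  proof (rule prod_mono)
    fix b :: 'a assume "b \<in> Basis"
    then have "\<bar>x \<bullet> b\<bar> \<le> norm x" by (rule Basis_le_norm)
    then have "(x \<bullet> b)\<^sup>2 \<le> (norm x)^2" by (metis abs_le_square_iff abs_norm_cancel)
    then show "0 \<le> 1 + (x \<bullet> b)\<^sup>2 \<and> 1 + (x \<bullet> b)\<^sup>2 \<le> (1 + norm x)\<^sup>2"
      using norm_ge_zero[of x] unfolding power2_sum by (auto simp del: norm_ge_zero)
  qed
  also have "\<dots> = (1 + norm x) ^ (2 * DIM('a))" by (simp add: power_mult)
  finally have le: "(\<Prod>b\<in>(Basis::'a set). 1 + (x \<bullet> b)\<^sup>2) \<le> (1 + norm x) ^ (2 * DIM('a))" .
  have pos: "(\<Prod>b\<in>(Basis::'a set). 1 + (x \<bullet> b)\<^sup>2) > 0" by (intro prod_pos) (auto simp: add_pos_nonneg)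
  have "decay x = inverse (\<Prod>b\<in>(Basis::'a set). 1 + (x \<bullet> b)\<^sup>2)"
    by (simp add: decay_def prod_inversef[symmetric] comp_def)
  then show ?thesis using le pos by (simp add: field_simps)
qed

lemma decay_nonneg: "0 \<le> decay x" unfolding decay_def by (intro prod_nonneg) auto

lemma decay_dominates: 
  assumes "\<And>x. (1 + norm x) ^ (2 * DIM('a)) * norm (f x) \<le> C"
  shows "norm (f (x::'a::euclidean_space)) \<le> C * decay x"
proof -
  have "norm (f x) * 1 \<le> norm (f x) * ((1 + norm x) ^ (2 * DIM('a)) * decay x)"
    by (intro mult_left_mono decay_bound) auto
  also have "\<dots> = ((1 + norm x) ^ (2 * DIM('a)) * norm (f x)) * decay x" by simp
  also have "\<dots> \<le> C * decay x" by (intro mult_right_mono assms decay_nonneg)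
  finally show ?thesis by simp
qed

lemma rapid_measurable: "rapid f \<Longrightarrow> f \<in> borel_measurable borel"
  unfolding rapid_def by (auto intro: borel_measurable_continuous_onI)

lemma rapid_bound: "rapid f \<Longrightarrow> \<exists>C. \<forall>x. (1 + norm x) ^ k * norm (f x) \<le> C"
  by (simp add: rapid_def)

lemma rapid_dominated: "rapid f \<Longrightarrow> \<exists>C. \<forall>x. norm (f (x::'a::euclidean_space)) \<le> C * decay x"
  using rapid_bound[of f "2 * DIM('a)"] decay_dominates by metis

lemma rapid_integrable: 
  assumes "rapid (f :: 'a::euclidean_space \<Rightarrow> complex)" shows "integrable lborel f"
proof -
  obtain C where "\<And>x. norm (f x) \<le> C * decay x" using rapid_dominated[OF assms] by blast
  then show ?thesis
    using rapid_measurable[OF assms] decay_nonneg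
    by (intro Bochner_Integration.integrable_bound[OF integrable_mult_right[OF decay_integrable, of C]])
       (auto simp: order_trans[OF _ abs_ge_self])
qed

lemma rapid_0 [simp]: "rapid (\<lambda>x. 0)" by (auto simp: rapid_def)

lemma rapid_add: assumes "rapid f" "rapid g" shows "rapid (\<lambda>x. f x + g x)"
  unfolding rapid_def
proof (intro conjI allI)
  fix k
  obtain C D where C: "\<forall>x. (1 + norm x) ^ k * norm (f x) \<le> C" "\<forall>x. (1 + norm x) ^ k * norm (g x) \<le> D"
    using assms rapid_bound by metis
  have "(1 + norm x) ^ k * norm (f x + g x) \<le> C + D" for x
  proof -
    have "(1 + norm x) ^ k * norm (f x + g x) \<le> (1 + norm x) ^ k * (norm (f x) + norm (g x))"
      by (intro mult_left_mono norm_triangle_ineq) auto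
    also have "\<dots> \<le> C + D" using C by (auto simp: distrib_left intro: add_mono)
    finally show ?thesis .
  qed
  then show "\<exists>C. \<forall>x. (1 + norm x) ^ k * norm (f x + g x) \<le> C" by blast
qed (use assms in \<open>auto simp: rapid_def intro!: continuous_intros\<close>)

lemma rapid_mult_poly:
  assumes "rapid f" "continuous_on UNIV g" "\<And>x. norm (g x) \<le> D * (1 + norm x) ^ j"
  shows "rapid (\<lambda>x. g x * f x)"
  unfolding rapid_def
proof (intro conjI allI)
  fix k
  obtain C where C: "\<forall>x. (1 + norm x) ^ (k + j) * norm (f x) \<le> C"
    using assms rapid_bound by metis
  have D: "0 \<le> D"
  proof -
    have "0 \<le> D * (1 + norm (0::'a))^j" using norm_ge_zero[of "g 0"] assms(3)[of 0] by linarith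
    then show ?thesis by simp
  qed
  have "(1 + norm x) ^ k * norm (g x * f x) \<le> D * C" for x
  proof -
    have "(1 + norm x) ^ k * norm (g x * f x) \<le> (1 + norm x) ^ k * ((D * (1 + norm x) ^ j) * norm (f x))"
      unfolding norm_mult by (intro mult_left_mono mult_right_mono assms) auto
    also have "\<dots> = D * ((1 + norm x) ^ (k + j) * norm (f x))" by (simp add: power_add)
    also have "\<dots> \<le> D * C" using C D by (intro mult_left_mono) auto
    finally show ?thesis .
  qed
  then show "\<exists>C. \<forall>x. (1 + norm x) ^ k * norm (g x * f x) \<le> C" by blast
qed (use assms in \<open>auto simp: rapid_def intro!: continuous_intros\<close>)

lemma rapid_cmult: "rapid f \<Longrightarrow> rapid (\<lambda>x. c * f x)"
  using rapid_mult_poly[of f "\<lambda>_. c" "norm c" 0] by simp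

lemma rapid_mult: assumes "rapid f" "rapid g" shows "rapid (\<lambda>x. f x * g x)"
proof -
  obtain C where "\<forall>x. (1 + norm x) ^ 0 * norm (f x) \<le> C" using assms rapid_bound by metis
  then show ?thesis using assms rapid_mult_poly[of g f C 0] by (simp add: rapid_def)
qed

lemma rapid_cnj: "rapid f \<Longrightarrow> rapid (\<lambda>x. cnj (f x))"
  unfolding rapid_def by (auto intro: continuous_intros)

lemma rapid_unimodular: "rapid f \<Longrightarrow> continuous_on UNIV g \<Longrightarrow> (\<And>x. norm (g x) = 1) \<Longrightarrow> rapid (\<lambda>x. g x * f x)"
  using rapid_mult_poly[of f g 1 0] by simp

section \<open>The Fourier transform of the Gaussian and the inversion theorem\<close>

definition fourier :: "('a::euclidean_space \<Rightarrow> complex) \<Rightarrow> 'a \<Rightarrow> complex" where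
  "fourier f p = (LINT y|lborel. exp (- \<i> * of_real (p \<bullet> y)) * f y)"

lemma norm_exp_ii: "norm (exp (\<i> * of_real t)) = 1" "norm (exp (- \<i> * of_real t)) = 1" "norm (exp (- (\<i> * of_real t))) = 1"
  by (simp_all add: norm_exp_eq_Re)

definition gauss :: "'a::euclidean_space \<Rightarrow> real" where "gauss x = exp (- (norm x)\<^sup>2 / 2)"

lemma gauss_prod: "gauss (x::'a::euclidean_space) = (\<Prod>b\<in>Basis. exp (- (x \<bullet> b)\<^sup>2 / 2))"
proof -
  have "(norm x)\<^sup>2 = (\<Sum>b\<in>Basis. (x \<bullet> b)\<^sup>2)"
    unfolding power2_norm_eq_inner by (subst euclidean_inner) (simp add: power2_eq_square)
  then show ?thesis unfolding gauss_def by (simp add: exp_sum sum_divide_distrib sum_negf flip: exp_sum)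
qed

text \<open>The value is read off from the characteristic function of the standard normal
  distribution.\<close>

lemma gauss_1d: 
  "integrable lborel (\<lambda>s::real. exp (\<i> * of_real (t * s)) * of_real (exp (- s\<^sup>2 / 2)))" (is ?I)
  "(LINT s|lborel. exp (\<i> * of_real (t * s)) * of_real (exp (- s\<^sup>2 / 2))) = of_real (sqrt (2 * pi) * exp (- t\<^sup>2 / 2))" (is ?E)
proof -
  have e: "exp (- s\<^sup>2 / 2) = sqrt (2 * pi) * std_normal_density s" for s
    by (simp add: std_normal_density_def)
  have "integrable lborel (\<lambda>s. of_real (sqrt (2 * pi) * std_normal_density s) :: complex)"
    by (intro integrable_of_real integrable_mult_right integrable_normal_density) simp
  then show ?I unfolding e
    by (rule Bochner_Integration.integrable_bound) (auto simp: norm_mult norm_exp_ii)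
  have "of_real (exp (- t\<^sup>2 / 2)) = (LINT s|std_normal_distribution. exp (\<i> * of_real (t * s)))"
    using char_std_normal_distribution by (simp add: char_def fun_eq_iff)
  also have "\<dots> = (LINT s|lborel. std_normal_density s *\<^sub>R exp (\<i> * of_real (t * s)))"
    by (subst integral_density) auto
  finally have "(LINT s|lborel. std_normal_density s *\<^sub>R exp (\<i> * of_real (t * s))) = of_real (exp (- t\<^sup>2 / 2))" by simp
  then have "of_real (sqrt (2*pi)) * (LINT s|lborel. std_normal_density s *\<^sub>R exp (\<i> * of_real (t * s))) = of_real (sqrt (2 * pi) * exp (- t\<^sup>2 / 2))"
    by simp
  then show ?E unfolding e
    by (subst (asm) integral_mult_right_zero[symmetric]) (simp add: scaleR_conv_of_real mult_ac)
qed

lemma gauss_fourier: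
  fixes z :: "'a::euclidean_space"
  shows "integrable lborel (\<lambda>p. exp (\<i> * of_real (z \<bullet> p)) * of_real (gauss p))" (is ?I)
    and "(LINT p|lborel. exp (\<i> * of_real (z \<bullet> p)) * of_real (gauss p)) = of_real (sqrt (2 * pi) ^ DIM('a) * gauss z)" (is ?E)
proof -
  have e: "exp (\<i> * of_real (z \<bullet> p)) * of_real (gauss p) = 
    (\<Prod>b\<in>Basis. exp (\<i> * of_real ((z \<bullet> b) * (p \<bullet> b))) * of_real (exp (- (p \<bullet> b)\<^sup>2 / 2)))" for p
  proof -
    have "exp (\<i> * of_real (z \<bullet> p)) = (\<Prod>b\<in>Basis. exp (\<i> * of_real ((z \<bullet> b) * (p \<bullet> b))))"
      by (subst euclidean_inner) (simp add: exp_sum sum_distrib_left flip: exp_sum)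
    then show ?thesis by (simp add: gauss_prod prod.distrib)
  qed
  show ?I unfolding e by (rule lborel_prod_integral(1)) (rule gauss_1d)
  have "(LINT p|lborel. exp (\<i> * of_real (z \<bullet> p)) * of_real (gauss p)) 
    = (\<Prod>b\<in>(Basis::'a set). of_real (sqrt (2 * pi) * exp (- (z \<bullet> b)\<^sup>2 / 2)))"
    unfolding e by (subst lborel_prod_integral(2)) (rule gauss_1d, simp only: gauss_1d)
  also have "\<dots> = of_real (sqrt (2 * pi) ^ DIM('a) * gauss z)"
    by (simp add: gauss_prod prod.distrib del: of_real_mult flip: of_real_prod) 
  finally show ?E .
qed

lemma integral_affine:
  fixes f :: "'a::euclidean_space \<Rightarrow> complex"
  assumes "c \<noteq> 0" "f \<in> borel_measurable borel"
  shows "(LINT x|lborel. f x) = of_real (\<bar>c\<bar> ^ DIM('a)) * (LINT x|lborel. f (t + c *\<^sub>R x))"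
proof -
  have "(LINT x|lborel. f x) = (LINT x|density (distr lborel borel (\<lambda>x. t + c *\<^sub>R x)) (\<lambda>_. ennreal (\<bar>c\<bar>^DIM('a))). f x)"
    using lborel_affine[OF assms(1), of t] by simp
  also have "\<dots> = (LINT x|distr lborel borel (\<lambda>x. t + c *\<^sub>R x). (\<bar>c\<bar>^DIM('a)) *\<^sub>R f x)"
    using assms by (subst integral_density) auto
  also have "\<dots> = (LINT x|lborel. (\<bar>c\<bar>^DIM('a)) *\<^sub>R f (t + c *\<^sub>R x))"
    using assms by (subst integral_distr) auto
  also have "\<dots> = of_real (\<bar>c\<bar> ^ DIM('a)) * (LINT x|lborel. f (t + c *\<^sub>R x))"
    by (simp add: scaleR_conv_of_real)
  finally show ?thesis .
qed

lemma gauss_measurable [measurable]: "gauss \<in> borel_measurable borel"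
  unfolding gauss_def[abs_def] by measurable

lemma gauss_integrable: "integrable lborel (gauss :: 'a::euclidean_space \<Rightarrow> real)"
proof -
  have "integrable lborel (\<lambda>p::'a. of_real (gauss p) :: complex)"
    using gauss_fourier(1)[of "0::'a"] by simp
  then show ?thesis by (simp add: complex_of_real_integrable_eq)
qed

lemma gauss_nonneg: "0 \<le> gauss x" and gauss_le_1: "gauss x \<le> 1"
  by (auto simp: gauss_def)

text \<open>Inserting the factor \<open>exp (- \<epsilon>\<^sup>2 \<bar>p\<bar>\<^sup>2 / 2)\<close> makes the double integral absolutely convergent;
  both sides then converge by dominated convergence as \<open>\<epsilon> \<rightarrow> 0\<close>.\<close>

lemma fourier_regularized:
  fixes f :: "'a::euclidean_space \<Rightarrow> complex"
  assumes f: "rapid f" and e: "e > 0"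
  shows "(LINT p|lborel. exp (\<i> * of_real (x \<bullet> p)) * fourier f p * of_real (gauss (e *\<^sub>R p)))
    = of_real (sqrt (2 * pi) ^ DIM('a)) * (LINT u|lborel. f (x - e *\<^sub>R u) * of_real (gauss u))"
proof -
  note [measurable] = rapid_measurable[OF f]
  let ?K = "\<lambda>p y. exp (\<i> * of_real ((x - y) \<bullet> p)) * f y * of_real (gauss (e *\<^sub>R p))"
  have fi: "integrable lborel (\<lambda>y. norm (f y))" using rapid_integrable[OF f] by simp
  have gi: "integrable lborel (\<lambda>p::'a. gauss (e *\<^sub>R p))"
  proof -
    have "integrable (density (distr lborel borel (\<lambda>x::'a. 0 + e *\<^sub>R x)) (\<lambda>_. ennreal (\<bar>e\<bar>^DIM('a)))) gauss"
      using lborel_affine[of e "0::'a"] e gauss_integrable by simp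
    then have "integrable (distr lborel borel (\<lambda>x::'a. e *\<^sub>R x)) (\<lambda>x. (\<bar>e\<bar>^DIM('a)) *\<^sub>R gauss x)"
      by (subst (asm) integrable_density) auto
    then have "integrable lborel (\<lambda>x::'a. (\<bar>e\<bar>^DIM('a)) *\<^sub>R gauss (e *\<^sub>R x))"
      by (subst (asm) integrable_distr_eq) auto
    then show ?thesis using e by simp
  qed
  have K: "integrable (lborel \<Otimes>\<^sub>M lborel) (case_prod ?K)"
  proof (rule lborel_pair.Fubini_integrable)
    show "integrable lborel (\<lambda>p. LINT y|lborel. norm (case (p, y) of (p, y) \<Rightarrow> ?K p y))"
      using gi by (simp add: norm_mult norm_exp_ii gauss_nonneg)
    show "AE p in lborel. integrable lborel (\<lambda>y. case (p, y) of (p, y) \<Rightarrow> ?K p y)"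
    proof (intro AE_I2)
      fix p
      show "integrable lborel (\<lambda>y. case (p, y) of (p, y) \<Rightarrow> ?K p y)"
        using integrable_mult_left[OF fi, of "gauss (e *\<^sub>R p)"]
        by (rule Bochner_Integration.integrable_bound) (auto simp: norm_mult norm_exp_ii gauss_nonneg)
    qed
  qed measurable
  have "(LINT p|lborel. exp (\<i> * of_real (x \<bullet> p)) * fourier f p * of_real (gauss (e *\<^sub>R p)))
    = (LINT p|lborel. LINT y|lborel. ?K p y)"
  proof (rule Bochner_Integration.integral_cong[OF refl])
    fix p
    have "?K p y = (exp (\<i> * of_real (x \<bullet> p)) * of_real (gauss (e *\<^sub>R p))) * (exp (- \<i> * of_real (p \<bullet> y)) * f y)" for y
      by (simp add: inner_diff_left inner_commute algebra_simps exp_add exp_diff exp_minus divide_inverse)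
    then have "(LINT y|lborel. ?K p y) = (exp (\<i> * of_real (x \<bullet> p)) * of_real (gauss (e *\<^sub>R p))) * fourier f p"
      by (simp only: fourier_def integral_mult_right_zero)
    then show "exp (\<i> * of_real (x \<bullet> p)) * fourier f p * of_real (gauss (e *\<^sub>R p)) = (LINT y|lborel. ?K p y)"
      by (simp only: mult_ac)
  qed
  also have "\<dots> = (LINT y|lborel. LINT p|lborel. ?K p y)"
    by (rule lborel_pair.Fubini_integral[OF K, symmetric])
  also have "\<dots> = (LINT y|lborel. f y * of_real (inverse e ^ DIM('a) * (sqrt (2 * pi) ^ DIM('a) * gauss ((x - y) /\<^sub>R e))))"
  proof (rule Bochner_Integration.integral_cong[OF refl])
    fix y
    have "(LINT p|lborel. ?K p y) = f y * (LINT p|lborel. exp (\<i> * of_real ((x - y) \<bullet> p)) * of_real (gauss (e *\<^sub>R p)))"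
      by (subst integral_mult_right_zero[symmetric]) (simp add: mult_ac)
    also have "(LINT p|lborel. exp (\<i> * of_real ((x - y) \<bullet> p)) * of_real (gauss (e *\<^sub>R p)))
      = of_real (\<bar>inverse e\<bar> ^ DIM('a)) * (LINT p|lborel. exp (\<i> * of_real ((x - y) \<bullet> (0 + inverse e *\<^sub>R p))) * of_real (gauss (e *\<^sub>R (0 + inverse e *\<^sub>R p))))"
      using e by (intro integral_affine) auto
    also have "\<dots> = of_real (inverse e ^ DIM('a)) * (LINT p|lborel. exp (\<i> * of_real (((x - y) /\<^sub>R e) \<bullet> p)) * of_real (gauss p))"
      using e by (simp add: mult_ac)
    finally show "(LINT p|lborel. ?K p y) = f y * of_real (inverse e ^ DIM('a) * (sqrt (2 * pi) ^ DIM('a) * gauss ((x - y) /\<^sub>R e)))"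
      by (simp only: gauss_fourier of_real_mult)
  qed
  \<comment> \<open>Substitution of \<open>x - e *\<^sub>R u\<close> for y; its Jacobian cancels the
    factor from rescaling p.\<close>
  also have "\<dots> = of_real (\<bar>- e\<bar> ^ DIM('a)) * (LINT u|lborel. f (x + (- e) *\<^sub>R u) * of_real (inverse e ^ DIM('a) * (sqrt (2 * pi) ^ DIM('a) * gauss ((x - (x + (- e) *\<^sub>R u)) /\<^sub>R e))))"
    using e by (intro integral_affine) (auto, measurable)
  also have "\<dots> = of_real (e ^ DIM('a)) * (LINT u|lborel. of_real (inverse e ^ DIM('a) * sqrt (2 * pi) ^ DIM('a)) * (f (x - e *\<^sub>R u) * of_real (gauss u)))"
    using e by (simp add: mult_ac)
  also have "\<dots> = of_real (e ^ DIM('a) * (inverse e ^ DIM('a) * sqrt (2 * pi) ^ DIM('a))) * (LINT u|lborel. f (x - e *\<^sub>R u) * of_real (gauss u))"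
    by (simp only: integral_mult_right_zero of_real_mult mult.assoc)
  also have "e ^ DIM('a) * (inverse e ^ DIM('a) * sqrt (2 * pi) ^ DIM('a)) = sqrt (2 * pi) ^ DIM('a)"
    using e by (simp add: power_inverse)
  finally show ?thesis .
qed

theorem fourier_inversion:
  fixes f :: "'a::euclidean_space \<Rightarrow> complex"
  assumes f: "rapid f" and F: "integrable lborel (fourier f)"
  shows "(LINT p|lborel. exp (\<i> * of_real (x \<bullet> p)) * fourier f p) = of_real ((2 * pi) ^ DIM('a)) * f x"
proof -
  define e where "e n = inverse (real (Suc n))" for n
  have e: "e n > 0" for n by (simp add: e_def)
  have e0: "e \<longlonglongrightarrow> 0" unfolding e_def by (rule LIMSEQ_inverse_real_of_nat)
  note [measurable] = rapid_measurable[OF f] borel_measurable_integrable[OF F]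
  have g: "isCont gauss (0::'a)" unfolding gauss_def[abs_def] by (intro continuous_intros) auto
  have "(\<lambda>n. LINT p|lborel. exp (\<i> * of_real (x \<bullet> p)) * fourier f p * of_real (gauss (e n *\<^sub>R p))) \<longlonglongrightarrow> 
     (LINT p|lborel. exp (\<i> * of_real (x \<bullet> p)) * fourier f p * of_real 1)"
  proof (rule integral_dominated_convergence[where w="\<lambda>p. norm (fourier f p)"])
    show "AE p in lborel. (\<lambda>n. exp (\<i> * of_real (x \<bullet> p)) * fourier f p * of_real (gauss (e n *\<^sub>R p))) \<longlonglongrightarrow>
      exp (\<i> * of_real (x \<bullet> p)) * fourier f p * of_real 1"
    proof (intro AE_I2 tendsto_mult tendsto_const tendsto_of_real)
      fix p :: 'a
      have "(\<lambda>n. e n *\<^sub>R p) \<longlonglongrightarrow> 0 *\<^sub>R p" by (intro tendsto_intros e0)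
      then have "(\<lambda>n. gauss (e n *\<^sub>R p)) \<longlonglongrightarrow> gauss (0::'a)" using isCont_tendsto_compose[OF g] by simp
      then show "(\<lambda>n. gauss (e n *\<^sub>R p)) \<longlonglongrightarrow> 1" by (simp add: gauss_def)
    qed
    show "AE p in lborel. norm (exp (\<i> * of_real (x \<bullet> p)) * fourier f p * of_real (gauss (e n *\<^sub>R p))) \<le> norm (fourier f p)" for n
      by (auto simp: norm_mult norm_exp_ii gauss_nonneg gauss_le_1 intro!: mult_left_le)
  qed (use F in \<open>auto\<close>)
  \<comment> \<open>On this side \<open>f\<close> enters through its bound and its continuity at
    \<open>x\<close>, with a Gaussian as majorant; on the other side the majorant was
    \<open>fourier f\<close>.\<close>
  moreover have "(\<lambda>n. of_real (sqrt (2 * pi) ^ DIM('a)) * (LINT u|lborel. f (x - e n *\<^sub>R u) * of_real (gauss u))) \<longlonglongrightarrow> 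
     of_real (sqrt (2 * pi) ^ DIM('a)) * (LINT u|lborel. f x * of_real (gauss (u::'a)))"
  proof (rule tendsto_mult_left)
    obtain C where C: "\<forall>x. (1 + norm x) ^ 0 * norm (f x) \<le> C" using rapid_bound[OF f, of 0] by blast
    have c: "isCont f x" using f by (simp add: rapid_def continuous_on_eq_continuous_at)
    show "(\<lambda>n. LINT u|lborel. f (x - e n *\<^sub>R u) * of_real (gauss u)) \<longlonglongrightarrow> (LINT u|lborel. f x * of_real (gauss (u::'a)))"
    proof (rule integral_dominated_convergence[where w="\<lambda>u::'a. C * gauss u"])
      show "AE u in lborel. (\<lambda>n. f (x - e n *\<^sub>R u) * of_real (gauss u)) \<longlonglongrightarrow> f x * of_real (gauss u)"
      proof (intro AE_I2 tendsto_mult tendsto_const)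
        fix u
        have "(\<lambda>n. x - e n *\<^sub>R u) \<longlonglongrightarrow> x - 0 *\<^sub>R u" by (intro tendsto_intros e0)
        then show "(\<lambda>n. f (x - e n *\<^sub>R u)) \<longlonglongrightarrow> f x" using isCont_tendsto_compose[OF c] by simp
      qed
      show "AE u in lborel. norm (f (x - e n *\<^sub>R u) * of_real (gauss u)) \<le> C * gauss u" for n
        using C by (auto simp: norm_mult gauss_nonneg intro!: mult_right_mono)
    qed (use gauss_integrable in auto)
  qed
  ultimately have "(LINT p|lborel. exp (\<i> * of_real (x \<bullet> p)) * fourier f p * of_real 1) = 
    of_real (sqrt (2 * pi) ^ DIM('a)) * (LINT u|lborel. f x * of_real (gauss (u::'a)))"
    unfolding fourier_regularized[OF f e] by (rule LIMSEQ_unique)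
  \<comment> \<open>One factor \<open>sqrt (2 * pi) ^ DIM('a)\<close> is the total mass of the
    Gaussian, the other comes from its Fourier transform.\<close>
  also have "(LINT u|lborel. f x * of_real (gauss (u::'a))) = f x * of_real (sqrt (2 * pi) ^ DIM('a))"
    using gauss_fourier(2)[of "0::'a"] by (simp add: gauss_def)
  also have "of_real (sqrt (2 * pi) ^ DIM('a)) * (f x * of_real (sqrt (2 * pi) ^ DIM('a))) 
    = of_real (sqrt (2 * pi) ^ DIM('a) * sqrt (2 * pi) ^ DIM('a)) * f x" by (simp add: mult_ac)
  also have "sqrt (2 * pi) ^ DIM('a) * sqrt (2 * pi) ^ DIM('a) = (2 * pi) ^ DIM('a)"
    by (subst power_mult_distrib[symmetric]) simp
  finally show ?thesis by simp
qed

section \<open>Schwartz functions and Weyl quantization\<close>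

subsection \<open>Partial derivatives\<close>

text \<open>\<open>pdiff\<close> speaks only of the parameter 0. Full differentiability gives the
  derivative along the line at every parameter, as the mean value inequality requires.\<close>

lemma pdiff_line:
  fixes f :: "real^'n \<Rightarrow> complex"
  assumes "f differentiable (at (x + t *\<^sub>R axis j 1))"
  shows "((\<lambda>t. f (x + t *\<^sub>R axis j 1)) has_vector_derivative pdiff j f (x + t *\<^sub>R axis j 1)) (at t)"
proof -
  obtain D where D: "(f has_derivative D) (at (x + t *\<^sub>R axis j 1))" using assms by (auto simp: differentiable_def)
  have lin: "D (s *\<^sub>R v) = s *\<^sub>R D v" for s v
    using D has_derivative_linear linear_scale by metis
  have l: "((\<lambda>s. f (y + s *\<^sub>R axis j 1)) has_vector_derivative D (axis j 1)) (at u)"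
    if "y + u *\<^sub>R axis j 1 = x + t *\<^sub>R axis j 1" for y u
  proof -
    have "((\<lambda>s. y + s *\<^sub>R axis j (1::real)) has_derivative (\<lambda>s. s *\<^sub>R axis j 1)) (at u)"
      by (auto intro!: derivative_eq_intros)
    then have "((\<lambda>s. f (y + s *\<^sub>R axis j 1)) has_derivative (\<lambda>s. D (s *\<^sub>R axis j 1))) (at u)"
      by (rule has_derivative_compose) (use D that in simp)
    then show ?thesis by (simp add: has_vector_derivative_def lin)
  qed
  have "((\<lambda>s. f ((x + t *\<^sub>R axis j 1) + s *\<^sub>R axis j 1)) has_vector_derivative D (axis j 1)) (at 0)"
    by (rule l) simp
  then have "pdiff j f (x + t *\<^sub>R axis j 1) = D (axis j 1)"
    unfolding pdiff_def by (rule vector_derivative_at)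
  then show ?thesis using l[of x t] by simp
qed

lemma pdiff_line0:
  assumes "f differentiable (at x)"
  shows "((\<lambda>t. f (x + t *\<^sub>R axis j 1)) has_vector_derivative pdiff j f x) (at 0)"
  using pdiff_line[of f x 0 j] assms by simp

lemma pdiffI: "((\<lambda>t. f (x + t *\<^sub>R axis j 1)) has_vector_derivative d) (at 0) \<Longrightarrow> pdiff j f x = d"
  unfolding pdiff_def by (rule vector_derivative_at)

lemma pdiff_mult:
  assumes "f differentiable (at x)" "g differentiable (at x)"
  shows "pdiff j (\<lambda>x. f x * g x) x = f x * pdiff j g x + pdiff j f x * g x"
  by (rule pdiffI) (use has_vector_derivative_mult[OF pdiff_line0[OF assms(1)] pdiff_line0[OF assms(2)]] in simp)

lemma pdiff_add:
  assumes "f differentiable (at x)" "g differentiable (at x)"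
  shows "pdiff j (\<lambda>x. f x + g x) x = pdiff j f x + pdiff j g x"
  by (rule pdiffI) (use has_vector_derivative_add[OF pdiff_line0[OF assms(1)] pdiff_line0[OF assms(2)]] in simp)

lemma pdiff_cmult:
  assumes "f differentiable (at x)"
  shows "pdiff j (\<lambda>x. c * f x) x = c * pdiff j f x"
  by (rule pdiffI) (use has_vector_derivative_mult_right[OF pdiff_line0[OF assms(1)]] in simp)

lemma pdiff_cnj:
  assumes "f differentiable (at x)"
  shows "pdiff j (\<lambda>x. cnj (f x)) x = cnj (pdiff j f x)"
  by (rule pdiffI) (use has_vector_derivative_cnj[OF pdiff_line0[OF assms(1)]] in simp)

lemma coord_differentiable: "(\<lambda>x::real^'n. complex_of_real (x $ k)) differentiable (at x)"
  unfolding differentiable_def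
  by (rule exI, rule bounded_linear.has_derivative[OF bounded_linear_of_real], 
      rule bounded_linear.has_derivative[OF bounded_linear_vec_nth], rule has_derivative_ident)

lemma pdiff_coord: "pdiff j (\<lambda>x. complex_of_real (x $ k)) x = (if j = k then 1 else 0)"
proof (rule pdiffI)
  have "((\<lambda>t. x $ k + t * (if j = k then 1 else 0)) has_real_derivative (if j = k then 1 else 0)) (at 0)"
    by (auto intro!: derivative_eq_intros)
  then have "((\<lambda>t. complex_of_real (x $ k + t * (if j = k then 1 else 0))) has_vector_derivative of_real (if j = k then 1 else 0)) (at 0)"
    by (rule has_vector_derivative_of_real)
  then show "((\<lambda>t. complex_of_real ((x + t *\<^sub>R axis j 1) $ k)) has_vector_derivative (if j = k then 1 else 0)) (at 0)"
    by (simp add: axis_def if_distrib eq_commute[of k j] cong: if_cong)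
qed

lemma differentiable_cnj: "f differentiable (at x) \<Longrightarrow> (\<lambda>x. cnj (f x)) differentiable (at x)"
  unfolding differentiable_def using bounded_linear.has_derivative[OF bounded_linear_cnj] by blast

subsection \<open>Schwartz functions\<close>

lemma schwartz_iff: "\<psi> \<in> schwartz \<longleftrightarrow> 
  (\<forall>js. (\<forall>x. foldr pdiff js \<psi> differentiable (at x)) \<and> rapid (foldr pdiff js \<psi>))"
proof -
  have b: "bounded (range (\<lambda>x. (1 + norm x) ^ k *\<^sub>R f x)) \<longleftrightarrow> (\<exists>C. \<forall>x. (1 + norm x) ^ k * norm (f x) \<le> C)"
    for f :: "real^'n \<Rightarrow> complex" and k
    by (simp add: bounded_iff)
  have c: "continuous_on UNIV f" if "\<forall>x. f differentiable (at x)" for f :: "real^'n \<Rightarrow> complex"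
    using that by (auto simp: continuous_on_eq_continuous_at intro: differentiable_imp_continuous_within)
  show ?thesis unfolding schwartz_def rapid_def mem_Collect_eq b using c by metis
qed

lemma schwartz_differentiable: "\<psi> \<in> schwartz \<Longrightarrow> \<psi> differentiable (at x)"
  unfolding schwartz_iff by (drule spec[of _ "[]"]) simp
lemma schwartz_rapid: "\<psi> \<in> schwartz \<Longrightarrow> rapid \<psi>"
  unfolding schwartz_iff by (drule spec[of _ "[]"]) simp
lemma schwartz_pdiff: assumes "\<psi> \<in> schwartz" shows "pdiff j \<psi> \<in> schwartz"
proof -
  have "foldr pdiff js (pdiff j \<psi>) = foldr pdiff (js @ [j]) \<psi>" for js by simp
  then show ?thesis using assms unfolding schwartz_iff by metis
qed

text \<open>The Schwartz space is the largest family of differentiable, rapidly decreasing functions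
  closed under partial derivatives. Exhibiting such a family replaces the computation of iterated
  derivatives.\<close>

lemma schwartz_coinduct:
  assumes "f \<in> S"
    and S: "\<And>g. g \<in> S \<Longrightarrow> (\<forall>x. g differentiable (at x)) \<and> rapid g \<and> (\<forall>j. pdiff j g \<in> S)"
  shows "f \<in> schwartz"
proof -
  have "foldr pdiff js f \<in> S" for js using assms by (induction js) auto
  then show ?thesis unfolding schwartz_iff using S by blast
qed

lemma schwartz_0: "(\<lambda>x. 0) \<in> schwartz"
proof (rule schwartz_coinduct[where S="{\<lambda>x. 0}"])
  have "pdiff j (\<lambda>x. 0) = (\<lambda>x. 0)" for j :: 'a
    by (rule ext, rule pdiffI) simp
  then show "\<And>g. g \<in> {\<lambda>x::real^'a. 0::complex} \<Longrightarrow> (\<forall>x. g differentiable (at x)) \<and> rapid g \<and> (\<forall>j. pdiff j g \<in> {\<lambda>x. 0})"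
    by auto
qed simp

lemma schwartz_add: 
  assumes "f \<in> schwartz" "g \<in> schwartz" shows "(\<lambda>x. f x + g x) \<in> schwartz"
proof (rule schwartz_coinduct[where S="{\<lambda>x. f x + g x | f g. f \<in> schwartz \<and> g \<in> schwartz}"])
  fix u :: "real^'a \<Rightarrow> complex" assume "u \<in> {\<lambda>x. f x + g x | f g. f \<in> schwartz \<and> g \<in> schwartz}"
  then obtain f g where u: "u = (\<lambda>x. f x + g x)" and fg: "f \<in> schwartz" "g \<in> schwartz" by blast
  have "pdiff j u = (\<lambda>x. pdiff j f x + pdiff j g x)" for j
    unfolding u by (rule ext) (simp add: pdiff_add schwartz_differentiable fg)
  then show "(\<forall>x. u differentiable (at x)) \<and> rapid u \<and> (\<forall>j. pdiff j u \<in> {\<lambda>x. f x + g x | f g. f \<in> schwartz \<and> g \<in> schwartz})"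
    using fg by (auto simp: u schwartz_differentiable rapid_add schwartz_rapid) (metis schwartz_pdiff)
qed (use assms in blast)

lemma schwartz_cmult: 
  assumes "f \<in> schwartz" shows "(\<lambda>x. c * f x) \<in> schwartz"
proof (rule schwartz_coinduct[where S="{\<lambda>x. c * f x | f. f \<in> schwartz}"])
  fix u :: "real^'a \<Rightarrow> complex" assume "u \<in> {\<lambda>x. c * f x | f. f \<in> schwartz}"
  then obtain f where u: "u = (\<lambda>x. c * f x)" and fg: "f \<in> schwartz" by blast
  have "pdiff j u = (\<lambda>x. c * pdiff j f x)" for j
    unfolding u by (rule ext) (simp add: pdiff_cmult schwartz_differentiable fg)
  then show "(\<forall>x. u differentiable (at x)) \<and> rapid u \<and> (\<forall>j. pdiff j u \<in> {\<lambda>x. c * f x | f. f \<in> schwartz})"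
    using fg by (auto simp: u schwartz_differentiable rapid_cmult schwartz_rapid) (metis schwartz_pdiff)
qed (use assms in blast)

lemma rapid_coord: 
  fixes f :: "real^'n \<Rightarrow> complex"
  assumes "rapid f" shows "rapid (\<lambda>x. of_real (x $ k) * f x)"
proof (rule rapid_mult_poly[of f _ 1 1])
  fix x :: "real^'n"
  show "norm (complex_of_real (x $ k)) \<le> 1 * (1 + norm x) ^ 1" 
    using component_le_norm_cart[of x k] by simp
qed (use assms in \<open>auto intro!: continuous_intros\<close>)

lemma schwartz_coord: 
  assumes "f \<in> schwartz" shows "(\<lambda>x. of_real (x $ k) * f x) \<in> schwartz"
\<comment> \<open>The summand \<open>g\<close> absorbs the term that the product rule creates by
  differentiating the coordinate; it makes the family closed.\<close>
proof (rule schwartz_coinduct[where S="{\<lambda>x. of_real (x $ k) * f x + g x | f g. f \<in> schwartz \<and> g \<in> schwartz}"])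
  fix u :: "real^'a \<Rightarrow> complex" assume "u \<in> {\<lambda>x. of_real (x $ k) * f x + g x | f g. f \<in> schwartz \<and> g \<in> schwartz}"
  then obtain f g where u: "u = (\<lambda>x. of_real (x $ k) * f x + g x)" and fg: "f \<in> schwartz" "g \<in> schwartz" by blast
  have d: "(\<lambda>x. of_real (x $ k) * f x) differentiable (at x)" for x
    using coord_differentiable schwartz_differentiable[OF fg(1)] by (intro differentiable_mult)
  have "pdiff j u = (\<lambda>x. of_real (x $ k) * pdiff j f x + ((if j = k then 1 else 0) * f x + pdiff j g x))" for j
    unfolding u by (rule ext) (simp add: pdiff_add pdiff_mult d coord_differentiable schwartz_differentiable fg pdiff_coord)
  moreover have "(\<lambda>x. (if j = k then 1 else 0) * f x + pdiff j g x) \<in> schwartz" for j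
    by (intro schwartz_add schwartz_cmult schwartz_pdiff fg)
  ultimately have "pdiff j u \<in> {\<lambda>x. of_real (x $ k) * f x + g x | f g. f \<in> schwartz \<and> g \<in> schwartz}" for j
    using schwartz_pdiff[OF fg(1), of j]
    by (intro CollectI exI[of _ "pdiff j f"] exI[of _ "\<lambda>x. (if j = k then 1 else 0) * f x + pdiff j g x"]) auto
  then show "(\<forall>x. u differentiable (at x)) \<and> rapid u \<and> (\<forall>j. pdiff j u \<in> {\<lambda>x. of_real (x $ k) * f x + g x | f g. f \<in> schwartz \<and> g \<in> schwartz})"
    using fg d by (auto simp: u schwartz_differentiable rapid_add rapid_coord schwartz_rapid)
next
  have "(\<lambda>x. of_real (x $ k) * f x) = (\<lambda>x. of_real (x $ k) * f x + 0)" by simp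
  then show "(\<lambda>x. of_real (x $ k) * f x) \<in> {\<lambda>x. of_real (x $ k) * f x + g x | f g. f \<in> schwartz \<and> g \<in> schwartz}"
    using assms schwartz_0 by (intro CollectI exI[of _ f] exI[of _ "\<lambda>x. 0"]) auto
qed

subsection \<open>Integration by parts\<close>

lemma rapid_shift: assumes "rapid f" shows "rapid (\<lambda>x. f (x + a))"
  unfolding rapid_def
proof (intro conjI allI)
  fix k
  obtain C where C: "\<forall>x. (1 + norm x) ^ k * norm (f x) \<le> C" using assms rapid_bound by metis
  have "(1 + norm x) ^ k * norm (f (x + a)) \<le> (1 + norm a) ^ k * C" for x
  proof -
    have "norm x \<le> norm (x + a) + norm a" using norm_triangle_ineq4[of "x + a" a] by simp
    then have "1 + norm x \<le> (1 + norm a) * (1 + norm (x + a))"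
      using mult_nonneg_nonneg[of "norm a" "norm (x + a)"] by (simp add: distrib_left distrib_right del: mult_nonneg_nonneg)
    then have "(1 + norm x) ^ k \<le> ((1 + norm a) * (1 + norm (x + a))) ^ k" by (intro power_mono) auto
    then have "(1 + norm x) ^ k * norm (f (x + a)) \<le> ((1 + norm a) * (1 + norm (x + a))) ^ k * norm (f (x + a))"
      by (intro mult_right_mono) auto
    also have "\<dots> = (1 + norm a) ^ k * ((1 + norm (x + a)) ^ k * norm (f (x + a)))"
      by (simp add: power_mult_distrib)
    also have "\<dots> \<le> (1 + norm a) ^ k * C" using C by (intro mult_left_mono) auto
    finally show ?thesis .
  qed
  then show "\<exists>C. \<forall>x. (1 + norm x) ^ k * norm (f (x + a)) \<le> C" by blast
next
  show "continuous_on UNIV (\<lambda>x. f (x + a))"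
  proof (rule continuous_on_compose2[of UNIV f])
    show "continuous_on UNIV f" using assms by (simp add: rapid_def)
    show "continuous_on UNIV (\<lambda>x. x + a)" by (intro continuous_intros)
  qed auto
qed

lemma has_vector_derivative_quotient:
  fixes g :: "real \<Rightarrow> complex"
  assumes "(g has_vector_derivative d) (at 0)" "e \<longlonglongrightarrow> 0" "\<And>n. e n > 0"
  shows "(\<lambda>n. (g (e n) - g 0) /\<^sub>R e n) \<longlonglongrightarrow> d"
proof -
  have "((\<lambda>y. (g y - g 0 - (y - 0) *\<^sub>R d) /\<^sub>R norm (y - 0)) \<longlongrightarrow> 0) (at 0)"
    using assms(1) unfolding has_vector_derivative_def has_derivative_at_within by simp
  moreover have "filterlim e (at 0) sequentially"
    using assms(2,3) by (auto simp: filterlim_at less_imp_neq[symmetric] intro!: always_eventually)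
  ultimately have "(\<lambda>n. (g (e n) - g 0 - (e n - 0) *\<^sub>R d) /\<^sub>R norm (e n - 0)) \<longlonglongrightarrow> 0"
    by (rule filterlim_compose)
  moreover have "(g (e n) - g 0 - (e n - 0) *\<^sub>R d) /\<^sub>R norm (e n - 0) = (g (e n) - g 0) /\<^sub>R e n - d" for n
    using assms(3)[of n] by (simp add: scaleR_right_diff_distrib)
  ultimately show ?thesis by (simp add: LIM_zero_iff)
qed

text \<open>By translation invariance the integral of every difference quotient is zero, and the
  quotients converge dominatedly to the derivative. This gives integration by parts without boundary
  terms.\<close>

lemma integral_pdiff_0:
  fixes f :: "real^'n::finite \<Rightarrow> complex"
  assumes d: "\<And>x. f differentiable (at x)" and f: "rapid f" and f': "rapid (pdiff j f)"
  shows "(LINT x|lborel. pdiff j f x) = 0"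
proof -
  define D where "D = 2 * DIM(real^'n)"
  define a :: "real^'n" where "a = axis j 1"
  have na: "norm a = 1" by (simp add: a_def)
  define e where "e n = inverse (real (Suc n))" for n
  have e: "e n > 0" "e n \<le> 1" for n by (auto simp: e_def inverse_le_1_iff)
  have e0: "e \<longlonglongrightarrow> 0" unfolding e_def by (rule LIMSEQ_inverse_real_of_nat)
  obtain C where C: "\<And>x. (1 + norm x) ^ D * norm (pdiff j f x) \<le> C" using rapid_bound[OF f'] by blast
  note [measurable] = rapid_measurable[OF f] rapid_measurable[OF f']
  define q where "q n x = (f (x + e n *\<^sub>R a) - f x) /\<^sub>R e n" for n x
  \<comment> \<open>Mean value inequality along a segment of length at most one, on which 1 + norm x
    drops at most by the factor 2; hence the majorant does not depend on the step
    \<open>e n\<close>.\<close>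
  have qb: "(1 + norm x) ^ D * norm (q n x) \<le> 2 ^ D * C" for n x
  proof -
    define B where "B = 2 ^ D * C / (1 + norm x) ^ D"
    have p: "(1 + norm x) ^ D > 0" by (intro zero_less_power) (auto simp: add_pos_nonneg)
    have dB: "norm (pdiff j f (x + s *\<^sub>R a)) \<le> B" if "s \<in> {0..e n}" for s
    proof -
      have "norm (s *\<^sub>R a) \<le> 1" using that e(2)[of n] na by simp
      moreover have "norm x \<le> norm (x + s *\<^sub>R a) + norm (s *\<^sub>R a)" using norm_triangle_ineq4[of "x + s *\<^sub>R a" "s *\<^sub>R a"] by simp
      ultimately have "1 + norm x \<le> 2 * (1 + norm (x + s *\<^sub>R a))" by (smt (verit) norm_ge_zero)
      then have "(1 + norm x) ^ D \<le> (2 * (1 + norm (x + s *\<^sub>R a))) ^ D" by (intro power_mono) auto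
      then have "(1 + norm x) ^ D * norm (pdiff j f (x + s *\<^sub>R a)) \<le> 2 ^ D * ((1 + norm (x + s *\<^sub>R a)) ^ D * norm (pdiff j f (x + s *\<^sub>R a)))"
        unfolding mult.assoc[symmetric] power_mult_distrib by (rule mult_right_mono) simp
      also have "\<dots> \<le> 2 ^ D * C" using C by (intro mult_left_mono) auto
      finally show ?thesis using p by (simp add: B_def field_simps)
    qed
    have "norm (f (x + e n *\<^sub>R a) - f (x + 0 *\<^sub>R a)) \<le> B * norm (e n - 0)"
    proof (rule differentiable_bound[of "{0..e n}" "\<lambda>s. f (x + s *\<^sub>R a)" "\<lambda>s r. r *\<^sub>R pdiff j f (x + s *\<^sub>R a)"])
      fix s assume s: "s \<in> {0..e n}"
      show "((\<lambda>s. f (x + s *\<^sub>R a)) has_derivative (\<lambda>r. r *\<^sub>R pdiff j f (x + s *\<^sub>R a))) (at s within {0..e n})"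
        using pdiff_line[OF d, where x=x and t=s and j=j] unfolding a_def has_vector_derivative_def
        by (rule has_derivative_at_withinI)
      show "onorm (\<lambda>r. r *\<^sub>R pdiff j f (x + s *\<^sub>R a)) \<le> B"
      proof (rule onorm_le)
        fix r :: real
        show "norm (r *\<^sub>R pdiff j f (x + s *\<^sub>R a)) \<le> B * norm r"
          using mult_left_mono[OF dB[OF s], of "\<bar>r\<bar>"] by (simp add: mult.commute)
      qed
    qed (use e(1)[of n] in auto)
    then have "norm (q n x) \<le> B" using e(1)[of n] by (simp add: q_def divide_simps mult.commute)
    then show ?thesis using p by (simp add: B_def field_simps)
  qed
  have "(\<lambda>n. LINT x|lborel. q n x) \<longlonglongrightarrow> (LINT x|lborel. pdiff j f x)"
  proof (rule integral_dominated_convergence[where w="\<lambda>x::real^'n. 2 ^ D * C * decay x"])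
    show "integrable lborel (\<lambda>x::real^'n. 2 ^ D * C * decay x)" by (intro integrable_mult_right decay_integrable)
    show "AE x in lborel. (\<lambda>n. q n x) \<longlonglongrightarrow> pdiff j f x"
    proof (intro AE_I2)
      fix x
      show "(\<lambda>n. q n x) \<longlonglongrightarrow> pdiff j f x"
        using has_vector_derivative_quotient[OF pdiff_line0[OF d, where x=x and j=j] e0 e(1)] by (simp add: q_def a_def)
    qed
    show "AE x in lborel. norm (q n x) \<le> 2 ^ D * C * decay x" for n
      using decay_dominates[of "q n" "2 ^ D * C"] qb by (auto simp: D_def)
    show "q n \<in> borel_measurable lborel" for n unfolding q_def by measurable
  qed measurable
  moreover have "(LINT x|lborel. q n x) = 0" for n
  proof -
    have "(LINT x|lborel. f x) = (LINT x|lborel. f (x + e n *\<^sub>R a))"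
      using integral_affine[of 1 f "e n *\<^sub>R a"] by (simp add: add.commute)
    then have "(LINT x|lborel. f (x + e n *\<^sub>R a) - f x) = 0"
      using rapid_integrable[OF f] rapid_integrable[OF rapid_shift[OF f]] by simp
    then show ?thesis unfolding q_def by simp
  qed
  ultimately have "(\<lambda>n::nat. 0) \<longlonglongrightarrow> (LINT x|lborel. pdiff j f x)" by simp
  then show ?thesis by (simp add: LIMSEQ_const_iff)
qed

subsection \<open>Oscillatory integrals\<close>

definition kern :: "real \<Rightarrow> real^'n \<Rightarrow> real^'n \<Rightarrow> real^'n \<Rightarrow> complex" where
  "kern h x p y = exp (\<i> / of_real h * of_real ((x - y) \<bullet> p))"

lemma norm_kern [simp]: "norm (kern h x p y) = 1"
proof -
  have "kern h x p y = exp (\<i> * of_real ((x - y) \<bullet> p / h))" by (simp add: kern_def)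
  then show ?thesis by (simp only: norm_exp_ii)
qed

lemma kern_continuous: "continuous_on UNIV (kern h x p)" "continuous_on UNIV (\<lambda>p. kern h x p y)"
  unfolding kern_def by (intro continuous_intros)+

lemma kern_differentiable: "kern h x p differentiable (at y)"
  and pdiff_kern: "pdiff j (kern h x p) y = - (\<i> / of_real h * of_real (p $ j)) * kern h x p y"
proof -
  have D: "(kern h x p has_derivative (\<lambda>v. kern h x p y * (\<i> / of_real h * of_real (- v \<bullet> p)))) (at y)"
  proof -
    have l: "((\<lambda>y. (x - y) \<bullet> p) has_derivative (\<lambda>v. - v \<bullet> p)) (at y)"
      by (auto intro!: derivative_eq_intros)
    have "((\<lambda>y. \<i> / of_real h * complex_of_real ((x - y) \<bullet> p)) has_derivative (\<lambda>v. \<i> / of_real h * of_real (- v \<bullet> p))) (at y)"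
      by (rule bounded_linear.has_derivative[OF bounded_linear_mult_right bounded_linear.has_derivative[OF bounded_linear_of_real l]])
    then show ?thesis unfolding kern_def
      by (rule has_derivative_compose) (rule DERIV_exp[unfolded has_field_derivative_def])
  qed
  then show 1: "kern h x p differentiable (at y)" by (auto simp: differentiable_def)
  have "((\<lambda>t. y + t *\<^sub>R axis j (1::real)) has_derivative (\<lambda>s. s *\<^sub>R axis j 1)) (at 0)"
    by (auto intro!: derivative_eq_intros)
  then have "((\<lambda>t. kern h x p (y + t *\<^sub>R axis j 1)) has_derivative (\<lambda>s. kern h x p y * (\<i> / of_real h * of_real (- (s *\<^sub>R axis j 1) \<bullet> p)))) (at 0)"
    by (rule has_derivative_compose) (use D in simp)
  moreover have "kern h x p y * (\<i> / of_real h * of_real (- (s *\<^sub>R axis j 1) \<bullet> p)) = s *\<^sub>R (- (\<i> / of_real h * of_real (p $ j)) * kern h x p y)" for s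
  proof -
    have "- (s *\<^sub>R axis j 1) \<bullet> p = - (s * p $ j)" by (simp add: inner_axis')
    then show ?thesis by (simp add: scaleR_conv_of_real)
  qed
  ultimately have "((\<lambda>t. kern h x p (y + t *\<^sub>R axis j 1)) has_vector_derivative - (\<i> / of_real h * of_real (p $ j)) * kern h x p y) (at 0)"
    unfolding has_vector_derivative_def by simp
  then show "pdiff j (kern h x p) y = - (\<i> / of_real h * of_real (p $ j)) * kern h x p y"
    by (rule pdiffI)
qed

definition kint :: "real \<Rightarrow> real^'n::finite \<Rightarrow> (real^'n \<Rightarrow> complex) \<Rightarrow> real^'n \<Rightarrow> complex" where
  "kint h x \<phi> p = (LINT y|lborel. kern h x p y * \<phi> y)"

lemma kern_rapid: "rapid \<phi> \<Longrightarrow> rapid (\<lambda>y. kern h x p y * \<phi> y)"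
  by (rule rapid_unimodular) (auto intro: kern_continuous)

lemma kint_add: "rapid \<phi> \<Longrightarrow> rapid \<psi> \<Longrightarrow> kint h x (\<lambda>y. \<phi> y + \<psi> y) p = kint h x \<phi> p + kint h x \<psi> p"
  unfolding kint_def by (simp add: distrib_left rapid_integrable kern_rapid)

lemma kint_cmult: "kint h x (\<lambda>y. c * \<phi> y) p = c * kint h x \<phi> p"
proof -
  have "kern h x p y * (c * \<phi> y) = c * (kern h x p y * \<phi> y)" for y by simp
  then show ?thesis unfolding kint_def by (simp only: integral_mult_right_zero)
qed

text \<open>The kernel is an exponential in y, so the factor \<open>p $ j\<close> amounts to a
  derivative of the kernel, which integration by parts moves to the function.\<close>

lemma kint_parts:
  assumes "\<phi> \<in> schwartz" "h \<noteq> 0"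
  shows "of_real (p $ j) * kint h x \<phi> p = - \<i> * of_real h * kint h x (pdiff j \<phi>) p"
proof -
  have d: "(\<lambda>y. kern h x p y * \<phi> y) differentiable (at y)" for y
    by (intro differentiable_mult kern_differentiable schwartz_differentiable assms)
  have p: "pdiff j (\<lambda>y. kern h x p y * \<phi> y) = (\<lambda>y. kern h x p y * pdiff j \<phi> y + (- (\<i> / of_real h * of_real (p $ j))) * (kern h x p y * \<phi> y))"
    by (rule ext) (simp add: pdiff_mult kern_differentiable schwartz_differentiable assms pdiff_kern)
  have r: "rapid (\<lambda>y. kern h x p y * pdiff j \<phi> y)" "rapid (\<lambda>y. (- (\<i> / of_real h * of_real (p $ j))) * (kern h x p y * \<phi> y))"
    by (intro rapid_cmult kern_rapid schwartz_rapid schwartz_pdiff assms)+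
  have "(LINT y|lborel. pdiff j (\<lambda>y. kern h x p y * \<phi> y) y) = 0"
    by (rule integral_pdiff_0[OF d kern_rapid[OF schwartz_rapid[OF assms(1)]]])
      (use rapid_add[OF r] in \<open>simp add: p\<close>)
  then have "kint h x (pdiff j \<phi>) p + (- (\<i> / of_real h * of_real (p $ j))) * kint h x \<phi> p = 0"
    unfolding p Bochner_Integration.integral_add[OF rapid_integrable[OF r(1)] rapid_integrable[OF r(2)]]
    unfolding integral_mult_right_zero kint_def .
  then have "kint h x (pdiff j \<phi>) p = \<i> / of_real h * of_real (p $ j) * kint h x \<phi> p" by simp
  then show ?thesis using assms(2) by simp
qed

lemma kint_continuous: assumes "rapid \<phi>" shows "continuous_on UNIV (kint h x \<phi>)"
proof -
  note [measurable] = rapid_measurable[OF assms]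
  have [measurable]: "kern h x p \<in> borel_measurable borel" for p
    by (intro borel_measurable_continuous_onI kern_continuous)
  have "(\<lambda>n. kint h x \<phi> (u n)) \<longlonglongrightarrow> kint h x \<phi> p" if "u \<longlonglongrightarrow> p" for u p
    unfolding kint_def
  proof (rule integral_dominated_convergence[where w="\<lambda>y. norm (\<phi> y)"])
    show "AE y in lborel. (\<lambda>n. kern h x (u n) y * \<phi> y) \<longlonglongrightarrow> kern h x p y * \<phi> y"
    proof (intro AE_I2 tendsto_mult tendsto_const)
      fix y
      have "isCont (\<lambda>p. kern h x p y) p" using kern_continuous(2)[of h x y] by (simp add: continuous_on_eq_continuous_at)
      then show "(\<lambda>n. kern h x (u n) y) \<longlonglongrightarrow> kern h x p y" using that by (rule isCont_tendsto_compose)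
    qed
  qed (use rapid_integrable[OF assms] in \<open>auto simp: norm_mult\<close>)
  then show ?thesis
    by (auto simp: continuous_on_eq_continuous_at continuous_at_sequentially comp_def)
qed

text \<open>Every power of p costs one derivative of the function, and a Schwartz function has all
  of them with the same properties. The decay makes the outer integral over p converge
  absolutely.\<close>

lemma kint_bound: 
  assumes "\<phi> \<in> schwartz" "h \<noteq> 0"
  shows "\<exists>C. \<forall>p. (1 + norm p) ^ k * norm (kint h x \<phi> p) \<le> C"
  using assms(1)
proof (induction k arbitrary: \<phi>)
  case 0
  have "norm (kint h x \<phi> p) \<le> (LINT y|lborel. norm (\<phi> y))" for p
    unfolding kint_def by (rule order_trans[OF integral_norm_bound]) (simp add: norm_mult)
  then show ?case by auto
next
  case (Suc k)
  obtain C where C: "\<forall>p. (1 + norm p) ^ k * norm (kint h x \<phi> p) \<le> C" using Suc by blast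
  have "\<forall>j. \<exists>C. \<forall>p. (1 + norm p) ^ k * norm (kint h x (pdiff j \<phi>) p) \<le> C"
    using Suc schwartz_pdiff by blast
  then obtain D where D: "\<forall>j. \<forall>p. (1 + norm p) ^ k * norm (kint h x (pdiff j \<phi>) p) \<le> D j" by metis
  have "(1 + norm p) ^ Suc k * norm (kint h x \<phi> p) \<le> C + (\<Sum>j\<in>UNIV. \<bar>h\<bar> * D j)" for p
  proof -
    have "norm p * norm (kint h x \<phi> p) \<le> (\<Sum>j\<in>UNIV. \<bar>p $ j\<bar>) * norm (kint h x \<phi> p)"
      by (intro mult_right_mono norm_le_l1_cart) auto
    also have "\<dots> = (\<Sum>j\<in>UNIV. norm (of_real (p $ j) * kint h x \<phi> p))"
      by (simp add: sum_distrib_right norm_mult)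
    also have "\<dots> = (\<Sum>j\<in>UNIV. \<bar>h\<bar> * norm (kint h x (pdiff j \<phi>) p))"
      unfolding kint_parts[OF Suc.prems assms(2)] by (simp add: norm_mult)
    finally have 1: "norm p * norm (kint h x \<phi> p) \<le> (\<Sum>j\<in>UNIV. \<bar>h\<bar> * norm (kint h x (pdiff j \<phi>) p))" .
    have "(1 + norm p) ^ Suc k * norm (kint h x \<phi> p) = 
      (1 + norm p) ^ k * norm (kint h x \<phi> p) + (1 + norm p) ^ k * (norm p * norm (kint h x \<phi> p))"
      by (simp add: algebra_simps)
    also have "\<dots> \<le> C + (1 + norm p) ^ k * (\<Sum>j\<in>UNIV. \<bar>h\<bar> * norm (kint h x (pdiff j \<phi>) p))"
      using C 1 by (intro add_mono mult_left_mono) auto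
    also have "\<dots> = C + (\<Sum>j\<in>UNIV. \<bar>h\<bar> * ((1 + norm p) ^ k * norm (kint h x (pdiff j \<phi>) p)))"
      by (simp add: sum_distrib_left mult_ac)
    also have "\<dots> \<le> C + (\<Sum>j\<in>UNIV. \<bar>h\<bar> * D j)"
      using D by (intro add_left_mono sum_mono mult_left_mono) auto
    finally show ?thesis .
  qed
  then show ?case by blast
qed

lemma kint_rapid: "\<phi> \<in> schwartz \<Longrightarrow> h \<noteq> 0 \<Longrightarrow> rapid (kint h x \<phi>)"
  unfolding rapid_def using kint_continuous[OF schwartz_rapid] kint_bound by blast

lemma kint_fourier: "kint h x \<phi> p = exp (\<i> * of_real (x \<bullet> (p /\<^sub>R h))) * fourier \<phi> (p /\<^sub>R h)"
proof -
  have "kern h x p y = exp (\<i> * of_real (x \<bullet> (p /\<^sub>R h))) * exp (- \<i> * of_real ((p /\<^sub>R h) \<bullet> y))" for y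
    by (simp add: kern_def inner_diff_left inner_commute algebra_simps exp_add exp_diff exp_minus divide_inverse)
  then have "kern h x p y * \<phi> y = exp (\<i> * of_real (x \<bullet> (p /\<^sub>R h))) * (exp (- \<i> * of_real ((p /\<^sub>R h) \<bullet> y)) * \<phi> y)" for y
    by (simp only: mult.assoc)
  then show ?thesis unfolding kint_def fourier_def by (simp only: integral_mult_right_zero)
qed

lemma fourier_rapid: assumes "\<phi> \<in> schwartz" shows "rapid (fourier \<phi>)"
proof -
  have "fourier \<phi> = kint 1 0 \<phi>" by (rule ext) (simp add: kint_fourier)
  then show ?thesis using kint_rapid[OF assms, of 1 0] by simp
qed

subsection \<open>Evaluation of symbols\<close>

lemma sym_eval_add: "sym_eval h p x (A + B) = sym_eval h p x A + sym_eval h p x B"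
  unfolding sym_eval_def by (rule peval_add) simp
lemma sym_eval_diff: "sym_eval h p x (A - B) = sym_eval h p x A - sym_eval h p x B"
  unfolding sym_eval_def by (rule peval_diff) simp
lemma sym_eval_mult: "sym_eval h p x (A * B) = sym_eval h p x A * sym_eval h p x B"
  unfolding sym_eval_def by (rule peval_mult) simp
lemma sym_eval_sconst [simp]: "sym_eval h p x (sconst c) = c"
  unfolding sym_eval_def sconst_def by (simp add: peval_const)
lemma sym_eval_1 [simp]: "sym_eval h p x 1 = 1" using sym_eval_sconst[of h p x 1] by simp
lemma sym_eval_0 [simp]: "sym_eval h p x 0 = 0" using sym_eval_sconst[of h p x 0] by simp
lemma sym_eval_svar: "sym_eval h p x (svar v) = of_real (case v of MOM k \<Rightarrow> p $ k | POS k \<Rightarrow> x $ k | HBAR \<Rightarrow> h)"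
  unfolding sym_eval_def svar_def by (rule peval_var) simp

lemma sym_eval_deriv:
  fixes P X :: "real \<Rightarrow> real^'n::finite"
  assumes "\<And>k. ((\<lambda>t. P t $ k) has_real_derivative P' k) (at t)" "\<And>k. ((\<lambda>t. X t $ k) has_real_derivative X' k) (at t)"
  shows "((\<lambda>t. sym_eval h (P t) (X t) A) has_vector_derivative
    (\<Sum>k\<in>UNIV. of_real (P' k) * sym_eval h (P t) (X t) (spartial (MOM k) A) + of_real (X' k) * sym_eval h (P t) (X t) (spartial (POS k) A))) (at t)"
proof (induction A rule: sym_induct)
  case (add A B)
  then show ?case using has_vector_derivative_add[OF add]
    by (simp add: spartial_add sym_eval_add distrib_left sum.distrib add_ac)
next
  case (var v A)
  define d where "d = (case v of MOM k \<Rightarrow> P' k | POS k \<Rightarrow> X' k | HBAR \<Rightarrow> 0)"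
  have "((\<lambda>t. case v of MOM k \<Rightarrow> P t $ k | POS k \<Rightarrow> X t $ k | HBAR \<Rightarrow> h) has_real_derivative d) (at t)"
    using assms by (cases v) (auto simp: d_def)
  then have v: "((\<lambda>t. sym_eval h (P t) (X t) (svar v)) has_vector_derivative of_real d) (at t)"
    unfolding sym_eval_svar by (rule has_vector_derivative_of_real)
  have "(\<Sum>k\<in>UNIV. of_real (P' k) * sym_eval h (P t) (X t) (spartial (MOM k) (svar v * A)) + of_real (X' k) * sym_eval h (P t) (X t) (spartial (POS k) (svar v * A)))
    = (\<Sum>k\<in>UNIV. (if MOM k = v then of_real (P' k) * sym_eval h (P t) (X t) A else 0) + (if POS k = v then of_real (X' k) * sym_eval h (P t) (X t) A else 0))
     + sym_eval h (P t) (X t) (svar v) * (\<Sum>k\<in>UNIV. of_real (P' k) * sym_eval h (P t) (X t) (spartial (MOM k) A) + of_real (X' k) * sym_eval h (P t) (X t) (spartial (POS k) A))"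
    unfolding spartial_svar_mult sum_distrib_left sum.distrib[symmetric]
    by (intro sum.cong refl) (simp add: sym_eval_add sym_eval_mult algebra_simps)
  also have "(\<Sum>k\<in>UNIV. (if MOM k = v then of_real (P' k) * sym_eval h (P t) (X t) A else 0) + (if POS k = v then of_real (X' k) * sym_eval h (P t) (X t) A else 0)) = of_real d * sym_eval h (P t) (X t) A"
    by (cases v) (simp_all add: d_def sum.distrib)
  finally show ?case using has_vector_derivative_mult[OF v var] by (simp add: sym_eval_mult add.commute)
qed simp

subsection \<open>Weyl quantization of polynomials\<close>

definition wint :: "real \<Rightarrow> real^'n::finite \<Rightarrow> 'n sym \<Rightarrow> (real^'n \<Rightarrow> complex) \<Rightarrow> real^'n \<Rightarrow> complex" where
  "wint h x A \<psi> p = kint h x (\<lambda>y. sym_eval h p ((1 / 2) *\<^sub>R (x + y)) A * \<psi> y) p"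

lemma weyl_wint: "weyl h A \<psi> x = of_real (1 / (2 * pi * h) ^ CARD('n)) * (LINT p|lborel. wint h x A \<psi> p)"
  for \<psi> :: "real^'n::finite \<Rightarrow> complex"
  unfolding weyl_def wint_def kint_def kern_def by (simp only: mult.assoc)

definition mulx :: "'n \<Rightarrow> (real^'n \<Rightarrow> complex) \<Rightarrow> real^'n \<Rightarrow> complex" where
  "mulx k \<psi> x = of_real (x $ k) * \<psi> x"

lemma mulx_schwartz: "\<psi> \<in> schwartz \<Longrightarrow> mulx k \<psi> \<in> schwartz"
  unfolding mulx_def[abs_def] by (rule schwartz_coord)

lemma sym_eval_POS: "sym_eval h p ((1 / 2) *\<^sub>R (x + y)) (svar (POS k) * A) * z = 
  of_real (x $ k / 2) * (sym_eval h p ((1 / 2) *\<^sub>R (x + y)) A * z) + 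
  (1/2) * (of_real (y $ k) * (sym_eval h p ((1 / 2) *\<^sub>R (x + y)) A * z))"
  by (simp add: sym_eval_mult sym_eval_svar) (simp add: field_simps)

lemma sym_eval_schwartz: 
  "\<psi> \<in> schwartz \<Longrightarrow> (\<lambda>y. sym_eval h p ((1 / 2) *\<^sub>R (x + y)) A * \<psi> y) \<in> schwartz"
proof (induction A rule: sym_induct)
  case (const c)
  then show ?case by (simp add: schwartz_cmult)
next
  case (add A B)
  then show ?case using schwartz_add by (simp add: sym_eval_add distrib_right)
next
  case (var v A)
  then have A: "(\<lambda>y. sym_eval h p ((1 / 2) *\<^sub>R (x + y)) A * \<psi> y) \<in> schwartz" by simp
  show ?case
  proof (cases v)
    case (POS k)
    show ?thesis unfolding POS sym_eval_POS
      by (intro schwartz_add schwartz_cmult schwartz_coord A)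
  qed (use schwartz_cmult[OF A] in \<open>simp_all add: sym_eval_mult sym_eval_svar mult.assoc\<close>)
qed

lemma wint_cmult: "wint h x A (\<lambda>y. c * \<psi> y) p = c * wint h x A \<psi> p"
  unfolding wint_def by (simp add: mult.left_commute[of _ c] kint_cmult)

context
  fixes h :: real
  assumes h: "h > 0"
begin

lemma wint_add: "\<psi> \<in> schwartz \<Longrightarrow> wint h x (A + B) \<psi> p = wint h x A \<psi> p + wint h x B \<psi> p"
  unfolding wint_def sym_eval_add distrib_right
  by (intro kint_add schwartz_rapid sym_eval_schwartz)

lemma wint_add_fun: "\<phi> \<in> schwartz \<Longrightarrow> \<psi> \<in> schwartz \<Longrightarrow> wint h x A (\<lambda>y. \<phi> y + \<psi> y) p = wint h x A \<phi> p + wint h x A \<psi> p"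
  unfolding wint_def distrib_left
  by (intro kint_add schwartz_rapid sym_eval_schwartz)

lemma wint_sconst: "wint h x (sconst c * A) \<psi> p = c * wint h x A \<psi> p"
  unfolding wint_def by (simp add: sym_eval_mult mult.assoc kint_cmult)

lemma wint_HBAR: "wint h x (svar HBAR * A) \<psi> p = of_real h * wint h x A \<psi> p"
  unfolding wint_def by (simp add: sym_eval_mult sym_eval_svar mult.assoc kint_cmult)

lemma wint_MOM: "wint h x (svar (MOM k) * A) \<psi> p = of_real (p $ k) * wint h x A \<psi> p"
  unfolding wint_def by (simp add: sym_eval_mult sym_eval_svar mult.assoc kint_cmult)

lemma wint_POS: "\<psi> \<in> schwartz \<Longrightarrow> 
  wint h x (svar (POS k) * A) \<psi> p = of_real (x $ k / 2) * wint h x A \<psi> p + (1/2) * wint h x A (mulx k \<psi>) p"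
  unfolding wint_def sym_eval_POS mulx_def
  by (subst kint_add) (simp_all only: kint_cmult mult.left_commute[of "of_real (_ $ k)"] schwartz_rapid schwartz_cmult sym_eval_schwartz schwartz_coord)

text \<open>Momentum factors do not spoil rapid decay. A position factor at the midpoint is half a
  constant and half a multiplication of the argument by y, which keeps it a Schwartz
  function.\<close>

lemma wint_rapid: "\<psi> \<in> schwartz \<Longrightarrow> rapid (wint h x A \<psi>)"
proof (induction A arbitrary: \<psi> rule: sym_induct)
  case (const c)
  have "wint h x (sconst c) \<psi> = (\<lambda>p. c * kint h x \<psi> p)"
    by (rule ext) (simp add: wint_def kint_cmult)
  then show ?case using const h by (simp add: rapid_cmult kint_rapid)
next
  case (add A B)
  have "wint h x (A + B) \<psi> = (\<lambda>p. wint h x A \<psi> p + wint h x B \<psi> p)"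
    by (rule ext) (simp add: wint_add add)
  then show ?case using add by (simp add: rapid_add)
next
  case (var v A)
  show ?case
  proof (cases v)
    case (MOM k)
    have "wint h x (svar v * A) \<psi> = (\<lambda>p. of_real (p $ k) * wint h x A \<psi> p)"
      by (rule ext) (simp add: MOM wint_MOM)
    then show ?thesis using var by (simp add: rapid_coord)
  next
    case (POS k)
    have "wint h x (svar v * A) \<psi> = (\<lambda>p. of_real (x $ k / 2) * wint h x A \<psi> p + (1/2) * wint h x A (mulx k \<psi>) p)"
      by (rule ext) (simp only: POS wint_POS[OF var(2)])
    then show ?thesis using var.IH[OF var.prems] var.IH[OF mulx_schwartz[OF var.prems]] 
      by (simp only: rapid_add rapid_cmult)
  next
    case HBAR
    have "wint h x (svar v * A) \<psi> = (\<lambda>p. of_real h * wint h x A \<psi> p)"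
      by (rule ext) (simp add: HBAR wint_HBAR)
    then show ?thesis using var by (simp add: rapid_cmult)
  qed
qed

lemma wint_integrable: "\<psi> \<in> schwartz \<Longrightarrow> integrable lborel (wint h x A \<psi>)"
  by (rule rapid_integrable) (rule wint_rapid)

lemma weyl_add: "\<psi> \<in> schwartz \<Longrightarrow> weyl h (A + B) \<psi> x = weyl h A \<psi> x + weyl h B \<psi> x"
  by (simp add: weyl_wint wint_add wint_integrable distrib_left)

lemma weyl_add_fun: "\<phi> \<in> schwartz \<Longrightarrow> \<psi> \<in> schwartz \<Longrightarrow> weyl h A (\<lambda>y. \<phi> y + \<psi> y) x = weyl h A \<phi> x + weyl h A \<psi> x"
  by (simp add: weyl_wint wint_add_fun wint_integrable distrib_left)

lemma weyl_sconst_mult: "weyl h (sconst c * A) \<psi> x = c * weyl h A \<psi> x"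
  by (simp add: weyl_wint wint_sconst)

lemma weyl_cmult: "weyl h A (\<lambda>y. c * \<psi> y) x = c * weyl h A \<psi> x"
  by (simp add: weyl_wint wint_cmult)

lemma weyl_HBAR: "weyl h (svar HBAR * A) \<psi> x = of_real h * weyl h A \<psi> x"
  by (simp add: weyl_wint wint_HBAR)

lemma weyl_0: "weyl h 0 \<psi> x = 0"
  using weyl_sconst_mult[of 0 0 \<psi> x] by simp

lemma weyl_uminus: "weyl h (- A) \<psi> x = - weyl h A \<psi> x"
  using weyl_sconst_mult[of "-1" A \<psi> x] by (simp add: sconst_uminus)

lemma weyl_diff: "\<psi> \<in> schwartz \<Longrightarrow> weyl h (A - B) \<psi> x = weyl h A \<psi> x - weyl h B \<psi> x"
  using weyl_add[of \<psi> A "- B" x] by (simp add: weyl_uminus)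

lemma weyl_sum: "\<psi> \<in> schwartz \<Longrightarrow> weyl h (\<Sum>i\<in>I. A i) \<psi> x = (\<Sum>i\<in>I. weyl h (A i) \<psi> x)"
  by (induction I rule: infinite_finite_induct) (auto simp: weyl_add weyl_0)

lemma weyl_0_fun: "weyl h A (\<lambda>y. 0) x = 0"
  using weyl_cmult[of A 0 "\<lambda>y. 0" x] by simp

lemma weyl_diff_fun: "\<phi> \<in> schwartz \<Longrightarrow> \<psi> \<in> schwartz \<Longrightarrow> weyl h A (\<lambda>y. \<phi> y - \<psi> y) x = weyl h A \<phi> x - weyl h A \<psi> x"
  using weyl_add_fun[of \<phi> "\<lambda>y. (-1) * \<psi> y" A x] schwartz_cmult[of \<psi> "-1"]
  unfolding weyl_cmult by simp

lemma weyl_POS_sym: "\<psi> \<in> schwartz \<Longrightarrow> 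
  weyl h (svar (POS k) * A) \<psi> x = (1/2) * (of_real (x $ k) * weyl h A \<psi> x + weyl h A (mulx k \<psi>) x)"
  by (simp add: weyl_wint wint_POS wint_integrable mulx_schwartz) (simp add: algebra_simps add_divide_distrib)

text \<open>Fourier inversion in the variable p/h; the prefactor of \<open>weyl\<close> cancels the
  Jacobian together with the constant of the inversion formula.\<close>

lemma weyl_1: assumes "\<psi> \<in> schwartz" shows "weyl h 1 \<psi> x = \<psi> x"
proof -
  have F: "rapid (fourier \<psi>)" by (rule fourier_rapid[OF assms])
  have [measurable]: "fourier \<psi> \<in> borel_measurable borel" by (rule rapid_measurable[OF F])
  have "(LINT p|lborel. wint h x 1 \<psi> p) = (LINT p|lborel. exp (\<i> * of_real (x \<bullet> (p /\<^sub>R h))) * fourier \<psi> (p /\<^sub>R h))"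
    by (simp add: wint_def kint_fourier)
  also have "\<dots> = of_real (\<bar>h\<bar> ^ DIM(real^'a)) * (LINT p|lborel. exp (\<i> * of_real (x \<bullet> ((0 + h *\<^sub>R p) /\<^sub>R h))) * fourier \<psi> ((0 + h *\<^sub>R p) /\<^sub>R h))"
    using h by (intro integral_affine) (simp, measurable)
  also have "(LINT p|lborel. exp (\<i> * of_real (x \<bullet> ((0 + h *\<^sub>R p) /\<^sub>R h))) * fourier \<psi> ((0 + h *\<^sub>R p) /\<^sub>R h)) = of_real ((2 * pi) ^ DIM(real^'a)) * \<psi> x"
    using fourier_inversion[OF schwartz_rapid[OF assms] rapid_integrable[OF F]] h by simp
  finally have e: "(LINT p|lborel. wint h x 1 \<psi> p) = of_real (\<bar>h\<bar> ^ DIM(real^'a)) * (of_real ((2 * pi) ^ DIM(real^'a)) * \<psi> x)" .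
  have "1 / (2 * pi * h) ^ CARD('a) * (\<bar>h\<bar> ^ DIM(real^'a) * (2 * pi) ^ DIM(real^'a)) = 1"
    using h by (simp add: power_mult_distrib)
  then have "complex_of_real (1 / (2 * pi * h) ^ CARD('a)) * (of_real (\<bar>h\<bar> ^ DIM(real^'a)) * of_real ((2 * pi) ^ DIM(real^'a))) = 1"
    by (metis of_real_1 of_real_mult)
  then show ?thesis unfolding weyl_wint e by (metis mult.assoc mult_1)
qed

lemma pdiff_sym_eval: 
  "(\<lambda>y. sym_eval h p ((1 / 2) *\<^sub>R (x + y)) A) differentiable (at y)"
  "pdiff k (\<lambda>y. sym_eval h p ((1 / 2) *\<^sub>R (x + y)) A) y = (1/2) * sym_eval h p ((1 / 2) *\<^sub>R (x + y)) (spartial (POS k) A)"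
proof -
  show "(\<lambda>y. sym_eval h p ((1 / 2) *\<^sub>R (x + y)) A) differentiable (at y)"
  proof (induction A rule: sym_induct)
    case (var v A)
    have "(\<lambda>y. sym_eval h p ((1 / 2) *\<^sub>R (x + y)) (svar v)) differentiable (at y)"
    proof (cases v)
      case (POS k)
      have "sym_eval h p ((1 / 2) *\<^sub>R (x + y)) (svar v) = of_real (x $ k) / 2 + (1/2) * of_real (y $ k)" for y
        by (simp add: sym_eval_svar POS)
      then show ?thesis by (simp only:) (intro differentiable_add differentiable_const differentiable_mult coord_differentiable)
    qed (simp_all add: sym_eval_svar)
    then show ?case unfolding sym_eval_mult using var by (rule differentiable_mult)
  qed (auto simp: sym_eval_add)
  have D: "((\<lambda>t. sym_eval h p ((1 / 2) *\<^sub>R (x + (y + t *\<^sub>R axis k 1))) A) has_vector_derivative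
    (\<Sum>j\<in>UNIV. of_real 0 * sym_eval h p ((1 / 2) *\<^sub>R (x + (y + 0 *\<^sub>R axis k 1))) (spartial (MOM j) A) + 
       of_real (if j = k then 1/2 else 0) * sym_eval h p ((1 / 2) *\<^sub>R (x + (y + 0 *\<^sub>R axis k 1))) (spartial (POS j) A))) (at 0)"
    by (rule sym_eval_deriv) (auto intro!: derivative_eq_intros simp: axis_def)
  have e: "(\<Sum>j\<in>UNIV. of_real 0 * sym_eval h p ((1 / 2) *\<^sub>R (x + (y + 0 *\<^sub>R axis k 1))) (spartial (MOM j) A) + 
       of_real (if j = k then 1/2 else 0) * sym_eval h p ((1 / 2) *\<^sub>R (x + (y + 0 *\<^sub>R axis k 1))) (spartial (POS j) A)) 
     = (1/2) * sym_eval h p ((1 / 2) *\<^sub>R (x + y)) (spartial (POS k) A)"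
    by (subst sum.remove[of _ k]) auto
  show "pdiff k (\<lambda>y. sym_eval h p ((1 / 2) *\<^sub>R (x + y)) A) y = (1/2) * sym_eval h p ((1 / 2) *\<^sub>R (x + y)) (spartial (POS k) A)"
    using D unfolding e by (rule pdiffI)
qed

text \<open>A momentum factor becomes a y-derivative. It falls on the function and, through the
  midpoint and therefore with factor 1/2, on the symbol.\<close>

lemma weyl_MOM: assumes "\<psi> \<in> schwartz"
  shows "weyl h (svar (MOM k) * A) \<psi> x = weyl h A (\<lambda>x. - \<i> * of_real h * pdiff k \<psi> x) x
    - \<i> * of_real h / 2 * weyl h (spartial (POS k) A) \<psi> x"
proof -
  have d: "pdiff k \<psi> \<in> schwartz" by (rule schwartz_pdiff[OF assms])
  have "wint h x (svar (MOM k) * A) \<psi> p = - \<i> * of_real h * wint h x A (pdiff k \<psi>) p - \<i> * of_real h / 2 * wint h x (spartial (POS k) A) \<psi> p" for p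
  proof -
    have p: "pdiff k (\<lambda>y. sym_eval h p ((1 / 2) *\<^sub>R (x + y)) A * \<psi> y) = 
      (\<lambda>y. sym_eval h p ((1 / 2) *\<^sub>R (x + y)) A * pdiff k \<psi> y + (1/2) * (sym_eval h p ((1 / 2) *\<^sub>R (x + y)) (spartial (POS k) A) * \<psi> y))"
      by (rule ext) (simp add: pdiff_mult pdiff_sym_eval schwartz_differentiable assms)
    have "wint h x (svar (MOM k) * A) \<psi> p = - \<i> * of_real h * kint h x (pdiff k (\<lambda>y. sym_eval h p ((1 / 2) *\<^sub>R (x + y)) A * \<psi> y)) p"
      unfolding wint_MOM unfolding wint_def
      by (rule kint_parts) (use sym_eval_schwartz[OF assms] h in auto)
    also have "kint h x (pdiff k (\<lambda>y. sym_eval h p ((1 / 2) *\<^sub>R (x + y)) A * \<psi> y)) p =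
      wint h x A (pdiff k \<psi>) p + (1/2) * wint h x (spartial (POS k) A) \<psi> p"
      unfolding p wint_def
      by (subst kint_add) (simp_all only: kint_cmult schwartz_rapid schwartz_cmult sym_eval_schwartz assms d)
    finally show ?thesis by (simp add: algebra_simps)
  qed
  then have *: "(LINT p|lborel. wint h x (svar (MOM k) * A) \<psi> p) = - \<i> * of_real h * (LINT p|lborel. wint h x A (pdiff k \<psi>) p) - \<i> * of_real h / 2 * (LINT p|lborel. wint h x (spartial (POS k) A) \<psi> p)"
    by (simp add: wint_integrable assms d)
  then have "weyl h (svar (MOM k) * A) \<psi> x = - \<i> * of_real h * weyl h A (pdiff k \<psi>) x - \<i> * of_real h / 2 * weyl h (spartial (POS k) A) \<psi> x"
  proof -
    have "c * (a * X - b * Y) = a * (c * X) - b * (c * Y)" for a b c X Y :: complex by (simp add: algebra_simps)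
    then show ?thesis unfolding weyl_wint using * by (simp only:)
  qed
  then show ?thesis by (simp only: weyl_cmult)
qed

section \<open>Coordinate operators, the recursion in the symbol, and composition\<close>

definition opv :: "'n svar \<Rightarrow> (real^'n \<Rightarrow> complex) \<Rightarrow> real^'n \<Rightarrow> complex" where
  "opv w \<psi> = (case w of MOM k \<Rightarrow> (\<lambda>x. - \<i> * of_real h * pdiff k \<psi> x) | POS k \<Rightarrow> mulx k \<psi> | HBAR \<Rightarrow> (\<lambda>x. of_real h * \<psi> x))"

lemma opv_schwartz: "\<psi> \<in> schwartz \<Longrightarrow> opv w \<psi> \<in> schwartz"
  unfolding opv_def by (cases w) (auto intro: schwartz_cmult[of _ "- \<i> * of_real h", simplified] schwartz_cmult schwartz_pdiff mulx_schwartz)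

text \<open>The commutator of a coordinate with a quantized symbol, found by induction since passing
  a momentum produces a constant. It turns the symmetric rule \<open>weyl_POS_sym\<close> into one
  where the coordinate acts on the function first.\<close>

lemma weyl_POS_comm: 
  "\<psi> \<in> schwartz \<Longrightarrow> of_real (x $ k) * weyl h A \<psi> x = weyl h A (mulx k \<psi>) x + \<i> * of_real h * weyl h (spartial (MOM k) A) \<psi> x"
proof (induction A arbitrary: \<psi> x rule: sym_induct_deriv)
  case (const c)
  have "weyl h (sconst c) \<psi> x = c * \<psi> x" if "\<psi> \<in> schwartz" for \<psi> and x :: "real^'a"
    using weyl_sconst_mult[of c 1 \<psi> x] weyl_1[OF that] by simp
  then show ?case using const by (simp add: mulx_schwartz weyl_0) (simp add: mulx_def)
next
  case (add A B)
  then show ?case by (simp add: weyl_add mulx_schwartz distrib_left spartial_add)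
next
  case (var v A)
  note s = var.prems mulx_schwartz[OF var.prems] schwartz_pdiff[OF var.prems]
  show ?case
  proof (cases v)
    case (POS j)
    have c: "mulx k (mulx j \<psi>) = mulx j (mulx k \<psi>)" by (rule ext) (simp add: mulx_def)
    have "of_real (x $ k) * weyl h (svar v * A) \<psi> x = 
      (1/2) * (of_real (x $ j) * (of_real (x $ k) * weyl h A \<psi> x) + of_real (x $ k) * weyl h A (mulx j \<psi>) x)"
      unfolding POS weyl_POS_sym[OF var.prems] by (simp add: algebra_simps)
    also have "\<dots> = (1/2) * (of_real (x $ j) * (weyl h A (mulx k \<psi>) x + \<i> * of_real h * weyl h (spartial (MOM k) A) \<psi> x) + 
       (weyl h A (mulx j (mulx k \<psi>)) x + \<i> * of_real h * weyl h (spartial (MOM k) A) (mulx j \<psi>) x))"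
      using var.IH(1)[OF s(1)] var.IH(1)[OF s(2)] by (simp add: c)
    also have "\<dots> = weyl h (svar v * A) (mulx k \<psi>) x + \<i> * of_real h * weyl h (svar v * spartial (MOM k) A) \<psi> x"
      unfolding POS weyl_POS_sym[OF s(1)] weyl_POS_sym[OF s(2)] by (simp add: algebra_simps)
    finally show ?thesis using POS by (simp add: spartial_svar_mult)
  next
    case (MOM j)
    have c: "pdiff j (mulx k \<psi>) = (\<lambda>x. mulx k (pdiff j \<psi>) x + (if j = k then 1 else 0) * \<psi> x)"
      unfolding mulx_def[abs_def] by (rule ext) (simp add: pdiff_mult coord_differentiable schwartz_differentiable[OF var.prems] pdiff_coord)
    have a: "weyl h A (pdiff j (mulx k \<psi>)) x = weyl h A (mulx k (pdiff j \<psi>)) x + (if j = k then 1 else 0) * weyl h A \<psi> x"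
      using weyl_add_fun[OF mulx_schwartz[OF s(3), of k j] schwartz_cmult[OF s(1), of "if j = k then 1 else 0"], of A x]
      unfolding c[symmetric] weyl_cmult .
    have "of_real (x $ k) * weyl h (svar v * A) \<psi> x = 
      - \<i> * of_real h * (of_real (x $ k) * weyl h A (pdiff j \<psi>) x) - \<i> * of_real h / 2 * (of_real (x $ k) * weyl h (spartial (POS j) A) \<psi> x)"
      unfolding MOM weyl_MOM[OF s(1)] weyl_cmult by (simp add: algebra_simps)
    also have "\<dots> = - \<i> * of_real h * (weyl h A (mulx k (pdiff j \<psi>)) x + \<i> * of_real h * weyl h (spartial (MOM k) A) (pdiff j \<psi>) x) 
      - \<i> * of_real h / 2 * (weyl h (spartial (POS j) A) (mulx k \<psi>) x + \<i> * of_real h * weyl h (spartial (MOM k) (spartial (POS j) A)) \<psi> x)"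
      using var.IH(1)[OF s(3)] var.IH(2)[OF s(1)] by simp
    also have "\<dots> = weyl h (svar v * A) (mulx k \<psi>) x + \<i> * of_real h * (weyl h (svar v * spartial (MOM k) A) \<psi> x + (if j = k then 1 else 0) * weyl h A \<psi> x)"
      unfolding MOM weyl_MOM[OF s(1)] weyl_MOM[OF s(2)] weyl_cmult a spartial_comm[of "MOM k" "POS j"] by (simp add: algebra_simps)
    finally show ?thesis using MOM by (simp add: spartial_svar_mult weyl_add s weyl_0)
  next
    case HBAR
    have "of_real (x $ k) * weyl h (svar v * A) \<psi> x = of_real h * (of_real (x $ k) * weyl h A \<psi> x)"
      unfolding HBAR weyl_HBAR by simp
    also have "\<dots> = weyl h (svar v * A) (mulx k \<psi>) x + \<i> * of_real h * weyl h (svar v * spartial (MOM k) A) \<psi> x"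
      unfolding HBAR weyl_HBAR using var.IH(1)[OF s(1)] by (simp add: algebra_simps)
    finally show ?thesis using HBAR by (simp add: spartial_svar_mult)
  qed
qed

text \<open>This is \<open>svar w * A = star A (svar w) - ih2 * conj_deriv w A\<close> on the level
  of operators, obtained before composition is available. One rule for all variables drives the
  inductions that follow.\<close>

lemma weyl_rec: assumes "\<psi> \<in> schwartz"
  shows "weyl h (svar w * A) \<psi> x = weyl h A (opv w \<psi>) x - \<i> * of_real h / 2 * weyl h (conj_deriv w A) \<psi> x"
proof (cases w)
  case (POS k)
  have "weyl h (svar w * A) \<psi> x = (1/2) * (weyl h A (mulx k \<psi>) x + \<i> * of_real h * weyl h (spartial (MOM k) A) \<psi> x + weyl h A (mulx k \<psi>) x)"
    unfolding POS weyl_POS_sym[OF assms] weyl_POS_comm[OF assms] ..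
  also have "\<dots> = weyl h A (mulx k \<psi>) x + \<i> * of_real h / 2 * weyl h (spartial (MOM k) A) \<psi> x"
    by (simp add: distrib_left)
  finally show ?thesis using POS by (simp add: opv_def weyl_uminus)
next
  case (MOM k)
  then show ?thesis using weyl_MOM[OF assms, of k A x] by (simp add: opv_def)
next
  case HBAR
  then show ?thesis by (simp add: opv_def weyl_HBAR weyl_cmult weyl_0)
qed

lemma weyl_const: "\<psi> \<in> schwartz \<Longrightarrow> weyl h (sconst c) \<psi> x = c * \<psi> x"
  using weyl_sconst_mult[of c 1 \<psi> x] weyl_1[of \<psi> x] by simp

lemma weyl_svar: assumes "\<psi> \<in> schwartz" shows "weyl h (svar w) \<psi> = opv w \<psi>"
  using weyl_rec[OF assms, of w 1] weyl_1[OF opv_schwartz[OF assms]] by (intro ext) (simp add: weyl_0)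

lemma weyl_schwartz: "\<psi> \<in> schwartz \<Longrightarrow> weyl h A \<psi> \<in> schwartz"
proof (induction A arbitrary: \<psi> rule: sym_induct_deriv)
  case (const c)
  then have "weyl h (sconst c) \<psi> = (\<lambda>x. c * \<psi> x)" by (intro ext) (rule weyl_const)
  then show ?case using const by (simp add: schwartz_cmult)
next
  case (add A B)
  have "weyl h (A + B) \<psi> = (\<lambda>x. weyl h A \<psi> x + weyl h B \<psi> x)" using add by (intro ext) (simp add: weyl_add)
  then show ?case using add by (simp add: schwartz_add)
next
  case (var w A)
  have c: "weyl h (conj_deriv w A) \<psi> \<in> schwartz"
  proof (cases w)
    case (POS j)
    have "weyl h (conj_deriv w A) \<psi> = (\<lambda>x. (-1) * weyl h (spartial (MOM j) A) \<psi> x)" by (rule ext) (simp add: POS weyl_uminus)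
    then show ?thesis using var by (simp only: schwartz_cmult)
  next
    case (MOM j)
    then show ?thesis using var by simp
  next
    case HBAR
    have "weyl h (conj_deriv w A) \<psi> = (\<lambda>x. 0)" by (rule ext) (simp add: HBAR weyl_0)
    then show ?thesis by (simp add: schwartz_0)
  qed
  have "weyl h (svar w * A) \<psi> = (\<lambda>x. weyl h A (opv w \<psi>) x + (- \<i> * of_real h / 2) * weyl h (conj_deriv w A) \<psi> x)"
    by (rule ext) (simp add: weyl_rec var)
  then show ?case using var.IH(1)[OF opv_schwartz[OF var.prems]] c by (simp only: schwartz_add schwartz_cmult)
qed

lemma weyl_ih2: "weyl h (ih2 * A) \<psi> x = \<i> * of_real h / 2 * weyl h A \<psi> x"
  unfolding ih2_def mult.assoc weyl_sconst_mult weyl_HBAR by simp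

text \<open>Induction on the right factor with \<open>star_svar_right\<close> and
  \<open>weyl_rec\<close>. The terms containing \<open>conj_deriv w A\<close> cancel, and the
  remaining \<open>star A (conj_deriv w B)\<close> is covered by the hypothesis for derivatives of
  \<open>B\<close>.\<close>

theorem weyl_star: "\<psi> \<in> schwartz \<Longrightarrow> weyl h (star A B) \<psi> = weyl h A (weyl h B \<psi>)"
proof (induction B arbitrary: A \<psi> rule: sym_induct_deriv)
  case (const c)
  have "weyl h (sconst c) \<psi> = (\<lambda>x. c * \<psi> x)" using const by (intro ext) (rule weyl_const)
  then show ?case by (intro ext) (simp add: weyl_sconst_mult weyl_cmult)
next
  case (add B C)
  have "weyl h (B + C) \<psi> = (\<lambda>x. weyl h B \<psi> x + weyl h C \<psi> x)" using add by (intro ext) (simp add: weyl_add)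
  then show ?case using add by (intro ext) (simp add: star_add_right weyl_add weyl_add_fun weyl_schwartz)
next
  case (var w B)
  have c: "weyl h (star A (conj_deriv w B)) \<psi> = weyl h A (weyl h (conj_deriv w B) \<psi>)"
  proof (cases w)
    case (POS j)
    have 1: "star A (conj_deriv w B) = sconst (-1) * star A (spartial (MOM j) B)"
      using star_sconst_right'[of A "-1" "spartial (MOM j) B"] by (simp add: POS sconst_uminus)
    have 2: "weyl h (conj_deriv w B) \<psi> = (\<lambda>x. (-1) * weyl h (spartial (MOM j) B) \<psi> x)"
      by (rule ext) (simp add: POS weyl_uminus)
    show ?thesis unfolding 1 2 using var by (intro ext) (simp only: weyl_sconst_mult weyl_cmult)
  next
    case (MOM j)
    then show ?thesis using var by simp
  next
    case HBAR
    have "weyl h (conj_deriv w B) \<psi> = (\<lambda>x. 0)" by (rule ext) (simp add: HBAR weyl_0)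
    then show ?thesis by (intro ext) (simp add: HBAR weyl_0 weyl_0_fun)
  qed
  note s = var.prems opv_schwartz[OF var.prems, of w]
  have r: "weyl h (svar w * B) \<psi> = (\<lambda>x. weyl h B (opv w \<psi>) x - (\<i> * of_real h / 2) * weyl h (conj_deriv w B) \<psi> x)"
    by (rule ext) (simp add: weyl_rec s)
  show ?case
  proof (rule ext)
    fix x
    have "weyl h (star A (svar w * B)) \<psi> x = weyl h (svar w * star A B) \<psi> x + \<i> * of_real h / 2 * weyl h (star (conj_deriv w A) B) \<psi> x"
      unfolding star_svar_right by (simp add: weyl_add s weyl_ih2)
    also have "\<dots> = weyl h (star A B) (opv w \<psi>) x - \<i> * of_real h / 2 * weyl h (star A (conj_deriv w B)) \<psi> x"
      unfolding weyl_rec[OF s(1)] star_cwd weyl_add[OF s(1)] by (simp add: algebra_simps)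
    also have "\<dots> = weyl h A (weyl h B (opv w \<psi>)) x - (\<i> * of_real h / 2) * weyl h A (weyl h (conj_deriv w B) \<psi>) x"
      unfolding var.IH(1)[OF s(2)] c ..
    also have "\<dots> = weyl h A (weyl h (svar w * B) \<psi>) x"
      unfolding r by (subst weyl_diff_fun) (simp_all only: weyl_cmult weyl_schwartz s schwartz_cmult)
    finally show "weyl h (star A (svar w * B)) \<psi> x = weyl h A (weyl h (svar w * B) \<psi>) x" .
  qed
qed

lemma weyl_moyal: assumes "\<psi> \<in> schwartz"
  shows "weyl h (moyal A B) \<psi> x = \<i> / of_real h * (weyl h A (weyl h B \<psi>) x - weyl h B (weyl h A \<psi>) x)"
proof -
  have "of_real h * weyl h (moyal A B) \<psi> x = \<i> * (weyl h A (weyl h B \<psi>) x - weyl h B (weyl h A \<psi>) x)"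
    unfolding weyl_HBAR[symmetric] moyal weyl_sconst_mult by (simp add: weyl_diff assms weyl_star)
  then show ?thesis using h by (simp add: field_simps)
qed

subsection \<open>Adjoints\<close>

lemma inner_L2_integrable: "\<phi> \<in> schwartz \<Longrightarrow> \<psi> \<in> schwartz \<Longrightarrow> integrable lborel (\<lambda>x. cnj (\<phi> x) * \<psi> x)"
  by (intro rapid_integrable rapid_mult rapid_cnj schwartz_rapid)

lemma inner_L2_add_right: "\<phi> \<in> schwartz \<Longrightarrow> \<psi> \<in> schwartz \<Longrightarrow> \<theta> \<in> schwartz \<Longrightarrow> 
  inner_L2 \<phi> (\<lambda>x. \<psi> x + \<theta> x) = inner_L2 \<phi> \<psi> + inner_L2 \<phi> \<theta>"
  unfolding inner_L2_def by (simp add: distrib_left inner_L2_integrable)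
lemma inner_L2_add_left: "\<phi> \<in> schwartz \<Longrightarrow> \<psi> \<in> schwartz \<Longrightarrow> \<theta> \<in> schwartz \<Longrightarrow> 
  inner_L2 (\<lambda>x. \<psi> x + \<theta> x) \<phi> = inner_L2 \<psi> \<phi> + inner_L2 \<theta> \<phi>"
  unfolding inner_L2_def by (simp add: distrib_right inner_L2_integrable)
lemma inner_L2_cmult_right: "inner_L2 \<phi> (\<lambda>x. c * \<psi> x) = c * inner_L2 \<phi> \<psi>"
  unfolding inner_L2_def by (simp add: mult.left_commute[of _ c])
lemma inner_L2_cmult_left: "inner_L2 (\<lambda>x. c * \<psi> x) \<phi> = cnj c * inner_L2 \<psi> \<phi>"
  unfolding inner_L2_def by (simp add: mult.assoc)

lemma opv_symmetric: assumes "\<phi> \<in> schwartz" "\<psi> \<in> schwartz"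
  shows "inner_L2 \<phi> (opv w \<psi>) = inner_L2 (opv w \<phi>) \<psi>"
proof (cases w)
  case (POS k)
  then show ?thesis by (simp add: opv_def mulx_def inner_L2_def mult_ac)
next
  case HBAR
  then show ?thesis by (simp add: opv_def inner_L2_cmult_left inner_L2_cmult_right)
next
  case (MOM k)
  have d: "(\<lambda>x. cnj (\<phi> x) * \<psi> x) differentiable (at x)" for x
    by (intro differentiable_mult differentiable_cnj schwartz_differentiable assms)
  have p: "pdiff k (\<lambda>x. cnj (\<phi> x) * \<psi> x) = (\<lambda>x. cnj (\<phi> x) * pdiff k \<psi> x + cnj (pdiff k \<phi> x) * \<psi> x)"
    by (rule ext) (simp add: pdiff_mult differentiable_cnj schwartz_differentiable assms pdiff_cnj)
  have "(LINT x|lborel. pdiff k (\<lambda>x. cnj (\<phi> x) * \<psi> x) x) = 0"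
  proof (rule integral_pdiff_0[OF d])
    show "rapid (\<lambda>x. cnj (\<phi> x) * \<psi> x)"
      by (intro rapid_mult rapid_cnj schwartz_rapid assms)
    show "rapid (pdiff k (\<lambda>x. cnj (\<phi> x) * \<psi> x))"
      unfolding p by (intro rapid_add rapid_mult rapid_cnj schwartz_rapid schwartz_pdiff assms)
  qed
  then have "inner_L2 \<phi> (pdiff k \<psi>) + inner_L2 (pdiff k \<phi>) \<psi> = 0"
    unfolding p inner_L2_def by (simp add: inner_L2_integrable assms schwartz_pdiff)
  then have e: "inner_L2 (pdiff k \<phi>) \<psi> = - inner_L2 \<phi> (pdiff k \<psi>)" by (simp add: eq_neg_iff_add_eq_0 add.commute)
  have "opv w \<psi> = (\<lambda>x. (- \<i> * of_real h) * pdiff k \<psi> x)" "opv w \<phi> = (\<lambda>x. (- \<i> * of_real h) * pdiff k \<phi> x)"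
    by (simp_all add: opv_def MOM)
  then show ?thesis by (simp only: inner_L2_cmult_left inner_L2_cmult_right e) simp
qed

text \<open>Moving the coordinate operator across the inner product puts it to the left of the
  quantized symbol, where it is a star product from the left. The correction in that product cancels
  the conjugated correction from \<open>weyl_rec\<close>.\<close>

theorem weyl_adjoint: 
  "\<phi> \<in> schwartz \<Longrightarrow> \<psi> \<in> schwartz \<Longrightarrow> inner_L2 \<phi> (weyl h A \<psi>) = inner_L2 (weyl h (scnj A) \<phi>) \<psi>"
proof (induction A arbitrary: \<phi> \<psi> rule: sym_induct_deriv)
  case (const c)
  have "weyl h (sconst c) \<psi> = (\<lambda>x. c * \<psi> x)" "weyl h (sconst (cnj c)) \<phi> = (\<lambda>x. cnj c * \<phi> x)"
    using const by (auto intro!: ext weyl_const)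
  then show ?case by (simp add: inner_L2_cmult_left inner_L2_cmult_right)
next
  case (add A B)
  have "weyl h (A + B) \<psi> = (\<lambda>x. weyl h A \<psi> x + weyl h B \<psi> x)" 
    "weyl h (scnj A + scnj B) \<phi> = (\<lambda>x. weyl h (scnj A) \<phi> x + weyl h (scnj B) \<phi> x)" 
    using add by (auto intro!: ext simp: weyl_add)
  then show ?case using add by (simp add: scnj_add inner_L2_add_left inner_L2_add_right weyl_schwartz)
next
  case (var w A)
  note s = var.prems opv_schwartz[OF var.prems(2), of w]
  have c: "inner_L2 \<phi> (weyl h (conj_deriv w A) \<psi>) = inner_L2 (weyl h (conj_deriv w (scnj A)) \<phi>) \<psi>"
  proof (cases w)
    case (POS j)
    have 2: "weyl h (conj_deriv w A) \<psi> = (\<lambda>x. (-1) * weyl h (spartial (MOM j) A) \<psi> x)"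
      "weyl h (conj_deriv w (scnj A)) \<phi> = (\<lambda>x. (-1) * weyl h (spartial (MOM j) (scnj A)) \<phi> x)"
      by (auto intro!: ext simp: POS weyl_uminus)
    show ?thesis unfolding 2 inner_L2_cmult_left inner_L2_cmult_right
      using var.IH(2)[OF s(1,2), of "MOM j"] by (simp add: scnj_spartial)
  next
    case (MOM j)
    then show ?thesis using var.IH(2)[OF s(1,2), of "POS j"] by (simp add: scnj_spartial)
  next
    case HBAR
    have "weyl h (conj_deriv w A) \<psi> = (\<lambda>x. 0)" "weyl h (conj_deriv w (scnj A)) \<phi> = (\<lambda>x. 0)" by (auto intro!: ext simp: HBAR weyl_0)
    then show ?thesis by (simp add: inner_L2_def)
  qed
  have l: "star (svar w) (scnj A) = svar w * scnj A - ih2 * conj_deriv w (scnj A)"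
  proof -
    have "scnj (conj_deriv w A) = conj_deriv w (scnj A)" 
    proof -
      have "scnj (- B) = - scnj B" for B :: "'a sym" by (rule poly_mapping_eqI) simp
      then show ?thesis by (cases w) (auto simp: scnj_spartial)
    qed
    moreover have "star (svar w) (scnj A) = scnj (star A (svar w))" by (simp add: scnj_star)
    moreover have "star A (svar w) = svar w * A + ih2 * conj_deriv w A" using star_svar_right[of A w 1] by simp
    ultimately show ?thesis by (simp add: scnj_add scnj_mult ih2_def sconst_uminus)
  qed
  have r: "weyl h (svar w * A) \<psi> = (\<lambda>x. weyl h A (opv w \<psi>) x + (- (\<i> * of_real h / 2)) * weyl h (conj_deriv w A) \<psi> x)"
    by (rule ext) (simp add: weyl_rec s)
  have "inner_L2 \<phi> (weyl h (svar w * A) \<psi>) = inner_L2 \<phi> (weyl h A (opv w \<psi>)) + (- (\<i> * of_real h / 2)) * inner_L2 \<phi> (weyl h (conj_deriv w A) \<psi>)"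
    unfolding r by (subst inner_L2_add_right) (simp_all only: inner_L2_cmult_right s weyl_schwartz schwartz_cmult)
  also have "inner_L2 \<phi> (weyl h A (opv w \<psi>)) = inner_L2 (weyl h (scnj A) \<phi>) (opv w \<psi>)"
    by (rule var.IH(1)[OF s(1,3)])
  also have "\<dots> = inner_L2 (opv w (weyl h (scnj A) \<phi>)) \<psi>" by (simp add: opv_symmetric weyl_schwartz s)
  also have "opv w (weyl h (scnj A) \<phi>) = weyl h (star (svar w) (scnj A)) \<phi>"
    by (simp add: weyl_star weyl_svar weyl_schwartz s)
  also have "inner_L2 \<dots> \<psi> + (- (\<i> * of_real h / 2)) * inner_L2 \<phi> (weyl h (conj_deriv w A) \<psi>) = 
    inner_L2 (\<lambda>x. weyl h (star (svar w) (scnj A)) \<phi> x + (\<i> * of_real h / 2) * weyl h (conj_deriv w (scnj A)) \<phi> x) \<psi>"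
    unfolding c by (subst inner_L2_add_left) (simp_all only: inner_L2_cmult_left s weyl_schwartz schwartz_cmult, simp)
  also have "(\<lambda>x. weyl h (star (svar w) (scnj A)) \<phi> x + (\<i> * of_real h / 2) * weyl h (conj_deriv w (scnj A)) \<phi> x) = weyl h (svar w * scnj A) \<phi>"
    unfolding l by (rule ext) (simp add: weyl_diff s weyl_ih2)
  finally show ?case by simp
qed

text \<open>The set where the function is nonzero is open by continuity and a null set by the
  vanishing norm, hence empty. This yields uniqueness in the definite description of
  \<open>op_adjoint\<close>.\<close>

lemma schwartz_inner_0: assumes "\<eta> \<in> schwartz" "inner_L2 \<eta> \<eta> = 0" shows "\<eta> x = 0"
proof -
  have e: "cnj z * z = of_real ((norm z)^2)" for z :: complex by (simp add: complex_mod_sqrt_Re_mult_cnj complex_eq_iff cmod_power2 power2_eq_square)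
  have i: "integrable lborel (\<lambda>x. (norm (\<eta> x))^2)"
    using inner_L2_integrable[OF assms(1,1)] unfolding e complex_of_real_integrable_eq .
  have "(LINT x|lborel. (norm (\<eta> x))^2) = 0"
    using assms(2) unfolding inner_L2_def e integral_complex_of_real by simp
  then have "AE x in lborel. (norm (\<eta> x))^2 = 0"
    using integral_nonneg_eq_0_iff_AE[OF i] by simp
  then have ae: "AE x in lborel. \<eta> x = 0" by simp
  have c: "continuous_on UNIV \<eta>" using schwartz_rapid[OF assms(1)] by (simp add: rapid_def)
  have op: "open {x. \<eta> x \<noteq> 0}" 
    using continuous_open_preimage[OF c open_UNIV open_delete[OF open_UNIV, of 0]] by (simp add: vimage_def)
  have "{x. \<eta> x \<noteq> 0} \<in> null_sets lborel"
    using ae op AE_iff_null_sets[of "{x. \<eta> x \<noteq> 0}" lborel] by (simp add: borel_open)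
  then have "negligible {x. \<eta> x \<noteq> 0}"
    using null_sets_completionI negligible_iff_null_sets by blast
  then have "{x. \<eta> x \<noteq> 0} = {}" using op open_not_negligible by blast
  then show ?thesis by blast
qed

lemma op_adjointI: 
  assumes "\<eta> \<in> schwartz" "\<And>\<psi>. \<psi> \<in> schwartz \<Longrightarrow> inner_L2 \<phi> (T \<psi>) = inner_L2 \<eta> \<psi>"
  shows "op_adjoint T \<phi> = \<eta>"
  unfolding op_adjoint_def
proof (rule the_equality)
  show "\<eta> \<in> schwartz \<and> (\<forall>\<psi>\<in>schwartz. inner_L2 \<eta> \<psi> = inner_L2 \<phi> (T \<psi>))" using assms by simp
  fix \<zeta> assume z: "\<zeta> \<in> schwartz \<and> (\<forall>\<psi>\<in>schwartz. inner_L2 \<zeta> \<psi> = inner_L2 \<phi> (T \<psi>))"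
  define d where "d = (\<lambda>x. \<zeta> x + (-1) * \<eta> x)"
  have d: "d \<in> schwartz" unfolding d_def using z assms by (intro schwartz_add schwartz_cmult) auto
  have "inner_L2 d d = inner_L2 \<zeta> d + inner_L2 (\<lambda>x. (-1) * \<eta> x) d"
    using z assms d unfolding d_def[of ] by (subst (1) inner_L2_add_left) (auto intro: schwartz_cmult[of _ "-1", simplified] simp: )
  also have "\<dots> = 0" unfolding inner_L2_cmult_left using z assms d by simp
  finally have "d x = 0" for x using schwartz_inner_0[OF d] by blast
  then show "\<zeta> = \<eta>" by (simp add: d_def fun_eq_iff)
qed

end

section \<open>Formal operator series\<close>

text \<open>A copy of the symbols in which multiplication is the star product, so that operator series become
  formal power series over a ring.\<close>

typedef 'n ssym = "UNIV :: 'n sym set" morphisms Rs As ..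

setup_lifting type_definition_ssym

instantiation ssym :: (finite) ring_1
begin
lift_definition zero_ssym :: "'a ssym" is 0 .
lift_definition one_ssym :: "'a ssym" is 1 .
lift_definition plus_ssym :: "'a ssym \<Rightarrow> 'a ssym \<Rightarrow> 'a ssym" is "(+)" .
lift_definition minus_ssym :: "'a ssym \<Rightarrow> 'a ssym \<Rightarrow> 'a ssym" is "(-)" .
lift_definition uminus_ssym :: "'a ssym \<Rightarrow> 'a ssym" is "uminus" .
lift_definition times_ssym :: "'a ssym \<Rightarrow> 'a ssym \<Rightarrow> 'a ssym" is star .
instance
  by standard (transfer; simp add: star_assoc star_add_left star_add_right; fail)+
end

lemma Rs_simps: "Rs 0 = 0" "Rs 1 = 1" "Rs (a + b) = Rs a + Rs b" "Rs (a - b) = Rs a - Rs b" "Rs (- a) = - Rs a"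
  "Rs (a * b) = star (Rs a) (Rs b)" "Rs (As A) = A" "As (Rs a) = a"
  by (simp_all add: zero_ssym.rep_eq one_ssym.rep_eq plus_ssym.rep_eq minus_ssym.rep_eq uminus_ssym.rep_eq
      times_ssym.rep_eq As_inverse Rs_inverse)

lemma Rs_sum: "Rs (\<Sum>i\<in>I. f i) = (\<Sum>i\<in>I. Rs (f i))"
  by (induction I rule: infinite_finite_induct) (auto simp: Rs_simps)

lemma ssym_eqI: "Rs a = Rs b \<Longrightarrow> a = b" by (simp add: Rs_inject)

text \<open>Numerical scalars are central in the star algebra and, unlike the variable
  \<open>HBAR\<close>, have inverses when nonzero.\<close>

definition scl :: "complex \<Rightarrow> 'n ssym" where "scl c = As (sconst c)"

lemma scl_central: "x * scl c = scl c * x"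
  by (rule ssym_eqI) (simp add: Rs_simps scl_def)
lemma scl_mult: "scl (a * b) = scl a * scl b"
  by (rule ssym_eqI) (simp add: Rs_simps scl_def sconst_mult)
lemma scl_add: "scl (a + b) = scl a + scl b"
  by (rule ssym_eqI) (simp add: Rs_simps scl_def sconst_add)
lemma scl_1 [simp]: "scl 1 = 1" and scl_0 [simp]: "scl 0 = 0"
  by (rule ssym_eqI; simp add: Rs_simps scl_def)+
lemma scl_uminus: "scl (- a) = - scl a"
  by (rule ssym_eqI) (simp add: Rs_simps scl_def sconst_uminus)
lemma Rs_scl_mult: "Rs (scl c * a) = sconst c * Rs a"
  by (simp add: Rs_simps scl_def)

lemma scl_left_commute: "a * (scl c * b) = scl c * (a * b)"
  by (metis mult.assoc scl_central)

lemma scl_power: "(scl c * a) ^ k = scl (c ^ k) * a ^ k"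
proof (induction k)
  case (Suc k)
  have "(scl c * a) ^ Suc k = scl c * a * (scl (c ^ k) * a ^ k)" by (simp add: Suc)
  also have "\<dots> = scl (c ^ Suc k) * a ^ Suc k" by (simp add: scl_left_commute[of a] mult.assoc scl_mult)
  finally show ?case .
qed simp

text \<open>The coefficient of t ^ m in exp(t a) B exp(- t a).\<close>

definition conj_coeff :: "'n::finite ssym \<Rightarrow> 'n ssym \<Rightarrow> nat \<Rightarrow> 'n ssym" where
  "conj_coeff a B m = (\<Sum>k\<le>m. scl (1 / (fact k * fact (m - k))) * (a ^ k * B * (- a) ^ (m - k)))"

text \<open>The differential equation in t of the conjugated series: m + 1 is split into k and m + 1
  - k, and each part cancels a factor of one of the factorials.\<close>

lemma conj_coeff_Suc: "scl (of_nat (Suc m)) * conj_coeff a B (Suc m) = a * conj_coeff a B m - conj_coeff a B m * a"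
proof -
  let ?t = "\<lambda>k. a ^ k * B * (- a) ^ (Suc m - k)"
  have "scl (of_nat (Suc m)) * conj_coeff a B (Suc m) = 
    (\<Sum>k\<le>Suc m. scl (of_nat k / (fact k * fact (Suc m - k))) * ?t k) + 
    (\<Sum>k\<le>Suc m. scl (of_nat (Suc m - k) / (fact k * fact (Suc m - k))) * ?t k)"
    unfolding conj_coeff_def sum_distrib_left sum.distrib[symmetric]
  proof (rule sum.cong[OF refl])
    fix k assume "k \<in> {..Suc m}"
    then have e: "of_nat (Suc m) * (1 / (fact k * fact (Suc m - k))) = of_nat k / (fact k * fact (Suc m - k)) + (of_nat (Suc m - k) / (fact k * fact (Suc m - k)) :: complex)"
      by (simp add: of_nat_diff add_divide_distrib[symmetric] del: of_nat_Suc)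
    show "scl (of_nat (Suc m)) * (scl (1 / (fact k * fact (Suc m - k))) * ?t k) = 
      scl (of_nat k / (fact k * fact (Suc m - k))) * ?t k + scl (of_nat (Suc m - k) / (fact k * fact (Suc m - k))) * ?t k"
      by (simp only: mult.assoc[symmetric] scl_mult[symmetric] e scl_add distrib_right)
  qed
  also have "(\<Sum>k\<le>Suc m. scl (of_nat k / (fact k * fact (Suc m - k))) * ?t k) = a * conj_coeff a B m"
  proof (subst sum.atMost_Suc_shift)
    have "scl (of_nat (Suc k) / (fact (Suc k) * fact (Suc m - Suc k))) * ?t (Suc k) = a * (scl (1 / (fact k * fact (m - k))) * (a ^ k * B * (- a) ^ (m - k)))" for k
    proof -
      have "of_nat (Suc k) / (fact (Suc k) * fact (Suc m - Suc k)) = (1 / (fact k * fact (m - k)) :: complex)"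
        by (simp add: fact_Suc del: of_nat_Suc)
      then show ?thesis by (simp add: scl_left_commute[of a] mult.assoc)
    qed
    then show "scl (of_nat 0 / (fact 0 * fact (Suc m - 0))) * ?t 0 + (\<Sum>k\<le>m. scl (of_nat (Suc k) / (fact (Suc k) * fact (Suc m - Suc k))) * ?t (Suc k)) = a * conj_coeff a B m"
      by (simp add: conj_coeff_def sum_distrib_left)
  qed
  also have "(\<Sum>k\<le>Suc m. scl (of_nat (Suc m - k) / (fact k * fact (Suc m - k))) * ?t k) = - (conj_coeff a B m * a)"
  proof -
    have "scl (of_nat (Suc m - k) / (fact k * fact (Suc m - k))) * ?t k = - (scl (1 / (fact k * fact (m - k))) * (a ^ k * B * (- a) ^ (m - k)) * a)" if "k \<le> m" for k
    proof -
      have 1: "Suc m - k = Suc (m - k)" using that by simp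
      have 2: "of_nat (Suc m - k) / (fact k * fact (Suc m - k)) = (1 / (fact k * fact (m - k)) :: complex)"
        unfolding 1 by (simp add: fact_Suc del: of_nat_Suc)
      show ?thesis unfolding 2 unfolding 1 by (simp add: mult.assoc power_Suc2 del: power_Suc)
    qed
    then show ?thesis by (simp add: conj_coeff_def sum_distrib_right sum_negf)
  qed
  finally show ?thesis by simp
qed

lemma conj_coeff_ad: "conj_coeff a B m = scl (1 / fact m) * ((\<lambda>X. a * X - X * a) ^^ m) B"
proof (induction m)
  case (Suc m)
  have "conj_coeff a B (Suc m) = scl (1 / of_nat (Suc m)) * (scl (of_nat (Suc m)) * conj_coeff a B (Suc m))"
    by (simp add: mult.assoc[symmetric] scl_mult[symmetric] del: of_nat_Suc)
  also have "\<dots> = scl (1 / of_nat (Suc m)) * (scl (1 / fact m) * ((\<lambda>X. a * X - X * a) ^^ Suc m) B)"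
    unfolding conj_coeff_Suc Suc by (simp add: scl_left_commute[of a] right_diff_distrib mult.assoc)
  also have "\<dots> = scl (1 / fact (Suc m)) * ((\<lambda>X. a * X - X * a) ^^ Suc m) B"
    unfolding mult.assoc[symmetric] scl_mult[symmetric] by (simp add: fact_Suc mult.commute del: of_nat_Suc)
  finally show ?case .
qed (simp add: conj_coeff_def)

abbreviation fps_at :: "'a fps \<Rightarrow> nat \<Rightarrow> 'a" (infixl "$$" 75) where "u $$ s \<equiv> fps_nth u s"

text \<open>The exponent \<open>a\<close> is placed in degree d of the series, so that its k-th
  power sits at index k * d; for d > 0 each coefficient has at most one term.\<close>

definition sexp :: "nat \<Rightarrow> 'n::finite ssym \<Rightarrow> 'n ssym fps" where
  "sexp d a = Abs_fps (\<lambda>s. \<Sum>k | k * d = s. scl (1 / fact k) * a ^ k)"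

lemma finite_mult_le: "0 < d \<Longrightarrow> finite {k. k * d \<le> (s::nat)}"
proof (rule finite_subset[of _ "{..s}"])
  assume d: "0 < d"
  show "{k. k * d \<le> s} \<subseteq> {..s}"
  proof
    fix k assume "k \<in> {k. k * d \<le> s}"
    then have "k * d \<le> s" by simp
    moreover have "k \<le> k * d" using d by simp
    ultimately show "k \<in> {..s}" using order_trans by blast
  qed
qed simp

lemma sum_group_mult:
  fixes d s :: nat and F :: "nat \<Rightarrow> 'a::comm_monoid_add"
  assumes d: "0 < d"
  shows "(\<Sum>i\<le>s. \<Sum>k | k * d = i. F k) = (\<Sum>k | k * d \<le> s. F k)"
proof -
  have "(\<Sum>i\<le>s. \<Sum>k\<in>{k\<in>{k. k * d \<le> s}. k * d = i}. F k) = (\<Sum>k | k * d \<le> s. F k)"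
    by (rule sum.group) (auto simp: finite_mult_le[OF d])
  moreover have "{k\<in>{k. k * d \<le> s}. k * d = i} = {k. k * d = i}" if "i \<le> s" for i using that by auto
  ultimately show ?thesis by simp
qed

lemma sexp_mult_left:
  assumes d: "0 < d"
  shows "(sexp d a * B) $$ s = (\<Sum>k | k * d \<le> s. scl (1 / fact k) * a ^ k * B $$ (s - k * d))"
proof -
  have "(sexp d a * B) $$ s = (\<Sum>i\<le>s. \<Sum>k | k * d = i. scl (1 / fact k) * a ^ k * B $$ (s - i))"
    by (simp add: fps_mult_nth sexp_def sum_distrib_right atLeast0AtMost)
  also have "\<dots> = (\<Sum>i\<le>s. \<Sum>k | k * d = i. scl (1 / fact k) * a ^ k * B $$ (s - k * d))"
    by (intro sum.cong refl) auto
  also have "\<dots> = (\<Sum>k | k * d \<le> s. scl (1 / fact k) * a ^ k * B $$ (s - k * d))"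
    by (rule sum_group_mult[OF d])
  finally show ?thesis .
qed

lemma sexp_mult_right:
  assumes d: "0 < d"
  shows "(B * sexp d a) $$ s = (\<Sum>k | k * d \<le> s. scl (1 / fact k) * B $$ (s - k * d) * a ^ k)"
proof -
  have "(B * sexp d a) $$ s = (\<Sum>i\<le>s. B $$ (s - i) * sexp d a $$ i)"
    unfolding fps_mult_nth atLeast0AtMost
    by (rule sum.reindex_bij_witness[of _ "\<lambda>i. s - i" "\<lambda>i. s - i"]) auto
  also have "\<dots> = (\<Sum>i\<le>s. \<Sum>k | k * d = i. scl (1 / fact k) * B $$ (s - i) * a ^ k)"
    by (simp add: sexp_def sum_distrib_left scl_left_commute[of "fps_nth B i" for i] mult.assoc)
  also have "\<dots> = (\<Sum>i\<le>s. \<Sum>k | k * d = i. scl (1 / fact k) * B $$ (s - k * d) * a ^ k)"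
    by (intro sum.cong refl) auto
  also have "\<dots> = (\<Sum>k | k * d \<le> s. scl (1 / fact k) * B $$ (s - k * d) * a ^ k)"
    by (rule sum_group_mult[OF d])
  finally show ?thesis .
qed

text \<open>Collecting the terms of both exponentials by the total number m of factors
  \<open>a\<close> gives \<open>conj_coeff\<close>, that is, iterated commutators.\<close>

theorem sexp_conj:
  assumes d: "0 < d"
  shows "(sexp d a * B * sexp d (- a)) $$ s = (\<Sum>k | k * d \<le> s. scl (1 / fact k) * ((\<lambda>X. a * X - X * a) ^^ k) (B $$ (s - k * d)))"
proof -
  let ?F = "\<lambda>k l. scl (1 / (fact k * fact l)) * (a ^ k * B $$ (s - (k + l) * d) * (- a) ^ l)"
  have "(sexp d a * B * sexp d (- a)) $$ s = (\<Sum>l | l * d \<le> s. \<Sum>k | k * d \<le> s - l * d. ?F k l)"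
    unfolding sexp_mult_right[OF d] sexp_mult_left[OF d] sum_distrib_left sum_distrib_right
  proof (intro sum.cong refl)
    fix l k
    have "s - l * d - k * d = s - (k + l) * d" by (simp add: distrib_right add.commute)
    then show "scl (1 / fact l) * (scl (1 / fact k) * a ^ k * B $$ (s - l * d - k * d)) * (- a) ^ l = ?F k l"
      by (simp add: scl_mult[of "1 / fact l" "1 / fact k", simplified] mult.assoc mult.commute[of "fact k"])
  qed
  also have "\<dots> = (\<Sum>(l, k)\<in>(SIGMA l:{l. l * d \<le> s}. {k. k * d \<le> s - l * d}). ?F k l)"
    by (rule sum.Sigma) (auto simp: finite_mult_le[OF d])
  also have "\<dots> = (\<Sum>(m, k)\<in>(SIGMA m:{m. m * d \<le> s}. {..m}). ?F k (m - k))"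
    by (rule sum.reindex_bij_witness[of _ "\<lambda>(m, k). (m - k, k)" "\<lambda>(l, k). (k + l, k)"])
      (auto simp: distrib_right diff_mult_distrib diff_le_mono intro: order_trans[OF mult_le_mono1])
  also have "\<dots> = (\<Sum>m | m * d \<le> s. \<Sum>k\<le>m. ?F k (m - k))"
    by (rule sum.Sigma[symmetric]) (auto simp: finite_mult_le[OF d])
  also have "\<dots> = (\<Sum>m | m * d \<le> s. conj_coeff a (B $$ (s - m * d)) m)"
    by (simp add: conj_coeff_def)
  finally show ?thesis unfolding conj_coeff_ad .
qed

text \<open>Conjugating 1 leaves only the zeroth term, since 1 commutes with
  \<open>a\<close>.\<close>

lemma sexp_inverse: assumes d: "0 < d" shows "sexp d a * sexp d (- a) = 1"
proof (rule fps_ext)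
  fix s
  have z: "((\<lambda>X. a * X - X * a) ^^ k) 1 = (if k = 0 then 1 else 0)" "((\<lambda>X. a * X - X * a) ^^ k) 0 = 0" for k
    by (induction k) auto
  have "(sexp d a * 1 * sexp d (- a)) $$ s = (\<Sum>k | k * d \<le> s. if k = 0 then 1 $$ s else 0)"
    unfolding sexp_conj[OF d] by (rule sum.cong[OF refl]) (auto simp: fps_one_nth z)
  also have "\<dots> = 1 $$ s" using finite_mult_le[OF d, of s] by simp
  finally show "(sexp d a * sexp d (- a)) $$ s = 1 $$ s" by simp
qed

lemma sexp_inverse': "0 < d \<Longrightarrow> sexp d (- a) * sexp d a = 1"
  using sexp_inverse[of d "- a"] by simp

subsection \<open>Symbols of operator series\<close>

definition sadj :: "'n::finite ssym fps \<Rightarrow> 'n ssym fps" where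
  "sadj u = Abs_fps (\<lambda>s. As (scnj (Rs (u $$ s))))"

lemma sadj_mult: "sadj (u * v) = sadj v * sadj u"
proof (rule fps_ext, rule ssym_eqI)
  fix s
  have "Rs (sadj (u * v) $$ s) = (\<Sum>i\<le>s. star (scnj (Rs (v $$ (s - i)))) (scnj (Rs (u $$ i))))"
    by (simp add: sadj_def fps_mult_nth Rs_sum Rs_simps scnj_sum scnj_star atLeast0AtMost)
  also have "\<dots> = (\<Sum>i\<le>s. star (scnj (Rs (v $$ i))) (scnj (Rs (u $$ (s - i)))))"
    by (rule sum.reindex_bij_witness[of _ "\<lambda>i. s - i" "\<lambda>i. s - i"]) auto
  also have "\<dots> = Rs ((sadj v * sadj u) $$ s)"
    by (simp add: sadj_def fps_mult_nth Rs_sum Rs_simps atLeast0AtMost)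
  finally show "Rs (sadj (u * v) $$ s) = Rs ((sadj v * sadj u) $$ s)" .
qed

lemma scnj_1 [simp]: "scnj 1 = 1" using scnj_sconst[of 1] by simp

lemma sadj_1: "sadj 1 = 1"
  by (rule fps_ext, rule ssym_eqI) (simp add: sadj_def fps_one_nth Rs_simps)

text \<open>The star powers of a real symbol are real again, so only the factor i changes sign. This
  is unitarity of the exponential in symbol form.\<close>

lemma sadj_sexp: 
  assumes "realsym W" "c \<in> \<real>"
  shows "sadj (sexp d (scl (\<i> * c) * As W)) = sexp d (- (scl (\<i> * c) * As W))"
proof (rule fps_ext, rule ssym_eqI)
  fix s
  have W: "scnj (Rs ((As W) ^ k)) = Rs ((As W) ^ k)" for k
  proof (induction k)
    case (Suc k)
    then show ?case using assms(1) by (simp add: Rs_simps scnj_star realsym_iff power_commutes)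
      (metis Rs_simps(6) Rs_simps(7) power_commutes)
  qed (simp add: Rs_simps)
  have "cnj c = c" using assms(2) by (simp add: Reals_cnj_iff)
  then have "scnj (Rs (scl (1 / fact k) * (scl (\<i> * c) * As W) ^ k)) = Rs (scl (1 / fact k) * (- (scl (\<i> * c) * As W)) ^ k)" for k
    unfolding mult_minus_left[symmetric] scl_uminus[symmetric] scl_power Rs_scl_mult by (simp add: W)
  then show "Rs (sadj (sexp d (scl (\<i> * c) * As W)) $$ s) = Rs (sexp d (- (scl (\<i> * c) * As W)) $$ s)"
    by (simp add: sadj_def sexp_def Rs_sum scnj_sum Rs_simps(7))
qed

section \<open>Operator series at a fixed value of Planck's constant\<close>

context
  fixes h :: real
  assumes h: "h > 0"
begin

text \<open>A relation rather than a map: different symbols may have the same quantization at a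
  given h, for instance \<open>svar HBAR\<close> and the constant h. This freedom is what permits
  division by h in the coefficients.\<close>

definition rep :: "'n::finite oper_series \<Rightarrow> 'n ssym fps \<Rightarrow> bool" where
  "rep S u \<longleftrightarrow> (\<forall>s. \<forall>\<psi>\<in>schwartz. S s \<psi> = weyl h (Rs (u $$ s)) \<psi>)"

lemma rep_eq: "rep S u \<Longrightarrow> rep T u \<Longrightarrow> ser_eq S T"
  by (simp add: rep_def ser_eq_def)

lemma rep_mult: assumes "rep S u" "rep T v" shows "rep (ser_mult S T) (u * v)"
  unfolding rep_def
proof (intro allI ballI ext)
  fix s \<psi> and x :: "real^'a" assume \<psi>: "\<psi> \<in> (schwartz :: (real^'a \<Rightarrow> complex) set)"
  show "ser_mult S T s \<psi> x = weyl h (Rs ((u * v) $$ s)) \<psi> x"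
    using assms \<psi> unfolding ser_mult_def fps_mult_nth Rs_sum weyl_sum[OF h \<psi>] rep_def Rs_simps
    by (simp add: weyl_star[OF h] weyl_schwartz[OF h] atLeast0AtMost)
qed

lemma rep_one: "rep ser_one 1"
  unfolding rep_def
proof (intro allI ballI ext)
  fix s \<psi> and x :: "real^'a" assume \<psi>: "\<psi> \<in> (schwartz :: (real^'a \<Rightarrow> complex) set)"
  show "ser_one s \<psi> x = weyl h (Rs (1 $$ s)) \<psi> x"
    by (simp add: ser_one_def fps_one_nth Rs_simps weyl_0[OF h] weyl_1[OF h \<psi>])
qed

lemma rep_adjoint: assumes "rep S u" shows "rep (ser_adjoint S) (sadj u)"
  unfolding rep_def
proof (intro allI ballI)
  fix s and \<psi> :: "real^'a \<Rightarrow> complex" assume \<psi>: "\<psi> \<in> schwartz"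
  show "ser_adjoint S s \<psi> = weyl h (Rs (sadj u $$ s)) \<psi>"
    unfolding ser_adjoint_def
  proof (rule op_adjointI[OF h])
    show "weyl h (Rs (sadj u $$ s)) \<psi> \<in> schwartz" by (rule weyl_schwartz[OF h \<psi>])
    fix \<phi> :: "real^'a \<Rightarrow> complex" assume "\<phi> \<in> schwartz"
    then show "inner_L2 \<psi> (S s \<phi>) = inner_L2 (weyl h (Rs (sadj u $$ s)) \<psi>) \<phi>"
      using assms \<psi> by (simp add: rep_def sadj_def Rs_simps weyl_adjoint[OF h])
  qed
qed

lemma weyl_power: "\<psi> \<in> schwartz \<Longrightarrow> ((weyl h A) ^^ k) \<psi> = weyl h (Rs (As A ^ k)) \<psi>"
proof (induction k)
  case 0
  then show ?case by (intro ext) (simp add: Rs_simps weyl_1[OF h])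
next
  case (Suc k)
  then show ?case by (simp add: Rs_simps weyl_star[OF h])
qed

lemma rep_exp: "rep (ser_exp h c n W) (sexp (n - 2) (scl (c / of_real h) * As W))"
  unfolding rep_def
proof (intro allI ballI ext)
  fix s \<psi> and x :: "real^'a" assume \<psi>: "\<psi> \<in> (schwartz :: (real^'a \<Rightarrow> complex) set)"
  have "weyl h (Rs (scl (1 / fact k) * (scl (c / of_real h) * As W) ^ k)) \<psi> x = (c / of_real h) ^ k / fact k * ((weyl h W) ^^ k) \<psi> x" for k
    unfolding scl_power Rs_scl_mult weyl_sconst_mult[OF h] weyl_power[OF \<psi>] by simp
  then show "ser_exp h c n W s \<psi> x = weyl h (Rs (sexp (n - 2) (scl (c / of_real h) * As W) $$ s)) \<psi> x"
    by (simp add: ser_exp_def sexp_def Rs_sum weyl_sum[OF h \<psi>])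
qed

text \<open>\<open>moyal\<close> divides by the variable \<open>HBAR\<close>, the commutator on the
  right by the number h, so the symbols may differ while the operators agree. Hence the assumption
  links \<open>B\<close> and \<open>b\<close> only through quantization.\<close>

lemma weyl_ad:
  assumes "\<And>\<psi>. \<psi> \<in> schwartz \<Longrightarrow> weyl h B \<psi> = weyl h (Rs b) \<psi>" "\<psi> \<in> schwartz"
  shows "weyl h ((moyal W ^^ k) B) \<psi> = weyl h (Rs (((\<lambda>X. (scl (\<i> / of_real h) * As W) * X - X * (scl (\<i> / of_real h) * As W)) ^^ k) b)) \<psi>"
  using assms(2)
proof (induction k arbitrary: \<psi>)
  case (Suc k)
  define Y where "Y = ((\<lambda>X. (scl (\<i> / of_real h) * As W) * X - X * (scl (\<i> / of_real h) * As W)) ^^ k) b"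
  have IH: "weyl h ((moyal W ^^ k) B) \<phi> = weyl h (Rs Y) \<phi>" if "\<phi> \<in> schwartz" for \<phi>
    unfolding Y_def by (rule Suc.IH[OF that])
  have "(scl (\<i> / of_real h) * As W) * Y - Y * (scl (\<i> / of_real h) * As W) = scl (\<i> / of_real h) * (As W * Y - Y * As W)"
    by (simp add: right_diff_distrib scl_left_commute[of Y] mult.assoc)
  then have "Rs ((scl (\<i> / of_real h) * As W) * Y - Y * (scl (\<i> / of_real h) * As W)) = sconst (\<i> / of_real h) * (star W (Rs Y) - star (Rs Y) W)"
    by (simp only: Rs_scl_mult) (simp only: Rs_simps)
  then show ?case
    by (intro ext) (simp add: Y_def[symmetric] weyl_moyal[OF h] IH Suc.prems weyl_schwartz[OF h]
         weyl_diff[OF h] weyl_sconst_mult[OF h] weyl_star[OF h] del: mult_minus_left)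
qed (use assms in simp)

lemma rep_conj:
  assumes "3 \<le> n" "rep (ser_weyl h H) v"
  shows "rep (ser_weyl h (exp_ad moyal n W H)) (sexp (n - 2) (scl (\<i> / of_real h) * As W) * v * sexp (n - 2) (- (scl (\<i> / of_real h) * As W)))"
  unfolding rep_def
proof (intro allI ballI ext)
  fix s \<psi> and x :: "real^'a" assume \<psi>: "\<psi> \<in> (schwartz :: (real^'a \<Rightarrow> complex) set)"
  have d: "0 < n - 2" using assms by simp
  have v: "weyl h (H t) \<phi> = weyl h (Rs (v $$ t)) \<phi>" if "\<phi> \<in> schwartz" for \<phi> t
    using assms(2) that by (simp add: rep_def ser_weyl_def)
  show "ser_weyl h (exp_ad moyal n W H) s \<psi> x = weyl h (Rs ((sexp (n - 2) (scl (\<i> / of_real h) * As W) * v * sexp (n - 2) (- (scl (\<i> / of_real h) * As W))) $$ s)) \<psi> x"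
    unfolding sexp_conj[OF d] ser_weyl_def exp_ad_def Rs_sum weyl_sum[OF h \<psi>] Rs_scl_mult weyl_sconst_mult[OF h]
    by (rule sum.cong[OF refl]) (simp only: weyl_ad[OF v \<psi>])
qed

lemma rep_weyl: "rep (ser_weyl h H) (Abs_fps (\<lambda>s. As (H s)))"
  by (simp add: rep_def ser_weyl_def Rs_simps)

theorem ser_exp_conj:
  assumes "3 \<le> n"
  shows "ser_eq (ser_weyl h (exp_ad moyal n W H)) (ser_mult (ser_mult (ser_exp h \<i> n W) (ser_weyl h H)) (ser_exp h (- \<i>) n W))"
proof -
  have "- (scl (\<i> / of_real h) * As W) = scl (- \<i> / of_real h) * As W" by (simp add: scl_uminus)
  then show ?thesis
    using rep_conj[OF assms rep_weyl[of H], of W] rep_mult[OF rep_mult[OF rep_exp[of \<i> n W] rep_weyl[of H]] rep_exp[of "- \<i>" n W]]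
    by (intro rep_eq) simp_all
qed

theorem ser_exp_unitary:
  assumes "3 \<le> n" "realsym W"
  shows "ser_unitary (ser_exp h \<i> n W)"
proof -
  let ?a = "scl (\<i> / of_real h) * As W"
  have d: "0 < n - 2" using assms by simp
  have r: "rep (ser_exp h \<i> n W) (sexp (n - 2) ?a)" by (rule rep_exp)
  have "sadj (sexp (n - 2) ?a) = sexp (n - 2) (- ?a)"
    using sadj_sexp[OF assms(2), of "1 / of_real h" "n - 2"] by simp
  then have r': "rep (ser_adjoint (ser_exp h \<i> n W)) (sexp (n - 2) (- ?a))"
    using rep_adjoint[OF r] by simp
  show ?thesis unfolding ser_unitary_def
    using rep_eq[OF rep_mult[OF r' r, unfolded sexp_inverse'[OF d]] rep_one] 
      rep_eq[OF rep_mult[OF r r', unfolded sexp_inverse[OF d]] rep_one] by blast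
qed

text \<open>The witness collects the factors exp(- i W / h) from left to right. Its adjoint is the
  product of their inverses in reverse order, so conjugation by it performs the steps one after the
  other.\<close>

lemma U_rep:
  assumes "\<And>n. n \<in> {3..N} \<Longrightarrow> realsym (W n)"
  shows "\<exists>u. rep (U_ser h W N) u \<and> sadj u * u = 1 \<and> u * sadj u = 1 \<and> 
     rep (ser_weyl h (transformed moyal W H N)) (sadj u * Abs_fps (\<lambda>s. As (H s)) * u)"
  using assms
proof (induction N)
  case 0
  show ?case by (rule exI[of _ 1]) (simp add: sadj_1 rep_one rep_weyl)
next
  case (Suc n)
  show ?case
  proof (cases "Suc n < 3")
    case True
    then have t: "transformed moyal W H (Suc n) = H" "U_ser h W (Suc n) = ser_one" by simp_all
    show ?thesis unfolding t by (rule exI[of _ 1]) (simp add: sadj_1 rep_one rep_weyl)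
  next
    case False
    then have n: "3 \<le> Suc n" and d: "0 < Suc n - 2" by auto
    obtain u where u: "rep (U_ser h W n) u" "sadj u * u = 1" "u * sadj u = 1" 
      "rep (ser_weyl h (transformed moyal W H n)) (sadj u * Abs_fps (\<lambda>s. As (H s)) * u)"
      using Suc by auto
    let ?a = "scl (\<i> / of_real h) * As (W (Suc n))"
    define e where "e = sexp (Suc n - 2) ?a"
    define e' where "e' = sexp (Suc n - 2) (- ?a)"
    have ee: "e * e' = 1" "e' * e = 1" unfolding e_def e'_def using sexp_inverse[OF d] sexp_inverse'[OF d] by blast+
    have "realsym (W (Suc n))" using Suc.prems n by simp
    then have ad: "sadj e = e'"
      unfolding e_def e'_def using sadj_sexp[of "W (Suc n)" "1 / of_real h" "Suc n - 2"] by simp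
    have ad': "sadj e' = e" 
      unfolding e_def e'_def using sadj_sexp[OF \<open>realsym (W (Suc n))\<close>, of "- 1 / of_real h" "Suc n - 2"] by (simp add: scl_uminus)
    have "- ?a = scl (- \<i> / of_real h) * As (W (Suc n))" by (simp add: scl_uminus)
    then have "rep (ser_exp h (- \<i>) (Suc n) (W (Suc n))) e'" unfolding e'_def using rep_exp[of "- \<i>" "Suc n" "W (Suc n)"] by simp
    then have 1: "rep (U_ser h W (Suc n)) (u * e')" using u(1) False by (simp add: rep_mult)
    have 2: "sadj (u * e') * (u * e') = 1"
    proof -
      have "sadj (u * e') * (u * e') = e * (sadj u * u) * e'" by (simp add: sadj_mult ad' mult.assoc)
      then show ?thesis by (simp add: u ee)
    qed
    have 3: "(u * e') * sadj (u * e') = 1"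
    proof -
      have "(u * e') * sadj (u * e') = u * (e' * e) * sadj u" by (simp add: sadj_mult ad' mult.assoc)
      then show ?thesis by (simp add: u ee)
    qed
    have 4: "rep (ser_weyl h (transformed moyal W H (Suc n))) (sadj (u * e') * Abs_fps (\<lambda>s. As (H s)) * (u * e'))"
      using rep_conj[OF n u(4), of "W (Suc n)", folded e_def e'_def] False by (simp add: sadj_mult ad' mult.assoc)
    show ?thesis using 1 2 3 4 by blast
  qed
qed

theorem U_ser_conj:
  assumes "\<And>n. n \<in> {3..N} \<Longrightarrow> realsym (W n)"
  shows "ser_unitary (U_ser h W N)"
    "ser_eq (ser_mult (ser_mult (ser_adjoint (U_ser h W N)) (ser_weyl h H)) (U_ser h W N)) (ser_weyl h (transformed moyal W H N))"
proof -
  obtain u where u: "rep (U_ser h W N) u" "sadj u * u = 1" "u * sadj u = 1" 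
      "rep (ser_weyl h (transformed moyal W H N)) (sadj u * Abs_fps (\<lambda>s. As (H s)) * u)"
    using U_rep[of N W H] assms by blast
  note r' = rep_adjoint[OF u(1)]
  show "ser_unitary (U_ser h W N)" unfolding ser_unitary_def
    using rep_eq[OF rep_mult[OF r' u(1), unfolded u(2)] rep_one] rep_eq[OF rep_mult[OF u(1) r', unfolded u(3)] rep_one] by blast
  show "ser_eq (ser_mult (ser_mult (ser_adjoint (U_ser h W N)) (ser_weyl h H)) (U_ser h W N)) (ser_weyl h (transformed moyal W H N))"
    using rep_eq[OF rep_mult[OF rep_mult[OF r' rep_weyl] u(1)] u(4)] .
qed

end

section \<open>The homological equation\<close>

subsection \<open>Symbols vanishing at all real points\<close>

definition rval :: "('n svar \<Rightarrow> real) \<Rightarrow> 'n sym \<Rightarrow> complex" where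
  "rval val A = peval id (\<lambda>v. of_real (val v)) A"

lemma rval_simps: "rval val (sconst c) = c" "rval val (A + B) = rval val A + rval val B" 
  "rval val (A * B) = rval val A * rval val B" "rval val (svar v) = of_real (val v)"
  unfolding rval_def sconst_def svar_def 
  by (simp_all add: peval_const peval_add peval_mult peval_var del: One_nat_def)

lemma rval_deriv: "((\<lambda>t. rval (val(v := t)) A) has_vector_derivative rval (val(v := t)) (spartial v A)) (at t)"
proof (induction A rule: sym_induct)
  case (const c)
  have "rval w 0 = 0" for w :: "'a svar \<Rightarrow> real" using rval_simps(1)[of w 0] by simp
  then show ?case by (simp add: rval_simps)
next
  case (add A B)
  then show ?case by (simp add: rval_simps spartial_add has_vector_derivative_add)
next
  case (var w A)
  have "((\<lambda>t. (val(v := t)) w) has_real_derivative (if v = w then 1 else 0)) (at t)"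
    by (cases "v = w") (auto intro!: derivative_eq_intros)
  then have d: "((\<lambda>t. rval (val(v := t)) (svar w)) has_vector_derivative of_real (if v = w then 1 else 0)) (at t)"
    unfolding rval_simps by (rule has_vector_derivative_of_real)
  have "rval w 0 = 0" for w :: "'a svar \<Rightarrow> real" using rval_simps(1)[of w 0] by simp
  then show ?case using has_vector_derivative_mult[OF d var] by (auto simp: rval_simps spartial_svar_mult add.commute)
qed

text \<open>The partial derivatives vanish at all real points as well and have lower degree, so by
  induction they are zero; in characteristic zero only a constant is left.\<close>

lemma rval_zero: assumes "\<And>val. rval val A = 0" shows "A = 0"
proof -
  obtain d where "poly_deg_le d A" using poly_deg_le_exists by blast
  then show ?thesis using assms
  proof (induction d arbitrary: A)
    case (0 A)
    have s: "spartial v A = 0" for v using 0(1) by (rule poly_deg_le_0_spartial)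
    have "lk A m = 0" if "m \<noteq> 0" for m
    proof -
      have "tdeg m \<noteq> 0"
      proof
        assume "tdeg m = 0"
        then have "m = 0" by (intro poly_mapping_eqI) (auto simp: tdeg_def in_keys_iff)
        then show False using that by simp
      qed
      then show ?thesis using 0(1) unfolding poly_deg_le_def by fastforce
    qed
    then have "A = sconst (lk A 0)" by (intro poly_mapping_eqI) (auto simp: sconst_def lookup_single when_def)
    then show ?case using 0(2) rval_simps(1) sconst_0 by metis
  next
    case (Suc d A)
    have "spartial v A = 0" for v
    proof (rule Suc.IH)
      show "poly_deg_le d (spartial v A)" using poly_deg_le_spartial[OF Suc.prems(1), of v] by simp
      fix val
      have "((\<lambda>t. 0) has_vector_derivative rval val (spartial v A)) (at (val v))"
        using rval_deriv[of val v A "val v"] Suc.prems(2) by simp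
      moreover have "((\<lambda>t::real. 0::complex) has_vector_derivative 0) (at (val v))" by simp
      ultimately show "rval val (spartial v A) = 0" by (rule vector_derivative_unique_at)
    qed
    then have z: "lk (spartial v A) m = 0" for v m by simp
    have "lk A m = 0" if "m \<noteq> 0" for m
    proof -
      obtain v where v: "lk m v \<noteq> 0" using \<open>m \<noteq> 0\<close> by (metis poly_mapping_eqI lookup_zero)
      have e: "m - sg v 1 + sg v 1 = m" using mono_split[OF v] by (simp add: add.commute)
      show ?thesis using z[of v "m - sg v 1"] unfolding lookup_spartial e by (simp del: of_nat_add of_nat_Suc)
    qed
    then have "A = sconst (lk A 0)" by (intro poly_mapping_eqI) (auto simp: sconst_def lookup_single when_def)
    then show ?case using Suc.prems(2) rval_simps(1) sconst_0 by metis
  qed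
qed

lemma sym_eval_zero: assumes "\<And>h p x. sym_eval h p x A = 0" shows "A = 0"
proof (rule rval_zero)
  fix val
  have "rval val A = sym_eval (val HBAR) (\<chi> k. val (MOM k)) (\<chi> k. val (POS k)) A"
    unfolding rval_def sym_eval_def
    by (rule arg_cong[where f="\<lambda>f. peval id f A"]) (auto split: svar.split)
  then show "rval val A = 0" using assms by simp
qed

subsection \<open>Diagonalizing coordinates\<close>

fun zvar :: "'n \<Rightarrow> 'n svar \<Rightarrow> 'n sym" where
  "zvar r (MOM k) = (if k = r then svar (MOM k) else svar (MOM k) + sconst \<i> * svar (POS k))"
| "zvar r (POS k) = (if k = r then svar (POS k) else svar (MOM k) - sconst \<i> * svar (POS k))"
| "zvar r HBAR = svar HBAR"

text \<open>The substitution inverse to \<open>zvar\<close>: with z = p + i x and z' = p - i x one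
  has p = (z + z') / 2 and x = (z - z') / (2 i).\<close>

fun yvar :: "'n \<Rightarrow> 'n svar \<Rightarrow> 'n sym" where
  "yvar r (MOM k) = (if k = r then svar (MOM k) else sconst (1/2) * (svar (MOM k) + svar (POS k)))"
| "yvar r (POS k) = (if k = r then svar (POS k) else sconst (1/(2*\<i>)) * (svar (MOM k) - svar (POS k)))"
| "yvar r HBAR = svar HBAR"

definition subs :: "('n svar \<Rightarrow> 'n sym) \<Rightarrow> 'n sym \<Rightarrow> 'n sym" where
  "subs f A = peval sconst f A"

lemma subs_simps: "subs f (sconst c) = sconst c" "subs f (A + B) = subs f A + subs f B" "subs f (A - B) = subs f A - subs f B"
  "subs f (A * B) = subs f A * subs f B" "subs f (svar v) = f v" "subs f 0 = 0" "subs f (- A) = - subs f A"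
  using peval_const[of sconst f c, OF ring_map_sconst] peval_var[of sconst f v, OF ring_map_sconst]
  unfolding subs_def by (simp_all add: sconst_def[of c] svar_def peval_add peval_mult peval_diff peval_zero peval_uminus)

lemma subs_expand: "finite K \<Longrightarrow> kys A \<subseteq> K \<Longrightarrow> subs f A = (\<Sum>m\<in>K. sconst (lk A m) * mev f m)"
  unfolding subs_def by (rule peval_superset) auto

lemma subs_homog: 
  assumes "\<And>v. homog (weight v) (f v)" "homog s A" shows "homog s (subs f A)"
proof -
  have m: "homog (mon_order m) (mev f m)" for m
  proof (induction m rule: mono_induct)
    case zero
    then show ?case using homog_sconst[of 1] by simp
  next
    case (step v m)
    then show ?case using homog_mult[OF assms(1)[of v] step] by (simp add: mev_add mon_order_add)
  qed
  show ?thesis unfolding subs_expand[OF finite_keys order_refl]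
  proof (intro homog_sum homog_sconst_mult)
    fix i assume "i \<in> kys A"
    then have "mon_order i = s" using assms(2) by (simp add: homog_def in_keys_iff)
    then show "homog s (mev f i)" using m[of i] by simp
  qed
qed

lemma weight_simps [simp]: "weight (MOM k) = 1" "weight (POS k) = 1" "weight HBAR = 2" by (simp_all add: weight_def)

lemma zvar_homog: "homog (weight v) (zvar r v)"
  using homog_svar[of "MOM k" for k] homog_svar[of "POS k" for k] homog_svar[of HBAR]
  by (cases v) (auto intro!: homog_add homog_diff homog_sconst_mult)

lemma yvar_homog: "homog (weight v) (yvar r v)"
  using homog_svar[of "MOM k" for k] homog_svar[of "POS k" for k] homog_svar[of HBAR]
  by (cases v) (auto intro!: homog_add homog_diff homog_sconst_mult)

lemma lookup_two_times [simp]: "lk (2 * A) m = 2 * lk A m" for A :: "'n sym"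
  unfolding mult_2 lookup_add ..

lemma half_add_half: "sconst (1/2) * A + sconst (1/2) * A = A"
proof (rule poly_mapping_eqI)
  fix m
  show "lk (sconst (1/2) * A + sconst (1/2) * A) m = lk A m"
    unfolding lookup_add lookup_sconst_times by (simp add: field_simps)
qed

lemma subs_zy: "subs (zvar r) (subs (yvar r) A) = A"
proof (induction A rule: sym_induct)
  case (var v A)
  have "subs (zvar r) (yvar r v) = svar v"
  proof (cases v)
    case (MOM k)
    then show ?thesis by (rule_tac poly_mapping_eqI) (auto simp: subs_simps lookup_add lookup_minus)
  next
    case (POS k)
    then show ?thesis by (rule_tac poly_mapping_eqI) (auto simp: subs_simps lookup_add lookup_minus)
  qed (simp add: subs_simps)
  then show ?case using var by (simp add: subs_simps)
qed (simp_all add: subs_simps)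

lemma subs_yz: "subs (yvar r) (subs (zvar r) A) = A"
proof (induction A rule: sym_induct)
  case (var v A)
  have "subs (yvar r) (zvar r v) = svar v"
  proof (cases v)
    case (MOM k)
    then show ?thesis by (rule_tac poly_mapping_eqI) (cases "k = r"; simp add: subs_simps lookup_add lookup_minus; simp add: field_simps)
  next
    case (POS k)
    then show ?thesis by (rule_tac poly_mapping_eqI) (cases "k = r"; simp add: subs_simps lookup_add lookup_minus; simp add: field_simps)
  qed (simp add: subs_simps)
  then show ?case using var by (simp add: subs_simps)
qed (simp_all add: subs_simps)

text \<open>Eigenvalue of the bracket with the k-th action on the monomial \<open>m\<close> in the
  variables \<open>zvar r\<close>: real for the saddle, imaginary for an oscillator.\<close>

definition eig :: "'n \<Rightarrow> 'n \<Rightarrow> ('n svar \<Rightarrow>\<^sub>0 nat) \<Rightarrow> complex" where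
  "eig r k m = (if k = r then of_nat (lk m (POS k)) - of_nat (lk m (MOM k)) 
     else \<i> * (of_nat (lk m (MOM k)) - of_nat (lk m (POS k))))"

lemma eig_add: "eig r k (m + n) = eig r k m + eig r k n"
  by (simp add: eig_def lookup_add algebra_simps)
lemma eig_0 [simp]: "eig r k 0 = 0" by (simp add: eig_def)

lemma spartial_action: "spartial v (action r k) = (case v of 
    MOM j \<Rightarrow> (if j = k then (if k = r then svar (POS k) else svar (MOM k)) else 0)
  | POS j \<Rightarrow> (if j = k then (if k = r then svar (MOM k) else svar (POS k)) else 0) | HBAR \<Rightarrow> 0)"
proof -
  have hh: "sconst (1/2) * spartial v (svar w ^ 2) = (if v = w then svar w else 0)" for v w :: "'a svar"
  proof -
    have "sconst (1/2) * spartial v (svar w ^ 2) = sconst (1/2) * (2 * svar w) * spartial v (svar w)"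
      unfolding spartial_power by simp
    also have "sconst (1/2) * (2 * svar w) = (svar w :: 'a sym)"
      unfolding mult_2 distrib_left by (rule half_add_half)
    finally show ?thesis by (simp add: spartial_svar)
  qed
  show ?thesis
    unfolding action_def distrib_left
    by (cases v) (auto simp: spartial_mult spartial_svar spartial_add hh)
qed

lemma poisson_action: "poisson (action r k) G = (if k = r 
   then svar (POS k) * spartial (POS k) G - svar (MOM k) * spartial (MOM k) G
   else svar (MOM k) * spartial (POS k) G - svar (POS k) * spartial (MOM k) G)"
proof -
  have "poisson (action r k) G = (\<Sum>j\<in>UNIV. if j = k then (if k = r 
   then svar (POS k) * spartial (POS k) G - svar (MOM k) * spartial (MOM k) G
   else svar (MOM k) * spartial (POS k) G - svar (POS k) * spartial (MOM k) G) else 0)"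
    unfolding poisson_def by (rule sum.cong[OF refl]) (simp add: spartial_action)
  then show ?thesis by simp
qed

lemma poisson_action_zvar: "poisson (action r k) (zvar r v) = sconst (eig r k (sg v 1)) * zvar r v"
proof (cases v)
  case (MOM j)
  show ?thesis unfolding MOM
    by (rule poly_mapping_eqI)
      (auto simp: poisson_action spartial_add spartial_sconst_mult spartial_svar lookup_add lookup_minus eig_def lookup_single when_def algebra_simps
         if_distrib[of "\<lambda>x. _ * x"] sconst_uminus)
next
  case (POS j)
  show ?thesis unfolding POS
    by (rule poly_mapping_eqI)
      (auto simp: poisson_action spartial_diff spartial_sconst_mult spartial_svar lookup_add lookup_minus eig_def lookup_single when_def algebra_simps
         if_distrib[of "\<lambda>x. _ * x"] sconst_uminus)
next
  case HBAR
  then show ?thesis by (simp add: poisson_action spartial_svar eig_def lookup_single)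
qed

lemma poisson_action_mev: "poisson (action r k) (mev (zvar r) m) = sconst (eig r k m) * mev (zvar r) m"
proof (induction m rule: mono_induct)
  case zero
  then show ?case using poisson_sconst(1)[of "action r k" 1] by simp
next
  case (step v m)
  then show ?case
    by (simp add: mev_add poisson_mult_right eig_add sconst_add algebra_simps del: One_nat_def)
      (simp add: poisson_action_zvar algebra_simps del: One_nat_def)
qed

definition emul :: "(('n svar \<Rightarrow>\<^sub>0 nat) \<Rightarrow> complex) \<Rightarrow> 'n sym \<Rightarrow> 'n sym" where
  "emul e A = (\<Sum>m\<in>kys A. sg m (e m * lk A m))"

lemma lookup_emul [simp]: "lk (emul e A) m = e m * lk A m"
  by (simp add: emul_def lookup_sum lookup_single when_def in_keys_iff)

lemma homog_emul: "homog s A \<Longrightarrow> homog s (emul e A)" by (simp add: homog_def)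

lemma poisson_eigen: 
  assumes "\<And>m. poisson B (mev f m) = sconst (e m) * mev f m"
  shows "poisson B (subs f A) = subs f (emul e A)"
proof -
  have k: "kys (emul e A) \<subseteq> kys A" by (auto simp: in_keys_iff)
  show ?thesis unfolding subs_expand[OF finite_keys order_refl, of f A] subs_expand[OF finite_keys k]
    by (simp add: poisson_sum_right poisson_sconst_mult assms sconst_mult) (simp add: mult_ac)
qed

definition invar :: "'n::finite \<Rightarrow> 'n sym \<Rightarrow> bool" where
  "invar r G \<longleftrightarrow> (\<forall>k. poisson (action r k) G = 0)"

lemma subs_zvar_eq_0: "subs (zvar r) A = 0 \<longleftrightarrow> A = 0"
  using subs_yz[of r A] subs_simps(6) by metis

text \<open>The monomials in the new variables are common eigenvectors of the brackets with all
  actions, so only those with all eigenvalues zero may occur.\<close>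

lemma invar_subs: "invar r (subs (zvar r) g) \<longleftrightarrow> (\<forall>m k. lk g m \<noteq> 0 \<longrightarrow> eig r k m = 0)"
proof -
  have "emul e g = 0 \<longleftrightarrow> (\<forall>m. lk g m \<noteq> 0 \<longrightarrow> e m = 0)" for e
    by (auto simp: poly_mapping_eq_iff fun_eq_iff)
  then show ?thesis unfolding invar_def poisson_eigen[OF poisson_action_mev] subs_zvar_eq_0 by auto
qed

lemma invar_add: "invar r A \<Longrightarrow> invar r B \<Longrightarrow> invar r (A + B)" by (simp add: invar_def poisson_add_right)
lemma invar_diff: "invar r A \<Longrightarrow> invar r B \<Longrightarrow> invar r (A - B)" by (simp add: invar_def poisson_diff_right)
lemma invar_0 [simp]: "invar r 0" by (simp add: invar_def)

lemma realsym_action: "realsym (action r k)"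
  by (auto simp: action_def intro!: realsym_mult realsym_svar realsym_sconst_mult realsym_add realsym_power)
lemma homog_action: "homog 2 (action r k)"
proof -
  have m: "homog 1 (svar (MOM k))" "homog 1 (svar (POS k))"
    using homog_svar[of "MOM k"] homog_svar[of "POS k"] by simp_all
  have "homog 2 (svar (MOM k) ^ 2)" "homog 2 (svar (POS k) ^ 2)" "homog 2 (svar (MOM k) * svar (POS k))"
    using homog_power[OF m(1), of 2] homog_power[OF m(2), of 2] homog_mult[OF m] by (simp_all add: numeral_2_eq_2)
  then show ?thesis by (auto simp: action_def intro!: homog_sconst_mult homog_add)
qed

lemma invar_sre: "invar r G \<Longrightarrow> invar r (sre G)"
proof -
  assume "invar r G"
  then have "poisson G (action r k) = 0" for k using poisson_skew[of G] by (simp add: invar_def)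
  then have "poisson (sre G) (action r k) = 0" for k
    using sre_poisson[OF realsym_action[of r k], of G] by (simp add: sre_def)
  then show ?thesis using poisson_skew[of "action r _" "sre G"] by (simp add: invar_def)
qed

section \<open>Nonresonance: kernel and image of the bracket with the quadratic part\<close>

locale nonres =
  fixes r :: "'n::finite" and lam :: real and om :: "'n \<Rightarrow> real"
  assumes lam: "lam \<noteq> 0"
    and nonresonant: "\<And>c :: 'n \<Rightarrow> rat. (\<Sum>k\<in>UNIV - {r}. of_rat (c k) * om k) = 0
          \<Longrightarrow> (\<forall>k\<in>UNIV - {r}. c k = 0)"
begin

abbreviation "Q \<equiv> quadratic_part r lam om"

definition freq :: "('n svar \<Rightarrow>\<^sub>0 nat) \<Rightarrow> complex" where
  "freq m = of_real lam * eig r r m + (\<Sum>k\<in>UNIV - {r}. of_real (om k) * eig r k m)"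

text \<open>The oscillators contribute to the imaginary part and the saddle to the real part, so the
  conditions separate: rational independence settles the first, \<open>lam \<noteq> 0\<close> the
  second.\<close>

lemma freq_0_iff: "freq m = 0 \<longleftrightarrow> (\<forall>k. eig r k m = 0)"
proof
  assume f: "freq m = 0"
  have "Im (freq m) = (\<Sum>k\<in>UNIV - {r}. om k * (real (lk m (MOM k)) - real (lk m (POS k))))"
    by (simp add: freq_def eig_def)
  also have "\<dots> = (\<Sum>k\<in>UNIV - {r}. of_rat (of_int (int (lk m (MOM k)) - int (lk m (POS k)))) * om k)"
    by (simp add: of_rat_diff mult.commute)
  finally have "\<forall>k\<in>UNIV - {r}. (of_int (int (lk m (MOM k)) - int (lk m (POS k))) :: rat) = 0"
    using f by (intro nonresonant) simp
  then have k: "k \<noteq> r \<Longrightarrow> lk m (MOM k) = lk m (POS k)" for k by auto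
  have "Re (freq m) = lam * (real (lk m (POS r)) - real (lk m (MOM r)))"
    by (simp add: freq_def eig_def)
  then have "lk m (MOM r) = lk m (POS r)" using f lam by simp
  then show "\<forall>k. eig r k m = 0" using k by (simp add: eig_def)
qed (simp add: freq_def)

lemma poisson_Q_subs: "poisson Q (subs (zvar r) A) = subs (zvar r) (emul freq A)"
  by (rule poisson_eigen)
    (simp add: quadratic_part_def poisson_add_left poisson_sum_left poisson_sconst_mult poisson_action_mev 
      freq_def sconst_add sconst_mult sconst_sum distrib_right sum_distrib_right mult.assoc)

lemma invar_iff: "invar r G \<longleftrightarrow> poisson G Q = 0"
proof -
  define g where "g = subs (yvar r) G"
  have G: "G = subs (zvar r) g" by (simp add: g_def subs_zy)
  have "poisson G Q = 0 \<longleftrightarrow> poisson Q G = 0" using poisson_skew[of G Q] by simp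
  also have "\<dots> \<longleftrightarrow> emul freq g = 0" unfolding G poisson_Q_subs subs_zvar_eq_0 ..
  also have "\<dots> \<longleftrightarrow> (\<forall>m. lk g m \<noteq> 0 \<longrightarrow> freq m = 0)" by (auto simp: poly_mapping_eq_iff fun_eq_iff)
  also have "\<dots> \<longleftrightarrow> invar r G" unfolding G invar_subs freq_0_iff by blast
  finally show ?thesis ..
qed

text \<open>On a monomial the bracket multiplies by minus its frequency: the image has no component
  of frequency zero, and invariance excludes all others.\<close>

lemma invar_image: "invar r (poisson V Q) \<Longrightarrow> poisson V Q = 0"
proof -
  define g where "g = subs (yvar r) V"
  have V: "V = subs (zvar r) g" by (simp add: g_def subs_zy)
  have e: "poisson V Q = subs (zvar r) (emul (\<lambda>m. - freq m) g)"
  proof -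
    have "emul (\<lambda>m. - freq m) g = - emul freq g" by (rule poly_mapping_eqI) simp
    then show ?thesis using poisson_skew[of V Q] by (simp add: V poisson_Q_subs subs_simps)
  qed
  assume "invar r (poisson V Q)"
  then have "\<forall>m k. lk (emul (\<lambda>m. - freq m) g) m \<noteq> 0 \<longrightarrow> eig r k m = 0" unfolding e invar_subs .
  then have "emul (\<lambda>m. - freq m) g = 0"
    by (intro poly_mapping_eqI) (auto simp: freq_0_iff)
  then show ?thesis unfolding e by (simp add: subs_simps)
qed

lemma realsym_Q: "realsym Q"
  unfolding quadratic_part_def by (intro realsym_add realsym_sum realsym_sconst_mult realsym_action) auto
lemma homog_Q: "homog 2 Q"
  unfolding quadratic_part_def by (intro homog_add homog_sum homog_sconst_mult homog_action)
lemma invar_Q: "invar r Q"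
  unfolding invar_iff by (metis poisson_skew add.inverse_neutral eq_neg_iff_add_eq_0 half_add_half distrib_left mult_zero_right)

text \<open>On the monomials in the diagonalizing coordinates the map \<open>W \<mapsto> {W, H\<^sub>2}\<close> is multiplication by the
  negative frequency, so that its kernel and its image are complementary.\<close>

lemma homological:
  assumes G: "G \<in> Word n"
  shows "\<exists>V\<in>Word n. poisson V Q \<in> Word n \<and> invar r (G + poisson (poisson V Q) Q)"
proof -
  define g where "g = subs (yvar r) G"
  have Gz: "G = subs (zvar r) g" by (simp add: g_def subs_zy)
  have g: "homog n g" unfolding g_def using G yvar_homog by (intro subs_homog) (auto simp: Word_iff)
  \<comment> \<open>The square appears because the generator is to be \<open>poisson V Q\<close>,
    hence itself in the image, and the bracket acts twice on \<open>V\<close>. At frequency zero the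
    value 0 leaves the invariant part of \<open>G\<close> untouched.\<close>
  define v where "v = emul (\<lambda>m. if freq m = 0 then 0 else - 1 / (freq m)^2) g"
  have v: "homog n (subs (zvar r) v)" unfolding v_def by (intro subs_homog zvar_homog homog_emul g)
  \<comment> \<open>Taking real parts commutes with the bracket with the real symbol
    \<open>Q\<close>.\<close>
  define V where "V = sre (subs (zvar r) v)"
  have pV: "poisson V Q = sre (poisson (subs (zvar r) v) Q)" by (simp add: V_def sre_poisson realsym_Q)
  have ppV: "poisson (poisson V Q) Q = sre (poisson (poisson (subs (zvar r) v) Q) Q)" by (simp add: pV sre_poisson realsym_Q)
  have "poisson (poisson (subs (zvar r) v) Q) Q = subs (zvar r) (emul freq (emul freq v))"
    using poisson_skew[of _ Q] by (simp add: poisson_Q_subs poisson_uminus_right)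
  then have "G + poisson (poisson V Q) Q = sre (subs (zvar r) (g + emul freq (emul freq v)))"
    using sre_real[of G] G unfolding ppV by (simp add: Word_iff subs_simps Gz[symmetric] sre_def scnj_add algebra_simps)
  moreover have "invar r (sre (subs (zvar r) (g + emul freq (emul freq v))))"
    by (rule invar_sre) (auto simp: invar_subs lookup_add v_def power2_eq_square freq_0_iff[symmetric])
  moreover have "V \<in> Word n" using v by (simp add: V_def sre_Word)
  moreover have "poisson V Q \<in> Word n" using poisson_Word[OF \<open>V \<in> Word n\<close>, of Q 2] realsym_Q homog_Q by (simp add: Word_iff)
  ultimately show ?thesis by auto
qed

end

subsection \<open>Invariants are polynomials in the actions\<close>

lemma apoly_sym_simps: "apoly_sym r (A + B) = apoly_sym r A + apoly_sym r B" 
  "apoly_sym r (A * B) = apoly_sym r A * apoly_sym r B"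
  "apoly_sym r (sg 0 c) = sconst (of_real c)" "apoly_sym r (sg (sg v 1) 1) = (case v of ACT k \<Rightarrow> action r k | AHBAR \<Rightarrow> svar HBAR)"
  "apoly_sym r (\<Sum>i\<in>I. f i) = (\<Sum>i\<in>I. apoly_sym r (f i))"
  "apoly_sym r (sg m c) = sconst (of_real c) * mev (\<lambda>v. case v of ACT k \<Rightarrow> action r k | AHBAR \<Rightarrow> svar HBAR) m"
  unfolding apoly_sym_def 
  by (simp_all add: peval_const peval_add peval_mult peval_var peval_sum peval_single del: One_nat_def)

lemma mev_sum: "mev f (\<Sum>i\<in>I. g i) = (\<Prod>i\<in>I. mev f (g i))"
  by (induction I rule: infinite_finite_induct) (auto simp: mev_add)

lemma svar_mono_expand: "(m :: 'n::finite svar \<Rightarrow>\<^sub>0 nat) = (\<Sum>k\<in>UNIV. sg (MOM k) (lk m (MOM k))) + (\<Sum>k\<in>UNIV. sg (POS k) (lk m (POS k))) + sg HBAR (lk m HBAR)"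
proof (rule poly_mapping_eqI)
  fix v
  show "lk m v = lk ((\<Sum>k\<in>UNIV. sg (MOM k) (lk m (MOM k))) + (\<Sum>k\<in>UNIV. sg (POS k) (lk m (POS k))) + sg HBAR (lk m HBAR)) v"
    by (cases v) (simp_all add: lookup_add lookup_sum lookup_single when_def)
qed

text \<open>Meant for balanced monomials, in which the position exponents repeat the momentum
  exponents.\<close>

definition action_mono :: "('n::finite svar \<Rightarrow>\<^sub>0 nat) \<Rightarrow> 'n avar \<Rightarrow>\<^sub>0 nat" where
  "action_mono m = (\<Sum>k\<in>UNIV. sg (ACT k) (lk m (MOM k))) + sg AHBAR (lk m HBAR)"

lemma zvar_product: "zvar r (MOM k) * zvar r (POS k) = sconst (if k = r then 1 else 2) * action r k"
proof (cases "k = r")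
  case False
  have 2: "sconst 2 * (sconst (1/2) * A) = A" for A :: "'a sym" by (simp add: mult.assoc[symmetric] flip: sconst_mult)
  have ii: "sconst \<i> * sconst \<i> = (- 1 :: 'a sym)" by (simp add: sconst_uminus flip: sconst_mult)
  have "(P + I * X) * (P - I * X) = P ^ 2 - (I * I) * X ^ 2" for P I X :: "'a sym"
    by (simp add: algebra_simps power2_eq_square)
  then show ?thesis using False by (simp add: action_def 2 ii)
qed (simp add: action_def)

lemma sconst_prod: "(\<Prod>i\<in>I. sconst (f i)) = sconst (\<Prod>i\<in>I. f i)"
  by (induction I rule: infinite_finite_induct) (auto simp: sconst_mult)

text \<open>A balanced pair of conjugate variables multiplies to twice the action for an oscillator
  and to the action itself at the saddle, whence the powers of two.\<close>

lemma mev_balanced: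
  assumes "\<And>k. lk m (MOM k) = lk m (POS k)"
  shows "mev (zvar r) m = sconst (of_real (\<Prod>k\<in>UNIV - {r}. 2 ^ lk m (MOM k))) * apoly_sym r (sg (action_mono m) 1)"
proof -
  have "mev (zvar r) m = (\<Prod>k\<in>UNIV. zvar r (MOM k) ^ lk m (MOM k)) * (\<Prod>k\<in>UNIV. zvar r (POS k) ^ lk m (MOM k)) * svar HBAR ^ lk m HBAR"
    by (subst svar_mono_expand) (simp add: mev_add mev_sum assms[symmetric])
  also have "\<dots> = (\<Prod>k\<in>UNIV. sconst (if k = r then 1 else 2) ^ lk m (MOM k)) * (\<Prod>k\<in>UNIV. action r k ^ lk m (MOM k)) * svar HBAR ^ lk m HBAR"
    unfolding prod.distrib[symmetric] power_mult_distrib[symmetric] zvar_product ..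
  also have "(\<Prod>k\<in>UNIV. sconst (if k = r then 1 else 2) ^ lk m (MOM k)) = sconst (of_real (\<Prod>k\<in>UNIV - {r}. 2 ^ lk m (MOM k)) :: complex)"
  proof -
    have "(\<Prod>k\<in>UNIV. sconst (if k = r then 1 else 2) ^ lk m (MOM k)) = sconst (\<Prod>k\<in>UNIV. (if k = r then 1 else 2) ^ lk m (MOM k))"
      by (simp only: sconst_power[symmetric] sconst_prod)
    also have "(\<Prod>k\<in>UNIV. (if k = r then 1 else 2 :: complex) ^ lk m (MOM k)) = (\<Prod>k\<in>UNIV - {r}. (if k = r then 1 else 2) ^ lk m (MOM k))"
      by (subst prod.remove[of _ r]) auto
    also have "\<dots> = of_real (\<Prod>k\<in>UNIV - {r}. 2 ^ lk m (MOM k))"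
      unfolding of_real_prod by (rule prod.cong) auto
    finally show ?thesis .
  qed
  finally show ?thesis by (simp add: apoly_sym_simps action_mono_def mev_add mev_sum mult.assoc)
qed

lemma realsym_apoly_sym: "realsym (apoly_sym r K)"
  by (induction K rule: poly_induct) 
    (auto simp: apoly_sym_simps intro!: realsym_add realsym_mult realsym_sconst realsym_action realsym_svar split: avar.split simp del: One_nat_def)

lemma sre_sconst_mult: "realsym P \<Longrightarrow> sre (sconst c * P) = sconst (of_real (Re c)) * P"
proof -
  assume "realsym P"
  then have "sre (sconst c * P) = sconst (1/2) * (sconst c + sconst (cnj c)) * P"
    by (simp add: sre_def realsym_iff distrib_right mult.assoc)
  also have "sconst (1/2) * (sconst c + sconst (cnj c)) = sconst (1/2 * (c + cnj c))"
    by (simp only: sconst_mult sconst_add)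
  also have "1/2 * (c + cnj c) = of_real (Re c)" by (simp add: complex_eq_iff)
  finally show ?thesis .
qed
lemma sre_sum: "sre (\<Sum>i\<in>I. f i) = (\<Sum>i\<in>I. sre (f i))"
  by (simp add: sre_def scnj_sum sum_distrib_left sum.distrib distrib_left)

text \<open>Vanishing eigenvalues mean equal exponents of conjugate variables, so only monomials in
  the actions and \<open>HBAR\<close> occur. Each of these has order two, which relates order and
  degree.\<close>

lemma invar_apoly:
  assumes "invar r G" "realsym G" "homog s G"
  shows "\<exists>K. G = apoly_sym r K \<and> (\<forall>m\<in>kys K. 2 * tdeg m = s)"
proof -
  define g where "g = subs (yvar r) G"
  have Gz: "G = subs (zvar r) g" by (simp add: g_def subs_zy)
  have g: "homog s g" unfolding g_def using assms yvar_homog by (intro subs_homog) auto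
  have bal: "lk m (MOM k) = lk m (POS k)" if "m \<in> kys g" for m k
  proof -
    have "eig r k m = 0" using assms(1) that unfolding Gz invar_subs by (simp add: in_keys_iff)
    then show ?thesis by (auto simp: eig_def split: if_splits)
  qed
  define c where "c m = (\<Prod>k\<in>UNIV - {r}. 2 ^ lk m (MOM k) :: real)" for m
  define K where "K = (\<Sum>m\<in>kys g. sg (action_mono m) (Re (lk g m * of_real (c m))))"
  have "G = (\<Sum>m\<in>kys g. sconst (lk g m * of_real (c m)) * apoly_sym r (sg (action_mono m) 1))"
    unfolding Gz subs_expand[OF finite_keys order_refl] 
    by (rule sum.cong[OF refl]) (simp add: mev_balanced bal c_def sconst_mult mult.assoc)
  \<comment> \<open>Monomials in the actions are real, so passing to the real part of
    \<open>G\<close> replaces the coefficients by their real parts.\<close>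
  then have "sre G = (\<Sum>m\<in>kys g. sconst (of_real (Re (lk g m * of_real (c m)))) * apoly_sym r (sg (action_mono m) 1))"
    by (simp only: sre_sum sre_sconst_mult realsym_apoly_sym)
  also have "\<dots> = apoly_sym r K" unfolding K_def by (simp add: apoly_sym_simps)
  finally have "G = apoly_sym r K" using sre_real[OF assms(2)] by simp
  moreover have "2 * tdeg a = s" if "a \<in> kys K" for a
  proof -
    have "a \<in> (\<Union>m\<in>kys g. kys (sg (action_mono m) (Re (lk g m * of_real (c m)))))"
      by (rule subsetD[OF keys_sum that[unfolded K_def]])
    then obtain m where m: "m \<in> kys g" and "a \<in> kys (sg (action_mono m) (Re (lk g m * of_real (c m))))" by (rule UN_E)
    then have am: "a = action_mono m" by (simp only: keys_single) (metis empty_iff singletonD)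
    have "mon_order m = (\<Sum>k\<in>UNIV. lk m (MOM k)) + (\<Sum>k\<in>UNIV. lk m (MOM k)) + 2 * lk m HBAR"
    proof -
      have ms: "mon_order (\<Sum>k\<in>I. f k) = (\<Sum>k\<in>I. mon_order (f k))" for I and f :: "'a \<Rightarrow> _"
        by (induction I rule: infinite_finite_induct) (auto simp: mon_order_add)
      show ?thesis by (subst svar_mono_expand) (simp add: mon_order_add ms bal[OF m, symmetric])
    qed
    moreover have "tdeg (action_mono m) = (\<Sum>k\<in>UNIV. lk m (MOM k)) + lk m HBAR"
    proof -
      have ts: "tdeg (\<Sum>k\<in>I. f k) = (\<Sum>k\<in>I. tdeg (f k))" for I and f :: "'a \<Rightarrow> 'a avar \<Rightarrow>\<^sub>0 nat"
        by (induction I rule: infinite_finite_induct) (auto simp: tdeg_add)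
      show ?thesis by (simp add: action_mono_def tdeg_add ts)
    qed
    moreover have "mon_order m = s" using g m by (simp add: homog_def in_keys_iff)
    ultimately show ?thesis using am by simp
  qed
  ultimately show ?thesis by blast
qed

subsection \<open>Functions of the actions\<close>

lemma fn_of_actions_apoly: "fn_of_actions r (apoly_sym r K)"
proof -
  define g where "g h a = peval complex_of_real (\<lambda>v. case v of ACT k \<Rightarrow> a k | AHBAR \<Rightarrow> of_real h) K" for h and a :: "'a \<Rightarrow> complex"
  have rm: "ring_map complex_of_real" by (simp add: ring_map_def)
  have "sym_eval h p x (apoly_sym r K) = g h (\<lambda>k. sym_eval h p x (action r k))" for h p x
    unfolding g_def
  proof (induction K rule: poly_induct)
    case (var v A)
    then show ?case by (cases v) (simp_all add: apoly_sym_simps sym_eval_mult peval_mult[OF rm] peval_var[OF rm] sym_eval_svar del: One_nat_def)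
  qed (simp_all add: apoly_sym_simps sym_eval_add peval_const[OF rm] peval_add[OF rm])
  then show ?thesis unfolding fn_of_actions_def by blast
qed

lemma fn_of_actions_invar: assumes "fn_of_actions r G" shows "invar r G"
  unfolding invar_def
proof (intro allI sym_eval_zero)
  fix k h and p x :: "real^'a"
  obtain g where g: "\<And>h (p :: real^'a) x. sym_eval h p x G = g h (\<lambda>k. sym_eval h p x (action r k))"
    using assms unfolding fn_of_actions_def by blast
  \<comment> \<open>Together with \<open>X\<close> the Hamiltonian flow of the k-th action:
    hyperbolic in the saddle plane, a rotation in the others.\<close>
  define P where "P t = (\<chi> j. if j \<noteq> k then p $ j else if k = r then exp (- t) * p $ k else cos t * p $ k - sin t * x $ k)" for t
  define X where "X t = (\<chi> j. if j \<noteq> k then x $ j else if k = r then exp t * x $ k else sin t * p $ k + cos t * x $ k)" for t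
  define P' where "P' j = (if j \<noteq> k then 0 else if k = r then - (p $ k) else - (x $ k))" for j
  define X' where "X' j = (if j \<noteq> k then 0 else if k = r then x $ k else p $ k)" for j
  have d: "((\<lambda>t. P t $ j) has_real_derivative P' j) (at 0)" "((\<lambda>t. X t $ j) has_real_derivative X' j) (at 0)" for j
    by (auto simp: P_def X_def P'_def X'_def intro!: derivative_eq_intros)
  have 0: "P 0 = p" "X 0 = x" by (auto simp: P_def X_def vec_eq_iff)
  have act: "sym_eval h (P t) (X t) (action r j) = sym_eval h p x (action r j)" for t j
  proof -
    have "(cos t * a - sin t * b)\<^sup>2 * 2 + (sin t * a + cos t * b)\<^sup>2 * 2 = a\<^sup>2 * 2 + b\<^sup>2 * 2" for a b :: real
    proof -
      have "(c * a - s * b)\<^sup>2 + (s * a + c * b)\<^sup>2 = (s\<^sup>2 + c\<^sup>2) * (a\<^sup>2 + b\<^sup>2)" for s c :: real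
        by algebra
      from this[of "cos t" "sin t"] have "(cos t * a - sin t * b)\<^sup>2 + (sin t * a + cos t * b)\<^sup>2 = ((sin t)\<^sup>2 + (cos t)\<^sup>2) * (a\<^sup>2 + b\<^sup>2)" .
      then have "(cos t * a - sin t * b)\<^sup>2 + (sin t * a + cos t * b)\<^sup>2 = a\<^sup>2 + b\<^sup>2" by (simp only: sin_cos_squared_add mult_1)
      then show ?thesis by linarith
    qed
    moreover have "exp (- t) * a * (exp t * b) = a * b" for a b :: real by (simp add: exp_minus)
    moreover have "sym_eval h (P t) (X t) (action r j) = of_real (if j = r then P t $ j * X t $ j else ((P t $ j)\<^sup>2 + (X t $ j)\<^sup>2) / 2)" for P X :: "real \<Rightarrow> real^'a"
      by (simp add: action_def sym_eval_mult sym_eval_add sym_eval_svar power2_eq_square)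
    note e = this this[of "\<lambda>_. p" "\<lambda>_. x"]
    ultimately show ?thesis unfolding e by (auto simp: P_def X_def)
  qed
  have "sym_eval h (P t) (X t) G = sym_eval h p x G" for t unfolding g[of h "P t" "X t"] g[of h p x] act ..
  then have "((\<lambda>t. sym_eval h p x G) has_vector_derivative 
     (\<Sum>j\<in>UNIV. of_real (P' j) * sym_eval h p x (spartial (MOM j) G) + of_real (X' j) * sym_eval h p x (spartial (POS j) G))) (at 0)"
    using sym_eval_deriv[of P P' 0 X X' h G, OF d] 0 by simp
  then have "(\<Sum>j\<in>UNIV. of_real (P' j) * sym_eval h p x (spartial (MOM j) G) + of_real (X' j) * sym_eval h p x (spartial (POS j) G)) = 0"
    using vector_derivative_unique_at[OF _ has_vector_derivative_const] by blast
  moreover have "(\<Sum>j\<in>UNIV. of_real (P' j) * sym_eval h p x (spartial (MOM j) G) + of_real (X' j) * sym_eval h p x (spartial (POS j) G))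
    = of_real (P' k) * sym_eval h p x (spartial (MOM k) G) + of_real (X' k) * sym_eval h p x (spartial (POS k) G)"
    by (subst sum.remove[of _ k]) (auto simp: P'_def X'_def)
  ultimately show "sym_eval h p x (poisson (action r k) G) = 0"
    by (auto simp: poisson_action sym_eval_diff sym_eval_mult sym_eval_svar P'_def X'_def split: if_splits)
qed

lemma fn_of_actions_iff: "G \<in> Word s \<Longrightarrow> fn_of_actions r G \<longleftrightarrow> invar r G"
  using fn_of_actions_invar fn_of_actions_apoly invar_apoly unfolding Word_iff by metis

text \<open>Polynomials in the actions and \<open>HBAR\<close> contain only terms of even
  order.\<close>

lemma invar_odd: assumes "invar r G" "G \<in> Word s" "odd s" shows "G = 0"
proof -
  obtain K where K: "G = apoly_sym r K" "\<forall>m\<in>kys K. 2 * tdeg m = s" using invar_apoly[of r G s] assms by (auto simp: Word_iff)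
  then have "kys K = {}" using assms(3) by fastforce
  then show ?thesis using K(1) by (simp add: apoly_sym_def peval_def)
qed

section \<open>The normal form procedure\<close>

subsection \<open>Effect of one step\<close>

text \<open>Properties of the Hamiltonian that every step preserves. A constant in order zero and
  nothing in order one cut the exponential series short at low orders.\<close>

definition admissible :: "(nat \<Rightarrow> 'n sym) \<Rightarrow> bool" where
  "admissible H \<longleftrightarrow> (\<exists>E::real. H 0 = sconst (of_real E)) \<and> H 1 = 0 \<and> (\<forall>s. H s \<in> Word s)"

lemma inv_fact_real: "1 / fact k \<in> (\<real> :: complex set)"
  by (metis Reals_of_real of_real_1 of_real_divide of_real_fact)

text \<open>What the quantum and the classical procedure have in common; orders and low-order terms
  are treated once for both.\<close>

locale bracket =
  fixes br :: "'n::finite sym \<Rightarrow> 'n sym \<Rightarrow> 'n sym"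
  assumes br_Word: "\<And>A B s t. A \<in> Word s \<Longrightarrow> B \<in> Word t \<Longrightarrow> br A B \<in> Word (s + t - 2)"
    and br_sconst: "\<And>A c. br A (sconst c) = 0"
begin

lemma br_0 [simp]: "br A 0 = 0" using br_sconst[of A 0] by simp

lemma br_pow_0: "(br A ^^ k) 0 = 0" by (induction k) auto

lemma br_pow_Word: "W \<in> Word n \<Longrightarrow> 3 \<le> n \<Longrightarrow> B \<in> Word s \<Longrightarrow> (br W ^^ k) B \<in> Word (s + k * (n - 2))"
proof (induction k)
  case (Suc k)
  have "br W ((br W ^^ k) B) \<in> Word (n + (s + k * (n - 2)) - 2)" by (rule br_Word) (use Suc in auto)
  moreover have "n + (s + k * (n - 2)) - 2 = s + Suc k * (n - 2)" using Suc by simp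
  ultimately show ?case by simp
qed simp

text \<open>With at least one bracket the argument has order at most s - (n - 2) \<le> 1, where the
  symbol is constant or zero.\<close>

lemma exp_ad_low:
  assumes "admissible H" "3 \<le> n" "s < n"
  shows "exp_ad br n W H s = H s"
proof -
  have "sconst (1 / fact k) * (br W ^^ k) (H (s - k * (n - 2))) = (if k = 0 then H s else 0)" for k
  proof (cases k)
    case (Suc j)
    have "n - 2 \<le> k * (n - 2)" using Suc by simp
    then have "s - k * (n - 2) \<le> 1" using assms by linarith
    then have "s - k * (n - 2) = 0 \<or> s - k * (n - 2) = 1" by linarith
    then have "br W (H (s - k * (n - 2))) = 0" using assms(1) unfolding admissible_def by (auto simp: br_sconst)
    then show ?thesis using Suc by (simp add: funpow_swap1 br_pow_0 del: funpow.simps) (simp add: funpow_Suc_right br_pow_0 del: funpow.simps)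
  qed simp
  then show ?thesis using finite_mult_le[of "n - 2" s] assms by (simp add: exp_ad_def)
qed

text \<open>Two or more brackets act on a term of order at most n - 2 (n - 2) \<le> 1, a constant or
  zero; a single bracket acts on order n - (n - 2) = 2.\<close>

lemma exp_ad_n:
  assumes "admissible H" "3 \<le> n"
  shows "exp_ad br n W H n = H n + br W (H 2)"
proof -
  have "sconst (1 / fact k) * (br W ^^ k) (H (n - k * (n - 2))) = (if k = 0 then H n else if k = 1 then br W (H 2) else 0)" for k
  proof -
    consider "k = 0" | "k = 1" | j where "k = Suc (Suc j)" by (metis One_nat_def not0_implies_Suc)
    then show ?thesis
    proof cases
      case 3
      have "2 * (n - 2) \<le> k * (n - 2)" using 3 by (intro mult_le_mono1) simp
      then have "n - k * (n - 2) \<le> 1" using assms by linarith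
      then have "n - k * (n - 2) = 0 \<or> n - k * (n - 2) = 1" by linarith
      then have "br W (H (n - k * (n - 2))) = 0" using assms(1) unfolding admissible_def by (auto simp: br_sconst)
      then show ?thesis using 3 by (simp add: funpow_Suc_right br_pow_0 del: funpow.simps)
    qed (use assms in auto)
  qed
  then have "exp_ad br n W H n = (\<Sum>k\<in>{k. k * (n - 2) \<le> n}. if k = 0 then H n else if k = 1 then br W (H 2) else 0)"
    by (simp add: exp_ad_def)
  also have "\<dots> = (\<Sum>k\<in>{0, 1::nat}. if k = 0 then H n else if k = 1 then br W (H 2) else 0)"
    by (rule sum.mono_neutral_right) (use finite_mult_le[of "n - 2" n] assms in auto)
  finally show ?thesis by simp
qed

lemma exp_ad_adm:
  assumes "admissible H" "3 \<le> n" "W \<in> Word n"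
  shows "admissible (exp_ad br n W H)"
proof -
  have "exp_ad br n W H s \<in> Word s" for s
    unfolding exp_ad_def
  proof (intro Word_sum Word_scale)
    fix k assume k: "k \<in> {k. k * (n - 2) \<le> s}"
    then have "(br W ^^ k) (H (s - k * (n - 2))) \<in> Word (s - k * (n - 2) + k * (n - 2))"
      using assms by (intro br_pow_Word) (auto simp: admissible_def)
    then show "(br W ^^ k) (H (s - k * (n - 2))) \<in> Word s" using k by simp
  qed (rule inv_fact_real)
  moreover have "exp_ad br n W H 0 = H 0" "exp_ad br n W H 1 = H 1" using assms by (auto intro!: exp_ad_low)
  ultimately show ?thesis using assms(1) by (simp add: admissible_def)
qed

lemma transformed_adm: 
  "admissible H \<Longrightarrow> (\<And>n. n \<in> {3..N} \<Longrightarrow> W n \<in> Word n) \<Longrightarrow> admissible (transformed br W H N)"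
  by (induction N) (auto intro!: exp_ad_adm)

lemma transformed_low: 
  assumes "admissible H" "\<And>n. n \<in> {3..N} \<Longrightarrow> W n \<in> Word n" "n \<in> {3..N}"
  shows "s < n \<Longrightarrow> transformed br W H n s = transformed br W H (n - 1) s"
    and "transformed br W H n n = transformed br W H (n - 1) n + br (W n) (transformed br W H (n - 1) 2)"
proof -
  obtain k where k: "n = Suc k" using assms(3) by (cases n) auto
  have a: "admissible (transformed br W H k)" using assms k by (intro transformed_adm) auto
  have t: "transformed br W H n = exp_ad br n (W n) (transformed br W H k)" using k assms(3) by auto
  show "s < n \<Longrightarrow> transformed br W H n s = transformed br W H (n - 1) s"
    unfolding t using exp_ad_low[OF a] assms(3) k by simp
  show "transformed br W H n n = transformed br W H (n - 1) n + br (W n) (transformed br W H (n - 1) 2)"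
    unfolding t using exp_ad_n[OF a] assms(3) k by simp
qed

lemma transformed_stable:
  assumes "admissible H" "\<And>n. n \<in> {3..N} \<Longrightarrow> W n \<in> Word n" "s \<le> n" "n \<le> N"
  shows "transformed br W H N s = transformed br W H n s"
  using assms(4,1-3)
proof (induction N rule: dec_induct)
  case (step m)
  show ?case
  proof (cases "Suc m < 3")
    case True
    then have "transformed br W H n = H" "transformed br W H (Suc m) = H" using step.hyps 
      by (cases n; simp)+
    then show ?thesis by simp
  next
    case False
    then have "transformed br W H (Suc m) s = transformed br W H m s"
      using transformed_low(1)[of H "Suc m" W "Suc m" s] step by simp
    then show ?thesis using step by simp
  qed
qed simp

lemma transformed_2:
  assumes "admissible H" "\<And>n. n \<in> {3..N} \<Longrightarrow> W n \<in> Word n" "s \<le> 2"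
  shows "transformed br W H N s = H s"
proof (cases "N < 3")
  case True
  then have "transformed br W H N = H" by (cases N) auto
  then show ?thesis by simp
next
  case False
  then have "transformed br W H N s = transformed br W H 2 s" using assms by (intro transformed_stable) auto
  also have "transformed br W H 2 = H" by (simp add: numeral_2_eq_2)
  finally show ?thesis .
qed

end

lemma transformed_cong: "(\<And>k. k \<in> {3..n} \<Longrightarrow> W k = W' k) \<Longrightarrow> transformed br W H n = transformed br W' H n"
  by (induction n) auto

interpretation moyal: bracket moyal
  by standard (auto intro: moyal_Word)

interpretation poisson: bracket poisson
  by standard (auto intro: poisson_Word)

lemma drop_hbar_action [simp]: "drop_hbar (action r k) = action r k"
  by (simp add: action_def drop_hbar_add drop_hbar_mult drop_hbar_svar power2_eq_square)

lemma exp_ad_drop: "exp_ad poisson n (drop_hbar W) (\<lambda>s. drop_hbar (H s)) s = drop_hbar (exp_ad moyal n W H s)"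
proof -
  have "drop_hbar ((moyal W ^^ k) A) = (poisson (drop_hbar W) ^^ k) (drop_hbar A)" for k A
    by (induction k) (auto simp: drop_hbar_moyal)
  then show ?thesis by (simp add: exp_ad_def drop_hbar_sum)
qed

text \<open>Since \<open>drop_hbar\<close> carries the Moyal to the Poisson bracket, it commutes
  with every step; the quantum generators thereby supply one choice of classical generators.\<close>

lemma transformed_drop: 
  "transformed poisson (\<lambda>n. drop_hbar (W n)) (\<lambda>s. drop_hbar (H s)) N = (\<lambda>s. drop_hbar (transformed moyal W H N s))"
proof (induction N)
  case (Suc n)
  then show ?case by (auto simp: exp_ad_drop)
qed simp

lemma exp_ad_hbar_free:
  assumes "drop_hbar W = W" "\<And>s. drop_hbar (H s) = H s" 
  shows "drop_hbar (exp_ad poisson n W H s) = exp_ad poisson n W H s"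
proof -
  have "drop_hbar ((poisson W ^^ k) A) = (poisson W ^^ k) A" if "drop_hbar A = A" for k A
    by (induction k) (auto simp: that assms drop_hbar_poisson)
  then show ?thesis by (simp add: exp_ad_def drop_hbar_sum assms)
qed

lemma transformed_hbar_free:
  assumes "\<And>n. n \<in> {3..N} \<Longrightarrow> drop_hbar (W n) = W n" "\<And>s. drop_hbar (H s) = H s" 
  shows "drop_hbar (transformed poisson W H N s) = transformed poisson W H N s"
  using assms by (induction N arbitrary: s) (auto intro!: exp_ad_hbar_free)

lemma admissible_drop: "admissible H \<Longrightarrow> admissible (\<lambda>s. drop_hbar (H s))"
  by (auto simp: admissible_def drop_hbar_Word)

lemma invar_drop: "invar r G \<Longrightarrow> invar r (drop_hbar G)"
  unfolding invar_def using drop_hbar_poisson[of "action r _" G] by simp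

subsection \<open>Existence of generators\<close>

context nonres
begin

lemma pdeg_Q: "poly_deg_le 2 Q"
proof -
  have "tdeg m \<le> mon_order m" for m :: "'n svar \<Rightarrow>\<^sub>0 nat"
    unfolding tdeg_def mon_order_def by (rule sum_mono) auto
  then show ?thesis using homog_Q unfolding homog_def poly_deg_le_def by metis
qed

lemma moyal_Q: "moyal A Q = poisson A Q" by (rule moyal_quadratic[OF pdeg_Q])

lemma drop_hbar_Q [simp]: "drop_hbar Q = Q"
  by (simp add: quadratic_part_def drop_hbar_add drop_hbar_sum)

lemma solve:
  assumes "G \<in> Word n"
  shows "\<exists>W\<in>Word n. invar r (G + poisson W Q)"
  using homological[OF assms] by blast

lemma solve_classical:
  assumes "G \<in> Word n" "drop_hbar G = G"
  shows "\<exists>W\<in>Word n. drop_hbar W = W \<and> invar r (G + poisson W Q)"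
proof -
  obtain W where W: "W \<in> Word n" "invar r (G + poisson W Q)" using solve[OF assms(1)] by blast
  have "invar r (G + poisson (drop_hbar W) Q)"
    using invar_drop[OF W(2)] by (simp add: drop_hbar_add drop_hbar_poisson assms)
  then show ?thesis using W(1) by (intro bexI[of _ "drop_hbar W"]) (auto simp: drop_hbar_Word)
qed

text \<open>Each equation depends on the generators already chosen. The predicate \<open>P\<close>
  carries a side condition through the recursion: trivial in the quantum case, absence of
  \<open>HBAR\<close> in the classical case.\<close>

lemma generators_exist:
  assumes "bracket br" and brQ: "\<And>A. br A Q = poisson A Q"
    and H: "admissible H" "H 2 = Q" 
    and P: "\<And>n W. (\<And>k. k \<in> {3..n} \<Longrightarrow> W k \<in> Word k \<and> P (W k)) \<Longrightarrow> 2 \<le> n \<Longrightarrow> 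
      \<exists>V\<in>Word (Suc n). P V \<and> invar r (transformed br W H n (Suc n) + poisson V Q)"
  shows "\<exists>W. \<forall>n\<in>{3..N}. W n \<in> Word n \<and> P (W n) \<and> invar r (transformed br W H n n)"
proof (induction N)
  case (Suc n)
  interpret bracket br by fact
  obtain W where W: "\<forall>n\<in>{3..n}. W n \<in> Word n \<and> P (W n) \<and> invar r (transformed br W H n n)" using Suc by blast
  show ?case
  proof (cases "Suc n < 3")
    case True
    then show ?thesis by auto
  next
    case False
    then obtain V where V: "V \<in> Word (Suc n)" "P V" "invar r (transformed br W H n (Suc n) + poisson V Q)"
      using P[of n W] W by auto
    \<comment> \<open>Only the last generator is changed, so the transforms up to order n stay the
      same.\<close>
    define W' where "W' = W(Suc n := V)"
    have c: "transformed br W' H k = transformed br W H k" if "k \<le> n" for k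
      by (rule transformed_cong) (use that in \<open>auto simp: W'_def\<close>)
    have Wn: "W' k \<in> Word k" if "k \<in> {3..Suc n}" for k using that W V by (auto simp: W'_def le_Suc_eq)
    have "transformed br W' H (Suc n) (Suc n) = transformed br W' H n (Suc n) + br V (transformed br W' H n 2)"
      using transformed_low(2)[of H "Suc n" W' "Suc n"] H Wn False by (simp add: W'_def)
    also have "transformed br W' H n 2 = Q" using transformed_2[of H n W' 2] H Wn by simp
    finally have "invar r (transformed br W' H (Suc n) (Suc n))" using V(3) by (simp add: brQ c)
    then have "\<forall>n\<in>{3..Suc n}. W' n \<in> Word n \<and> P (W' n) \<and> invar r (transformed br W' H n n)"
      using W V c by (auto simp: W'_def le_Suc_eq)
    then show ?thesis by blast
  qed
qed auto

lemma moyal_generators: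
  assumes "admissible H" "H 2 = Q"
  shows "\<exists>W. \<forall>n\<in>{3..N}. W n \<in> Word n \<and> invar r (transformed moyal W H n n)"
proof -
  have "\<exists>W. \<forall>n\<in>{3..N}. W n \<in> Word n \<and> True \<and> invar r (transformed moyal W H n n)"
  proof (rule generators_exist[OF moyal.bracket_axioms moyal_Q assms])
    fix n and W :: "nat \<Rightarrow> 'n sym" assume "\<And>k. k \<in> {3..n} \<Longrightarrow> W k \<in> Word k \<and> True" "2 \<le> n"
    then have "transformed moyal W H n (Suc n) \<in> Word (Suc n)"
      using moyal.transformed_adm[OF assms(1), of n W] by (simp add: admissible_def)
    then show "\<exists>V\<in>Word (Suc n). True \<and> invar r (transformed moyal W H n (Suc n) + poisson V Q)" using solve by simp
  qed
  then show ?thesis by simp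
qed

lemma poisson_generators:
  assumes "admissible H" "H 2 = Q" "\<And>s. drop_hbar (H s) = H s"
  shows "\<exists>W. \<forall>n\<in>{3..N}. W n \<in> Word n \<and> drop_hbar (W n) = W n \<and> invar r (transformed poisson W H n n)"
proof (rule generators_exist[OF poisson.bracket_axioms refl assms(1,2)])
  fix n and W :: "nat \<Rightarrow> 'n sym" assume W: "\<And>k. k \<in> {3..n} \<Longrightarrow> W k \<in> Word k \<and> drop_hbar (W k) = W k" "2 \<le> n"
  then have "transformed poisson W H n (Suc n) \<in> Word (Suc n)"
    using poisson.transformed_adm[OF assms(1), of n W] by (simp add: admissible_def)
  moreover have "drop_hbar (transformed poisson W H n (Suc n)) = transformed poisson W H n (Suc n)"
    using W by (intro transformed_hbar_free assms) auto
  ultimately show "\<exists>V\<in>Word (Suc n). drop_hbar V = V \<and> invar r (transformed poisson W H n (Suc n) + poisson V Q)" 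
    by (rule solve_classical)
qed

end

subsection \<open>Uniqueness of the classical normal form\<close>

lemma lookup_euler: "lk (svar v * spartial v A) m = of_nat (lk m v) * lk A m"
proof (cases "lk m v = 0")
  case False
  have e: "m - sg v 1 + sg v 1 = m" using mono_split[OF False] by (simp add: add.commute)
  show ?thesis unfolding lookup_svar_times lookup_spartial e using False
    by (simp add: lookup_minus del: of_nat_Suc of_nat_add)
qed (simp add: lookup_svar_times)

lemma mon_order_expand: "mon_order (m :: 'n::finite svar \<Rightarrow>\<^sub>0 nat) = (\<Sum>k\<in>UNIV. lk m (MOM k) + lk m (POS k)) + 2 * lk m HBAR"
proof -
  have ms: "mon_order (\<Sum>k\<in>I. f k) = (\<Sum>k\<in>I. mon_order (f k))" for I and f :: "'n \<Rightarrow> 'n svar \<Rightarrow>\<^sub>0 nat"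
    by (induction I rule: infinite_finite_induct) (auto simp: mon_order_add)
  show ?thesis by (subst svar_mono_expand) (simp add: mon_order_add ms sum.distrib)
qed

text \<open>Without \<open>HBAR\<close> the order is the plain degree in momenta and positions, so
  it is the factor in Euler's identity.\<close>

lemma euler:
  fixes A :: "'n::finite sym"
  assumes "homog s A" "drop_hbar A = A"
  shows "(\<Sum>k\<in>UNIV. svar (MOM k) * spartial (MOM k) A + svar (POS k) * spartial (POS k) A) = sconst (of_nat s) * A"
proof (rule poly_mapping_eqI)
  fix m
  have "lk (\<Sum>k\<in>UNIV. svar (MOM k) * spartial (MOM k) A + svar (POS k) * spartial (POS k) A) m = 
    (\<Sum>k\<in>UNIV. of_nat (lk m (MOM k) + lk m (POS k))) * lk A m"
    by (simp add: lookup_sum lookup_add lookup_euler sum_distrib_right distrib_right)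
  also have "\<dots> = of_nat s * lk A m"
  proof (cases "lk A m = 0")
    case False
    then have "lk m HBAR = 0" using assms(2) lookup_drop_hbar[of A m] by metis
    moreover have "mon_order m = s" using False assms(1) by (simp add: homog_def)
    ultimately have "s = (\<Sum>k\<in>UNIV. lk m (MOM k) + lk m (POS k))" by (simp add: mon_order_expand)
    then show ?thesis by simp
  qed simp
  finally show "lk (\<Sum>k\<in>UNIV. svar (MOM k) * spartial (MOM k) A + svar (POS k) * spartial (POS k) A) m = lk (sconst (of_nat s) * A) m"
    by simp
qed

text \<open>Poincare lemma: a derivation of the Poisson algebra that raises the degree is Hamiltonian,
  and by Euler's identity its Hamiltonian is given by an explicit formula.\<close>

lemma poisson_derivation_inner:
  fixes D :: "'n::finite sym \<Rightarrow> 'n sym"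
  assumes add: "\<And>A B. D (A + B) = D A + D B" 
    and mult: "\<And>A B. D (A * B) = D A * B + A * D B"
    and br: "\<And>A B. D (poisson A B) = poisson (D A) B + poisson A (D B)"
    and const: "\<And>c. D (sconst c) = 0" and hbar: "D (svar HBAR) = 0"
    and Word: "\<And>v. v \<noteq> HBAR \<Longrightarrow> D (svar v) \<in> Word (Suc d) \<and> drop_hbar (D (svar v)) = D (svar v)"
  shows "\<exists>\<theta>\<in>Word (d + 2). drop_hbar \<theta> = \<theta> \<and> (\<forall>A. D A = poisson \<theta> A)"
proof -
  define a where "a v = D (svar v)" for v
  \<comment> \<open>Closedness: brackets of variables are constants, so applying \<open>D\<close> to
    the canonical relations gives symmetry of the derivatives.\<close>
  have c: "conj_deriv v (a u) = conj_deriv u (a v)" for u v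
  proof -
    have "D (poisson (svar u) (svar v)) = 0"
      using const[of 0] const[of 1] const[of "-1"] by (cases u; cases v) (auto simp: poisson_svar_right spartial_svar sconst_uminus)
    then have "poisson (a u) (svar v) - poisson (a v) (svar u) = 0"
      unfolding br a_def using poisson_skew[of "svar u"] by simp
    then show ?thesis by (simp add: poisson_svar_right)
  qed
  \<comment> \<open>The closed form given by the values of \<open>D\<close> on the variables,
    contracted with the radial vector field.\<close>
  define S where "S = (\<Sum>k\<in>UNIV. svar (MOM k) * a (POS k) - svar (POS k) * a (MOM k))"
  \<comment> \<open>Each \<open>a v\<close> has order d + 1, which is Euler's factor;
    differentiating the coordinates in \<open>S\<close> adds one more copy of
    \<open>a v\<close>.\<close>
  define \<theta> where "\<theta> = sconst (1 / of_nat (d + 2)) * S"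
  have aW: "a v \<in> Word (Suc d)" "drop_hbar (a v) = a v" "homog (Suc d) (a v)" if "v \<noteq> HBAR" for v
    using Word[OF that] by (auto simp: a_def Word_iff)
  have SW: "S \<in> Word (d + 2)"
    unfolding S_def
  proof (intro Word_sum Word_diff)
    fix k :: 'n
    have m: "svar (MOM k) \<in> Word 1" "svar (POS k) \<in> Word 1"
      using homog_svar[of "MOM k"] homog_svar[of "POS k"] by (simp_all add: Word_iff realsym_svar)
    show "svar (MOM k) * a (POS k) \<in> Word (d + 2)" "svar (POS k) * a (MOM k) \<in> Word (d + 2)"
      using Word_mult[OF m(1) aW(1)[of "POS k"]] Word_mult[OF m(2) aW(1)[of "MOM k"]] by simp_all
  qed
  have \<theta>W: "\<theta> \<in> Word (d + 2)" unfolding \<theta>_def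
    by (rule Word_scale[OF _ SW]) (metis Reals_1 Reals_divide Reals_of_nat)
  have \<theta>h: "drop_hbar \<theta> = \<theta>" unfolding \<theta>_def S_def
    by (simp add: drop_hbar_sum drop_hbar_diff drop_hbar_mult drop_hbar_svar aW(2))
  have Sd: "poisson S (svar v) = sconst (of_nat (d + 2)) * a v" if "v \<noteq> HBAR" for v
  proof -
    have "poisson S (svar v) = (\<Sum>k\<in>UNIV. poisson (svar (MOM k)) (svar v) * a (POS k) - poisson (svar (POS k)) (svar v) * a (MOM k))
      - (\<Sum>k\<in>UNIV. svar (MOM k) * conj_deriv v (a (POS k)) - svar (POS k) * conj_deriv v (a (MOM k)))"
      unfolding S_def by (simp add: poisson_sum_left poisson_diff_left poisson_mult_left poisson_svar_right[of "a _"] sum_subtractf sum.distrib sum_negf algebra_simps)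
    also have "(\<Sum>k\<in>UNIV. poisson (svar (MOM k)) (svar v) * a (POS k) - poisson (svar (POS k)) (svar v) * a (MOM k)) = a v"
    proof (cases v)
      case (MOM j)
      have "poisson (svar (MOM k)) (svar v) * a (POS k) - poisson (svar (POS k)) (svar v) * a (MOM k) = (if k = j then a v else 0)" for k
        by (auto simp: poisson_svar_right MOM spartial_svar)
      then show ?thesis by simp
    next
      case (POS j)
      have "poisson (svar (MOM k)) (svar v) * a (POS k) - poisson (svar (POS k)) (svar v) * a (MOM k) = (if k = j then a v else 0)" for k
        by (auto simp: poisson_svar_right POS spartial_svar)
      then show ?thesis by simp
    qed (use that in simp)
    also have "(\<Sum>k\<in>UNIV. svar (MOM k) * conj_deriv v (a (POS k)) - svar (POS k) * conj_deriv v (a (MOM k))) = 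
      - (\<Sum>k\<in>UNIV. svar (MOM k) * spartial (MOM k) (a v) + svar (POS k) * spartial (POS k) (a v))"
      unfolding c[of v] by (simp add: sum_negf[symmetric])
    also have "\<dots> = - (sconst (of_nat (Suc d)) * a v)" using euler[OF aW(3)[OF that] aW(2)[OF that]] by simp
    finally show ?thesis by (simp add: sconst_add sconst_numeral algebra_simps)
  qed
  have \<theta>v: "poisson \<theta> (svar v) = a v" for v
  proof (cases "v = HBAR")
    case True
    then show ?thesis using hbar by (simp add: poisson_svar_right a_def)
  next
    case False
    have "sconst (1 / of_nat (d + 2)) * sconst (of_nat (d + 2)) = (1 :: 'n sym)"
      unfolding sconst_mult[symmetric] by (simp del: of_nat_add of_nat_Suc)
    then show ?thesis unfolding \<theta>_def poisson_sconst_mult Sd[OF False] by (simp add: mult.assoc[symmetric])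
  qed
  have "D A = poisson \<theta> A" for A
  proof (induction A rule: sym_induct)
    case (var v A)
    then show ?case by (simp add: mult poisson_mult_right \<theta>v a_def)
  qed (simp_all add: const add poisson_add_right)
  then show ?thesis using \<theta>W \<theta>h by blast
qed

text \<open>Divided powers of the bracket, for which the Leibniz rule has no binomial
  coefficients.\<close>

definition ead :: "'n::finite sym \<Rightarrow> nat \<Rightarrow> 'n sym \<Rightarrow> 'n sym" where
  "ead W k A = sconst (1 / fact k) * (poisson W ^^ k) A"

lemma ead_Suc: "sconst (of_nat (Suc k)) * ead W (Suc k) A = poisson W (ead W k A)"
proof -
  have "of_nat (Suc k) * (1 / fact (Suc k)) = (1 / fact k :: complex)" by (simp add: fact_Suc del: of_nat_Suc)
  then show ?thesis unfolding ead_def poisson_sconst_mult mult.assoc[symmetric] sconst_mult[symmetric] by simp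
qed

lemma ead_0 [simp]: "ead W 0 A = A" by (simp add: ead_def)

lemma ead_add: "ead W k (A + B) = ead W k A + ead W k B"
proof -
  have "(poisson W ^^ k) (A + B) = (poisson W ^^ k) A + (poisson W ^^ k) B" by (induction k) (auto simp: poisson_add_right)
  then show ?thesis by (simp add: ead_def distrib_left)
qed

lemma ead_zero [simp]: "ead W k 0 = 0" using ead_add[of W k 0 0] by simp

lemma ead_sum: "ead W k (\<Sum>i\<in>I. f i) = (\<Sum>i\<in>I. ead W k (f i))"
  by (induction I rule: infinite_finite_induct) (auto simp: ead_add)

lemma exp_ad_ead: "exp_ad poisson n W F s = (\<Sum>k | k * (n - 2) \<le> s. ead W k (F (s - k * (n - 2))))"
  by (simp add: exp_ad_def ead_def)

lemma sconst_cancel: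
  fixes X Y :: "'n sym"
  assumes a: "sconst (of_nat (Suc k)) * X = sconst (of_nat (Suc k)) * Y"
  shows "X = Y"
proof -
  have e: "sconst (1 / of_nat (Suc k)) * (sconst (of_nat (Suc k)) * Z) = Z" for Z :: "'n sym"
    unfolding mult.assoc[symmetric] sconst_mult[symmetric] by (simp del: of_nat_Suc)
  show "X = Y" using e[of X] e[of Y] unfolding a by simp
qed

text \<open>Any bilinear operation of which the bracket with \<open>W\<close> is a derivation;
  instances are the product and, by the Jacobi identity, the bracket itself.\<close>

locale leibniz =
  fixes bop :: "'n::finite sym \<Rightarrow> 'n sym \<Rightarrow> 'n sym" and W :: "'n sym"
  assumes bop_add_left: "\<And>A A' B. bop (A + A') B = bop A B + bop A' B" and bop_add_right: "\<And>A B B'. bop A (B + B') = bop A B + bop A B'"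
    and bop_sconst: "\<And>c A B. bop (sconst c * A) B = sconst c * bop A B" "\<And>c A B. bop A (sconst c * B) = sconst c * bop A B"
    and bop_leibniz: "\<And>A B. poisson W (bop A B) = bop (poisson W A) B + bop A (poisson W B)"
begin

lemma bop_0: "bop 0 B = 0" "bop A 0 = 0"
  using bop_sconst(1)[of 0 0 B] bop_sconst(2)[of A 0 0] by simp_all

lemma bop_sum_left: "bop (\<Sum>i\<in>I. f i) B = (\<Sum>i\<in>I. bop (f i) B)"
  by (induction I rule: infinite_finite_induct) (auto simp: bop_add_left bop_0)
lemma bop_sum_right: "bop A (\<Sum>i\<in>I. f i) = (\<Sum>i\<in>I. bop A (f i))"
  by (induction I rule: infinite_finite_induct) (auto simp: bop_add_right bop_0)

text \<open>After multiplication by k + 1, the splitting into a and k + 1 - a undoes one division by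
  a factorial in either factor.\<close>

lemma ead_bop: "ead W k (bop A B) = (\<Sum>a\<le>k. bop (ead W a A) (ead W (k - a) B))"
proof (induction k)
  case (Suc k)
  let ?F = "\<lambda>a. bop (ead W a A) (ead W (Suc k - a) B)"
  have "sconst (of_nat (Suc k)) * ead W (Suc k) (bop A B) = (\<Sum>a\<le>k. bop (poisson W (ead W a A)) (ead W (k - a) B)) + (\<Sum>a\<le>k. bop (ead W a A) (poisson W (ead W (k - a) B)))"
    unfolding ead_Suc Suc poisson_sum_right bop_leibniz sum.distrib ..
  also have "\<dots> = (\<Sum>a\<le>Suc k. sconst (of_nat a) * ?F a) + (\<Sum>a\<le>Suc k. sconst (of_nat (Suc k - a)) * ?F a)"
  proof -
    have 1: "(\<Sum>a\<le>Suc k. sconst (of_nat a) * ?F a) = (\<Sum>a\<le>k. bop (poisson W (ead W a A)) (ead W (k - a) B))"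
      unfolding sum.atMost_Suc_shift ead_Suc[symmetric] bop_sconst by simp
    have "(\<Sum>a\<le>Suc k. sconst (of_nat (Suc k - a)) * ?F a) = (\<Sum>a\<le>k. sconst (of_nat (Suc k - a)) * ?F a)" by simp
    also have "\<dots> = (\<Sum>a\<le>k. bop (ead W a A) (poisson W (ead W (k - a) B)))"
    proof (rule sum.cong[OF refl])
      fix a assume "a \<in> {..k}"
      then have "Suc k - a = Suc (k - a)" by auto
      then show "sconst (of_nat (Suc k - a)) * ?F a = bop (ead W a A) (poisson W (ead W (k - a) B))"
        by (simp only: ead_Suc[symmetric] bop_sconst)
    qed
    finally show ?thesis using 1 by simp
  qed
  also have "\<dots> = (\<Sum>a\<le>Suc k. sconst (of_nat (Suc k)) * ?F a)"
    unfolding sum.distrib[symmetric] by (rule sum.cong[OF refl]) (simp add: distrib_right[symmetric] sconst_add[symmetric] of_nat_diff del: of_nat_Suc)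
  also have "\<dots> = sconst (of_nat (Suc k)) * (\<Sum>a\<le>Suc k. ?F a)" by (simp only: sum_distrib_left)
  finally show ?case by (rule sconst_cancel)
qed simp

text \<open>The exponential of a derivation is multiplicative; as each bracket with \<open>W\<close>
  raises the order by n - 2, only the bookkeeping of orders has to be added.\<close>

lemma exp_ad_bop:
  assumes n: "3 \<le> n"
  shows "exp_ad poisson n W (\<lambda>s. \<Sum>i\<le>s. bop (F i) (G (s - i))) s = (\<Sum>i\<le>s. bop (exp_ad poisson n W F i) (exp_ad poisson n W G (s - i)))"
proof -
  define m where "m = n - 2"
  have m: "0 < m" using n by (simp add: m_def)
  have "exp_ad poisson n W (\<lambda>s. \<Sum>i\<le>s. bop (F i) (G (s - i))) s = 
    (\<Sum>k | k * m \<le> s. \<Sum>i\<le>s - k * m. \<Sum>a\<le>k. bop (ead W a (F i)) (ead W (k - a) (G (s - k * m - i))))"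
    unfolding exp_ad_ead m_def[symmetric] ead_sum ead_bop ..
  also have "\<dots> = (\<Sum>(k, i, a)\<in>(SIGMA k:{k. k * m \<le> s}. {..s - k * m} \<times> {..k}). bop (ead W a (F i)) (ead W (k - a) (G (s - k * m - i))))"
    by (subst sum.Sigma[symmetric]) (auto simp: finite_mult_le[OF m] sum.cartesian_product intro!: sum.cong)
  \<comment> \<open>Here a and b count the brackets on the two factors, and t is the order reached
    by the first factor.\<close>
  also have "\<dots> = (\<Sum>(t, a, b)\<in>(SIGMA t:{..s}. {a. a * m \<le> t} \<times> {b. b * m \<le> s - t}). bop (ead W a (F (t - a * m))) (ead W b (G (s - t - b * m))))"
    by (rule sum.reindex_bij_witness[of _ "\<lambda>(t, a, b). (a + b, t - a * m, a)" "\<lambda>(k, i, a). (i + a * m, a, k - a)"])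
      (auto simp: distrib_right diff_mult_distrib le_diff_conv2 add.commute mult_le_mono1 le_trans[OF add_left_mono[OF mult_le_mono1]])
  also have "\<dots> = (\<Sum>t\<le>s. \<Sum>a | a * m \<le> t. \<Sum>b | b * m \<le> s - t. bop (ead W a (F (t - a * m))) (ead W b (G (s - t - b * m))))"
    by (subst sum.Sigma[symmetric]) (auto simp: finite_mult_le[OF m] sum.cartesian_product intro!: sum.cong)
  also have "\<dots> = (\<Sum>i\<le>s. bop (exp_ad poisson n W F i) (exp_ad poisson n W G (s - i)))"
    unfolding exp_ad_ead m_def[symmetric] bop_sum_left bop_sum_right
    by (rule sum.cong[OF refl]) (rule sum.swap)
  finally show ?thesis .
qed

end

lemma leibniz_times: "leibniz (*) W"
  by standard (simp_all add: distrib_left distrib_right mult_ac poisson_mult_right)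

lemma leibniz_poisson: "leibniz poisson W"
  by standard (simp_all add: poisson_add_left poisson_add_right poisson_sconst_mult, rule poisson_jacobi)

text \<open>A graded family \<open>\<Phi>\<close> of linear maps, \<open>\<Phi> d\<close> raising the order by \<open>d\<close>, whose formal sum is an
  automorphism of the Poisson algebra that is tangent to the identity.\<close>

definition poisson_aut :: "(nat \<Rightarrow> 'n::finite sym \<Rightarrow> 'n sym) \<Rightarrow> bool" where
  "poisson_aut \<Phi> \<longleftrightarrow> (\<forall>A. \<Phi> 0 A = A) \<and> (\<forall>d A B. \<Phi> d (A + B) = \<Phi> d A + \<Phi> d B) \<and>
     (\<forall>d A B. \<Phi> d (A * B) = (\<Sum>i\<le>d. \<Phi> i A * \<Phi> (d - i) B)) \<and>
     (\<forall>d A B. \<Phi> d (poisson A B) = (\<Sum>i\<le>d. poisson (\<Phi> i A) (\<Phi> (d - i) B))) \<and>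
     (\<forall>d>0. \<forall>c. \<Phi> d (sconst c) = 0) \<and> (\<forall>d>0. \<Phi> d (svar HBAR) = 0) \<and>
     (\<forall>d s. \<forall>A\<in>Word s. \<Phi> d A \<in> Word (s + d)) \<and>
     (\<forall>d A. drop_hbar A = A \<longrightarrow> drop_hbar (\<Phi> d A) = \<Phi> d A)"

lemma poisson_aut_Word: "poisson_aut \<Phi> \<Longrightarrow> A \<in> Word s \<Longrightarrow> \<Phi> d A \<in> Word (s + d)"
  and poisson_aut_hbar: "poisson_aut \<Phi> \<Longrightarrow> drop_hbar A = A \<Longrightarrow> drop_hbar (\<Phi> d A) = \<Phi> d A"
  by (simp_all add: poisson_aut_def)

lemma poisson_aut_id: "poisson_aut (\<lambda>d A. if d = 0 then A else 0)"
  unfolding poisson_aut_def by (auto simp: if_distrib[of "\<lambda>x. x * _"] if_distrib[of "\<lambda>x. poisson x _"] cong: if_cong)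

lemma ead_Word: assumes "W \<in> Word n" "3 \<le> n" "A \<in> Word s" shows "ead W k A \<in> Word (s + k * (n - 2))"
  unfolding ead_def by (rule Word_scale) (use poisson.br_pow_Word[OF assms] inv_fact_real in auto)

text \<open>\<open>exp_ad_bop\<close> yields multiplicativity for the product and for the bracket.
  The exponential begins with the identity and otherwise raises the order, so grade zero remains the
  identity.\<close>

lemma poisson_aut_exp:
  assumes \<Phi>: "poisson_aut \<Phi>" and W: "W \<in> Word n" "3 \<le> n" "drop_hbar W = W"
  shows "poisson_aut (\<lambda>d A. exp_ad poisson n W (\<lambda>s. \<Phi> s A) d)"
proof -
  interpret T: leibniz "(*)" W by (rule leibniz_times)
  interpret P: leibniz poisson W by (rule leibniz_poisson)
  have m: "0 < n - 2" using W by simp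
  note fin = finite_mult_le[OF m]
  have z: "(poisson W ^^ k) A = 0" if "poisson W A = 0" "k > 0" for k A
    using that by (cases k) (auto simp: funpow_Suc_right poisson.br_pow_0 simp del: funpow.simps)
  have const: "exp_ad poisson n W (\<lambda>s. \<Phi> s A) d = 0" if "d > 0" "poisson W A = 0" "\<And>d. d > 0 \<Longrightarrow> \<Phi> d A = 0" for A d
  proof -
    have "ead W k (\<Phi> (d - k * (n - 2)) A) = 0" for k
    proof (cases "d - k * (n - 2) = 0")
      case True
      then have "k > 0" using that(1) by (cases k) auto
      then show ?thesis using True z[OF that(2)] \<Phi> by (simp add: ead_def poisson_aut_def)
    qed (simp add: that)
    then show ?thesis by (simp add: exp_ad_ead)
  qed
  show ?thesis
    unfolding poisson_aut_def
  proof (intro conjI allI impI ballI)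
    fix A
    have "{k. k * (n - 2) \<le> 0} = {0}" using m by auto
    then show "exp_ad poisson n W (\<lambda>s. \<Phi> s A) 0 = A" using \<Phi> by (simp add: exp_ad_ead poisson_aut_def)
  next
    fix d A B
    show "exp_ad poisson n W (\<lambda>s. \<Phi> s (A + B)) d = exp_ad poisson n W (\<lambda>s. \<Phi> s A) d + exp_ad poisson n W (\<lambda>s. \<Phi> s B) d"
      using \<Phi> by (simp add: exp_ad_ead poisson_aut_def ead_add sum.distrib)
    have "(\<lambda>s. \<Phi> s (A * B)) = (\<lambda>s. \<Sum>i\<le>s. \<Phi> i A * \<Phi> (s - i) B)" using \<Phi> by (simp add: poisson_aut_def)
    then show "exp_ad poisson n W (\<lambda>s. \<Phi> s (A * B)) d = (\<Sum>i\<le>d. exp_ad poisson n W (\<lambda>s. \<Phi> s A) i * exp_ad poisson n W (\<lambda>s. \<Phi> s B) (d - i))"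
      using T.exp_ad_bop[OF W(2), of "\<lambda>s. \<Phi> s A" "\<lambda>s. \<Phi> s B" d] by simp
    have "(\<lambda>s. \<Phi> s (poisson A B)) = (\<lambda>s. \<Sum>i\<le>s. poisson (\<Phi> i A) (\<Phi> (s - i) B))" using \<Phi> by (simp add: poisson_aut_def)
    then show "exp_ad poisson n W (\<lambda>s. \<Phi> s (poisson A B)) d = (\<Sum>i\<le>d. poisson (exp_ad poisson n W (\<lambda>s. \<Phi> s A) i) (exp_ad poisson n W (\<lambda>s. \<Phi> s B) (d - i)))"
      using P.exp_ad_bop[OF W(2), of "\<lambda>s. \<Phi> s A" "\<lambda>s. \<Phi> s B" d] by simp
  next
    fix d :: nat and c :: complex assume "d > 0"
    then show "exp_ad poisson n W (\<lambda>s. \<Phi> s (sconst c)) d = 0" using \<Phi> by (intro const) (auto simp: poisson_aut_def)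
  next
    fix d :: nat assume "d > 0"
    then show "exp_ad poisson n W (\<lambda>s. \<Phi> s (svar HBAR)) d = 0" using \<Phi> by (intro const) (auto simp: poisson_aut_def poisson_svar_right)
  next
    fix d s :: nat and A :: "'a sym" assume A: "A \<in> Word s"
    show "exp_ad poisson n W (\<lambda>s. \<Phi> s A) d \<in> Word (s + d)"
      unfolding exp_ad_ead
    proof (rule Word_sum)
      fix k assume k: "k \<in> {k. k * (n - 2) \<le> d}"
      have "\<Phi> (d - k * (n - 2)) A \<in> Word (s + (d - k * (n - 2)))" using \<Phi> A by (simp add: poisson_aut_def)
      from ead_Word[OF W(1,2) this, of k] show "ead W k (\<Phi> (d - k * (n - 2)) A) \<in> Word (s + d)" using k by simp
    qed
  next
    fix d and A :: "'a sym" assume "drop_hbar A = A"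
    then show "drop_hbar (exp_ad poisson n W (\<lambda>s. \<Phi> s A) d) = exp_ad poisson n W (\<lambda>s. \<Phi> s A) d"
      using \<Phi> by (intro exp_ad_hbar_free W) (auto simp: poisson_aut_def)
  qed
qed

definition aut_apply :: "(nat \<Rightarrow> 'n sym \<Rightarrow> 'n sym) \<Rightarrow> (nat \<Rightarrow> 'n sym) \<Rightarrow> nat \<Rightarrow> 'n sym" where
  "aut_apply \<Phi> H s = (\<Sum>d\<le>s. \<Phi> d (H (s - d)))"

lemma aut_apply_exp:
  assumes n: "3 \<le> n"
  shows "aut_apply (\<lambda>d A. exp_ad poisson n W (\<lambda>s. \<Phi> s A) d) H = exp_ad poisson n W (aut_apply \<Phi> H)"
proof (rule ext)
  fix s
  define m where "m = n - 2"
  have m: "0 < m" using n by (simp add: m_def)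
  have "aut_apply (\<lambda>d A. exp_ad poisson n W (\<lambda>s. \<Phi> s A) d) H s = (\<Sum>d\<le>s. \<Sum>k | k * m \<le> d. ead W k (\<Phi> (d - k * m) (H (s - d))))"
    by (simp add: aut_apply_def exp_ad_ead m_def)
  also have "\<dots> = (\<Sum>(d, k)\<in>(SIGMA d:{..s}. {k. k * m \<le> d}). ead W k (\<Phi> (d - k * m) (H (s - d))))"
    by (rule sum.Sigma) (auto simp: finite_mult_le[OF m])
  also have "\<dots> = (\<Sum>(k, d)\<in>(SIGMA k:{k. k * m \<le> s}. {..s - k * m}). ead W k (\<Phi> d (H (s - k * m - d))))"
    by (rule sum.reindex_bij_witness[of _ "\<lambda>(k, d). (d + k * m, k)" "\<lambda>(d, k). (k, d - k * m)"]) (auto simp: add.commute)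
  also have "\<dots> = (\<Sum>k | k * m \<le> s. \<Sum>d\<le>s - k * m. ead W k (\<Phi> d (H (s - k * m - d))))"
    by (rule sum.Sigma[symmetric]) (auto simp: finite_mult_le[OF m])
  also have "\<dots> = exp_ad poisson n W (aut_apply \<Phi> H) s"
    by (simp add: aut_apply_def exp_ad_ead m_def ead_sum)
  finally show "aut_apply (\<lambda>d A. exp_ad poisson n W (\<lambda>s. \<Phi> s A) d) H s = exp_ad poisson n W (aut_apply \<Phi> H) s" .
qed

text \<open>The automorphism depends on the generators alone and is the same for all
  \<open>H\<close>; this allows two procedures to be compared on arbitrary symbols.\<close>

lemma transformed_paut:
  assumes "\<And>n. n \<in> {3..N} \<Longrightarrow> W n \<in> Word n \<and> drop_hbar (W n) = W n"
  shows "\<exists>\<Phi>. poisson_aut \<Phi> \<and> (\<forall>H. transformed poisson W H N = aut_apply \<Phi> H)"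
  using assms
proof (induction N)
  case 0
  show ?case
    by (intro exI[of _ "\<lambda>d A. if d = 0 then A else 0"] conjI poisson_aut_id) (auto simp: aut_apply_def fun_eq_iff)
next
  case (Suc n)
  then obtain \<Phi> where \<Phi>: "poisson_aut \<Phi>" "\<And>H. transformed poisson W H n = aut_apply \<Phi> H" by force
  show ?case
  proof (cases "Suc n < 3")
    case True
    then have "transformed poisson W H (Suc n) = transformed poisson W H n" for H by (cases n) auto
    then show ?thesis using \<Phi> by auto
  next
    case False
    then show ?thesis 
      using Suc.prems[of "Suc n"] \<Phi>
      by (intro exI[of _ "\<lambda>d A. exp_ad poisson (Suc n) (W (Suc n)) (\<lambda>s. \<Phi> s A) d"] conjI poisson_aut_exp) (simp_all add: aut_apply_exp)
  qed
qed

text \<open>\<open>A\<close> is a polynomial in the actions, each of which commutes with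
  \<open>B\<close>, so the product rule applies.\<close>

lemma invar_poisson: assumes "invar r A" "A \<in> Word s" "invar r B" shows "poisson A B = 0"
proof -
  obtain K where "A = apoly_sym r K" using invar_apoly[of r A s] assms by (auto simp: Word_iff)
  moreover have "poisson (apoly_sym r K) B = 0"
  proof (induction K rule: poly_induct)
    case (var v K)
    then show ?case using assms(3) poisson_svar_right[of B HBAR] poisson_skew[of "svar HBAR" B]
      by (auto simp: apoly_sym_simps poisson_mult_left invar_def split: avar.split simp del: One_nat_def)
  qed (simp_all add: apoly_sym_simps poisson_add_left)
  ultimately show ?thesis by simp
qed

section \<open>Comparison of two normalizing automorphisms\<close>

context nonres
begin

text \<open>\<open>\<Phi>\<close> is corrected grade by grade to agree with \<open>\<Psi>\<close>,
  keeping the transformed Hamiltonian up to order N. Agreement up to grade N - 2 suffices: in these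
  orders higher grades meet only the terms of \<open>H\<close> of order zero and one, which they
  annihilate.\<close>

theorem poisson_aut_normal_form_unique:
  assumes \<Phi>: "poisson_aut \<Phi>" and \<Psi>: "poisson_aut \<Psi>" and H: "admissible H" "H 2 = Q"
    and n1: "\<And>s. s \<le> N \<Longrightarrow> invar r (aut_apply \<Phi> H s)" and n2: "\<And>s. s \<le> N \<Longrightarrow> invar r (aut_apply \<Psi> H s)"
    and s: "s \<le> N"
  shows "aut_apply \<Phi> H s = aut_apply \<Psi> H s"
proof -
  have const: "\<Xi> d (H t) = 0" if "poisson_aut \<Xi>" "d > 0" "t < 2" for \<Xi> d t
  proof -
    have "t = 0 \<or> t = 1" using that by linarith
    then show ?thesis using H(1) that unfolding admissible_def poisson_aut_def by (metis sconst_0)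
  qed
  \<comment> \<open>Grade d acts on the quadratic part in order d + 2, whence the range; the
    alternative d = 0 covers N < 2.\<close>
  have "\<exists>\<Xi>. poisson_aut \<Xi> \<and> (\<forall>s\<le>N. aut_apply \<Xi> H s = aut_apply \<Phi> H s) \<and> (\<forall>i\<le>d. \<forall>A. \<Xi> i A = \<Psi> i A)" if "d + 2 \<le> N \<or> d = 0" for d
    using that
  proof (induction d)
    case 0
    then show ?case using \<Phi> \<Psi> by (intro exI[of _ \<Phi>]) (auto simp: poisson_aut_def)
  next
    case (Suc d)
    then obtain \<Xi> where \<Xi>: "poisson_aut \<Xi>" "\<forall>s\<le>N. aut_apply \<Xi> H s = aut_apply \<Phi> H s" "\<And>i A. i \<le> d \<Longrightarrow> \<Xi> i A = \<Psi> i A" by auto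
    define D where "D A = \<Psi> (Suc d) A - \<Xi> (Suc d) A" for A
    \<comment> \<open>Up to grade d the two maps agree and grade zero is the identity, so only the
      two end terms of the convolution differ.\<close>
    have diff: "(\<Sum>i\<le>Suc d. f (\<Psi> i A) (\<Psi> (Suc d - i) B)) - (\<Sum>i\<le>Suc d. f (\<Xi> i A) (\<Xi> (Suc d - i) B)) = f (D A) B + f A (D B)"
      if f: "\<And>a b c. f (a - b) c = f a c - f b c" "\<And>a b c. f a (b - c) = f a b - f a c" for f :: "'n sym \<Rightarrow> 'n sym \<Rightarrow> 'n sym" and A B
    proof -
      have e: "f (\<Psi> i A) (\<Psi> (Suc d - i) B) - f (\<Xi> i A) (\<Xi> (Suc d - i) B) = (if i = 0 then f A (D B) else 0) + (if i = Suc d then f (D A) B else 0)" if i: "i \<le> Suc d" for i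
      proof -
        have id: "\<Psi> 0 X = X" "\<Xi> 0 X = X" for X using \<Psi> \<Xi>(1) by (simp_all add: poisson_aut_def)
        consider "i = 0" | "i = Suc d" | "0 < i" "i \<le> d" using i by linarith
        then show ?thesis
        proof cases
          case 3
          then have "Suc d - i \<le> d" by simp
          then show ?thesis using 3 \<Xi>(3)[of i] \<Xi>(3)[of "Suc d - i"] by simp
        qed (simp_all add: id f D_def)
      qed
      have "(\<Sum>i\<le>Suc d. f (\<Psi> i A) (\<Psi> (Suc d - i) B)) - (\<Sum>i\<le>Suc d. f (\<Xi> i A) (\<Xi> (Suc d - i) B)) = 
        (\<Sum>i\<le>Suc d. (if i = 0 then f A (D B) else 0) + (if i = Suc d then f (D A) B else 0))"
        unfolding sum_subtractf[symmetric] by (rule sum.cong[OF refl]) (simp only: e atMost_iff)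
      then show ?thesis by (simp add: sum.distrib add.commute)
    qed
    have "\<exists>\<theta>\<in>Word (Suc d + 2). drop_hbar \<theta> = \<theta> \<and> (\<forall>A. D A = poisson \<theta> A)"
    proof (rule poisson_derivation_inner)
      fix A B
      show "D (A + B) = D A + D B" using \<Psi> \<Xi>(1) by (simp add: D_def poisson_aut_def)
      show "D (A * B) = D A * B + A * D B"
        using diff[of "(*)" A B] \<Psi> \<Xi>(1) by (simp add: D_def poisson_aut_def left_diff_distrib right_diff_distrib del: sum.atMost_Suc)
      show "D (poisson A B) = poisson (D A) B + poisson A (D B)"
        using diff[of poisson A B] \<Psi> \<Xi>(1) by (simp add: D_def poisson_aut_def poisson_diff_left poisson_diff_right del: sum.atMost_Suc)
    next
      show "D (sconst c) = 0" "D (svar HBAR) = 0" for c using \<Psi> \<Xi>(1) by (simp_all add: D_def poisson_aut_def)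
      fix v :: "'n svar" assume v: "v \<noteq> HBAR"
      then have "svar v \<in> Word 1" "drop_hbar (svar v) = svar v" 
        using homog_svar[of v] by (auto simp: Word_iff realsym_svar weight_def drop_hbar_svar)
      then have "\<Psi> (Suc d) (svar v) \<in> Word (1 + Suc d)" "\<Xi> (Suc d) (svar v) \<in> Word (1 + Suc d)" 
         "drop_hbar (\<Psi> (Suc d) (svar v)) = \<Psi> (Suc d) (svar v)" "drop_hbar (\<Xi> (Suc d) (svar v)) = \<Xi> (Suc d) (svar v)"
        by (auto intro: poisson_aut_Word[OF \<Psi>, of _ 1 "Suc d", simplified] poisson_aut_Word[OF \<Xi>(1), of _ 1 "Suc d", simplified] poisson_aut_hbar[OF \<Psi>] poisson_aut_hbar[OF \<Xi>(1)])
      then show "D (svar v) \<in> Word (Suc (Suc d)) \<and> drop_hbar (D (svar v)) = D (svar v)"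
        by (simp add: D_def Word_diff drop_hbar_diff)
    qed
    then obtain \<theta> where \<theta>: "\<theta> \<in> Word (Suc d + 2)" "drop_hbar \<theta> = \<theta>" "\<And>A. D A = poisson \<theta> A" by blast
    let ?n = "Suc d + 2"
    \<comment> \<open>Grades up to d cancel and grades above d + 1 annihilate what they meet, which
      leaves the derivation applied to the quadratic part.\<close>
    have "aut_apply \<Psi> H ?n - aut_apply \<Xi> H ?n = (\<Sum>i\<le>?n. if i = Suc d then poisson \<theta> Q else 0)"
      unfolding aut_apply_def sum_subtractf[symmetric]
    proof (rule sum.cong[OF refl])
      fix i assume "i \<in> {..?n}"
      then consider "i \<le> d" | "i = Suc d" | "i > 0" "?n - i < 2" by fastforce
      then show "\<Psi> i (H (?n - i)) - \<Xi> i (H (?n - i)) = (if i = Suc d then poisson \<theta> Q else 0)"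
      proof cases
        case 2
        then show ?thesis using \<theta>(3)[of Q] H(2) by (simp add: D_def)
      next
        case 3
        then have "i \<noteq> Suc d" by auto
        then show ?thesis using 3 const[OF \<Psi>] const[OF \<Xi>(1)] by simp
      qed (use \<Xi>(3) in auto)
    qed
    then have e: "aut_apply \<Psi> H ?n - aut_apply \<Xi> H ?n = poisson \<theta> Q" by simp
    have N: "?n \<le> N" using Suc.prems by simp
    have "invar r (poisson \<theta> Q)" unfolding e[symmetric] using n1[OF N] n2[OF N] \<Xi>(2) N by (simp add: invar_diff)
    \<comment> \<open>An invariant element of the image vanishes, so \<open>\<theta>\<close> lies in
      the kernel.\<close>
    then have \<theta>i: "invar r \<theta>" using invar_image invar_iff by blast
    define \<Xi>' where "\<Xi>' = (\<lambda>d A. exp_ad poisson ?n \<theta> (\<lambda>s. \<Xi> s A) d)"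
    have "poisson_aut \<Xi>'" unfolding \<Xi>'_def by (rule poisson_aut_exp[OF \<Xi>(1) \<theta>(1) _ \<theta>(2)]) simp
    moreover have "aut_apply \<Xi>' H s = aut_apply \<Phi> H s" if "s \<le> N" for s
    proof -
      have "aut_apply \<Xi>' H = exp_ad poisson ?n \<theta> (aut_apply \<Xi> H)" unfolding \<Xi>'_def by (rule aut_apply_exp) simp
      \<comment> \<open>The terms up to order N are invariant and commute with
        \<open>\<theta>\<close>, so its exponential acts on them as the identity.\<close>
      moreover have "ead \<theta> k (aut_apply \<Xi> H (s - k * (?n - 2))) = (if k = 0 then aut_apply \<Xi> H s else 0)" for k
      proof (cases k)
        case (Suc j)
        have "poisson \<theta> (aut_apply \<Xi> H (s - k * (?n - 2))) = 0"
          using n1[of "s - k * (?n - 2)"] \<Xi>(2) that by (intro invar_poisson[OF \<theta>i \<theta>(1)]) simp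
        then show ?thesis using Suc by (simp add: ead_def funpow_Suc_right poisson.br_pow_0 del: funpow.simps)
      qed simp
      ultimately have "aut_apply \<Xi>' H s = aut_apply \<Xi> H s" using finite_mult_le[of "?n - 2" s] by (simp add: exp_ad_ead)
      then show ?thesis using \<Xi>(2) that by simp
    qed
    moreover have "\<Xi>' i A = \<Psi> i A" if i: "i \<le> Suc d" for i A
    proof -
      \<comment> \<open>Up to grade d + 1 the exponential of \<open>\<theta>\<close> contributes a
        single term, the missing difference \<open>D\<close> in grade d + 1.\<close>
      have "ead \<theta> k (\<Xi> (i - k * (?n - 2)) A) = (if k = 0 then \<Xi> i A else if k = 1 \<and> i = Suc d then poisson \<theta> A else 0)" if k: "k * (?n - 2) \<le> i" for k
      proof -
        have "k \<noteq> 0 \<Longrightarrow> k * (?n - 2) \<ge> Suc d" by (cases k) auto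
        moreover have "k \<ge> 2 \<Longrightarrow> k * (?n - 2) \<ge> 2 * Suc d" by (metis add_diff_cancel_right' mult_le_mono1)
        ultimately have "k = 0 \<or> (k = 1 \<and> i = Suc d)" using i k by (cases "k \<ge> 2") (auto simp: not_le less_2_cases_iff)
        then show ?thesis using \<Xi>(1) by (auto simp: poisson_aut_def ead_def)
      qed
      then have "\<Xi>' i A = (\<Sum>k | k * (?n - 2) \<le> i. if k = 0 then \<Xi> i A else if k = 1 \<and> i = Suc d then poisson \<theta> A else 0)"
        unfolding \<Xi>'_def exp_ad_ead by (intro sum.cong) auto
      also have "\<dots> = (\<Sum>k\<in>{0,1::nat}. if k = 0 then \<Xi> i A else if k = 1 \<and> i = Suc d then poisson \<theta> A else 0)"
        using finite_mult_le[of "?n - 2" i] i by (intro sum.mono_neutral_cong) auto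
      also have "\<dots> = \<Psi> i A" using \<Xi>(3)[of i A] i \<theta>(3)[of A, symmetric] by (auto simp: D_def le_Suc_eq)
      finally show ?thesis .
    qed
    ultimately show ?case by blast
  qed
  then obtain \<Xi> where \<Xi>: "poisson_aut \<Xi>" "\<forall>s\<le>N. aut_apply \<Xi> H s = aut_apply \<Phi> H s" "\<And>i A. i \<le> N - 2 \<Longrightarrow> \<Xi> i A = \<Psi> i A"
    by (metis le_add_diff_inverse2 diff_is_0_eq nat_le_linear)
  have "\<Xi> i (H (s - i)) = \<Psi> i (H (s - i))" if "i \<le> s" for i
  proof (cases "i \<le> N - 2")
    case False
    then have "i > 0" "s - i < 2" using that s by auto
    then show ?thesis using const[OF \<Psi>] const[OF \<Xi>(1)] by simp
  qed (rule \<Xi>(3))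
  then have "aut_apply \<Xi> H s = aut_apply \<Psi> H s" by (simp add: aut_apply_def)
  then show ?thesis using \<Xi>(2) s by simp
qed

theorem classical_normal_form_unique:
  assumes "admissible H" "H 2 = Q" 
    and V: "\<And>n. n \<in> {3..N} \<Longrightarrow> V n \<in> Word n \<and> drop_hbar (V n) = V n \<and> invar r (transformed poisson V H n n)"
    and W: "\<And>n. n \<in> {3..N} \<Longrightarrow> W n \<in> Word n \<and> drop_hbar (W n) = W n \<and> invar r (transformed poisson W H n n)"
    and s: "s \<le> N"
  shows "transformed poisson V H N s = transformed poisson W H N s"
proof -
  have inv: "invar r (transformed poisson V H N s)" 
    if V: "\<And>n. n \<in> {3..N} \<Longrightarrow> V n \<in> Word n \<and> drop_hbar (V n) = V n \<and> invar r (transformed poisson V H n n)" and "s \<le> N" for V s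
  proof (cases "s \<le> 2")
    case True
    then have "transformed poisson V H N s = H s" using V assms by (intro poisson.transformed_2) auto
    moreover have "invar r (H s)"
    proof -
      have "s = 0 \<or> s = 1 \<or> s = 2" using True by linarith
      then show ?thesis using assms(1,2) invar_Q by (auto simp: admissible_def invar_def)
    qed
    ultimately show ?thesis by simp
  next
    case False
    then have "transformed poisson V H N s = transformed poisson V H s s" using V assms that by (intro poisson.transformed_stable) auto
    then show ?thesis using V[of s] False that by simp
  qed
  obtain \<Phi> where \<Phi>: "poisson_aut \<Phi>" "\<And>H. transformed poisson V H N = aut_apply \<Phi> H" using transformed_paut[of N V] V by blast
  obtain \<Psi> where \<Psi>: "poisson_aut \<Psi>" "\<And>H. transformed poisson W H N = aut_apply \<Psi> H" using transformed_paut[of N W] W by blast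
  show ?thesis unfolding \<Phi>(2) \<Psi>(2)
    using inv[OF V] inv[OF W] s by (intro poisson_aut_normal_form_unique[OF \<Phi>(1) \<Psi>(1) assms(1,2)]) (auto simp: \<Phi>(2) \<Psi>(2))
qed

end

section \<open>The quantum normal form\<close>

subsection \<open>Star multiplication by an action\<close>

text \<open>The second and last correction in the star product with an action, which is quadratic.\<close>

definition action_lap :: "'n \<Rightarrow> 'n \<Rightarrow> 'n sym \<Rightarrow> 'n sym" where
  "action_lap r k F = (if k = r then - spartial (POS k) (spartial (MOM k) F) - spartial (MOM k) (spartial (POS k) F) 
     else spartial (MOM k) (spartial (MOM k) F) + spartial (POS k) (spartial (POS k) F))"

text \<open>An action has degree two, so the series stops after the second pairing, whose
  coefficient is (i/2)^2 / 2! = -1/8.\<close>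

lemma star_action:
  "star (action r k) F = action r k * F - ih2 * poisson (action r k) F - sconst (1/8) * (svar HBAR ^ 2 * action_lap r k F)"
proof -
  have "tdeg m \<le> mon_order m" for m :: "'a svar \<Rightarrow>\<^sub>0 nat"
    unfolding tdeg_def mon_order_def by (rule sum_mono) auto
  then have d: "poly_deg_le 2 (action r k)" using homog_action[of r k] unfolding homog_def poly_deg_le_def by metis
  have b1: "bidiff 1 (svar v) G = - conj_deriv v G" for v and G :: "'a sym"
    using poisson_skew[of G "svar v"] poisson_svar_right[of G v] by (simp add: poisson_bidiff del: bidiff.simps)
  have b2: "bidiff 2 (action r k) F = action_lap r k F"
  proof -
    have "bidiff 2 (action r k) F = (\<Sum>j\<in>UNIV. bidiff 1 (spartial (POS j) (action r k)) (spartial (MOM j) F) - bidiff 1 (spartial (MOM j) (action r k)) (spartial (POS j) F))"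
      by (simp only: numeral_2_eq_2 bidiff.simps One_nat_def)
    also have "\<dots> = (\<Sum>j\<in>UNIV. if j = k then action_lap r k F else 0)"
    proof (rule sum.cong[OF refl])
      fix j
      have z: "bidiff 1 0 G = 0" for G :: "'a sym" by (rule bidiff_0_left)
      show "bidiff 1 (spartial (POS j) (action r k)) (spartial (MOM j) F) - bidiff 1 (spartial (MOM j) (action r k)) (spartial (POS j) F) 
        = (if j = k then action_lap r k F else 0)"
        unfolding spartial_action by (auto simp: b1 z action_lap_def simp del: bidiff.simps One_nat_def)
    qed
    finally show ?thesis by simp
  qed
  have c: "ih2 ^ 2 * sconst (1 / fact 2) = sconst (- 1/8) * (svar HBAR ^ 2 :: 'a sym)"
  proof -
    have "ih2 ^ 2 * sconst (1 / fact 2) = sconst ((\<i> / 2)^2 * (1 / fact 2)) * (svar HBAR ^ 2 :: 'a sym)"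
      unfolding ih2_def power_mult_distrib sconst_power[symmetric] by (simp only: sconst_mult mult_ac)
    also have "(\<i> / 2)^2 * (1 / fact 2) = (- 1/8 :: complex)" by (simp add: power_divide)
    finally show ?thesis .
  qed
  have "star (action r k) F = action r k * F + ih2 * bidiff 1 (action r k) F + ih2 ^ 2 * sconst (1 / fact 2) * bidiff 2 (action r k) F"
    unfolding star_eq[OF d] by (simp add: numeral_2_eq_2 del: bidiff.simps(2))
  then show ?thesis unfolding b2 c using poisson_bidiff[of "action r k" F] by (simp add: sconst_uminus mult.assoc del: bidiff.simps)
qed

section \<open>Locality of star multiplication by an action, and powers of an action\<close>

definition free_of :: "'n \<Rightarrow> 'n sym \<Rightarrow> bool" where
  "free_of k B \<longleftrightarrow> spartial (MOM k) B = 0 \<and> spartial (POS k) B = 0"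

text \<open>Both corrections differentiate only in the k-th momentum and position, which pass
  through \<open>B\<close> as through a constant.\<close>

lemma star_action_local: assumes "free_of k B" shows "star (action r k) (X * B) = star (action r k) X * B"
proof -
  have "poisson (action r k) (X * B) = poisson (action r k) X * B"
  proof -
    have B: "spartial (MOM k) B = 0" "spartial (POS k) B = 0" using assms by (simp_all add: free_of_def)
    have "poisson (action r k) B = 0" unfolding poisson_action B by simp
    then show ?thesis by (simp add: poisson_mult_right)
  qed
  moreover have "action_lap r k (X * B) = action_lap r k X * B"
  proof -
    have B: "spartial (MOM k) B = 0" "spartial (POS k) B = 0" using assms by (simp_all add: free_of_def)
    show ?thesis
    proof (cases "k = r")
      case True
      show ?thesis unfolding action_lap_def if_P[OF True] spartial_mult B mult_zero_right add_0_right
        by (simp add: algebra_simps)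
    next
      case False
      show ?thesis unfolding action_lap_def if_not_P[OF False] spartial_mult B mult_zero_right add_0_right
        by (simp add: algebra_simps)
    qed
  qed
  ultimately show ?thesis unfolding star_action by (simp add: algebra_simps)
qed

text \<open>The sign that distinguishes the saddle from the oscillators in the recursion for
  powers.\<close>

definition eps :: "'n \<Rightarrow> 'n \<Rightarrow> real" where "eps r k = (if k = r then - 1 else 1)"

lemma spartial_action_power:
  "spartial v (action r k ^ n) = of_nat n * (action r k ^ (n - 1) * spartial v (action r k))"
  by (simp add: spartial_power mult.assoc)

lemma spartial_of_nat_mult: "spartial v (of_nat n * A) = of_nat n * spartial v A"
  unfolding sconst_of_nat[symmetric] by (rule spartial_sconst_mult)

text \<open>The second derivatives contribute n from the coordinate and n (n - 1) from the remaining
  power, together n^2, and this twice; the sign is built into \<open>action_lap\<close>.\<close>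

lemma action_lap_action_power: "action_lap r k (action r k ^ n) = sconst (of_real (2 * eps r k * (real n)\<^sup>2)) * action r k ^ (n - 1)"
proof (cases n)
  case (Suc j)
  let ?a = "action r k" and ?p = "svar (MOM k)" and ?x = "svar (POS k)"
  have h2: "2 * (sconst (1/2) * A) = A" for A :: "'a sym" 
    unfolding mult_2 by (rule half_add_half)
  show ?thesis
  proof (cases "k = r")
    case True
    then have a: "?a = ?p * ?x" by (simp add: action_def)
    have "action_lap r k (?a ^ n) = - (2 * (of_nat n * (?a ^ j + of_nat j * (?a ^ (j - 1) * ?a))))"
    proof -
      have d: "spartial (MOM k) (?a ^ n) = of_nat n * (?a ^ j * ?x)" "spartial (POS k) (?a ^ n) = of_nat n * (?a ^ j * ?p)"
        unfolding spartial_action_power spartial_action using True by (simp_all add: Suc del: of_nat_Suc)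
      have e: "spartial (POS k) (?a ^ j * ?x) = of_nat j * (?a ^ (j - 1) * (?p * ?x)) + ?a ^ j" 
        "spartial (MOM k) (?a ^ j * ?p) = of_nat j * (?a ^ (j - 1) * (?p * ?x)) + ?a ^ j"
        unfolding spartial_mult spartial_action_power spartial_action using True by (simp_all add: spartial_svar mult_ac)
      have "action_lap r k (?a ^ n) = - (of_nat n * (of_nat j * (?a ^ (j - 1) * ?a) + ?a ^ j)) - of_nat n * (of_nat j * (?a ^ (j - 1) * ?a) + ?a ^ j)"
        using True unfolding action_lap_def d spartial_of_nat_mult e a[symmetric] by simp
      then show ?thesis by (simp add: add.commute)
    qed
    also have "of_nat j * (?a ^ (j - 1) * ?a) = of_nat j * ?a ^ j" by (cases j) (simp_all add: mult.commute)
    also have "- (2 * (of_nat n * (?a ^ j + of_nat j * ?a ^ j))) = sconst (of_real (2 * eps r k * (real n)\<^sup>2)) * ?a ^ j"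
    proof -
      have c: "sconst (of_real (2 * eps r k * (real n)\<^sup>2)) = (- (2 * of_nat n * of_nat n) :: 'a sym)"
        using True by (simp add: eps_def sconst_uminus sconst_mult sconst_numeral sconst_of_nat power2_eq_square)
      show ?thesis unfolding c by (simp add: Suc algebra_simps)
    qed
    finally show ?thesis by (simp add: Suc)
  next
    case False
    then have a: "?p * ?p + ?x * ?x = 2 * ?a" 
      using h2[of "?p * ?p + ?x * ?x"] by (simp only: action_def power2_eq_square if_False)
    have "action_lap r k (?a ^ n) = of_nat n * (2 * ?a ^ j + of_nat j * (?a ^ (j - 1) * (?p * ?p + ?x * ?x)))"
    proof -
      have d: "spartial (MOM k) (?a ^ n) = of_nat n * (?a ^ j * ?p)" "spartial (POS k) (?a ^ n) = of_nat n * (?a ^ j * ?x)"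
        unfolding spartial_action_power spartial_action using False by (simp_all add: Suc del: of_nat_Suc)
      have e: "spartial (MOM k) (?a ^ j * ?p) = of_nat j * (?a ^ (j - 1) * (?p * ?p)) + ?a ^ j" 
        "spartial (POS k) (?a ^ j * ?x) = of_nat j * (?a ^ (j - 1) * (?x * ?x)) + ?a ^ j"
        unfolding spartial_mult spartial_action_power spartial_action using False by (simp_all add: spartial_svar mult_ac)
      show ?thesis
        using False unfolding action_lap_def d spartial_of_nat_mult e by (simp add: algebra_simps)
    qed
    also have "\<dots> = of_nat n * (2 * ?a ^ j + 2 * (of_nat j * (?a ^ (j - 1) * ?a)))" unfolding a by (simp add: mult_ac)
    also have "of_nat j * (?a ^ (j - 1) * ?a) = of_nat j * ?a ^ j" by (cases j) (simp_all add: mult.commute)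
    also have "of_nat n * (2 * ?a ^ j + 2 * (of_nat j * ?a ^ j)) = sconst (of_real (2 * eps r k * (real n)\<^sup>2)) * ?a ^ j"
    proof -
      have c: "sconst (of_real (2 * eps r k * (real n)\<^sup>2)) = (2 * of_nat n * of_nat n :: 'a sym)"
        using False by (simp add: eps_def sconst_mult sconst_numeral sconst_of_nat power2_eq_square)
      show ?thesis unfolding c by (simp add: Suc algebra_simps)
    qed
    finally show ?thesis by (simp add: Suc)
  qed
next
  case 0
  have "spartial v (1 :: 'a sym) = 0" for v by simp
  then show ?thesis using 0 by (simp add: action_lap_def)
qed

lemma poisson_power: "poisson A (B ^ n) = of_nat n * B ^ (n - 1) * poisson A B"
proof (induction n)
  case 0
  show ?case using poisson_sconst(1)[of A 1] by simp
next
  case (Suc n)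
  then show ?case by (cases n) (simp_all add: poisson_mult_right algebra_simps)
qed

lemma poisson_self: "poisson A A = 0" for A :: "'n::finite sym"
  by (simp add: poisson_def mult.commute)

text \<open>The first correction vanishes, an action commuting with its own powers; the second gives
  1/8 times 2 n^2, the n^2/4 of the recursion. At n = 0 the coefficient is zero, so the exponent
  \<open>n - 1\<close> is harmless.\<close>

lemma star_action_power:
  "star (action r k) (action r k ^ n) = action r k ^ (n + 1) - sconst (of_real (eps r k * (real n)\<^sup>2 / 4)) * (svar HBAR ^ 2 * action r k ^ (n - 1))"
proof -
  have "poisson (action r k) (action r k ^ n) = 0" by (simp add: poisson_power poisson_self)
  moreover have "sconst (1/8) * (svar HBAR ^ 2 * (sconst (of_real (2 * eps r k * (real n)\<^sup>2)) * X)) = 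
    sconst (of_real (eps r k * (real n)\<^sup>2 / 4)) * (svar HBAR ^ 2 * X)" for X :: "'a sym"
  proof -
    have "sconst (1/8) * (svar HBAR ^ 2 * (sconst (of_real (2 * eps r k * (real n)\<^sup>2)) * X)) = 
      sconst (1/8 * of_real (2 * eps r k * (real n)\<^sup>2)) * (svar HBAR ^ 2 * X)" by (simp only: sconst_mult mult_ac)
    also have "1/8 * complex_of_real (2 * eps r k * (real n)\<^sup>2) = of_real (eps r k * (real n)\<^sup>2 / 4)" by simp
    finally show ?thesis .
  qed
  ultimately show ?thesis unfolding star_action action_lap_action_power by simp
qed

theorem weyl_action_power:
  assumes "h > 0" "\<psi> \<in> schwartz"
  shows "weyl h (action r k ^ (n + 1)) \<psi> x = weyl h (action r k) (weyl h (action r k ^ n) \<psi>) x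
          + of_real (eps r k * ((real n)\<^sup>2 * h\<^sup>2 / 4)) * weyl h (action r k ^ (n - 1)) \<psi> x"
proof -
  have "action r k ^ (n + 1) = star (action r k) (action r k ^ n) + sconst (of_real (eps r k * (real n)\<^sup>2 / 4)) * (svar HBAR * (svar HBAR * action r k ^ (n - 1)))"
    unfolding star_action_power by (simp add: power2_eq_square mult.assoc)
  then show ?thesis
    by (simp only: weyl_add[OF assms] weyl_star[OF assms] weyl_sconst_mult[OF assms(1)] weyl_HBAR[OF assms(1)])
      (simp add: power2_eq_square)
qed

subsection \<open>Symbols of polynomials in the quantized actions\<close>

definition apow :: "'n::finite \<Rightarrow> 'n \<Rightarrow> nat \<Rightarrow> 'n sym" where
  "apow r k n = (star (action r k) ^^ n) 1"

text \<open>Star powers within one degree of freedom, but ordinary products between different ones: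
  by locality these agree with the star products, and the symbol is visibly independent of the order
  of factors.\<close>

definition monsym :: "'n::finite \<Rightarrow> ('n avar \<Rightarrow>\<^sub>0 nat) \<Rightarrow> 'n sym" where
  "monsym r m = svar HBAR ^ lk m AHBAR * (\<Prod>k\<in>UNIV. apow r k (lk m (ACT k)))"

definition opsym :: "'n::finite \<Rightarrow> 'n apoly \<Rightarrow> 'n sym" where
  "opsym r K = (\<Sum>m\<in>kys K. sconst (of_real (lk K m)) * monsym r m)"

lemma free_of_mult: "free_of k A \<Longrightarrow> free_of k B \<Longrightarrow> free_of k (A * B)"
  by (simp add: free_of_def spartial_mult)
lemma free_of_1 [simp]: "free_of k 1" by (simp add: free_of_def)
lemma free_of_prod: "(\<And>i. i \<in> I \<Longrightarrow> free_of k (f i)) \<Longrightarrow> free_of k (\<Prod>i\<in>I. f i)"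
  by (induction I rule: infinite_finite_induct) (auto intro: free_of_mult)
lemma free_of_HBAR: "free_of k (svar HBAR ^ n)"
  by (simp add: free_of_def spartial_power spartial_svar)
lemma free_of_apow: "j \<noteq> k \<Longrightarrow> free_of k (apow r j n)"
proof (induction n)
  case (Suc n)
  then show ?case by (simp add: apow_def free_of_def star_spartial spartial_action)
qed (simp add: apow_def)

lemma star_pow_local: "free_of k B \<Longrightarrow> (star (action r k) ^^ n) B = apow r k n * B"
  by (induction n) (auto simp: apow_def star_action_local)

lemma monsym_ACT: "monsym r (sg (ACT k) 1 + m) = star (action r k) (monsym r m)"
proof -
  let ?B = "svar HBAR ^ lk m AHBAR * (\<Prod>j\<in>UNIV - {k}. apow r j (lk m (ACT j)))"
  have B: "free_of k ?B" by (intro free_of_mult free_of_prod free_of_HBAR free_of_apow) auto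
  have "monsym r m = apow r k (lk m (ACT k)) * ?B"
    unfolding monsym_def by (subst prod.remove[of _ k]) (auto simp: mult_ac)
  moreover have "monsym r (sg (ACT k) 1 + m) = apow r k (Suc (lk m (ACT k))) * ?B"
  proof -
    have "(\<Prod>j\<in>UNIV - {k}. apow r j (lk (sg (ACT k) 1 + m) (ACT j))) = (\<Prod>j\<in>UNIV - {k}. apow r j (lk m (ACT j)))"
      by (rule prod.cong) (auto simp: lookup_add lookup_single when_def)
    then show ?thesis unfolding monsym_def by (subst prod.remove[of _ k]) (auto simp: mult_ac lookup_add lookup_single when_def)
  qed
  moreover have "apow r k (Suc n) = star (action r k) (apow r k n)" for n by (simp add: apow_def)
  ultimately show ?thesis using star_action_local[OF B, of r "apow r k (lk m (ACT k))"] by simp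
qed

lemma monsym_HBAR: "monsym r (sg AHBAR 1 + m) = svar HBAR * monsym r m"
  by (simp add: monsym_def lookup_add lookup_single when_def mult.assoc)

lemma opsym_superset: "finite I \<Longrightarrow> kys K \<subseteq> I \<Longrightarrow> opsym r K = (\<Sum>m\<in>I. sconst (of_real (lk K m)) * monsym r m)"
  unfolding opsym_def by (rule sum.mono_neutral_left) (auto simp: in_keys_iff)

lemma opsym_add: "opsym r (A + B) = opsym r A + opsym r B"
proof -
  let ?K = "kys A \<union> kys B"
  have "kys (A + B) \<subseteq> ?K" by (rule keys_add)
  then show ?thesis
    using opsym_superset[of ?K "A + B" r] opsym_superset[of ?K A r] opsym_superset[of ?K B r]
    by (simp add: lookup_add sum.distrib sconst_add distrib_right)
qed

lemma opsym_0 [simp]: "opsym r 0 = 0" by (simp add: opsym_def)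

lemma opsym_sum: "opsym r (\<Sum>i\<in>I. f i) = (\<Sum>i\<in>I. opsym r (f i))"
  by (induction I rule: infinite_finite_induct) (auto simp: opsym_add)

lemma opsym_single: "opsym r (sg m c) = sconst (of_real c) * monsym r m"
  using opsym_superset[of "{m}" "sg m c" r] by simp

lemma opsym_var: "opsym r (sg (sg v 1) 1 * K) = (case v of ACT k \<Rightarrow> star (action r k) (opsym r K) | AHBAR \<Rightarrow> svar HBAR * opsym r K)"
proof -
  have "opsym r (sg (sg v 1) 1 * K) = opsym r (\<Sum>m\<in>kys K. sg (sg v 1 + m) (lk K m))"
    by (subst poly_expand[of K]) (simp add: sum_distrib_left mult_single)
  also have "\<dots> = (\<Sum>m\<in>kys K. sconst (of_real (lk K m)) * monsym r (sg v 1 + m))"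
    by (simp only: opsym_sum opsym_single)
  also have "\<dots> = (case v of ACT k \<Rightarrow> star (action r k) (opsym r K) | AHBAR \<Rightarrow> svar HBAR * opsym r K)"
  proof (cases v)
    case (ACT k)
    have ss: "star A (\<Sum>i\<in>I. f i) = (\<Sum>i\<in>I. star A (f i))" for A and f :: "_ \<Rightarrow> 'a sym" and I :: "('a avar \<Rightarrow>\<^sub>0 nat) set"
      by (induction I rule: infinite_finite_induct) (auto simp: star_add_right)
    show ?thesis by (simp add: ACT monsym_ACT[unfolded One_nat_def] opsym_def ss star_sconst_right')
  next
    case AHBAR
    then show ?thesis by (simp add: monsym_HBAR[unfolded One_nat_def] opsym_def sum_distrib_left mult_ac)
  qed
  finally show ?thesis .
qed

lemma opsym_const: "opsym r (sg 0 c * K) = sconst (of_real c) * opsym r K"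
proof -
  have "opsym r (sg 0 c * K) = opsym r (\<Sum>m\<in>kys K. sg m (c * lk K m))"
    by (subst poly_expand[of K]) (simp add: sum_distrib_left mult_single)
  also have "\<dots> = sconst (of_real c) * opsym r K"
    by (simp add: opsym_sum opsym_single) (simp add: opsym_def sum_distrib_left sconst_mult mult.assoc)
  finally show ?thesis .
qed

text \<open>Locality turns repeated application of one quantized action into a factor
  \<open>apow\<close>; the resulting product depends only on the set of \<open>ks\<close>.\<close>

lemma weyl_apow: assumes "h > 0" "distinct ks" "\<psi> \<in> schwartz"
  shows "foldr (\<lambda>k. (weyl h (action r k)) ^^ n k) ks \<psi> = weyl h (\<Prod>k\<in>set ks. apow r k (n k)) \<psi>"
  using assms(2)
proof (induction ks)
  case Nil
  then show ?case by (intro ext) (simp add: weyl_1[OF assms(1,3)])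
next
  case (Cons k ks)
  let ?B = "\<Prod>k\<in>set ks. apow r k (n k)"
  have B: "free_of k ?B" using Cons.prems by (intro free_of_prod free_of_apow) auto
  have "(weyl h (action r k) ^^ j) (weyl h ?B \<psi>) = weyl h ((star (action r k) ^^ j) ?B) \<psi>" for j
    by (induction j) (simp_all add: weyl_star[OF assms(1,3)])
  then show ?case using Cons by (simp add: star_pow_local[OF B])
qed

lemma weyl_opsym:
  assumes "h > 0" "distinct ks" "set ks = UNIV" "\<psi> \<in> schwartz"
  shows "apoly_op h r ks K \<psi> = weyl h (opsym r K) \<psi>"
proof (rule ext)
  fix x
  have HB: "weyl h (svar HBAR ^ j * A) \<psi> x = of_real (h ^ j) * weyl h A \<psi> x" for j A
    by (induction j) (simp_all add: mult.assoc weyl_HBAR[OF assms(1)])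
  show "apoly_op h r ks K \<psi> x = weyl h (opsym r K) \<psi> x"
    unfolding apoly_op_def opsym_def weyl_sum[OF assms(1,4)] weyl_sconst_mult[OF assms(1)] monsym_def HB weyl_apow[OF assms(1,2,4)] assms(3)
    by (simp add: mult.assoc)
qed

subsection \<open>Classical limit of polynomials in the actions\<close>

lemma ring_map_ident [simp]: "ring_map (\<lambda>x. x)" by (simp add: ring_map_def)

definition apoly_cl :: "'n apoly \<Rightarrow> ('n \<Rightarrow>\<^sub>0 nat) \<Rightarrow>\<^sub>0 real" where
  "apoly_cl K = peval (\<lambda>c. sg 0 c) (\<lambda>v. case v of ACT k \<Rightarrow> sg (sg k 1) 1 | AHBAR \<Rightarrow> 0) K"

lemma ring_map_single: "ring_map (\<lambda>c::real. sg (0::'v \<Rightarrow>\<^sub>0 nat) c)"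
  by (simp add: ring_map_def single_add mult_single flip: single_one)

lemma apoly_cl_simps: "apoly_cl (A + B) = apoly_cl A + apoly_cl B" "apoly_cl (A * B) = apoly_cl A * apoly_cl B"
  "apoly_cl (sg 0 c) = sg 0 c" "apoly_cl (sg (sg v 1) 1) = (case v of ACT k \<Rightarrow> sg (sg k 1) 1 | AHBAR \<Rightarrow> 0)"
  "apoly_cl (\<Sum>i\<in>I. f i) = (\<Sum>i\<in>I. apoly_cl (f i))"
  unfolding apoly_cl_def 
  by (simp_all add: peval_const[OF ring_map_single] peval_add[OF ring_map_single] peval_mult[OF ring_map_single] peval_var[OF ring_map_single] peval_sum[OF ring_map_single] del: One_nat_def)

definition csym :: "'n \<Rightarrow> (('n \<Rightarrow>\<^sub>0 nat) \<Rightarrow>\<^sub>0 real) \<Rightarrow> 'n sym" where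
  "csym r C = peval (\<lambda>c. sconst (of_real c)) (action r) C"

lemma csym_simps: "csym r (A + B) = csym r A + csym r B" "csym r (A * B) = csym r A * csym r B"
  "csym r (sg 0 c) = sconst (of_real c)" "csym r (sg (sg v 1) 1) = action r v" "csym r (\<Sum>i\<in>I. f i) = (\<Sum>i\<in>I. csym r (f i))"
  "csym r 0 = 0"
  unfolding csym_def by (simp_all add: peval_const peval_add peval_mult peval_var peval_sum peval_zero del: One_nat_def)

lemma drop_hbar_apoly_sym: "drop_hbar (apoly_sym r K) = csym r (apoly_cl K)"
proof (induction K rule: poly_induct)
  case (var v K)
  then show ?case by (cases v) (simp_all add: apoly_sym_simps apoly_cl_simps csym_simps drop_hbar_mult drop_hbar_svar del: One_nat_def)
qed (simp_all add: apoly_sym_simps apoly_cl_simps csym_simps drop_hbar_add)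

lemma apoly_val_simps: "apoly_val h a (A + B) = apoly_val h a A + apoly_val h a B" "apoly_val h a (A * B) = apoly_val h a A * apoly_val h a B"
  "apoly_val h a (sg 0 c) = c" "apoly_val h a (sg (sg v 1) 1) = (case v of ACT k \<Rightarrow> a k | AHBAR \<Rightarrow> h)"
  unfolding apoly_val_def by (simp_all add: peval_const peval_add peval_mult peval_var del: One_nat_def)

lemma apoly_val_limit: "((\<lambda>h. apoly_val h a K) \<longlongrightarrow> peval id a (apoly_cl K)) (at_right 0)"
proof (induction K rule: poly_induct)
  case (const c)
  show ?case unfolding apoly_val_simps apoly_cl_simps peval_const[OF ring_map_id] by simp
next
  case (add A B)
  then show ?case by (simp add: apoly_val_simps apoly_cl_simps peval_add tendsto_add)
next
  case (var v K)
  have "((\<lambda>h. case v of ACT k \<Rightarrow> a k | AHBAR \<Rightarrow> h) \<longlongrightarrow> peval id a (case v of ACT k \<Rightarrow> sg (sg k 1) 1 | AHBAR \<Rightarrow> 0)) (at_right 0)"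
  proof (cases v)
    case (ACT k)
    then show ?thesis by (simp add: peval_var[OF ring_map_id] del: One_nat_def)
  next
    case AHBAR
    have "((\<lambda>h. h) \<longlongrightarrow> (0::real)) (at_right 0)" by (rule tendsto_ident_at)
    then show ?thesis using AHBAR by (simp add: peval_zero)
  qed
  from tendsto_mult[OF this var] show ?case
    by (simp add: apoly_val_simps apoly_cl_simps peval_mult id_def del: One_nat_def)
qed

text \<open>The actions take arbitrary real values simultaneously if complex momenta are allowed.\<close>

lemma csym_inj:
  assumes "csym r C = csym r C'" 
  shows "peval id a C = peval id a C'"
proof -
  \<comment> \<open>With x = 1 in the saddle plane and x = 0 in the others, the momentum alone fixes
    the action.\<close>
  define val where "val v = (case v of MOM k \<Rightarrow> if k = r then of_real (a k) else csqrt (of_real (2 * a k)) 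
    | POS k \<Rightarrow> if k = r then 1 else 0 | HBAR \<Rightarrow> 0)" for v
  have act: "peval id val (action r k) = of_real (a k)" for k
    unfolding action_def sconst_def svar_def
    by (simp add: peval_mult peval_add peval_power peval_const peval_var val_def del: One_nat_def)
  have "peval id val (csym r D) = of_real (peval id a D)" for D
  proof (induction D rule: poly_induct)
    case (const c)
    show ?case unfolding csym_simps sconst_def peval_const[OF ring_map_id] by simp
  next
    case (add A B)
    then show ?case by (simp add: csym_simps peval_add)
  next
    case (var v K)
    then show ?case by (simp add: csym_simps peval_mult act[unfolded id_def] peval_var id_def del: One_nat_def)
  qed
  then show ?thesis using assms by (metis of_real_eq_iff)
qed

subsection \<open>Rewriting the normal form in terms of the quantized actions\<close>

definition agrade :: "nat \<Rightarrow> 'n apoly \<Rightarrow> bool" where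
  "agrade d K \<longleftrightarrow> (\<forall>m. lk K m \<noteq> 0 \<longrightarrow> tdeg m = d)"

lemma agrade_add: "agrade d A \<Longrightarrow> agrade d B \<Longrightarrow> agrade d (A + B)"
  unfolding agrade_def lookup_add by (metis add_0)
lemma agrade_const: "agrade d K \<Longrightarrow> agrade d (sg 0 c * K)"
  by (auto simp: agrade_def lookup_const_times)
lemma agrade_var: "agrade d K \<Longrightarrow> agrade (Suc d) (sg (sg v 1) 1 * K)"
  unfolding agrade_def
proof (intro allI impI)
  fix m assume K: "\<forall>m. lk K m \<noteq> 0 \<longrightarrow> tdeg m = d" and m: "lk (sg (sg v 1) 1 * K) m \<noteq> 0"
  have "lk m v \<noteq> 0 \<and> lk K (m - sg v 1) \<noteq> 0" using m unfolding lookup_var_times by (simp split: if_splits)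
  then have v: "lk m v \<noteq> 0" and "tdeg (m - sg v 1) = d" using K by auto
  then show "tdeg m = Suc d" using tdeg_add[of "sg v 1" "m - sg v 1"] unfolding mono_split[OF v] by simp
qed

text \<open>One action is split off and replaced by its star multiplication. The error carries h^2
  and a smaller monomial, so strong induction applies, the total degree is kept, and the classical
  part is unaffected.\<close>

lemma opsym_mono_exists:
  "\<exists>K. opsym r K = apoly_sym r (sg m 1) \<and> apoly_cl K = apoly_cl (sg m 1) \<and> agrade (tdeg m) K"
proof (induction "tdeg m" arbitrary: m rule: less_induct)
  case less
  show ?case
  proof (cases "m = 0")
    case True
    show ?thesis
      unfolding True by (rule exI[of _ "sg 0 1"], unfold opsym_single apoly_sym_simps(3))
        (simp add: monsym_def apow_def agrade_def lookup_one when_def)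
  next
    case False
    then obtain v where v: "lk m v \<noteq> 0" by (metis poly_mapping_eqI lookup_zero)
    define m' where "m' = m - sg v 1"
    have m: "m = sg v 1 + m'" using mono_split[OF v] by (simp add: m'_def)
    have t: "tdeg m = Suc (tdeg m')" unfolding m by (simp add: tdeg_add)
    have sgm: "sg m (1::real) = sg (sg v 1) 1 * sg m' 1" by (simp add: m mult_single)
    obtain K' where K': "opsym r K' = apoly_sym r (sg m' 1)" "apoly_cl K' = apoly_cl (sg m' 1)" "agrade (tdeg m') K'"
      using less[of m'] t by auto
    show ?thesis
    proof (cases v)
      case AHBAR
      show ?thesis
        by (rule exI[of _ "sg (sg v 1) 1 * K'"])
          (use K' AHBAR in \<open>simp add: sgm opsym_var apoly_sym_simps(2,4) apoly_cl_simps agrade_var t del: One_nat_def\<close>)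
    next
      case (ACT k)
      \<comment> \<open>The power of the k-th action already present in \<open>m'\<close>; it
        determines the correction through \<open>star_action_power\<close>.\<close>
      define n where "n = lk m' (ACT k)"
      define B where "B = apoly_sym r (sg (m' - sg (ACT k) n) 1)"
      have m'n: "m' = sg (ACT k) n + (m' - sg (ACT k) n)"
        by (rule poly_mapping_eqI) (auto simp: lookup_add lookup_minus lookup_single when_def n_def)
      have sgn: "apoly_sym r (sg (sg (ACT k) j + (m' - sg (ACT k) n)) 1) = action r k ^ j * B" for j
        by (simp add: apoly_sym_simps(6) mev_add B_def)
      have m's: "apoly_sym r (sg m' 1) = action r k ^ n * B" using sgn[of n] m'n by simp
      have kB: "free_of k B"
      proof -
        have 0: "lk (m' - sg (ACT k) n) (ACT k) = 0" by (simp add: lookup_minus n_def)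
        have "B = (\<Prod>v\<in>kys (m' - sg (ACT k) n). (case v of ACT k \<Rightarrow> action r k | AHBAR \<Rightarrow> svar HBAR) ^ lk (m' - sg (ACT k) n) v)"
          by (simp add: B_def apoly_sym_simps(6) mev_def)
        moreover have "free_of k ((case v of ACT k \<Rightarrow> action r k | AHBAR \<Rightarrow> svar HBAR) ^ lk (m' - sg (ACT k) n) v)" if "v \<in> kys (m' - sg (ACT k) n)" for v
          using that 0 by (cases v) (auto simp: in_keys_iff free_of_def spartial_power spartial_action spartial_svar)
        ultimately show ?thesis by (simp only: free_of_prod)
      qed
      define c where "c = eps r k * (real n)\<^sup>2 / 4"
      have st: "star (action r k) (action r k ^ n * B) = action r k ^ (n + 1) * B - sconst (of_real c) * (svar HBAR ^ 2 * (action r k ^ (n - 1) * B))"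
        unfolding star_action_local[OF kB] star_action_power c_def by (simp add: left_diff_distrib mult.assoc)
      have e: "apoly_sym r (sg m 1) = star (action r k) (apoly_sym r (sg m' 1)) + sconst (of_real c) * (svar HBAR ^ 2 * (action r k ^ (n - 1) * B))"
        unfolding m's st sgm apoly_sym_simps(2,4) by (simp add: ACT m's mult.assoc)
      show ?thesis
      proof (cases "n = 0")
        case True
        show ?thesis
          by (rule exI[of _ "sg (sg v 1) 1 * K'"])
            (use K' ACT True e in \<open>simp add: c_def opsym_var agrade_var t apoly_cl_simps sgm del: One_nat_def\<close>)
      next
        case n0: False
        \<comment> \<open>Compared with \<open>m\<close> the correction loses two factors of the
          action and gains two factors \<open>AHBAR\<close>; the latter restore the degree and make
          it vanish in the classical limit.\<close>
        define m'' where "m'' = sg (ACT k) (n - 1) + (m' - sg (ACT k) n)"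
        have t'': "tdeg m' = Suc (tdeg m'')" using n0 m'n by (metis (no_types, lifting) Suc_pred' add_Suc gr0I m''_def tdeg_add tdeg_single)
        obtain K'' where K'': "opsym r K'' = apoly_sym r (sg m'' 1)" "agrade (tdeg m'') K''"
          using less[of m''] t t'' by auto
        have m''s: "apoly_sym r (sg m'' 1) = action r k ^ (n - 1) * B" unfolding m''_def by (rule sgn)
        let ?h = "sg (sg AHBAR 1) (1::real)"
        let ?K = "sg (sg v 1) 1 * K' + sg 0 c * (?h * (?h * K''))"
        have "opsym r ?K = apoly_sym r (sg m 1)"
          unfolding opsym_add opsym_var opsym_const K' K'' m''s e by (simp add: ACT power2_eq_square mult.assoc)
        moreover have "apoly_cl ?K = apoly_cl (sg m 1)"
          unfolding sgm by (simp add: apoly_cl_simps K' del: One_nat_def)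
        moreover have "agrade (tdeg m) ?K"
        proof (rule agrade_add)
          show "agrade (tdeg m) (sg (sg v 1) 1 * K')" using agrade_var[OF K'(3), of v] by (simp only: t)
          show "agrade (tdeg m) (sg 0 c * (?h * (?h * K'')))"
            using agrade_const[OF agrade_var[OF agrade_var[OF K''(2), of AHBAR], of AHBAR], of c] by (simp only: t t'')
        qed
        ultimately show ?thesis by blast
      qed
    qed
  qed
qed

lemma opsym_exists:
  assumes "\<And>m. m \<in> kys S \<Longrightarrow> 2 * tdeg m = s"
  shows "\<exists>K. opsym r K = apoly_sym r S \<and> apoly_cl K = apoly_cl S \<and> (\<forall>m. lk K m \<noteq> 0 \<longrightarrow> 2 * tdeg m = s)"
proof -
  obtain \<kappa> where \<kappa>: "\<And>m. opsym r (\<kappa> m) = apoly_sym r (sg m 1)" "\<And>m. apoly_cl (\<kappa> m) = apoly_cl (sg m 1)" "\<And>m. agrade (tdeg m) (\<kappa> m)"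
    using opsym_mono_exists[of r] by metis
  define K where "K = (\<Sum>m\<in>kys S. sg 0 (lk S m) * \<kappa> m)"
  have S: "S = (\<Sum>m\<in>kys S. sg 0 (lk S m) * sg m 1)" using poly_expand[of S] by (simp add: mult_single)
  have "opsym r K = apoly_sym r (\<Sum>m\<in>kys S. sg 0 (lk S m) * sg m 1)"
    unfolding K_def opsym_sum opsym_const \<kappa> apoly_sym_simps(2,3,5) ..
  moreover have "apoly_cl K = apoly_cl (\<Sum>m\<in>kys S. sg 0 (lk S m) * sg m 1)"
    unfolding K_def apoly_cl_simps \<kappa> ..
  moreover have "2 * tdeg m = s" if "lk K m \<noteq> 0" for m
  proof -
    have "m \<in> kys K" using that by (simp add: in_keys_iff)
    then have "m \<in> (\<Union>n\<in>kys S. kys (sg 0 (lk S n) * \<kappa> n))" unfolding K_def by (rule subsetD[OF keys_sum])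
    then obtain n where n: "n \<in> kys S" "m \<in> kys (sg 0 (lk S n) * \<kappa> n)" by (rule UN_E)
    then have "lk (sg 0 (lk S n) * \<kappa> n) m \<noteq> 0" by (simp add: in_keys_iff)
    then have "tdeg m = tdeg n" using agrade_const[OF \<kappa>(3)[of n]] unfolding agrade_def by blast
    then show ?thesis using assms[OF n(1)] by simp
  qed
  ultimately show ?thesis using S by metis
qed

lemma lookup_apoly_part: "lk (apoly_part s K) m = (if 2 * tdeg m = s then lk K m else 0)"
  by (auto simp: apoly_part_def lookup_sum lookup_single when_def in_keys_iff tdeg_def[symmetric])

section \<open>Existence and classical limit of the normal forms\<close>

context nonres
begin

text \<open>Order s > 2 is normalized in step s and untouched afterwards; the orders up to two are a
  constant, zero and \<open>Q\<close> from the start.\<close>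

lemma transformed_invar:
  assumes "admissible H" "H 2 = Q"
    and W: "\<And>n. n \<in> {3..N} \<Longrightarrow> W n \<in> Word n \<and> invar r (transformed br W H n n)" and "bracket br" and "s \<le> N"
  shows "invar r (transformed br W H N s)"
proof -
  interpret bracket br by fact
  show ?thesis
  proof (cases "s \<le> 2")
    case True
    then have "transformed br W H N s = H s" using W assms by (intro transformed_2) auto
    moreover have "invar r (H s)"
    proof -
      have "s = 0 \<or> s = 1 \<or> s = 2" using True by linarith
      then show ?thesis using assms(1,2) invar_Q by (auto simp: admissible_def invar_def)
    qed
    ultimately show ?thesis by simp
  next
    case False
    then have "transformed br W H N s = transformed br W H s s" using W assms by (intro transformed_stable) auto
    then show ?thesis using W[of s] False assms by simp
  qed
qed

lemma classical_normal_form_exists: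
  assumes "admissible H" "H 2 = Q"
  shows "\<exists>C. classical_normal_form r H N C"
proof -
  let ?H = "\<lambda>s. drop_hbar (H s)"
  have H: "admissible ?H" "?H 2 = Q" using assms by (simp_all add: admissible_drop)
  obtain V where V: "\<forall>n\<in>{3..N}. V n \<in> Word n \<and> drop_hbar (V n) = V n \<and> invar r (transformed poisson V ?H n n)"
    using poisson_generators[of ?H N] H by auto
  have w: "transformed poisson V ?H m s \<in> Word s" if "m \<le> N" for m s
    using poisson.transformed_adm[OF H(1), of m V] V that by (simp add: admissible_def)
  have "\<exists>S. transformed poisson V ?H N s = apoly_sym r S" if "s \<le> N" for s
    using invar_apoly[OF transformed_invar[OF H, of N V poisson s], of s] V that w[of N s] poisson.bracket_axioms
    by (auto simp: Word_iff)
  then obtain S where S: "\<And>s. s \<le> N \<Longrightarrow> transformed poisson V ?H N s = apoly_sym r (S s)" by metis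
  \<comment> \<open>The transform is free of \<open>HBAR\<close>, so its expression in the actions
    can be freed of it as well.\<close>
  have "transformed poisson V ?H N s = csym r (apoly_cl (S s))" if "s \<le> N" for s
    using transformed_hbar_free[of N V ?H s] V S[OF that] drop_hbar_apoly_sym[of r "S s"] by simp
  then have "(\<Sum>s\<le>N. transformed poisson V ?H N s) = csym r (\<Sum>s\<le>N. apoly_cl (S s))"
    by (simp add: csym_simps)
  moreover have "fn_of_actions r (transformed poisson V ?H n n)" if "n \<in> {3..N}" for n
    using V that w[of n n] fn_of_actions_iff[of "transformed poisson V ?H n n" n r] by auto
  ultimately show ?thesis
    unfolding classical_normal_form_def csym_def using V by blast
qed

text \<open>The polynomial in the symbols of the actions is rewritten order by order for the
  quantized actions, which keeps the order and the classical part. Hence one and the same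
  \<open>K\<close> serves the operator identity and the limit.\<close>

lemma quantum_normal_form:
  assumes "admissible H" "H 2 = Q"
    and W: "\<And>n. n \<in> {3..N} \<Longrightarrow> W n \<in> Word n \<and> invar r (transformed moyal W H n n)"
  shows "\<exists>S. (\<Sum>s\<le>N. transformed moyal W H N s) = apoly_sym r S"
    and "\<exists>K R. (\<forall>s>N. apoly_part s K = 0) \<and> (\<forall>s\<le>N. R s = 0) \<and> (\<forall>s>N. R s \<in> Word s) \<and>
           (\<forall>h>0. ser_unitary (U_ser h W N) \<and>
              (\<forall>ks. distinct ks \<and> set ks = UNIV \<longrightarrow>
                 ser_eq (ser_mult (ser_mult (ser_adjoint (U_ser h W N)) (ser_weyl h H)) (U_ser h W N))
                   (ser_add (ser_apoly h r ks K) (ser_weyl h R)))) \<and>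
           (\<forall>C. classical_normal_form r H N C \<longrightarrow>
              (\<forall>a. ((\<lambda>h. apoly_val h a K) \<longlongrightarrow> peval id a C) (at_right 0)))" (is "\<exists>K R. ?P K R")
proof -
  define T where "T = transformed moyal W H N"
  have T: "T s \<in> Word s" for s
    using moyal.transformed_adm[OF assms(1), of N W] W by (simp add: admissible_def T_def)
  have "\<exists>S. T s = apoly_sym r S \<and> (\<forall>m\<in>kys S. 2 * tdeg m = s)" if "s \<le> N" for s
    using invar_apoly[OF transformed_invar[OF assms(1,2) W moyal.bracket_axioms that], of s] T[of s]
    by (auto simp: Word_iff T_def)
  then obtain S where S: "\<And>s. s \<le> N \<Longrightarrow> T s = apoly_sym r (S s)" "\<And>s m. s \<le> N \<Longrightarrow> m \<in> kys (S s) \<Longrightarrow> 2 * tdeg m = s" by metis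
  have TS: "(\<Sum>s\<le>N. T s) = apoly_sym r (\<Sum>s\<le>N. S s)" using S(1) by (simp add: apoly_sym_simps(5))
  then show "\<exists>S. (\<Sum>s\<le>N. transformed moyal W H N s) = apoly_sym r S" by (auto simp: T_def)
  have "\<exists>K. opsym r K = apoly_sym r (S s) \<and> apoly_cl K = apoly_cl (S s) \<and> (\<forall>m. lk K m \<noteq> 0 \<longrightarrow> 2 * tdeg m = s)" if "s \<le> N" for s
    by (rule opsym_exists) (use S(2)[OF that] in auto)
  then obtain k where k: "\<And>s. s \<le> N \<Longrightarrow> opsym r (k s) = apoly_sym r (S s)" "\<And>s. s \<le> N \<Longrightarrow> apoly_cl (k s) = apoly_cl (S s)" 
    "\<And>s m. s \<le> N \<Longrightarrow> lk (k s) m \<noteq> 0 \<Longrightarrow> 2 * tdeg m = s" by metis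
  \<comment> \<open>Each \<open>k s\<close> is homogeneous of order s, so \<open>apoly_part\<close>
    recovers it from the sum.\<close>
  define K where "K = (\<Sum>s\<le>N. k s)"
  have part: "apoly_part s K = (if s \<le> N then k s else 0)" for s
  proof (rule poly_mapping_eqI)
    fix m
    have "lk K m = (\<Sum>t\<le>N. lk (k t) m)" by (simp add: K_def lookup_sum)
    also have "\<dots> = (\<Sum>t\<le>N. if t = 2 * tdeg m then lk (k t) m else 0)"
      using k(3) by (intro sum.cong refl) force
    finally have "lk K m = (if 2 * tdeg m \<le> N then lk (k (2 * tdeg m)) m else 0)" by simp
    then show "lk (apoly_part s K) m = lk (if s \<le> N then k s else 0) m"
      using k(3)[of s m] by (auto simp: lookup_apoly_part)
  qed
  define R where "R s = (if s \<le> N then 0 else T s)" for s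
  have 1: "ser_eq (ser_mult (ser_mult (ser_adjoint (U_ser h W N)) (ser_weyl h H)) (U_ser h W N))
                   (ser_add (ser_apoly h r ks K) (ser_weyl h R))" if "h > 0" "distinct ks" "set ks = UNIV" for h ks
    unfolding ser_eq_def
  proof (intro allI ballI ext)
    fix s \<psi> x assume \<psi>: "\<psi> \<in> (schwartz :: (real^'n \<Rightarrow> complex) set)"
    have "ser_mult (ser_mult (ser_adjoint (U_ser h W N)) (ser_weyl h H)) (U_ser h W N) s \<psi> = weyl h (T s) \<psi>"
      using U_ser_conj(2)[OF that(1), of N W H] W \<psi> by (simp add: ser_eq_def ser_weyl_def T_def Word_iff)
    moreover have "weyl h (T s) \<psi> x = apoly_op h r ks (apoly_part s K) \<psi> x + weyl h (R s) \<psi> x"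
      unfolding weyl_opsym[OF that \<psi>] part R_def using k(1)[of s] S(1)[of s] weyl_0[OF that(1)] by auto
    ultimately show "ser_mult (ser_mult (ser_adjoint (U_ser h W N)) (ser_weyl h H)) (U_ser h W N) s \<psi> x = 
      ser_add (ser_apoly h r ks K) (ser_weyl h R) s \<psi> x"
      by (simp add: ser_add_def ser_apoly_def ser_weyl_def)
  qed
  have 2: "ser_unitary (U_ser h W N)" if "h > 0" for h
    using U_ser_conj(1)[OF that, of N W] W by (simp add: Word_iff)
  have 3: "((\<lambda>h. apoly_val h a K) \<longlongrightarrow> peval id a C) (at_right 0)" if C: "classical_normal_form r H N C" for C a
  proof -
    let ?H = "\<lambda>s. drop_hbar (H s)" and ?W = "\<lambda>n. drop_hbar (W n)"
    have H: "admissible ?H" "?H 2 = Q" using assms by (simp_all add: admissible_drop)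
    obtain V where V: "\<forall>n\<in>{3..N}. V n \<in> Word n \<and> drop_hbar (V n) = V n \<and> fn_of_actions r (transformed poisson V ?H n n)"
      and VC: "(\<Sum>s\<le>N. transformed poisson V ?H N s) = csym r C"
      using C unfolding classical_normal_form_def csym_def by blast
    \<comment> \<open>The \<open>HBAR\<close>-free parts of the quantum generators are classical
      generators, and any other choice gives the same normal form.\<close>
    have "(\<Sum>s\<le>N. transformed poisson V ?H N s) = (\<Sum>s\<le>N. transformed poisson ?W ?H N s)"
    proof (rule sum.cong[OF refl])
      fix s assume "s \<in> {..N}"
      then show "transformed poisson V ?H N s = transformed poisson ?W ?H N s"
        using V W by (intro classical_normal_form_unique[OF H]) (auto intro: fn_of_actions_invar drop_hbar_Word invar_drop simp: transformed_drop)
    qed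
    also have "\<dots> = drop_hbar (\<Sum>s\<le>N. T s)" unfolding transformed_drop T_def drop_hbar_sum ..
    also have "\<dots> = csym r (apoly_cl (\<Sum>s\<le>N. S s))" unfolding TS by (rule drop_hbar_apoly_sym)
    also have "apoly_cl (\<Sum>s\<le>N. S s) = apoly_cl K" unfolding K_def apoly_cl_simps(5) using k(2) by simp
    finally have "csym r C = csym r (apoly_cl K)" unfolding VC .
    then have "peval id a C = peval id a (apoly_cl K)" by (rule csym_inj)
    then show ?thesis using apoly_val_limit[of a K] by simp
  qed
  show "\<exists>K R. ?P K R"
    by (intro exI[of _ K] exI[of _ R] conjI allI impI) (use 1 2 3 part T in \<open>auto simp: R_def\<close>)
qed

text \<open>Two solutions differ by an element of the kernel, that is, by a function of the actions.
  Requiring the solution to lie in the image of the bracket with \<open>Q\<close> singles out one;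
  for odd n the kernel is zero.\<close>

lemma homological_equation:
  assumes n: "3 \<le> n" and G: "G \<in> Word n"
  shows "\<exists>W\<in>Word n. fn_of_actions r (G + poisson W Q)"
    and "\<lbrakk>W \<in> Word n; W' \<in> Word n; fn_of_actions r (G + poisson W Q)\<rbrakk> \<Longrightarrow>
           fn_of_actions r (G + poisson W' Q) \<longleftrightarrow> fn_of_actions r (W' - W)"
    and "\<exists>!W. W \<in> Word n \<and> (\<exists>V\<in>Word n. W = poisson V Q) \<and> fn_of_actions r (G + poisson W Q)"
    and "odd n \<Longrightarrow> \<exists>!W. W \<in> Word n \<and> fn_of_actions r (G + poisson W Q)"
    and "fn_of_actions r G \<longleftrightarrow> (\<forall>k. poisson (action r k) G = 0)"
proof -
  have Q: "Q \<in> Word 2" using realsym_Q homog_Q by (simp add: Word_iff)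
  have GW: "G + poisson W Q \<in> Word n" if "W \<in> Word n" for W
    using Word_add[OF G] poisson_Word[OF that Q] by simp
  note fn = fn_of_actions_iff[OF GW, of _ r]
  have iff: "fn_of_actions r (G + poisson W' Q) \<longleftrightarrow> fn_of_actions r (W' - W)" 
    if "W \<in> Word n" "W' \<in> Word n" "fn_of_actions r (G + poisson W Q)" for W W'
  proof -
    have i: "invar r (G + poisson W Q)" using that fn by simp
    have e: "G + poisson W' Q = (G + poisson W Q) + poisson (W' - W) Q" by (simp add: poisson_diff_left)
    have "invar r (G + poisson W' Q) \<longleftrightarrow> invar r (poisson (W' - W) Q)"
      unfolding e using i invar_add[OF i] invar_diff[of r _ "G + poisson W Q"] by (metis add_diff_cancel_left')
    also have "\<dots> \<longleftrightarrow> invar r (W' - W)" using invar_image invar_iff by (metis invar_0)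
    finally show ?thesis using fn[OF that(2)] fn_of_actions_iff[OF Word_diff[OF that(2,1)]] by simp
  qed
  then show "\<lbrakk>W \<in> Word n; W' \<in> Word n; fn_of_actions r (G + poisson W Q)\<rbrakk> \<Longrightarrow>
           fn_of_actions r (G + poisson W' Q) \<longleftrightarrow> fn_of_actions r (W' - W)" .
  obtain V where V: "V \<in> Word n" "poisson V Q \<in> Word n" "invar r (G + poisson (poisson V Q) Q)"
    using homological[OF G] by blast
  have s: "fn_of_actions r (G + poisson (poisson V Q) Q)" using V fn by simp
  then show "\<exists>W\<in>Word n. fn_of_actions r (G + poisson W Q)" using V by blast
  show "\<exists>!W. W \<in> Word n \<and> (\<exists>V\<in>Word n. W = poisson V Q) \<and> fn_of_actions r (G + poisson W Q)"
  proof (intro ex1I[of _ "poisson V Q"] conjI)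
    fix W assume W: "W \<in> Word n \<and> (\<exists>V\<in>Word n. W = poisson V Q) \<and> fn_of_actions r (G + poisson W Q)"
    then obtain V' where V': "W = poisson V' Q" by blast
    have "fn_of_actions r (W - poisson V Q)" using iff[OF V(2) _ s] W by blast
    then have "invar r (poisson (V' - V) Q)" unfolding V' poisson_diff_left[symmetric] by (rule fn_of_actions_invar)
    from invar_image[OF this] show "W = poisson V Q" by (simp add: V' poisson_diff_left)
  qed (use V s in auto)
  show "\<exists>!W. W \<in> Word n \<and> fn_of_actions r (G + poisson W Q)" if "odd n"
  proof (intro ex1I[of _ "poisson V Q"] conjI)
    fix W assume W: "W \<in> Word n \<and> fn_of_actions r (G + poisson W Q)"
    then have "invar r (W - poisson V Q)" using iff[OF V(2) _ s] fn_of_actions_invar by blast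
    then show "W = poisson V Q" using invar_odd[OF _ Word_diff that] W V by fastforce
  qed (use V s in auto)
  show "fn_of_actions r G \<longleftrightarrow> (\<forall>k. poisson (action r k) G = 0)"
    using fn_of_actions_iff[OF G] by (simp add: invar_def)
qed

end

theorem mainTheorem1:
  fixes r :: "'n::finite" and lam E0 :: real and om :: "'n \<Rightarrow> real"
    and H :: "nat \<Rightarrow> 'n sym" and N :: nat
  assumes lam: "lam \<noteq> 0"
    and nonresonant: "\<And>c :: 'n \<Rightarrow> rat. (\<Sum>k\<in>UNIV - {r}. of_rat (c k) * om k) = 0
          \<Longrightarrow> (\<forall>k\<in>UNIV - {r}. c k = 0)"
    and H0: "H 0 = sconst (of_real E0)"
    and H1: "H 1 = 0"
    and H2: "H 2 = quadratic_part r lam om"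
    and Hs: "\<And>s. s \<ge> 3 \<Longrightarrow> H s \<in> Word s"
    and N: "N \<ge> 3"
  shows
    \<comment> \<open>conjugations and their effect on the symbols; homological equation\<close>
    "(\<forall>W. (\<forall>n\<in>{3..N}. W n \<in> Word n) \<longrightarrow>
        (\<forall>n\<in>{3..N}.
           (\<forall>h>0. ser_unitary (ser_exp h \<i> n (W n)) \<and>
              ser_eq (ser_weyl h (transformed moyal W H n))
                (ser_mult (ser_mult (ser_exp h \<i> n (W n)) (ser_weyl h (transformed moyal W H (n - 1))))
                   (ser_exp h (- \<i>) n (W n)))) \<and>
           (\<forall>s. transformed moyal W H n s \<in> Word s) \<and>
           (\<forall>s<n. transformed moyal W H n s = transformed moyal W H (n - 1) s) \<and>
           transformed moyal W H n 2 = H 2 \<and>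
           transformed moyal W H n n = transformed moyal W H (n - 1) n + poisson (W n) (H 2)))
     \<and> \<comment> \<open>solvability of the homological equation\<close>
     (\<forall>n\<ge>3. \<forall>G\<in>Word n.
        (\<exists>W\<in>Word n. fn_of_actions r (G + poisson W (H 2))) \<and>
        (\<forall>W\<in>Word n. \<forall>W'\<in>Word n. fn_of_actions r (G + poisson W (H 2)) \<longrightarrow>
           (fn_of_actions r (G + poisson W' (H 2)) \<longleftrightarrow> fn_of_actions r (W' - W))) \<and>
        (\<exists>!W. W \<in> Word n \<and> (\<exists>V\<in>Word n. W = poisson V (H 2)) \<and> fn_of_actions r (G + poisson W (H 2))) \<and>
        (odd n \<longrightarrow> (\<exists>!W. W \<in> Word n \<and> fn_of_actions r (G + poisson W (H 2)))) \<and>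
        (fn_of_actions r G \<longleftrightarrow> (\<forall>k. poisson (action r k) G = 0)))
     \<and> \<comment> \<open>recursion for the powers of the quantized actions\<close>
     (\<forall>h>0. \<forall>n. \<forall>\<psi>\<in>schwartz. \<forall>x.
        weyl h (action r r ^ (n + 1)) \<psi> x = weyl h (action r r) (weyl h (action r r ^ n) \<psi>) x
          - of_real ((real n)\<^sup>2 * h\<^sup>2 / 4) * weyl h (action r r ^ (n - 1)) \<psi> x \<and>
        (\<forall>k\<in>UNIV - {r}.
           weyl h (action r k ^ (n + 1)) \<psi> x = weyl h (action r k) (weyl h (action r k ^ n) \<psi>) x
             + of_real ((real n)\<^sup>2 * h\<^sup>2 / 4) * weyl h (action r k ^ (n - 1)) \<psi> x))
     \<and> \<comment> \<open>generators can be chosen recursively, and the classical normal form exists\<close>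
     (\<exists>W. \<forall>n\<in>{3..N}. W n \<in> Word n \<and> fn_of_actions r (transformed moyal W H n n))
     \<and> (\<exists>C. classical_normal_form r H N C)
     \<and> \<comment> \<open>every such choice leads to the quantum normal form\<close>
     (\<forall>W. (\<forall>n\<in>{3..N}. W n \<in> Word n \<and> fn_of_actions r (transformed moyal W H n n)) \<longrightarrow>
        (transformed moyal W H N 0 = sconst (of_real E0) \<and> transformed moyal W H N 1 = 0 \<and>
         (\<exists>S. sconst (of_real E0) + (\<Sum>s=2..N. transformed moyal W H N s) = apoly_sym r S) \<and>
         (\<forall>s>N. transformed moyal W H N s \<in> Word s)) \<and>
        (\<exists>K R.
           (\<forall>s>N. apoly_part s K = 0) \<and> (\<forall>s\<le>N. R s = 0) \<and> (\<forall>s>N. R s \<in> Word s) \<and>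
           (\<forall>h>0. ser_unitary (U_ser h W N) \<and>
              (\<forall>ks. distinct ks \<and> set ks = UNIV \<longrightarrow>
                 ser_eq (ser_mult (ser_mult (ser_adjoint (U_ser h W N)) (ser_weyl h H)) (U_ser h W N))
                   (ser_add (ser_apoly h r ks K) (ser_weyl h R)))) \<and>
           (\<forall>C. classical_normal_form r H N C \<longrightarrow>
              (\<forall>a. ((\<lambda>h. apoly_val h a K) \<longlongrightarrow> peval id a C) (at_right 0)))))"
proof -
  interpret nonres r lam om by (unfold_locales) (use lam nonresonant in auto)
  have admissible: "admissible H"
    unfolding admissible_def
  proof (intro conjI allI exI)
    show "H 0 = sconst (of_real E0)" "H 1 = 0" by fact+
    fix s :: nat
    consider "s = 0" | "s = 1" | "s = 2" | "s \<ge> 3" by linarith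
    then show "H s \<in> Word s"
      by cases (use H0 H1 H2 Hs homog_sconst realsym_sconst[OF Reals_of_real] realsym_Q homog_Q in \<open>auto simp: Word_iff\<close>)
  qed
  have HE: "sconst (of_real E0) + (\<Sum>s=2..N. T s) = (\<Sum>s\<le>N. T s)" if "T 0 = sconst (of_real E0)" "T 1 = 0" for T :: "nat \<Rightarrow> 'n sym"
  proof -
    have "{..N} = insert 0 (insert 1 {2..N})" using N by auto
    then show ?thesis using that by simp
  qed
  have fn: "fn_of_actions r (transformed moyal W H n n) \<longleftrightarrow> invar r (transformed moyal W H n n)" 
    if "\<forall>k\<in>{3..n}. W k \<in> Word k" for W n
    using moyal.transformed_adm[OF admissible, of n W] that by (intro fn_of_actions_iff[of _ n]) (simp add: admissible_def)
  have fnW: "(\<forall>n\<in>{3..N}. W n \<in> Word n \<and> fn_of_actions r (transformed moyal W H n n)) \<longleftrightarrow>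
    (\<forall>n\<in>{3..N}. W n \<in> Word n \<and> invar r (transformed moyal W H n n))" for W
  \<comment> \<open>The two forms of invariance are equivalent for symbols of a definite order,
    which the transforms have once all generators do.\<close>
  proof (cases "\<forall>n\<in>{3..N}. W n \<in> Word n")
    case True
    then have "\<forall>n\<in>{3..N}. fn_of_actions r (transformed moyal W H n n) \<longleftrightarrow> invar r (transformed moyal W H n n)"
      by (intro ballI fn) auto
    then show ?thesis by blast
  qed blast
  show ?thesis
  proof (intro conjI, goal_cases)
    case 1
    show ?case
    proof (intro allI impI ballI conjI)
      fix W :: "nat \<Rightarrow> 'n sym" and n
      assume W: "\<forall>n\<in>{3..N}. W n \<in> Word n" and n: "n \<in> {3..N}"
      obtain k where k: "n = Suc k" using n by (cases n) auto
      have t: "transformed moyal W H n = exp_ad moyal n (W n) (transformed moyal W H (n - 1))" using k n by auto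
      have Wn: "\<And>k. k \<in> {3..n} \<Longrightarrow> W k \<in> Word k" using W n by auto
      note low = moyal.transformed_low[OF admissible Wn, of n n]
      { fix h :: real assume h: "h > 0"
        show "ser_unitary (ser_exp h \<i> n (W n))"
          by (rule ser_exp_unitary[OF h]) (use n Wn[of n] in \<open>auto simp: Word_iff\<close>)
        show "ser_eq (ser_weyl h (transformed moyal W H n))
                (ser_mult (ser_mult (ser_exp h \<i> n (W n)) (ser_weyl h (transformed moyal W H (n - 1))))
                   (ser_exp h (- \<i>) n (W n)))"
          unfolding t using n by (intro ser_exp_conj[OF h]) simp }
      show "transformed moyal W H n s \<in> Word s" for s
        using moyal.transformed_adm[OF admissible, of n W] Wn by (simp add: admissible_def)
      show "transformed moyal W H n s = transformed moyal W H (n - 1) s" if "s < n" for s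
        using low(1) n that by simp
      show "transformed moyal W H n 2 = H 2"
        using moyal.transformed_2[OF admissible, of n W 2] Wn by simp
      have "transformed moyal W H (n - 1) 2 = Q"
        by (subst moyal.transformed_2[OF admissible]) (use Wn H2 in auto)
      then show "transformed moyal W H n n = transformed moyal W H (n - 1) n + poisson (W n) (H 2)"
        using low(2) n by (simp add: moyal_Q H2)
    qed
  next
    case 2
    show ?case
      unfolding H2 by (intro allI impI ballI conjI homological_equation) auto
  next
    case 3
    show ?case
      by (intro allI impI ballI conjI, unfold weyl_action_power) (auto simp: eps_def)
  next
    case 4
    show ?case
      unfolding fnW by (rule moyal_generators[OF admissible H2])
  next
    case 5
    show ?case by (rule classical_normal_form_exists[OF admissible H2])
  next
    case 6
    show ?case
      unfolding fnW
    proof (intro allI impI, goal_cases)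
      case (1 W)
      then have W: "W n \<in> Word n \<and> invar r (transformed moyal W H n n)" if "n \<in> {3..N}" for n
        using that by blast
      have T: "admissible (transformed moyal W H N)" using W by (intro moyal.transformed_adm[OF admissible]) auto
      have 0: "transformed moyal W H N 0 = sconst (of_real E0)" and 1: "transformed moyal W H N 1 = 0"
        using moyal.transformed_2[OF admissible, of N W] W H0 H1 by auto
      note qnf = quantum_normal_form[OF admissible H2 W]
      have S: "\<exists>S. sconst (of_real E0) + (\<Sum>s=2..N. transformed moyal W H N s) = apoly_sym r S"
        unfolding HE[OF 0 1] by (rule qnf(1))
      have "\<forall>s>N. transformed moyal W H N s \<in> Word s" using T by (simp add: admissible_def)
      then show ?case using 0 1 S qnf(2) by (intro conjI)
    qed
  qed
qed

end
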